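(* Assume that either $A_{min}>1$ or $0<A_{max}<1$. For a sequence of $\epsilon\to0$, let $k_\epsilon\in\mathbb{R}$ be transmission eigenvalues of $$\nabla\cdot A(x/\epsilon)\nabla w_\epsilon+k_\epsilon^2n(x/\epsilon)w_\epsilon=0,\quad \Delta v_\epsilon+k_\epsilon^2v_\epsilon=0\ \text{ in } D,\qquad w_\epsilon=v_\epsilon,\quad \nu\cdot A(x/\epsilon)\nabla w_\epsilon=\frac{\partial v_\epsilon}{\partial\nu}\ \text{ on }\partial D,$$ with corresponding eigenfunctions $(w_\epsilon,v_\epsilon)\in X(D)$ normalized by $\|w_\epsilon\|_{L^2(D)}+\|v_\epsilon\|_{L^2(D)}=1$. If $k_\epsilon$ is bounded with respect to $\epsilon$, then there is a subsequence of $\{(w_\epsilon,v_\epsilon),k_\epsilon\}\in X(D)\times\mathbb{R}$ such that $(w_\epsilon,v_\epsilon)\rightharpoonup(w,v)$ weakly in $X(D)$ (and strongly in $L^2(D)\times L^2(D)$) and $k_\epsilon\to k$ as $\epsilon\to0$, where $\{(w,v),k\}\in X(D)\times\mathbb{R}$ is an eigenpair (in particular $(w,v)\ne(0,0)$) of the homogenized transmission eigenvalue problem $$\nabla\cdot A_h\nabla w+k^2n_hw=0,\quad \Delta v+k^2v=0\ \text{ in } D,\qquad w=v,\quad \nu\cdot A_h\nabla w=\frac{\partial v}{\partial\nu}\ \text{ on }\partial D.$$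
   Context: $D\subset\mathbb{R}^d$ ($d=2$ or $3$) is a bounded simply connected open set with piecewise smooth boundary $\partial D$ and outward unit normal $\nu$; $Y=(0,1)^d$. $A\in L^\infty$ is a real symmetric positive definite $d\times d$ matrix-valued function and $n\in L^\infty$ is a positive real function, both $Y$-periodic on $\mathbb{R}^d$; $A_\epsilon(x):=A(x/\epsilon)$, $n_\epsilon(x):=n(x/\epsilon)$ for $\epsilon>0$. Set $A_{min}=\inf_{y\in Y}\inf_{|\xi|=1}\overline\xi\cdot A(y)\xi$, $A_{max}=\sup_{y\in Y}\sup_{|\xi|=1}\overline\xi\cdot A(y)\xi$, $n_{min}=\inf_Y n$, $n_{max}=\sup_Y n$, and assume $A_{min}>0$, $A_{max}<\infty$, $n_{min}>0$, $n_{max}<\infty$. $X(D)=\{(w,v): w,v\in H^1(D),\ w-v\in H^1_0(D)\}$ with the $H^1(D)\times H^1(D)$ norm. A value $k_\epsilon$ is a transmission eigenvalue with eigenfunctions $(w_\epsilon,v_\epsilon)$ if $(w_\epsilon,v_\epsilon)\in X(D)$ is nonzero and $$\int_D A_\epsilon\nabla w_\epsilon\cdot\nabla\overline\varphi_1-\nabla v_\epsilon\cdot\nabla\overline\varphi_2-k_\epsilon^2(n_\epsilon w_\epsilon\overline\varphi_1-v_\epsilon\overline\varphi_2)\,dx=0\quad\text{for all }(\varphi_1,\varphi_2)\in X(D);$$ eigenpairs $\{(w,v),k\}$ of the homogenized problem are defined in the same way with $A_h,n_h$ in place of $A_\epsilon,n_\epsilon$. Homogenized coefficients: for $i=1,\dots,d$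 let $\psi_i$ be the unique $Y$-periodic function in $H^1_\#(Y)$ (the $Y$-periodic $H^1$ functions) with $\int_Y\psi_i\,dy=0$ solving $\nabla_y\cdot A\nabla_y\psi_i=\nabla_y\cdot Ae_i$ in $Y$, where $e_i$ is the $i$-th standard basis vector. Then $A_h$ is the constant matrix with $A_he_i=\frac1{|Y|}\int_Y A(y)(e_i-\nabla_y\psi_i(y))\,dy$, and $n_h=\frac1{|Y|}\int_Y n(y)\,dy$. *)

theory Defs
  imports "HOL-Analysis.Analysis" "HOL-Probability.Essential_Supremum"
begin

section \<open>Smooth functions and test functions\<close>

definition partial_deriv :: "'d::finite \<Rightarrow> (real^'d \<Rightarrow> 'b::real_normed_vector) \<Rightarrow> real^'d \<Rightarrow> 'b" where
  "partial_deriv i f x = frechet_derivative f (at x) (axis i 1)"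

primrec C_k_on :: "nat \<Rightarrow> (real^'d) set \<Rightarrow> (real^'d::finite \<Rightarrow> 'b::real_normed_vector) \<Rightarrow> bool" where
  "C_k_on 0 U f \<longleftrightarrow> continuous_on U f"
| "C_k_on (Suc k) U f \<longleftrightarrow>
     (\<forall>x\<in>U. f differentiable (at x)) \<and> (\<forall>i. C_k_on k U (partial_deriv i f))"

definition C_infinity_on :: "(real^'d) set \<Rightarrow> (real^'d::finite \<Rightarrow> 'b::real_normed_vector) \<Rightarrow> bool" where
  "C_infinity_on U f \<longleftrightarrow> (\<forall>k. C_k_on k U f)"

definition test_function :: "(real^'d) set \<Rightarrow> (real^'d::finite \<Rightarrow> 'b::real_normed_vector) \<Rightarrow> bool" where
  "test_function S \<phi> \<longleftrightarrow>
     C_infinity_on UNIV \<phi> \<and> (\<exists>K. compact K \<and> K \<subseteq> S \<and> (\<forall>x. x \<notin> K \<longrightarrow> \<phi> x = 0))"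


section \<open>Domains with piecewise smooth boundary\<close>

text \<open>Vanishing Hausdorff measure of dimension \<open>s\<close> (used for \<open>s = d - 1 \<ge> 1\<close>).\<close>

definition hausdorff_null :: "nat \<Rightarrow> (real^'d::finite) set \<Rightarrow> bool" where
  "hausdorff_null s N \<longleftrightarrow>
     (\<forall>e>0. \<exists>(c :: nat \<Rightarrow> real^'d) (r :: nat \<Rightarrow> real).
        (\<forall>j. 0 \<le> r j) \<and> N \<subseteq> (\<Union>j. ball (c j) (r j)) \<and>
        summable (\<lambda>j. r j ^ s) \<and> (\<Sum>j. r j ^ s) < e)"

definition smooth_boundary_point :: "(real^'d::finite) set \<Rightarrow> real^'d \<Rightarrow> bool" where
  "smooth_boundary_point D p \<longleftrightarrow>
     (\<exists>U (g :: real^'d \<Rightarrow> real). open U \<and> p \<in> U \<and> C_infinity_on U g \<and>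
        (\<forall>x\<in>U. \<exists>i. partial_deriv i g x \<noteq> 0) \<and> D \<inter> U = {x \<in> U. g x < 0})"

definition cone_property :: "(real^'d::finite) set \<Rightarrow> bool" where
  "cone_property D \<longleftrightarrow>
     (\<exists>h>0. \<exists>c<1. \<forall>x\<in>D. \<exists>a. norm a = 1 \<and>
        (\<forall>y. 0 < dist x y \<and> dist x y < h \<and> (y - x) \<bullet> a > c * norm (y - x) \<longrightarrow> y \<in> D))"

text \<open>
  Away from a closed exceptional set \<open>N\<close> (corners, edges, vertices) of zero surface measure the
  boundary is a smooth hypersurface with \<open>D\<close> on one side of it, so that the outward unit normal
  exists there, and it consists of finitely many pieces.  The pieces may not meet in outward
  cusps, for which the compactness of the embedding of \<open>H\<^sup>1(D)\<close> into \<open>L\<^sup>2(D)\<close> may fail: this is the interior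
  cone property, which is implied by, and is weaker than, the boundary being Lipschitz.
\<close>

definition piecewise_smooth_boundary :: "(real^'d::finite) set \<Rightarrow> bool" where
  "piecewise_smooth_boundary D \<longleftrightarrow>
     cone_property D \<and>
     (\<exists>N. closed N \<and> N \<subseteq> frontier D \<and> hausdorff_null (CARD('d) - 1) N \<and>
        finite (components (frontier D - N)) \<and>
        (\<forall>p \<in> frontier D - N. smooth_boundary_point D p))"


section \<open>Lebesgue and Sobolev spaces\<close>

text \<open>
  Elements of \<open>L\<^sup>2\<close> and \<open>H\<^sup>1\<close> are represented by functions; equality in these spaces is equality
  almost everywhere, and the norms below are seminorms on representatives.
\<close>

definition in_L2 :: "(real^'d::finite) set \<Rightarrow> (real^'d \<Rightarrow> 'b::euclidean_space) \<Rightarrow> bool" where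
  "in_L2 S f \<longleftrightarrow>
     f \<in> borel_measurable (lebesgue_on S) \<and> integrable (lebesgue_on S) (\<lambda>x. (norm (f x))\<^sup>2)"

definition L2_norm :: "(real^'d::finite) set \<Rightarrow> (real^'d \<Rightarrow> 'b::euclidean_space) \<Rightarrow> real" where
  "L2_norm S f = sqrt (LINT x|lebesgue_on S. (norm (f x))\<^sup>2)"

definition in_Linfty :: "(real^'d::finite \<Rightarrow> 'b::euclidean_space) \<Rightarrow> bool" where
  "in_Linfty f \<longleftrightarrow> f \<in> borel_measurable lebesgue \<and> (\<exists>C. AE x in lebesgue. norm (f x) \<le> C)"

definition locally_integrable :: "(real^'d::finite) set \<Rightarrow> (real^'d \<Rightarrow> 'b::euclidean_space) \<Rightarrow> bool" where
  "locally_integrable S f \<longleftrightarrow> (\<forall>K. compact K \<and> K \<subseteq> S \<longrightarrow> integrable (lebesgue_on K) f)"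

definition has_weak_gradient ::
  "(real^'d::finite) set \<Rightarrow> (real^'d \<Rightarrow> 'b::euclidean_space) \<Rightarrow> (real^'d \<Rightarrow> 'b^'d) \<Rightarrow> bool" where
  "has_weak_gradient S u g \<longleftrightarrow>
     locally_integrable S u \<and> locally_integrable S g \<and>
     (\<forall>(\<phi> :: real^'d \<Rightarrow> real) i. test_function S \<phi> \<longrightarrow>
        (LINT x|lebesgue_on S. partial_deriv i \<phi> x *\<^sub>R u x) = - (LINT x|lebesgue_on S. \<phi> x *\<^sub>R (g x $ i)))"

text \<open>On an open set the weak gradient is unique up to equality almost everywhere.\<close>

definition weak_gradient ::
  "(real^'d::finite) set \<Rightarrow> (real^'d \<Rightarrow> 'b::euclidean_space) \<Rightarrow> real^'d \<Rightarrow> 'b^'d" where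
  "weak_gradient S u = (SOME g. has_weak_gradient S u g)"

definition in_H1 :: "(real^'d::finite) set \<Rightarrow> (real^'d \<Rightarrow> 'b::euclidean_space) \<Rightarrow> bool" where
  "in_H1 S u \<longleftrightarrow> in_L2 S u \<and> (\<exists>g. has_weak_gradient S u g \<and> in_L2 S g)"

definition H1_norm :: "(real^'d::finite) set \<Rightarrow> (real^'d \<Rightarrow> 'b::euclidean_space) \<Rightarrow> real" where
  "H1_norm S u = sqrt ((L2_norm S u)\<^sup>2 + (L2_norm S (weak_gradient S u))\<^sup>2)"

definition in_H1_0 :: "(real^'d::finite) set \<Rightarrow> (real^'d \<Rightarrow> 'b::euclidean_space) \<Rightarrow> bool" where
  "in_H1_0 S u \<longleftrightarrow>
     in_H1 S u \<and> (\<forall>e>0. \<exists>\<phi>. test_function S \<phi> \<and> H1_norm S (\<lambda>x. u x - \<phi> x) < e)"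


section \<open>The space \<open>X(D)\<close> and its weak convergence\<close>

type_synonym 'd cfun = "real^'d \<Rightarrow> complex"

definition X_space :: "(real^'d::finite) set \<Rightarrow> ('d cfun \<times> 'd cfun) set" where
  "X_space D = {(w, v). in_H1 D w \<and> in_H1 D v \<and> in_H1_0 D (\<lambda>x. w x - v x)}"

definition X_norm :: "(real^'d::finite) set \<Rightarrow> 'd cfun \<times> 'd cfun \<Rightarrow> real" where
  "X_norm D p = sqrt ((H1_norm D (fst p))\<^sup>2 + (H1_norm D (snd p))\<^sup>2)"

text \<open>Boundedness forces such an \<open>F\<close> to respect equality almost everywhere.\<close>

definition X_bounded_functional ::
  "(real^'d::finite) set \<Rightarrow> ('d cfun \<times> 'd cfun \<Rightarrow> complex) \<Rightarrow> bool" where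
  "X_bounded_functional D F \<longleftrightarrow>
     (\<forall>w v w' v'. (w, v) \<in> X_space D \<and> (w', v') \<in> X_space D \<longrightarrow>
        F (\<lambda>x. w x + w' x, \<lambda>x. v x + v' x) = F (w, v) + F (w', v')) \<and>
     (\<forall>c w v. (w, v) \<in> X_space D \<longrightarrow> F (\<lambda>x. c * w x, \<lambda>x. c * v x) = c * F (w, v)) \<and>
     (\<exists>C. \<forall>p \<in> X_space D. cmod (F p) \<le> C * X_norm D p)"

definition X_weakly_tendsto ::
  "(real^'d::finite) set \<Rightarrow> (nat \<Rightarrow> 'd cfun \<times> 'd cfun) \<Rightarrow> 'd cfun \<times> 'd cfun \<Rightarrow> bool" where
  "X_weakly_tendsto D p q \<longleftrightarrow>
     (\<forall>m. p m \<in> X_space D) \<and> q \<in> X_space D \<and>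
     (\<forall>F. X_bounded_functional D F \<longrightarrow> (\<lambda>m. F (p m)) \<longlonglongrightarrow> F q)"


section \<open>Transmission eigenvalues\<close>

definition hermitian_dot :: "complex^'d::finite \<Rightarrow> complex^'d \<Rightarrow> complex" where
  "hermitian_dot a b = (\<Sum>i\<in>UNIV. a $ i * cnj (b $ i))"

definition complex_matrix :: "real^'d^'d::finite \<Rightarrow> complex^'d^'d" where
  "complex_matrix M = (\<chi> i j. complex_of_real (M $ i $ j))"

definition transmission_eigenpair ::
  "(real^'d::finite) set \<Rightarrow> (real^'d \<Rightarrow> real^'d^'d) \<Rightarrow> (real^'d \<Rightarrow> real) \<Rightarrow>
     'd cfun \<times> 'd cfun \<Rightarrow> real \<Rightarrow> bool" where
  "transmission_eigenpair D A n p k \<longleftrightarrow> (case p of (w, v) \<Rightarrow>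
     (w, v) \<in> X_space D \<and>
     \<not> (AE x in lebesgue_on D. w x = 0 \<and> v x = 0) \<and>
     (\<forall>(\<phi>\<^sub>1, \<phi>\<^sub>2) \<in> X_space D.
        (LINT x|lebesgue_on D.
            hermitian_dot (complex_matrix (A x) *v weak_gradient D w x) (weak_gradient D \<phi>\<^sub>1 x)
          - hermitian_dot (weak_gradient D v x) (weak_gradient D \<phi>\<^sub>2 x)
          - (complex_of_real k)\<^sup>2 *
              (complex_of_real (n x) * w x * cnj (\<phi>\<^sub>1 x) - v x * cnj (\<phi>\<^sub>2 x))) = 0))"


section \<open>Periodic coefficients and homogenization\<close>

definition unit_cell :: "(real^'d::finite) set" where
  "unit_cell = {y. \<forall>i. 0 < y $ i \<and> y $ i < 1}"

definition cell_periodic :: "(real^'d::finite \<Rightarrow> 'b) \<Rightarrow> bool" where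
  "cell_periodic f \<longleftrightarrow> (\<forall>i. AE y in lebesgue. f (y + axis i 1) = f y)"

definition sym_pos_def :: "real^'d^'d::finite \<Rightarrow> bool" where
  "sym_pos_def M \<longleftrightarrow> transpose M = M \<and> (\<forall>\<xi>. \<xi> \<noteq> 0 \<longrightarrow> 0 < \<xi> \<bullet> (M *v \<xi>))"

definition scaled :: "real \<Rightarrow> (real^'d::finite \<Rightarrow> 'b) \<Rightarrow> real^'d \<Rightarrow> 'b" where
  "scaled \<epsilon> f x = f (x /\<^sub>R \<epsilon>)"

text \<open>
  Infima and suprema over the cell are essential ones, as the coefficients are elements of
  \<open>L\<^sup>\<infinity>\<close>; they are extended reals.  For real symmetric \<open>M\<close> the number
  \<open>hermitian_dot (complex_matrix M *v \<xi>) \<xi>\<close> is real, so taking its real part loses nothing.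
\<close>

definition ess_sup_cell :: "(real^'d::finite \<Rightarrow> ereal) \<Rightarrow> ereal" where
  "ess_sup_cell f = esssup (lebesgue_on unit_cell) f"

definition ess_inf_cell :: "(real^'d::finite \<Rightarrow> ereal) \<Rightarrow> ereal" where
  "ess_inf_cell f = - esssup (lebesgue_on unit_cell) (\<lambda>y. - f y)"

definition A_min :: "(real^'d::finite \<Rightarrow> real^'d^'d) \<Rightarrow> ereal" where
  "A_min A = ess_inf_cell (\<lambda>y. INF \<xi>\<in>{\<xi>. norm \<xi> = 1}.
     ereal (Re (hermitian_dot (complex_matrix (A y) *v \<xi>) \<xi>)))"

definition A_max :: "(real^'d::finite \<Rightarrow> real^'d^'d) \<Rightarrow> ereal" where
  "A_max A = ess_sup_cell (\<lambda>y. SUP \<xi>\<in>{\<xi>. norm \<xi> = 1}.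
     ereal (Re (hermitian_dot (complex_matrix (A y) *v \<xi>) \<xi>)))"

definition n_min :: "(real^'d::finite \<Rightarrow> real) \<Rightarrow> ereal" where
  "n_min n = ess_inf_cell (\<lambda>y. ereal (n y))"

definition n_max :: "(real^'d::finite \<Rightarrow> real) \<Rightarrow> ereal" where
  "n_max n = ess_sup_cell (\<lambda>y. ereal (n y))"

text \<open>
  Periodic \<open>H\<^sup>1\<close> functions are periodic functions on the whole space that are weakly differentiable
  across the faces of the cells.
\<close>

definition in_H1_per :: "(real^'d::finite \<Rightarrow> real) \<Rightarrow> bool" where
  "in_H1_per u \<longleftrightarrow>
     cell_periodic u \<and> in_L2 unit_cell u \<and>
     (\<exists>g. has_weak_gradient UNIV u g \<and> in_L2 unit_cell g)"

text \<open>
  The equation \<open>\<nabla> \<cdot> A \<nabla> \<psi> = \<nabla> \<cdot> A e\<^sub>i\<close> on the torus, in weak form.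
\<close>

definition cell_solution ::
  "(real^'d::finite \<Rightarrow> real^'d^'d) \<Rightarrow> 'd \<Rightarrow> (real^'d \<Rightarrow> real) \<Rightarrow> bool" where
  "cell_solution A i \<psi> \<longleftrightarrow>
     in_H1_per \<psi> \<and> (LINT y|lebesgue_on unit_cell. \<psi> y) = 0 \<and>
     (\<forall>\<phi>. in_H1_per \<phi> \<longrightarrow>
        (LINT y|lebesgue_on unit_cell. (A y *v weak_gradient UNIV \<psi> y) \<bullet> weak_gradient UNIV \<phi> y) =
        (LINT y|lebesgue_on unit_cell. (A y *v axis i 1) \<bullet> weak_gradient UNIV \<phi> y))"

definition cell_average :: "(real^'d::finite \<Rightarrow> 'b::euclidean_space) \<Rightarrow> 'b" where
  "cell_average f =
     (1 / measure lebesgue (unit_cell :: (real^'d) set)) *\<^sub>R (LINT y|lebesgue_on unit_cell. f y)"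

text \<open>The \<open>i\<close>-th column is the cell average of \<open>A (e\<^sub>i - \<nabla> \<psi>\<^sub>i)\<close>.\<close>

definition homogenized_matrix ::
  "(real^'d::finite \<Rightarrow> real^'d^'d) \<Rightarrow> ('d \<Rightarrow> real^'d \<Rightarrow> real) \<Rightarrow> real^'d^'d" where
  "homogenized_matrix A \<psi> =
     (\<chi> j i. cell_average (\<lambda>y. A y *v (axis i 1 - weak_gradient UNIV (\<psi> i) y)) $ j)"

end

theory Submission
  imports Defs "HOL-Library.Diagonal_Subsequence"
begin

text \<open>
  The proof combines three ingredients: a coercivity argument that survives the sign change of the
  transmission problem, compactness of the embedding of \<open>H\<^sup>1(D)\<close> into \<open>L\<^sup>2(D)\<close>, and Tartar's method of
  oscillating test functions.

  The form \<open>A\<nabla>w \<cdot> \<nabla>\<phi>\<^sub>1 - \<nabla>v \<cdot> \<nabla>\<phi>\<^sub>2\<close> is indefinite.  Testing with \<open>(w, 2w - v)\<close> if \<open>A\<close> exceeds one,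
  or with \<open>(w - 2v, - v)\<close> if \<open>A\<close> is less than one, completes a square, and the gradients of normalized
  eigenfunctions with bounded eigenvalues are bounded uniformly in \<open>\<epsilon>\<close> (\<open>gradient_bounds\<close>).

  The rest is weak compactness.  The jet \<open>(u, \<nabla>u)\<close> embeds \<open>H\<^sup>1(D)\<close> into a product of \<open>L\<^sup>2\<close> spaces, which
  are constructed here as a quotient type and proved to be complete, and \<open>X(D)\<close> becomes a closed
  subspace.  A bounded sequence in a Hilbert space has a weakly convergent subsequence
  (\<open>weak_sequential_compactness\<close>); a single extraction makes the jets and the fluxes \<open>A(x/\<epsilon>)\<nabla>w\<close>
  converge weakly and the eigenvalues converge.  Since \<open>X(D)\<close> is weakly closed and bounded functionals
  on it factor through the jets, this is weak convergence in \<open>X(D)\<close>.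

  Rellich's theorem (\<open>Rellich_compactness\<close>) makes the convergence strong in \<open>L\<^sup>2(D)\<close>, so that the limit
  inherits the normalization and is not zero.  It is proved by mollification inside \<open>D\<close>; near the
  boundary the cone property allows one to move every point a short way along one of finitely many
  directions into the interior, at a cost that the gradient controls.

  It remains to identify the limit \<open>\<sigma>\<close> of the fluxes.  Periodic functions \<open>f(x/\<epsilon>)\<close> converge weakly
  to their cell average, because averaging over all translations of the pattern by a period turns
  the oscillating function into a constant.  The functions \<open>x\<^sub>i - \<epsilon> \<psi>\<^sub>i(x/\<epsilon>)\<close> converge strongly to \<open>x\<^sub>i\<close>,
  while \<open>A(x/\<epsilon>)\<close> times their gradient is divergence free and converges weakly to \<open>A\<^sub>h e\<^sub>i\<close>.  Testing
  the equation of \<open>w\<close> with these functions and their equation with \<open>w\<close>, the products of two weakly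
  convergent factors cancel by the symmetry of \<open>A\<close>, and what remains in the limit says that
  \<open>\<sigma> = A\<^sub>h \<nabla>w\<close> (\<open>homogenized_flux\<close>).  The coefficients being real, this applies to the real and
  the imaginary parts separately, and every term of the weak formulation then converges.
\<close>

notation scaleR (infixr "*R" 75)

abbreviation (input) tends_to :: "(nat \<Rightarrow> 'a::topological_space) \<Rightarrow> 'a \<Rightarrow> bool" (infixr "---->" 60) where
  "f ----> l \<equiv> f \<longlonglongrightarrow> l"

section \<open>Weak convergence in Hilbert spaces\<close>

definition weakly_tendsto :: "(nat => 'a::real_inner) => 'a => bool" where
 "weakly_tendsto x p \<longleftrightarrow> (\<forall>h. (%m. x m \<bullet> h) ----> p \<bullet> h)"

lemma weakly_tendsto_subseq:
 "weakly_tendsto x p ==> strict_mono r ==> weakly_tendsto (x \<circ> r) p"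
 unfolding weakly_tendsto_def using LIMSEQ_subseq_LIMSEQ[of "%m. x m \<bullet> _" _ r] by (auto simp: o_def)

lemma Cauchy_minimizing_in_convex:
 fixes S :: "nat => 'a::real_inner set"
 assumes conv: "!!i. convex (S i)" and mono: "!!i j. i <= j ==> S j <= S i"
  and yS: "!!i. y i : S i" and d: "d ----> l" "!!i. 0 <= d i"
  and lower: "!!i z. z : S i ==> d i <= norm z"
  and upper: "!!i. norm (y i) <= d i + inverse (real (Suc i))"
 shows "Cauchy y"
proof -
 define u where "u i = d i + inverse (real (Suc i))" for i
 have u: "u ----> l" using tendsto_add[OF d(1) LIMSEQ_inverse_real_of_nat] by (simp add: u_def[abs_def])
 \<comment> \<open>Parallelogram law: midpoints stay in the larger set, hence have norm at least \<open>d i\<close>.\<close>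
 have key: "(norm (y i - y j))^2 <= 2 * (u i)^2 + 2 * (u j)^2 - 4 * (d i)^2" if "i <= j" for i j
 proof -
  have "(1/2) *R y i + (1/2) *R y j : S i"
   using convexD[OF conv[of i] yS[of i], of "y j" "1/2" "1/2"] yS[of j] mono[OF that] by auto
  then have "d i <= norm ((1/2) *R (y i + y j))" using lower by (simp add: scaleR_add_right)
  then have "2 * d i <= norm (y i + y j)" by simp
  then have "(2 * d i)^2 <= (norm (y i + y j))^2" using d(2)[of i] by (intro power_mono) auto
  moreover have "(norm (y i - y j))^2 + (norm (y i + y j))^2 = 2 * (norm (y i))^2 + 2 * (norm (y j))^2"
   by (simp add: power2_norm_eq_inner inner_add inner_diff inner_commute)
  moreover have "(norm (y i))^2 <= (u i)^2" "(norm (y j))^2 <= (u j)^2" using upper unfolding u_def by (auto intro!: power_mono)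
  ultimately show ?thesis by (simp add: power_mult_distrib)
 qed
 show ?thesis
 proof (rule CauchyI)
  fix e :: real assume "e > 0"
  have "(%i. (u i)^2) ----> l^2" "(%i. (d i)^2) ----> l^2" using u d(1) by (auto intro: tendsto_power)
  then have ev: "\<forall>\<^sub>F i in sequentially. (u i)^2 < l^2 + e^2/8" "\<forall>\<^sub>F i in sequentially. (d i)^2 > l^2 - e^2/8"
   using \<open>e > 0\<close> by (auto intro: order_tendstoD)
  then obtain N where N: "!!i. i >= N ==> (u i)^2 < l^2 + e^2/8 & (d i)^2 > l^2 - e^2/8"
   using eventually_conj[OF ev] unfolding eventually_sequentially by auto
  have small: "norm (y i - y j) < e" if "i <= j" "N <= i" for i j
  proof -
   have "(norm (y i - y j))^2 < e^2" using key[OF that(1)] N[of i] N[of j] that by auto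
   then show ?thesis using \<open>e > 0\<close> by (simp add: power2_less_imp_less)
  qed
  show "\<exists>M. \<forall>m\<ge>M. \<forall>n\<ge>M. norm (y m - y n) < e"
   by (rule exI[of _ N]) (metis small norm_minus_commute nle_le)
 qed
qed

text \<open>Nearly minimal elements of decreasing convex sets form a Cauchy sequence by the parallelogram
 law; its limit belongs to all of the sets and has minimal norm.\<close>

lemma nested_closed_convex_Int_nonempty:
 fixes S :: "nat => 'a::{real_inner,complete_space} set"
 assumes conv: "!!i. convex (S i)" and cl: "!!i. closed (S i)" and ne: "!!i. S i ~= {}"
  and mono: "!!i j. i <= j ==> S j <= S i" and bd: "!!z. z : S 0 ==> norm z <= B"
 obtains p where "!!i. p : S i" "!!z. (!!i. z : S i) ==> norm p <= norm z"
proof -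
 define d where "d i = Inf (norm ` S i)" for i
 have bdd: "bdd_below (norm ` S i)" for i by (rule bdd_belowI[of _ 0]) auto
 have d0: "0 <= d i" for i unfolding d_def using ne by (intro cInf_greatest) auto
 have lower: "d i <= norm z" if "z : S i" for i z unfolding d_def using that bdd by (intro cInf_lower) auto
 have "\<exists>z\<in>S i. norm z <= d i + inverse (real (Suc i))" for i
 proof -
  have "Inf (norm ` S i) < d i + inverse (real (Suc i))" unfolding d_def by simp
  then show ?thesis using cInf_lessD[of "norm ` S i"] ne by fastforce
 qed
 then obtain y where y: "!!i. y i : S i" "!!i. norm (y i) <= d i + inverse (real (Suc i))" by metis
 have "incseq d" unfolding d_def by (intro monoI cInf_superset_mono image_mono bdd mono) (use ne in auto)
 moreover have "d i <= B" for i using lower[OF y(1)[of i]] bd mono[of 0 i] y(1)[of i] by force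
 ultimately obtain l where l: "d ----> l" "!!i. d i <= l" using incseq_convergent[of d B] by blast
 have "Cauchy y" by (rule Cauchy_minimizing_in_convex[OF conv mono y(1) l(1) d0 lower y(2)]) auto
 then obtain p where p: "y ----> p" using Cauchy_convergent convergent_def by blast
 have pS: "p : S i" for i
 proof (rule closed_sequentially[OF cl[of i]])
  show "(%n. y (n + i)) ----> p" using p by (rule LIMSEQ_ignore_initial_segment)
  show "!!n. y (n + i) : S i" using y(1) mono by (meson le_add2 subsetD)
 qed
 have "norm p <= l"
 proof (rule LIMSEQ_le[OF tendsto_norm[OF p]])
  show "(%i. d i + inverse (real (Suc i))) ----> l" using tendsto_add[OF l(1) LIMSEQ_inverse_real_of_nat] by simp
 qed (use y(2) in auto)
 moreover have "l <= norm z" if "!!i. z : S i" for z by (rule LIMSEQ_le_const2[OF l(1)]) (use lower that in auto)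
 ultimately show ?thesis using that pS by (meson order_trans)
qed

lemma closest_point_exists_closed_convex:
 fixes C :: "'a::{real_inner,complete_space} set"
 assumes "closed C" "convex C" "C ~= {}"
 obtains p where "p : C" "!!y. y : C ==> dist a p <= dist a y"
proof -
 obtain c where c: "c : C" using assms by blast
 define S where "S = (%z. z - a) ` C Int cball 0 (norm (c - a))"
 have "closed S" unfolding S_def using assms(1) by (intro closed_Int closed_cball) (metis closed_translation_subtract)
 moreover have "convex S" unfolding S_def
  using assms(2) by (intro convex_Int convex_cball) (simp add: convex_translation_subtract_eq)
 moreover have "c - a : S" unfolding S_def using c by auto
 ultimately obtain q where q: "q : S" "!!z. z : S ==> norm q <= norm z"
  using nested_closed_convex_Int_nonempty[of "%_. S" "norm (c - a)"]
  by (metis (no_types, lifting) Int_iff S_def dist_0_norm empty_iff mem_cball subset_refl)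
 then obtain p where p: "p : C" "q = p - a" unfolding S_def by auto
 show ?thesis
 proof (rule that[OF p(1)])
  fix y assume y: "y : C"
  show "dist a p <= dist a y"
  proof (cases "norm (y - a) <= norm (c - a)")
   case True
   then have "y - a : S" unfolding S_def using y by auto
   then show ?thesis using q(2) p by (metis dist_commute dist_norm)
  next
   case False
   have "norm q <= norm (c - a)" using q(1) unfolding S_def by auto
   then show ?thesis using False p by (metis dist_commute dist_norm linear order_trans)
  qed
 qed
qed

text \<open>Obtuse-angle characterization of the projection: otherwise moving from \<open>p\<close> a little
 towards \<open>y\<close> would decrease the distance to \<open>a\<close>.\<close>

lemma inner_projection_le_0:
 fixes C :: "'a::real_inner set"
 assumes "convex C" "p : C" "y : C" "!!y. y : C ==> dist a p <= dist a y"
 shows "(a - p) \<bullet> (y - p) <= 0"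
proof (rule ccontr)
 assume "~ ?thesis"
 then have pos: "(a - p) \<bullet> (y - p) > 0" by simp
 define N where "N = (norm (y - p))^2"
 define t where "t = min 1 (((a - p) \<bullet> (y - p)) / (N + 1))"
 have N: "N >= 0" unfolding N_def by simp
 have t: "0 < t" "t <= 1" unfolding t_def using pos N by auto
 have "t * (N + 1) <= ((a - p) \<bullet> (y - p)) / (N + 1) * (N + 1)" unfolding t_def using N by (intro mult_right_mono) auto
 then have tN: "t * (N + 1) <= (a - p) \<bullet> (y - p)" using N by simp
 have "p + t *R (y - p) = (1 - t) *R p + t *R y" by (simp add: algebra_simps)
 also have "... : C" using convexD[OF assms(1-3), of "1-t" t] t by auto
 finally have "(norm (a - p))^2 <= (norm (a - (p + t *R (y - p))))^2"
  using assms(4) by (intro power_mono) (auto simp: dist_norm)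
 also have "... = (norm ((a - p) - t *R (y - p)))^2" by (simp add: algebra_simps)
 also have "... = (norm (a - p))^2 - 2 * t * ((a - p) \<bullet> (y - p)) + t * t * N" unfolding N_def power2_norm_eq_inner
  by (simp add: inner_diff inner_commute algebra_simps)
 finally have "t * (2 * ((a - p) \<bullet> (y - p))) <= t * (t * N)" by (simp add: algebra_simps)
 then have "2 * ((a - p) \<bullet> (y - p)) <= t * N" using t by simp
 moreover have "t * N <= t * (N + 1)" using t by simp
 ultimately show False using tN pos by linarith
qed

lemma weakly_tendsto_closed_convex:
 fixes C :: "'a::{real_inner,complete_space} set"
 assumes "closed C" "convex C" "!!m. x m : C" "weakly_tendsto x a"
 shows "a : C"
proof -
 obtain p where p: "p : C" "!!y. y : C ==> dist a p <= dist a y"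
  using closest_point_exists_closed_convex[OF assms(1,2), of a] assms(3) by auto
 have "(%m. x m \<bullet> (a - p) - p \<bullet> (a - p)) ----> a \<bullet> (a - p) - p \<bullet> (a - p)"
  using assms(4) unfolding weakly_tendsto_def by (intro tendsto_diff tendsto_const) auto
 moreover have "x m \<bullet> (a - p) - p \<bullet> (a - p) <= 0" for m
  using inner_projection_le_0[OF assms(2) p(1) assms(3)[of m] p(2)] by (simp add: inner_diff inner_commute)
 ultimately have "a \<bullet> (a - p) - p \<bullet> (a - p) <= 0" using LIMSEQ_le_const2 by blast
 then have "(a - p) \<bullet> (a - p) <= 0" by (simp add: inner_diff)
 then have "a = p" by (metis inner_eq_zero_iff inner_ge_zero order_antisym right_minus_eq)
 then show ?thesis using p by simp
qed

lemma dense_subspace_if_trivial_orthogonal: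
 fixes S :: "'a::{real_inner,complete_space} set"
 assumes S: "subspace S" and triv: "!!x. (!!y. y : S ==> x \<bullet> y = 0) ==> x = 0"
 shows "closure S = UNIV"
proof -
 have cv: "convex (closure S)" using S by (intro convex_closure subspace_imp_convex)
 have "a : closure S" for a
 proof -
  have "closure S ~= {}" using S subspace_0 by fastforce
  then obtain p where p: "p : closure S" "!!y. y : closure S ==> dist a p <= dist a y"
   using closest_point_exists_closed_convex[OF closed_closure cv] by metis
  have le: "(a - p) \<bullet> (y - p) <= 0" if "y : closure S" for y using inner_projection_le_0[OF cv p(1) that p(2)] .
  have "(a - p) \<bullet> y = 0" if y: "y : S" for y
  proof (rule ccontr)
   assume ne: "(a - p) \<bullet> y ~= 0"
   define c where "c = (1 + (a - p) \<bullet> p) / ((a - p) \<bullet> y)"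
   have "c *R y : closure S" using S y closure_subset subspace_scale by blast
   from le[OF this] have "c * ((a - p) \<bullet> y) - (a - p) \<bullet> p <= 0" by (simp add: inner_diff_right)
   then show False using ne unfolding c_def by simp
  qed
  then have "a - p = 0" by (rule triv)
  then show ?thesis using p by simp
 qed
 then show ?thesis by auto
qed

text \<open>The limit is the element of least norm in the intersection of the closed convex hulls of the
 tails.  No other weak limit is possible, even along a subsequence: after a diagonal extraction all
 subsequences share the limits of the inner products with the members of the sequence, and these
 members span the subspace in which the limits live.\<close>

lemma weak_sequential_compactness:
 fixes x :: "nat => 'a::{real_inner,complete_space}"
 assumes bd: "!!m. norm (x m) <= B"
 obtains r p where "strict_mono (r::nat=>nat)" "weakly_tendsto (x \<circ> r) p"
proof -
 have B0: "B >= 0" using bd[of 0] norm_ge_zero order_trans by blast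
 have bdd: "\<bar>x m \<bullet> h\<bar> <= B * norm h" for m h
  using Cauchy_Schwarz_ineq2[of "x m" h] bd[of m] mult_right_mono[OF bd[of m] norm_ge_zero[of h]] by linarith
 have subconv: "\<exists>r. strict_mono (r::nat=>nat) & convergent (%m. x (s (r m)) \<bullet> h)" for s h
 proof -
  have "bounded (range (%m. x (s m) \<bullet> h))" using bdd by (intro boundedI[of _ "B * norm h"]) auto
  then obtain l r where "strict_mono (r::nat=>nat)" "((%m. x (s m) \<bullet> h) \<circ> r) ----> l"
   using bounded_imp_convergent_subsequence by blast
  then show ?thesis unfolding convergent_def o_def by blast
 qed
 interpret subseqs "%n s. convergent (%m. x (s m) \<bullet> x n)" by standard (use subconv in "auto simp: o_def")
 define r where "r = diagseq"
 have r: "strict_mono r" unfolding r_def by (rule subseq_diagseq)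
 have "convergent (%m. x (r m) \<bullet> x n)" for n
 proof -
  have "convergent (%m. x ((diagseq \<circ> (+) (Suc n)) m) \<bullet> x n)"
  proof (rule diagseq_holds)
   fix r s :: "nat => nat" and n assume "strict_mono r" "convergent (%m. x (s m) \<bullet> x n)"
   then show "convergent (%m. x ((s \<circ> r) m) \<bullet> x n)"
    unfolding convergent_def using LIMSEQ_subseq_LIMSEQ[of "%m. x (s m) \<bullet> x n" _ r] by (auto simp: o_def)
  qed
  then have "convergent (%m. x (r (m + Suc n)) \<bullet> x n)" by (simp add: o_def r_def add.commute)
  then show ?thesis using convergent_ignore_initial_segment[of "%m. x (r m) \<bullet> x n" "Suc n"] by simp
 qed
 then obtain c where c: "!!n. (%m. x (r m) \<bullet> x n) ----> c n" unfolding convergent_def by metis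
 define S where "S s i = closure (convex hull (x ` s ` {i..}))" for s :: "nat => nat" and i
 have hull: "p \<bullet> h = l" if that1: "!!i. p : S s i" and that2: "(%m. x (s m) \<bullet> h) ----> l" for p h l s
 proof (rule ccontr)
  assume ne: "p \<bullet> h ~= l"
  define e where "e = \<bar>p \<bullet> h - l\<bar> / 2"
  have "e > 0" using ne unfolding e_def by simp
  then obtain N where N: "!!m. m >= N ==> \<bar>x (s m) \<bullet> h - l\<bar> < e"
   using that2 unfolding LIMSEQ_iff by (metis real_norm_def)
  let ?C = "{z. h \<bullet> z <= l + e} Int {z. h \<bullet> z >= l - e}"
  have "S s N <= ?C" unfolding S_def
  proof (intro closure_minimal hull_minimal)
   show "x ` s ` {N..} <= ?C" using N by (force simp: inner_commute abs_less_iff)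
   show "closed ?C" by (intro closed_Int closed_halfspace_le closed_halfspace_ge)
   show "convex ?C" by (intro convex_Int convex_halfspace_le convex_halfspace_ge)
  qed
  then have "h \<bullet> p <= l + e" "h \<bullet> p >= l - e" using that1[of N] by auto
  then have "\<bar>p \<bullet> h - l\<bar> <= e" by (simp add: inner_commute abs_le_iff)
  then show False using ne unfolding e_def by simp
 qed
 have exp: "\<exists>p. \<forall>i. p : S s i" for s
 proof -
  have "!!z. z : S s 0 ==> norm z <= B"
  proof -
   have "S s 0 <= cball 0 B" unfolding S_def by (intro closure_minimal hull_minimal) (use bd in auto)
   then show "!!z. z : S s 0 ==> norm z <= B" by auto
  qed
  moreover have "S s j <= S s i" if "i <= j" for i j
   unfolding S_def using that by (intro closure_mono hull_mono image_mono) auto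
  moreover have "convex (S s i)" "closed (S s i)" "S s i ~= {}" for i unfolding S_def by (auto intro: convex_closure)
  ultimately show ?thesis using nested_closed_convex_Int_nonempty[of "S s" B] by metis
 qed
 obtain p where p: "!!i. p : S r i" using exp by blast
 have pc: "p \<bullet> x n = c n" for n using hull[OF p c] .
 have "weakly_tendsto (x \<circ> r) p" unfolding weakly_tendsto_def
 proof (intro allI, rule ccontr)
  fix h assume "~ (%m. (x \<circ> r) m \<bullet> h) ----> p \<bullet> h"
  then obtain e where e: "e > 0" "!!N. \<exists>m\<ge>N. \<bar>x (r m) \<bullet> h - p \<bullet> h\<bar> >= e"
   unfolding LIMSEQ_iff real_norm_def o_def by (meson not_less)
  have "infinite {m. \<bar>x (r m) \<bullet> h - p \<bullet> h\<bar> >= e}"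
   unfolding infinite_nat_iff_unbounded_le using e(2) by auto
  then obtain t where t: "strict_mono (t::nat=>nat)" "!!m. \<bar>x (r (t m)) \<bullet> h - p \<bullet> h\<bar> >= e"
   using infinite_enumerate by blast
  obtain u where u: "strict_mono (u::nat=>nat)" "convergent (%m. x (r (t (u m))) \<bullet> h)"
   using subconv[of "r \<circ> t" h] by (auto simp: o_def)
  define s where "s = r \<circ> t \<circ> u"
  obtain l where l: "(%m. x (s m) \<bullet> h) ----> l" using u(2) unfolding s_def convergent_def o_def by blast
  obtain q where q: "!!i. q : S s i" using exp by blast
  have tu: "strict_mono (t \<circ> u)" using t(1) u(1) by (rule strict_mono_o)
  have "(%m. x (s m) \<bullet> x n) ----> c n" for n using LIMSEQ_subseq_LIMSEQ[OF c tu] by (simp add: o_def s_def)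
  then have qc: "q \<bullet> x n = c n" for n using hull[OF q] by blast
  have orth: "closure (convex hull range x) <= {z. (p - q) \<bullet> z = 0}"
  proof (intro closure_minimal hull_minimal closed_hyperplane convex_hyperplane)
   show "range x <= {z. (p - q) \<bullet> z = 0}" using pc qc by (auto simp: inner_diff_left)
  qed
  have "S s' 0 <= closure (convex hull range x)" for s' unfolding S_def by (intro closure_mono hull_mono) auto
  then have "(p - q) \<bullet> p = 0" "(p - q) \<bullet> q = 0" using p[of 0] q[of 0] orth by auto
  then have "(p - q) \<bullet> (p - q) = 0" by (simp add: inner_diff_right)
  then have "p = q" by simp
  moreover have "q \<bullet> h = l" using hull[OF q l] .
  moreover have "e <= \<bar>l - p \<bullet> h\<bar>"
  proof (rule LIMSEQ_le_const)
   show "(%m. \<bar>x (s m) \<bullet> h - p \<bullet> h\<bar>) ----> \<bar>l - p \<bullet> h\<bar>" by (intro tendsto_intros l)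
   show "\<exists>N. \<forall>m\<ge>N. e <= \<bar>x (s m) \<bullet> h - p \<bullet> h\<bar>" using t(2) unfolding s_def by auto
  qed
  ultimately show False using e(1) by simp
 qed
 then show ?thesis using that r by blast
qed

text \<open>The superlevel sets of a bounded functional on a subspace are convex and relatively closed, hence
 relatively weakly closed.\<close>

lemma bounded_functional_weakly_continuous:
 fixes S :: "'a::{real_inner,complete_space} set" and f :: "'a => real"
 assumes S: "subspace S" and x: "!!m. x m : S" and p: "p : S" and w: "weakly_tendsto x p"
  and add: "!!a b. a : S ==> b : S ==> f (a + b) = f a + f b"
  and scale: "!!c a. a : S ==> f (c *R a) = c * f a"
  and bd: "!!a. a : S ==> \<bar>f a\<bar> <= C * norm a"
 shows "(%m. f (x m)) ----> f p"
proof -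
 have half: "False"
  if add: "!!a b. a : S ==> b : S ==> f (a + b) = f a + f b"
   and scale: "!!c a. a : S ==> f (c *R a) = c * f a"
   and bd: "!!a. a : S ==> \<bar>f a\<bar> <= C * norm a"
   and e: "e > 0" and inf: "infinite {m. f (x m) >= f p + e}" for f and e :: real
 proof -
  obtain r where r: "strict_mono (r::nat=>nat)" "!!m. f (x (r m)) >= f p + e" using infinite_enumerate[OF inf] by auto
  let ?C = "{a : S. f a >= f p + e}"
  have "convex ?C"
  proof (rule convexI)
   fix a b and u v :: real assume *: "a : ?C" "b : ?C" "0 <= u" "0 <= v" "u + v = 1"
   then have "f (u *R a + v *R b) = u * f a + v * f b" using add scale S by (auto simp: subspace_scale)
   moreover have "u * f a + v * f b >= u * (f p + e) + v * (f p + e)" using * by (intro add_mono mult_left_mono) auto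
   moreover have "u * (f p + e) + v * (f p + e) = f p + e" using *(5) by (metis distrib_right mult_1)
   ultimately show "u *R a + v *R b : ?C" using * S by (auto intro: subspace_add subspace_scale)
  qed
  then have cv: "convex (closure ?C)" by (rule convex_closure)
  have "(x \<circ> r) m : closure ?C" for m using r(2)[of m] x[of "r m"] by (intro subsetD[OF closure_subset]) simp
  then have "p : closure ?C" by (rule weakly_tendsto_closed_convex[OF closed_closure cv _ weakly_tendsto_subseq[OF w r(1)]])
  then obtain y where y: "!!n. y n : ?C" "y ----> p" unfolding closure_sequential by blast
  have "(%n. C * norm (y n - p)) ----> C * norm (p - p)" by (intro tendsto_intros y(2))
  then have "\<forall>\<^sub>F n in sequentially. C * norm (y n - p) < e" using e by (intro order_tendstoD(2)) auto
  then obtain n where n: "C * norm (y n - p) < e" using eventually_happens by force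
  have "y n : S" "y n - p : S" using y(1)[of n] p S by (auto intro: subspace_diff)
  then have "f (y n) = f (y n - p) + f p" using add[of "y n - p" p] p by simp
  then show False using bd[OF \<open>y n - p \<in> S\<close>] y(1)[of n] n by auto
 qed
 show ?thesis
 proof (rule ccontr)
  assume "~ ?thesis"
  then obtain e where e: "e > 0" "!!N. \<exists>m\<ge>N. \<bar>f (x m) - f p\<bar> >= e"
   unfolding LIMSEQ_iff real_norm_def o_def by (meson not_less)
  have "infinite {m. \<bar>f (x m) - f p\<bar> >= e}" unfolding infinite_nat_iff_unbounded_le using e(2) by auto
  moreover have "{m. \<bar>f (x m) - f p\<bar> >= e} <= {m. f (x m) >= f p + e} Un {m. - f (x m) >= - f p + e}"
   by (auto simp: abs_if split: if_splits)
  ultimately have "infinite {m. f (x m) >= f p + e} | infinite {m. - f (x m) >= - f p + e}" using finite_subset by blast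
  then show False
  proof
   assume "infinite {m. f (x m) >= f p + e}"
   then show False using half[OF add scale bd e(1)] by blast
  next
   assume "infinite {m. - f (x m) >= - f p + e}"
   then show False by (rule half[OF _ _ _ e(1), rotated -1]) (simp_all add: add scale bd)
  qed
 qed
qed

text \<open>Against a bounded sequence it suffices to test weak convergence on a set with trivial
 orthogonal complement.\<close>

lemma weakly_tendsto_if_tested_on_total:
 fixes x :: "nat => 'a::{real_inner,complete_space}"
 assumes S: "subspace S" "closure S = UNIV" and bd: "!!m. norm (x m) <= B"
  and t: "!!h. h : S ==> (%m. x m \<bullet> h) ----> p \<bullet> h"
 shows "weakly_tendsto x p"
 unfolding weakly_tendsto_def
proof (intro allI LIMSEQ_I)
 fix h and e :: real assume "e > 0"
 have B0: "B >= 0" using bd[of 0] norm_ge_zero order_trans by blast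
 define d where "d = e / (2 * (B + norm p + 1))"
 have "d > 0" unfolding d_def using \<open>e > 0\<close> B0 by (simp add: add_nonneg_pos)
 then obtain g where g: "g : S" "dist g h < d" using S(2) by (metis UNIV_I closure_approachable)
 obtain N where N: "!!m. m >= N ==> \<bar>x m \<bullet> g - p \<bullet> g\<bar> < e/2"
  using LIMSEQ_D[OF t[OF g(1)], of "e/2"] \<open>e > 0\<close> by auto
 have "norm (x m \<bullet> h - p \<bullet> h) < e" if "m >= N" for m
 proof -
  have "\<bar>(x m - p) \<bullet> (h - g)\<bar> <= norm (x m - p) * norm (h - g)" by (rule Cauchy_Schwarz_ineq2)
  also have "... <= (B + norm p + 1) * d" using g(2) norm_triangle_ineq4[of "x m" p] bd[of m] B0
   by (intro mult_mono) (auto simp: dist_norm norm_minus_commute)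
  also have "... = e/2"
  proof -
   have "B + norm p + 1 ~= 0" using B0 norm_ge_zero[of p] by linarith
   then show ?thesis unfolding d_def by (metis (no_types) mult.commute nonzero_mult_div_cancel_left
    divide_divide_eq_left times_divide_eq_right)
  qed
  finally have "\<bar>(x m - p) \<bullet> (h - g)\<bar> <= e/2" .
  moreover have "x m \<bullet> h - p \<bullet> h = (x m \<bullet> g - p \<bullet> g) + (x m - p) \<bullet> (h - g)"
   by (simp add: inner_diff)
  ultimately show ?thesis using N[OF that] unfolding real_norm_def by linarith
 qed
 then show "\<exists>N. \<forall>m\<ge>N. norm (x m \<bullet> h - p \<bullet> h) < e" by blast
qed

section \<open>Smooth functions\<close>

abbreviation smooth :: "(real^'d::finite => 'b::real_normed_vector) => bool" where
 "smooth f \<equiv> C_infinity_on UNIV f"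

text \<open>A coinduction principle: membership in a class of differentiable functions that is closed
 under partial derivatives.\<close>

lemma smooth_coinduct:
 assumes "P f" and "!!g. P g ==> (\<forall>x. g differentiable (at x)) & (\<forall>i. P (partial_deriv i g))"
 shows "smooth f"
proof -
 have "P g ==> C_k_on k UNIV g" for k g
 proof (induction k arbitrary: g)
  case 0
  then show ?case using assms(2) by (auto intro!: differentiable_imp_continuous_on simp: differentiable_on_eq_differentiable_at)
 next
  case (Suc k)
  then show ?case using assms(2) by auto
 qed
 then show ?thesis using assms(1) unfolding C_infinity_on_def by blast
qed

lemma smooth_differentiable: "smooth f ==> f differentiable (at x)"
 unfolding C_infinity_on_def by (metis C_k_on.simps(2) UNIV_I)

lemma smooth_partial_deriv: "smooth f ==> smooth (partial_deriv i f)"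
 unfolding C_infinity_on_def by (metis C_k_on.simps(2))

lemma smooth_continuous_on: "smooth f ==> continuous_on S f"
 unfolding C_infinity_on_def by (metis C_k_on.simps(1) continuous_on_subset subset_UNIV)

lemma partial_deriv_eqI: "(f has_derivative f') (at x) ==> partial_deriv i f x = f' (axis i 1)"
 unfolding partial_deriv_def by (metis frechet_derivative_at)

lemma has_derivative_partial_deriv:
 fixes f :: "real^'d::finite => 'b::real_normed_vector"
 assumes "f differentiable (at x)"
 shows "(f has_derivative (%h. \<Sum>i\<in>UNIV. h $ i *R partial_deriv i f x)) (at x)"
proof -
 let ?f' = "frechet_derivative f (at x)"
 have d: "(f has_derivative ?f') (at x)" using assms frechet_derivative_works by blast
 interpret bounded_linear ?f' using d by (rule has_derivative_bounded_linear)
 have "?f' h = (\<Sum>i\<in>UNIV. h $ i *R partial_deriv i f x)" for h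
 proof -
  have "?f' (\<Sum>i\<in>UNIV. (h $ i) *R axis i 1) = (\<Sum>i\<in>UNIV. h $ i *R ?f' (axis i 1))" by (simp add: sum scaleR)
  moreover have "(\<Sum>i\<in>UNIV. (h $ i) *R axis i 1) = h" using basis_expansion[of h] by (simp add: scalar_mult_eq_scaleR)
  ultimately show ?thesis by (simp add: partial_deriv_def)
 qed
 then have "?f' = (%h. \<Sum>i\<in>UNIV. h $ i *R partial_deriv i f x)" by blast
 then show ?thesis using d by metis
qed

lemma partial_deriv_const: "partial_deriv i (%x. c) = (%x. 0)"
 by (rule ext, rule partial_deriv_eqI[OF has_derivative_const])

lemma partial_deriv_add:
 assumes "!!x. f differentiable (at x)" "!!x. g differentiable (at x)"
 shows "partial_deriv i (%x. f x + g x) = (%x. partial_deriv i f x + partial_deriv i g x)"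
proof (rule ext, rule trans[OF partial_deriv_eqI])
 fix x
 show "((%x. f x + g x) has_derivative
   (%h. frechet_derivative f (at x) h + frechet_derivative g (at x) h)) (at x)"
  by (intro has_derivative_add) (use assms frechet_derivative_works in auto)
qed (simp add: partial_deriv_def)

lemma partial_deriv_scaleR:
 fixes f :: "real^'d::finite => real" and g :: "real^'d::finite => 'b::real_normed_vector"
 assumes "!!x. f differentiable (at x)" "!!x. g differentiable (at x)"
 shows "partial_deriv i (%x. f x *R g x) =
  (%x. f x *R partial_deriv i g x + partial_deriv i f x *R g x)"
proof (rule ext, rule trans[OF partial_deriv_eqI])
 fix x
 show "((%x. f x *R g x) has_derivative
   (%h. f x *R frechet_derivative g (at x) h + frechet_derivative f (at x) h *R g x)) (at x)"
  by (intro has_derivative_scaleR) (use assms frechet_derivative_works in auto)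
qed (simp add: partial_deriv_def)

lemma partial_deriv_bounded_linear:
 assumes "bounded_linear L" "!!x. f differentiable (at x)"
 shows "partial_deriv i (%x. L (f x)) = (%x. L (partial_deriv i f x))"
proof (rule ext, rule trans[OF partial_deriv_eqI])
 fix x
 show "((%x. L (f x)) has_derivative (%h. L (frechet_derivative f (at x) h))) (at x)"
  by (rule bounded_linear.has_derivative[OF assms(1)]) (use assms frechet_derivative_works in auto)
qed (simp add: partial_deriv_def)

lemma partial_deriv_affine:
 assumes "!!x. f differentiable (at x)"
 shows "partial_deriv i (%x. f (c *R x + b)) = (%x. c *R partial_deriv i f (c *R x + b))"
proof (rule ext, rule trans[OF partial_deriv_eqI])
 fix x
 let ?f' = "frechet_derivative f (at (c *R x + b))"
 have f': "(f has_derivative ?f') (at (c *R x + b))" using assms frechet_derivative_works by auto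
 show "((%x. f (c *R x + b)) has_derivative (%h. ?f' (c *R h))) (at x)"
 proof -
  have "((%x. c *R x + b) has_derivative (%h. c *R h)) (at x)" by (auto intro!: derivative_eq_intros)
  then show ?thesis using has_derivative_compose[of "%x. c *R x + b" "%h. c *R h" x UNIV f ?f'] f' by simp
 qed
 show "?f' (c *R axis i 1) = c *R partial_deriv i f (c *R x + b)"
  using linear_scale[OF has_derivative_linear[OF f']] by (simp add: partial_deriv_def)
qed

lemma smooth_const: "smooth (%x. c)"
 by (rule smooth_coinduct[of "%f. \<exists>c. f = (%x. c)"]) (auto simp: partial_deriv_const)

lemma smooth_bounded_linear:
 assumes "bounded_linear L" "smooth f" shows "smooth (%x. L (f x))"
proof (rule smooth_coinduct[of "%h. \<exists>f. smooth f & h = (%x. L (f x))"])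
 fix h assume "\<exists>f. smooth f & h = (%x. L (f x))"
 then obtain f where f: "smooth f" "h = (%x. L (f x))" by blast
 have "h differentiable (at x)" for x
  unfolding f(2) using smooth_differentiable[OF f(1), of x] bounded_linear.has_derivative[OF assms(1)]
  unfolding differentiable_def by blast
 then show "(\<forall>x. h differentiable (at x)) & (\<forall>i. \<exists>f. smooth f & partial_deriv i h = (%x. L (f x)))"
  using smooth_partial_deriv[OF f(1)] partial_deriv_bounded_linear[OF assms(1) smooth_differentiable[OF f(1)]]
  unfolding f(2) by blast
qed (use assms in auto)

inductive sum_of_smooth_products :: "(real^'d::finite => 'b::real_normed_vector) => bool" where
 product: "smooth f ==> smooth g ==> sum_of_smooth_products (%x. f x *R g x)"
| plus: "sum_of_smooth_products f ==> sum_of_smooth_products g ==> sum_of_smooth_products (%x. f x + g x)"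

lemma sum_of_smooth_products_smooth: "sum_of_smooth_products f ==> smooth f"
proof (erule smooth_coinduct)
 fix g :: "real^'a => 'b" assume "sum_of_smooth_products g"
 then show "(\<forall>x. g differentiable (at x)) & (\<forall>i. sum_of_smooth_products (partial_deriv i g))"
 proof induction
  case (product f g)
  note d = smooth_differentiable[OF product(1)] smooth_differentiable[OF product(2)]
  show ?case unfolding partial_deriv_scaleR[OF d] using d product
   by (auto intro!: sum_of_smooth_products.intros smooth_partial_deriv differentiable_scaleR)
 next
  case (plus f g)
  then show ?case by (auto simp: partial_deriv_add intro: sum_of_smooth_products.intros)
 qed
qed

lemma smooth_scaleR: "smooth f ==> smooth g ==> smooth (%x. f x *R g x)"
 by (rule sum_of_smooth_products_smooth) (rule sum_of_smooth_products.product)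

lemma smooth_add: "smooth f ==> smooth g ==> smooth (%x. f x + g x)"
 using sum_of_smooth_products.plus[OF sum_of_smooth_products.product[OF smooth_const[of 1], of f]
   sum_of_smooth_products.product[OF smooth_const[of 1], of g]] by (auto dest: sum_of_smooth_products_smooth)

lemma smooth_mult: "smooth f ==> smooth g ==> smooth (%x. f x * g x :: real)"
 using smooth_scaleR[of f g] by simp

lemma smooth_cmult: "smooth f ==> smooth (%x. c *R f x)"
 by (rule smooth_scaleR[OF smooth_const])

lemma smooth_minus: "smooth f ==> smooth (%x. - f x)"
 using smooth_cmult[of f "-1"] by simp

lemma smooth_diff: "smooth f ==> smooth g ==> smooth (%x. f x - g x)"
 using smooth_add[of f "%x. - g x"] smooth_minus[of g] by simp

lemma smooth_sum: "finite I ==> (!!i. i : I ==> smooth (f i)) ==> smooth (%x. \<Sum>i\<in>I. f i x)"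
 by (induction rule: finite_induct) (auto intro: smooth_const smooth_add)

lemma smooth_prod:
 "finite I ==> (!!i. i : I ==> smooth (f i)) ==> smooth (%x. \<Prod>i\<in>I. f i x :: real)"
 by (induction rule: finite_induct) (auto intro: smooth_const smooth_mult)

lemma smooth_affine:
 assumes "smooth f" shows "smooth (%x. f (c *R x + b))"
proof (rule smooth_coinduct[of "%h. \<exists>f a. smooth f & h = (%x. a *R f (c *R x + b))"])
 show "\<exists>g a. smooth g & (%x. f (c *R x + b)) = (%x. a *R g (c *R x + b))"
  using assms by (intro exI[of _ f] exI[of _ 1]) auto
next
 fix h :: "real^'a => 'b" assume "\<exists>f a. smooth f & h = (%x. a *R f (c *R x + b))"
 then obtain f a where f: "smooth f" "h = (%x. a *R f (c *R x + b))" by blast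
 have d1: "(%x. f (c *R x + b)) differentiable (at x)" for x
 proof -
  have "(f \<circ> (%x. c *R x + b)) differentiable (at x)"
   by (rule differentiable_chain_at) (auto intro: smooth_differentiable[OF f(1)] derivative_intros)
  then show ?thesis by (simp add: o_def)
 qed
 then have d: "h differentiable (at x)" for x unfolding f(2) by (intro differentiable_scaleR) auto
 have "partial_deriv i h = (%x. (a * c) *R partial_deriv i f (c *R x + b))" for i
  unfolding f(2) using partial_deriv_bounded_linear[OF bounded_linear_scaleR_right d1]
  by (simp add: partial_deriv_affine[OF smooth_differentiable[OF f(1)]])
 then show "(\<forall>x. h differentiable (at x)) \<and>
   (\<forall>i. \<exists>f a. smooth f & partial_deriv i h = (%x. a *R f (c *R x + b)))"
  using d smooth_partial_deriv[OF f(1)] by blast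
qed

lemma partial_deriv_component:
 "partial_deriv j (%x. x $ i) = (%x. if i = j then 1 else 0 :: real)"
 by (rule ext, rule trans[OF partial_deriv_eqI[OF bounded_linear_imp_has_derivative[OF bounded_linear_vec_nth]]])
  (simp add: axis_def)

lemma smooth_component: "smooth (%x. x $ i :: real)"
proof (rule smooth_coinduct[of "%h. h = (%x. x $ i) | smooth h"])
 fix h :: "real^'a => real" assume "h = (%x. x $ i) | smooth h"
 then show "(\<forall>x. h differentiable (at x)) \<and>
   (\<forall>j. partial_deriv j h = (%x. x $ i) | smooth (partial_deriv j h))"
  by (auto simp: partial_deriv_component smooth_const smooth_differentiable smooth_partial_deriv
    intro: bounded_linear_imp_differentiable bounded_linear_vec_nth)
qed simp

lemma smooth_exp:
 assumes "smooth p" shows "smooth (%x. exp (p x) :: real)"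
proof (rule smooth_coinduct[of "%h. \<exists>f. smooth f & h = (%x. f x * exp (p x))"])
 show "\<exists>f. smooth f & (%x. exp (p x)) = (%x. f x * exp (p x))" by (intro exI[of _ "%x. 1"]) (auto intro: smooth_const)
next
 fix h :: "real^'a => real" assume "\<exists>f. smooth f & h = (%x. f x * exp (p x))"
 then obtain f where f: "smooth f" "h = (%x. f x * exp (p x))" by blast
 have D: "(h has_derivative (%y. (\<Sum>i\<in>UNIV. y $ i *R partial_deriv i f x) * exp (p x)
   + f x * (exp (p x) * (\<Sum>i\<in>UNIV. y $ i *R partial_deriv i p x)))) (at x)" for x unfolding f(2)
  by (auto intro!: derivative_eq_intros has_derivative_partial_deriv smooth_differentiable f(1) assms
    simp: algebra_simps)
 have ax: "(\<Sum>k\<in>UNIV. axis i 1 $ k * c k) = c i" for i :: 'a and c :: "'a => real"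
  by (simp add: axis_def if_distrib[of "%a. a * _"] cong: if_cong)
 have "partial_deriv i h = (%x. (partial_deriv i f x + f x * partial_deriv i p x) * exp (p x))" for i
  by (rule ext, subst partial_deriv_eqI[OF D]) (simp only: ax real_scaleR_def, simp add: algebra_simps)
 moreover have "smooth (%x. partial_deriv i f x + f x * partial_deriv i p x)" for i
  by (intro smooth_add smooth_mult smooth_partial_deriv f(1) assms)
 ultimately show "(\<forall>x. h differentiable (at x)) \<and>
   (\<forall>i. \<exists>f. smooth f & partial_deriv i h = (%x. f x * exp (p x)))" using D unfolding differentiable_def by blast
qed

subsection \<open>Smooth bump functions on boxes\<close>

text \<open>The derivative of \<open>flat n\<close> is a combination of \<open>flat (n + 1)\<close> and \<open>flat (n + 2)\<close>, so that the whole
 family becomes smooth at once by coinduction.\<close>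

definition flat :: "nat => real => real" where
 "flat n t = (if t > 0 then exp (- 1 / t) / t ^ n else 0)"

lemma power_le_fact_exp: "(x::real) >= 0 ==> x ^ m <= fact m * exp x"
proof -
 assume x: "x >= 0"
 have "(\<Sum>n\<in>{m}. x ^ n /\<^sub>R fact n) <= (\<Sum>n. x ^ n /\<^sub>R fact n)"
  by (intro sum_le_suminf summable_exp_generic) (use x in auto)
 then have "x ^ m / fact m <= exp x" by (simp add: exp_def divide_inverse mult.commute)
 then show ?thesis by (simp add: field_simps)
qed

lemma flat_le: "t >= 0 ==> \<bar>flat n t\<bar> <= fact (n + 2) * t^2"
proof (cases "t = 0")
 case False
 assume "t >= 0"
 then have t: "t > 0" using False by simp
 have "(1/t) ^ (n + 2) <= fact (n + 2) * exp (1/t)" using t by (intro power_le_fact_exp) auto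
 then have "1 <= fact (n + 2) * exp (1/t) * t ^ (n + 2)" using t by (simp add: field_simps power_add)
 then have "exp (- 1/t) <= fact (n + 2) * t ^ (n + 2)" using t by (simp add: exp_minus field_simps)
 then show ?thesis using t unfolding flat_def by (simp add: field_simps power_add power2_eq_square)
qed (simp add: flat_def)

lemma flat_deriv: "(flat n has_real_derivative (flat (n + 2) t - real n * flat (n + 1) t)) (at t)"
proof -
 consider "t > 0" | "t < 0" | "t = 0" by linarith
 then show ?thesis
 proof cases
  case 1
  have "((%t. exp (- 1 / t) * inverse t ^ n) has_real_derivative
   (exp (- 1 / t) * (1 / t\<^sup>2)) * inverse t ^ n + (real n * inverse t ^ (n - 1) * (- (inverse t)\<^sup>2)) * exp (- 1 / t)) (at t)"
   using 1 by (auto intro!: derivative_eq_intros simp: power2_eq_square divide_inverse)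
  moreover have "real n * inverse t ^ (n - 1) * (- (inverse t)\<^sup>2) = - real n * inverse t ^ (n + 1)"
   by (cases n) (auto simp: power2_eq_square algebra_simps)
  moreover have "(exp (- 1 / t) * (1 / t\<^sup>2)) * inverse t ^ n + (- real n * inverse t ^ (n + 1)) * exp (- 1 / t)
    = flat (n + 2) t - real n * flat (n + 1) t" using 1 by (simp add: flat_def divide_simps power2_eq_square)
  ultimately have "((%t. exp (- 1 / t) / t ^ n) has_real_derivative (flat (n + 2) t - real n * flat (n + 1) t)) (at t)"
   by (simp only: divide_inverse power_inverse)
  then show ?thesis by (rule has_field_derivative_transform_within_open[of _ _ _ "{0<..}"]) (use 1 in "auto simp: flat_def")
 next
  case 2
  have "((%t. 0) has_real_derivative (flat (n + 2) t - real n * flat (n + 1) t)) (at t)" using 2 by (auto simp: flat_def)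
  then show ?thesis by (rule has_field_derivative_transform_within_open[of _ _ _ "{..<0}"]) (use 2 in "auto simp: flat_def")
 next
  case 3
  have b: "\<bar>(flat n h - flat n 0) / h\<bar> <= fact (n + 2) * \<bar>h\<bar>" if "h ~= 0" for h
  proof (cases "h > 0")
   case True
   then have "\<bar>flat n h\<bar> / h <= fact (n + 2) * h^2 / h" by (intro divide_right_mono flat_le) auto
   then show ?thesis using True by (simp add: flat_def power2_eq_square)
  next
   case False
   have "0 <= fact (n + 2) * \<bar>h\<bar>" by (intro mult_nonneg_nonneg) auto
   then show ?thesis using False by (simp add: flat_def del: fact_Suc)
  qed
  have "((%h. (flat n h - flat n 0) / h) \<longlongrightarrow> 0) (at 0)"
  proof (rule Lim_null_comparison)
   show "\<forall>\<^sub>F h in at 0. norm ((flat n h - flat n 0) / h) <= fact (n + 2) * \<bar>h\<bar>"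
    using b by (auto simp: eventually_at_filter)
   show "((%h::real. fact (n + 2) * \<bar>h\<bar>) \<longlongrightarrow> 0) (at 0)" by (auto intro!: tendsto_eq_intros)
  qed
  then show ?thesis using 3 by (simp add: DERIV_def flat_def)
 qed
qed

lemma flat_nonneg: "flat n t >= 0" and flat_pos_iff: "flat n t > 0 \<longleftrightarrow> t > 0"
 by (auto simp: flat_def)

inductive flat_combination :: "'d => real => real => (real^'d::finite => real) => bool" for i s a where
 base: "flat_combination i s a (%x. c * flat n (s * x $ i + a))"
| plus: "flat_combination i s a f ==> flat_combination i s a g ==> flat_combination i s a (%x. f x + g x)"

lemma smooth_flat: "smooth (%x. flat n (s * x $ i + a))"
proof (rule smooth_coinduct[of "flat_combination i s a"])
 show "flat_combination i s a (%x. flat n (s * x $ i + a))" using flat_combination.base[of i s a 1 n] by simp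
next
 fix h assume "flat_combination i s a h"
 then show "(\<forall>x. h differentiable (at x)) & (\<forall>j. flat_combination i s a (partial_deriv j h))"
 proof induction
  case (base c n)
  have D: "((%x. c * flat n (s * x $ i + a)) has_derivative
   (%h. c * ((flat (n + 2) (s * x $ i + a) - real n * flat (n + 1) (s * x $ i + a)) * (s * h $ i)))) (at x)" for x
  proof -
   have 1: "((%x. s * x $ i + a) has_derivative (%h. s * h $ i)) (at x)"
    by (auto intro!: derivative_eq_intros bounded_linear.has_derivative[OF bounded_linear_vec_nth])
   have 2: "(flat n has_derivative (%h. (flat (n + 2) t - real n * flat (n + 1) t) * h)) (at t)" for t
    using flat_deriv[of n t] by (simp add: has_field_derivative_def)
   show ?thesis by (intro has_derivative_mult_right has_derivative_compose[OF 1 2])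
  qed
  have eq: "partial_deriv j (%x. c * flat n (s * x $ i + a)) =
   (%x. (if i = j then c * s else 0) * flat (n + 2) (s * x $ i + a)
    + (if i = j then - c * s * real n else 0) * flat (n + 1) (s * x $ i + a))" for j
   by (rule ext, subst partial_deriv_eqI[OF D]) (auto simp: axis_def algebra_simps)
  have "flat_combination i s a (partial_deriv j (%x. c * flat n (s * x $ i + a)))" for j
   unfolding eq by (rule flat_combination.plus[OF flat_combination.base flat_combination.base])
  then show ?case using D unfolding differentiable_def by blast
 next
  case (plus f g)
  then show ?case by (auto simp: partial_deriv_add intro: flat_combination.intros)
 qed
qed

definition box_profile :: "real^'d::finite => real^'d => real^'d => real" where
 "box_profile a b x = (\<Prod>i\<in>UNIV. flat 0 (1 * x $ i + - a $ i) * flat 0 (- 1 * x $ i + b $ i))"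

lemma smooth_box_profile: "smooth (box_profile a b)"
 unfolding box_profile_def[abs_def] by (intro smooth_prod smooth_mult smooth_flat) auto

lemma box_profile_nonneg: "box_profile a b x >= 0"
 unfolding box_profile_def by (intro prod_nonneg mult_nonneg_nonneg flat_nonneg ballI)

lemma box_profile_pos: "x : box a b ==> box_profile a b x > 0"
 unfolding box_profile_def by (intro prod_pos mult_pos_pos) (auto simp: flat_pos_iff mem_box_cart)

lemma box_profile_zero: "x ~: box a b ==> box_profile a b x = 0"
 unfolding box_profile_def mem_box_cart by (auto simp: prod_zero_iff flat_def)

subsection \<open>Test functions\<close>

lemma test_function_smooth: "test_function S \<phi> ==> smooth \<phi>"
 unfolding test_function_def by blast

lemma test_function_support:
 assumes "test_function S \<phi>"
 obtains K where "compact K" "K <= S" "!!x. x ~: K ==> \<phi> x = 0" using assms unfolding test_function_def by blast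

lemma test_functionI:
 "smooth \<phi> ==> compact K ==> K <= S ==> (!!x. x ~: K ==> \<phi> x = 0) ==> test_function S \<phi>"
 unfolding test_function_def by blast

lemma test_function_mono: "test_function S \<phi> ==> S <= T ==> test_function T \<phi>"
 unfolding test_function_def by blast

lemma partial_deriv_zero_off_closed:
 assumes "closed K" "!!x. x ~: K ==> f x = 0" "x ~: K"
 shows "partial_deriv i f x = 0"
proof (rule trans[OF partial_deriv_eqI])
 show "(f has_derivative (%h. 0)) (at x)"
  by (rule has_derivative_transform_within_open[OF has_derivative_const, of "- K"]) (use assms in auto)
qed simp

lemma test_function_partial_deriv:
 assumes "test_function S \<phi>" shows "test_function S (partial_deriv i \<phi>)"
proof -
 obtain K where K: "compact K" "K <= S" "!!x. x ~: K ==> \<phi> x = 0" using test_function_support[OF assms] by blast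
 show ?thesis by (rule test_functionI[OF smooth_partial_deriv[OF test_function_smooth[OF assms]] K(1,2)])
   (rule partial_deriv_zero_off_closed[OF compact_imp_closed[OF K(1)] K(3)])
qed

lemma test_function_add:
 assumes "test_function S \<phi>" "test_function S \<eta>" shows "test_function S (%x. \<phi> x + \<eta> x)"
proof -
 obtain K L where "compact K" "K <= S" "!!x. x ~: K ==> \<phi> x = 0" "compact L" "L <= S" "!!x. x ~: L ==> \<eta> x = 0"
  using test_function_support[OF assms(1)] test_function_support[OF assms(2)] by metis
 then show ?thesis by (intro test_functionI[of _ "K Un L"] smooth_add assms[THEN test_function_smooth]) auto
qed

lemma test_function_smooth_scaleR:
 assumes "test_function S \<phi>" "smooth f" shows "test_function S (%x. \<phi> x *R f x)"
proof -
 obtain K where "compact K" "K <= S" "!!x. x ~: K ==> \<phi> x = 0" using test_function_support[OF assms(1)] by blast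
 then show ?thesis by (intro test_functionI[of _ K] smooth_scaleR assms test_function_smooth[OF assms(1)]) auto
qed

lemma test_function_scaleR_const: "test_function S \<phi> ==> test_function S (%x. \<phi> x *R c)"
 by (rule test_function_smooth_scaleR[OF _ smooth_const])

lemma test_function_bounded_linear:
 assumes "bounded_linear L" "test_function S \<phi>" shows "test_function S (%x. L (\<phi> x))"
proof -
 obtain K where K: "compact K" "K <= S" "!!x. x ~: K ==> \<phi> x = 0" using test_function_support[OF assms(2)] by blast
 show ?thesis by (rule test_functionI[OF smooth_bounded_linear[OF assms(1) test_function_smooth[OF assms(2)]] K(1,2)])
   (simp add: K(3) linear_0[OF bounded_linear.linear[OF assms(1)]])
qed

lemma test_function_cmult: "test_function S \<phi> ==> test_function S (%x. c *R \<phi> x)"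
 by (rule test_function_bounded_linear[OF bounded_linear_scaleR_right])

lemma test_function_affine:
 fixes \<phi> :: "real^'d::finite => 'b::real_normed_vector"
 assumes "test_function S \<phi>" "c ~= 0" "!!x. x : S ==> (x - b) /\<^sub>R c : T"
 shows "test_function T (%x. \<phi> (c *R x + b))"
proof -
 obtain K where K: "compact K" "K <= S" "!!x. x ~: K ==> \<phi> x = 0" using test_function_support[OF assms(1)] by blast
 show ?thesis
 proof (rule test_functionI[of _ "(%x. (x - b) /\<^sub>R c) ` K"])
  show "compact ((%x. (x - b) /\<^sub>R c) ` K)" by (intro compact_continuous_image continuous_intros K)
  show "(%x. (x - b) /\<^sub>R c) ` K <= T" using K(2) assms(3) by auto
  fix x assume "x ~: (%x. (x - b) /\<^sub>R c) ` K"
  then have "c *R x + b ~: K" using assms(2) by (auto simp: image_iff)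
  then show "\<phi> (c *R x + b) = 0" by (rule K(3))
 qed (intro smooth_affine test_function_smooth[OF assms(1)])
qed

lemma uniformly_continuous_compact_support:
 fixes f :: "'a::heine_borel => 'b::real_normed_vector"
 assumes "continuous_on UNIV f" "compact K" "!!x. x ~: K ==> f x = 0" "e > 0"
 shows "\<exists>d>0. \<forall>x y. dist x y < d --> dist (f x) (f y) < e"
proof -
 have "uniformly_continuous_on K f" using assms by (intro compact_uniformly_continuous continuous_on_subset[OF assms(1)]) auto
 let ?U = "%x. {y. dist (f y) (f x) < e/2}"
 have op: "open (?U x)" for x by (intro open_Collect_less continuous_intros continuous_on_subset[OF assms(1)]) auto
 have "K <= (\<Union>x\<in>K. ?U x)" using assms(4) by auto
 obtain d where d: "d > 0" "!!x. x : K ==> \<exists>G\<in>(?U ` K). ball x d <= G"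
  using Heine_Borel_lemma[OF assms(2), of "?U ` K"] op \<open>K \<subseteq> _\<close> by auto
 have near: "dist (f x) (f y) < e" if xy: "x : K" "dist x y < d" for x y
 proof -
  obtain z where "ball x d <= ?U z" using d(2)[OF xy(1)] by auto
  moreover have "x : ball x d" "y : ball x d" using xy d(1) by auto
  ultimately have "dist (f x) (f z) < e/2" "dist (f y) (f z) < e/2" by blast+
  then show ?thesis by (rule dist_triangle_half_l)
 qed
 then have "dist (f x) (f y) < e" if "dist x y < d" for x y
  using that assms(3)[of x] assms(3)[of y] assms(4) near[of x y] near[of y x]
  by (cases "x : K"; cases "y : K") (simp_all add: dist_commute)
 then show ?thesis using d(1) by blast
qed

lemma test_function_bounded:
 assumes "test_function S \<phi>" obtains C where "C > 0" "!!x. norm (\<phi> x) <= C"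
proof -
 obtain K where K: "compact K" "!!x. x ~: K ==> \<phi> x = 0" using test_function_support[OF assms] by metis
 have "compact (\<phi> ` K)" by (intro compact_continuous_image smooth_continuous_on test_function_smooth[OF assms] K)
 then obtain C where "C > 0" "!!y. y : \<phi> ` K ==> norm y <= C" by (meson bounded_pos compact_imp_bounded)
 then show ?thesis using that[of C] K(2) by (metis image_eqI less_imp_le norm_zero)
qed

section \<open>Lebesgue integration over subsets of Euclidean space\<close>

lemma lebesgue_affine_density:
 fixes t :: "'a::euclidean_space"
 assumes "c ~= 0"
 shows "lebesgue = density (distr lebesgue lebesgue (%x. t + c *R x)) (%_. ennreal (\<bar>c\<bar> ^ DIM('a)))"
  and "(%x::'a. t + c *R x) : lebesgue \<rightarrow>\<^sub>M lebesgue"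
proof -
 have eq: "(%x. t + (\<Sum>j\<in>Basis. (c * (x \<bullet> j)) *R j)) = (%x::'a. t + c *R x)"
  by (simp add: scaleR_scaleR[symmetric] scaleR_sum_right[symmetric] euclidean_representation del: scaleR_scaleR)
 show "lebesgue = density (distr lebesgue lebesgue (%x. t + c *R x)) (%_. ennreal (\<bar>c\<bar> ^ DIM('a)))"
  using lebesgue_affine_euclidean[of "%_. c" t] assms by (simp add: eq)
 show "(%x::'a. t + c *R x) : lebesgue \<rightarrow>\<^sub>M lebesgue"
  using lebesgue_affine_measurable[of "%_. c" t] assms by (simp add: eq)
qed

lemma measurable_lebesgue_affine:
 fixes t :: "'a::euclidean_space"
 assumes "c ~= 0" "f : borel_measurable lebesgue"
 shows "(%x. f (t + c *R x)) : borel_measurable lebesgue"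
 using measurable_comp[OF lebesgue_affine_density(2)[OF assms(1)] assms(2)] by (simp add: o_def)

lemma nn_integral_lebesgue_affine:
 fixes t :: "'a::euclidean_space"
 assumes "c ~= 0" and f: "f : borel_measurable lebesgue"
 shows "(\<integral>\<^sup>+x. f x \<partial>lebesgue) = ennreal (\<bar>c\<bar> ^ DIM('a)) * (\<integral>\<^sup>+x. f (t + c *R x) \<partial>lebesgue)"
proof -
 have [measurable]: "(%x::'a. t + c *R x) : lebesgue \<rightarrow>\<^sub>M lebesgue" "f : borel_measurable lebesgue"
  using lebesgue_affine_density(2)[OF assms(1)] f by auto
 show ?thesis by (subst lebesgue_affine_density(1)[OF assms(1), of t])
   (simp add: nn_integral_density nn_integral_distr nn_integral_cmult)
qed

lemma integrable_lebesgue_affine: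
 fixes t :: "'a::euclidean_space" and f :: "'a => 'b::{banach,second_countable_topology}"
 assumes "c ~= 0" and f: "integrable lebesgue f"
 shows "integrable lebesgue (%x. f (t + c *R x))"
proof (rule integrableI_bounded)
 have m: "f : borel_measurable lebesgue" using f by auto
 then show "(%x. f (t + c *R x)) : borel_measurable lebesgue" by (rule measurable_lebesgue_affine[OF assms(1)])
 have "(\<integral>\<^sup>+x. norm (f x) \<partial>lebesgue) < \<infinity>" using f unfolding integrable_iff_bounded by simp
 then show "(\<integral>\<^sup>+x. norm (f (t + c *R x)) \<partial>lebesgue) < \<infinity>"
  using nn_integral_lebesgue_affine[OF assms(1), of "%x. ennreal (norm (f x))" t] m assms(1)
  by (auto simp: ennreal_mult_less_top less_top[symmetric] ennreal_mult_eq_top_iff)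
qed

lemma integral_lebesgue_affine:
 fixes t :: "'a::euclidean_space" and f :: "'a => 'b::{banach,second_countable_topology}"
 assumes "c ~= 0" and f: "f : borel_measurable lebesgue"
 shows "(LINT x|lebesgue. f x) = (\<bar>c\<bar> ^ DIM('a)) *R (LINT x|lebesgue. f (t + c *R x))"
proof -
 have [measurable]: "(%x::'a. t + c *R x) : lebesgue \<rightarrow>\<^sub>M lebesgue" "f : borel_measurable lebesgue"
  using lebesgue_affine_density(2)[OF assms(1)] f by auto
 show ?thesis by (subst lebesgue_affine_density(1)[OF assms(1), of t])
   (simp add: integral_density integral_distr)
qed

lemma AE_lebesgue_affine:
 fixes t :: "'a::euclidean_space"
 assumes "c ~= 0" "AE x in lebesgue. P x"
 shows "AE x in lebesgue. P (t + c *R x)"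
proof -
 obtain N where N: "{x. ~ P x} <= N" "N : null_sets lebesgue" using assms(2) unfolding eventually_ae_filter by auto
 let ?N = "{x. t + c *R x : N}"
 have "(%x. t + c *R x) -` N Int space lebesgue : sets lebesgue"
  using measurable_sets[OF lebesgue_affine_density(2)[OF assms(1)]] N(2) by blast
 then have s: "?N : sets lebesgue" by (simp add: vimage_def)
 have "emeasure lebesgue N = ennreal (\<bar>c\<bar> ^ DIM('a)) * (\<integral>\<^sup>+x. indicator N (t + c *R x) \<partial>lebesgue)"
  using nn_integral_lebesgue_affine[OF assms(1), of "indicator N" t] N(2) by auto
 moreover have "(%x. indicator N (t + c *R x) :: ennreal) = indicator ?N" by (auto simp: indicator_def)
 ultimately have "emeasure lebesgue ?N = 0" using N(2) s assms(1) by (auto simp: null_sets_def)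
 then have "?N : null_sets lebesgue" using s by auto
 then show ?thesis by (rule AE_I') (use N(1) in auto)
qed

lemma integral_lebesgue_translation:
 fixes t :: "'a::euclidean_space" and f :: "'a => 'b::{banach,second_countable_topology}"
 assumes "f : borel_measurable lebesgue"
 shows "(LINT x|lebesgue. f (x - t)) = (LINT x|lebesgue. f x)"
 using integral_lebesgue_affine[of 1 f "- t"] assms by simp

lemma integral_lebesgue_on:
 fixes f :: "'a::euclidean_space => 'b::{banach,second_countable_topology}"
 assumes "S : sets lebesgue"
 shows "(LINT x|lebesgue_on S. f x) = (LINT x|lebesgue. indicator S x *R f x)"
 using assms by (subst integral_restrict_space) auto

lemma integrable_lebesgue_on:
 fixes f :: "'a::euclidean_space => 'b::{banach,second_countable_topology}"
 assumes "S : sets lebesgue"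
 shows "integrable (lebesgue_on S) f \<longleftrightarrow> integrable lebesgue (%x. indicator S x *R f x)"
 using assms by (subst integrable_restrict_space) auto

lemma measurable_lebesgue_on:
 fixes f :: "'a::euclidean_space => 'b::real_normed_vector"
 assumes "S : sets lebesgue"
 shows "f : borel_measurable (lebesgue_on S) \<longleftrightarrow> (%x. indicator S x *R f x) : borel_measurable lebesgue"
 using assms by (subst borel_measurable_restrict_space_iff) (auto simp: scaleR_conv_of_real)

lemma AE_lebesgue_on:
 assumes "S : sets lebesgue"
 shows "(AE x in lebesgue_on S. P x) \<longleftrightarrow> (AE x in lebesgue. x : S --> P x)"
 using assms by (subst AE_restrict_space_iff) auto

lemma integrable_indicator_bounded:
 fixes S :: "'a::euclidean_space set"
 shows "bounded S ==> S : sets lebesgue ==> integrable lebesgue (indicator S :: 'a => real)"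
 using bounded_set_imp_lmeasurable lmeasurable_iff_integrable by blast

lemma continuous_borel_measurable_lebesgue:
 fixes f :: "'a::euclidean_space => 'b::euclidean_space"
 shows "continuous_on UNIV f ==> f : borel_measurable lebesgue"
 by (intro measurable_completion) (simp add: borel_measurable_continuous_onI)

lemma integrable_bounded_scaleR:
 fixes f :: "'a::euclidean_space => real" and u :: "'a => 'b::euclidean_space"
 assumes "integrable lebesgue u" "f : borel_measurable lebesgue" "AE x in lebesgue. \<bar>f x\<bar> <= C"
 shows "integrable lebesgue (%x. f x *R u x)"
proof (rule Bochner_Integration.integrable_bound)
 show "integrable lebesgue (%x. C *R norm (u x))" using assms(1) by (intro integrable_scaleR_right integrable_norm)
 show "(%x. f x *R u x) : borel_measurable lebesgue" using assms by measurable
 show "AE x in lebesgue. norm (f x *R u x) <= norm (C *R norm (u x))"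
  using assms(3) by eventually_elim (auto intro!: mult_right_mono)
qed

section \<open>Test functions under the integral\<close>

lemma test_function_measurable:
 fixes \<phi> :: "real^'d::finite => 'b::euclidean_space"
 shows "test_function S \<phi> ==> \<phi> : borel_measurable lebesgue"
 by (intro continuous_borel_measurable_lebesgue smooth_continuous_on test_function_smooth)

lemma integrable_test_function_scaleR:
 fixes u :: "real^'d::finite => 'b::euclidean_space"
 assumes "test_function S \<phi>" "locally_integrable S u"
 shows "integrable lebesgue (%x. \<phi> x *R u x)"
proof -
 obtain K where K: "compact K" "K <= S" "!!x. x ~: K ==> \<phi> x = 0" using test_function_support[OF assms(1)] by metis
 obtain C where C: "!!x. norm (\<phi> x) <= C" using test_function_bounded[OF assms(1)] by metis
 have "integrable lebesgue (%x. indicator K x *R u x)"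
  using assms(2) K unfolding locally_integrable_def by (simp add: integrable_lebesgue_on compact_imp_closed)
 then have "integrable lebesgue (%x. \<phi> x *R (indicator K x *R u x))"
  by (rule integrable_bounded_scaleR[OF _ test_function_measurable[OF assms(1)], where C=C]) (use C in auto)
 moreover have "(%x. \<phi> x *R (indicator K x *R u x)) = (%x. \<phi> x *R u x)"
  using K(3) by (force simp: indicator_def fun_eq_iff)
 ultimately show ?thesis by simp
qed

lemma integral_test_function_on:
 fixes u :: "real^'d::finite => 'b::euclidean_space"
 assumes "test_function S \<phi>" "S : sets lebesgue"
 shows "(LINT x|lebesgue_on S. \<phi> x *R u x) = (LINT x|lebesgue. \<phi> x *R u x)"
proof -
 obtain K where K: "K <= S" "!!x. x ~: K ==> \<phi> x = 0" using test_function_support[OF assms(1)] by metis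
 have "(%x. indicator S x *R \<phi> x *R u x) = (%x. \<phi> x *R u x)" using K by (force simp: indicator_def fun_eq_iff)
 then show ?thesis using assms(2) by (simp add: integral_lebesgue_on)
qed

lemma integrable_test_function:
 fixes \<phi> :: "real^'d::finite => 'b::euclidean_space"
 assumes "test_function S \<phi>" shows "integrable lebesgue \<phi>"
proof -
 obtain K where K: "compact K" "!!x. x ~: K ==> \<phi> x = 0" using test_function_support[OF assms(1)] by metis
 obtain C where C: "!!x. norm (\<phi> x) <= C" using test_function_bounded[OF assms(1)] by metis
 have "integrable lebesgue (%x. indicator K x *R C)"
  using K(1) by (intro integrable_scaleR_left integrable_real_indicator) (auto simp: compact_imp_closed less_top[symmetric]
    dest: emeasure_compact_finite)
 then show ?thesis by (rule Bochner_Integration.integrable_bound[OF _ test_function_measurable[OF assms]])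
   (use K(2) C order_trans[OF C abs_ge_self] in "auto simp: indicator_def")
qed

subsection \<open>Convolution\<close>

text \<open>The convolution of \<open>u\<close> with the reflection of \<open>\<rho>\<close>; its derivatives are minus the
 correlations with the derivatives of \<open>\<rho>\<close>.\<close>

definition corr :: "(real^'d::finite => real) => (real^'d => 'b::euclidean_space) => real^'d => 'b" where
 "corr \<rho> u x = (LINT y|lebesgue. \<rho> (y - x) *R u y)"

lemma integrable_corr:
 fixes u :: "real^'d::finite => 'b::euclidean_space"
 assumes "test_function UNIV \<rho>" "integrable lebesgue u"
 shows "integrable lebesgue (%y. \<rho> (y - x) *R u y)"
proof -
 have t: "test_function UNIV (%y. \<rho> (y - x))" using test_function_affine[OF assms(1), of 1 "-x" UNIV] by simp
 obtain C where C: "!!x. norm (\<rho> x) <= C" using test_function_bounded[OF assms(1)] by metis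
 show ?thesis by (rule integrable_bounded_scaleR[OF assms(2) test_function_measurable[OF t], where C=C]) (use C in auto)
qed

lemma onorm_coefficients_le:
 fixes c :: "'d::finite => real"
 assumes "!!i. \<bar>c i\<bar> <= e" shows "\<bar>\<Sum>i\<in>UNIV. h $ i * c i\<bar> <= e * real CARD('d) * norm (h :: real^'d)"
proof -
 have "\<bar>\<Sum>i\<in>UNIV. h $ i * c i\<bar> <= (\<Sum>i\<in>(UNIV::'d set). norm h * e)"
 proof (rule order_trans[OF sum_abs sum_mono])
  fix i show "\<bar>h $ i * c i\<bar> <= norm h * e"
   unfolding abs_mult using component_le_norm_cart[of h i] assms by (intro mult_mono) auto
 qed
 then show ?thesis by (simp add: mult_ac)
qed

lemma test_function_uniformly_differentiable:
 fixes \<rho> :: "real^'d::finite => real"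
 assumes "test_function UNIV \<rho>" "e > 0"
 obtains d where "d > 0"
  "!!y h. norm h < d ==> \<bar>\<rho> (y + h) - \<rho> y - (\<Sum>i\<in>UNIV. h $ i * partial_deriv i \<rho> y)\<bar> <= e * norm h"
proof -
 define n where "n = real CARD('d)"
 have n: "n > 0" unfolding n_def by simp
 have "\<exists>d>0. \<forall>x y. dist x y < d --> dist (partial_deriv i \<rho> x) (partial_deriv i \<rho> y) < e / n" for i
 proof -
  have t: "test_function UNIV (partial_deriv i \<rho>)" by (rule test_function_partial_deriv[OF assms(1)])
  obtain K where K: "compact K" "!!x. x ~: K ==> partial_deriv i \<rho> x = 0" using test_function_support[OF t] by metis
  have "e / n > 0" using assms(2) n by simp
  from uniformly_continuous_compact_support[OF smooth_continuous_on[OF test_function_smooth[OF t]] K this]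
  show ?thesis .
 qed
 then obtain D where D: "!!i. D i > 0"
  "!!i x y. dist x y < D i ==> dist (partial_deriv i \<rho> x) (partial_deriv i \<rho> y) < e / n" by metis
 define d where "d = Min (range D)"
 have d: "d > 0" "!!i. d <= D i" unfolding d_def using D(1) by auto
 let ?L = "%x h. \<Sum>i\<in>UNIV. h $ i *R partial_deriv i \<rho> x"
 have "\<bar>\<rho> (y + h) - \<rho> y - ?L y h\<bar> <= e * norm h" if h: "norm h < d" for y h
 proof -
  have "norm (\<rho> (y + h) - \<rho> y - ?L y (y + h - y)) <= norm (y + h - y) * e"
  proof (rule differentiable_bound_linearization[of y "y + h" "ball y d" \<rho> ?L y e])
   show "y + t *R (y + h - y) : ball y d" if "t : {0..1}" for t
   proof -
    have "\<bar>t\<bar> * norm h <= 1 * norm h" using that by (intro mult_right_mono) auto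
    then show ?thesis using h by (simp add: dist_norm)
   qed
   show "(\<rho> has_derivative ?L x) (at x within ball y d)" for x
    by (rule has_derivative_at_withinI[OF has_derivative_partial_deriv[OF smooth_differentiable[OF test_function_smooth[OF assms(1)]]]])
   show "onorm (?L x - ?L y) <= e" if x: "x : ball y d" for x
   proof (rule onorm_bound)
    fix h' :: "real^'d"
    have "\<bar>\<Sum>i\<in>UNIV. h' $ i * (partial_deriv i \<rho> x - partial_deriv i \<rho> y)\<bar> <= e / n * real CARD('d) * norm h'"
    proof (rule onorm_coefficients_le)
     fix i
     have "dist x y < D i" using x d(2)[of i] by (auto simp: dist_commute)
     from D(2)[OF this] show "\<bar>partial_deriv i \<rho> x - partial_deriv i \<rho> y\<bar> <= e / n" by (simp add: dist_real_def)
    qed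
    then show "norm ((?L x - ?L y) h') <= e * norm h'" using n by (simp add: n_def sum_subtractf[symmetric] right_diff_distrib)
   qed (use assms(2) in auto)
   show "y : ball y d" using d by simp
  qed
  then show ?thesis by (simp add: mult.commute)
 qed
 then show ?thesis using that d(1) by simp
qed

lemma corr_has_derivative:
 fixes u :: "real^'d::finite => 'b::euclidean_space"
 assumes \<rho>: "test_function UNIV \<rho>" and u: "integrable lebesgue u"
 shows "(corr \<rho> u has_derivative (%h. - (\<Sum>i\<in>UNIV. h $ i *R corr (partial_deriv i \<rho>) u x))) (at x)"
 unfolding has_derivative_at_alt
proof (intro conjI allI impI)
 show "bounded_linear (%h::real^'d. - (\<Sum>i\<in>UNIV. h $ i *R corr (partial_deriv i \<rho>) u x))"
  by (intro bounded_linear_minus bounded_linear_sum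
    bounded_linear_compose[OF bounded_linear_scaleR_left bounded_linear_vec_nth])
 fix e :: real assume "e > 0"
 define M where "M = (LINT y|lebesgue. norm (u y))"
 have M: "M >= 0" unfolding M_def by simp
 have "e / (M + 1) > 0" using \<open>e > 0\<close> M by simp
 from test_function_uniformly_differentiable[OF \<rho> this] obtain d where d: "d > 0"
  "!!y h. norm h < d ==> \<bar>\<rho> (y + h) - \<rho> y - (\<Sum>i\<in>UNIV. h $ i * partial_deriv i \<rho> y)\<bar> <= e / (M + 1) * norm h"
  by blast
 have "norm (corr \<rho> u z - corr \<rho> u x - - (\<Sum>i\<in>UNIV. (z - x) $ i *R corr (partial_deriv i \<rho>) u x))
   <= e * norm (z - x)" if z: "norm (z - x) < d" for z
 proof -
  let ?r = "%y. \<rho> (y - z) - \<rho> (y - x) + (\<Sum>i\<in>UNIV. (z - x) $ i * partial_deriv i \<rho> (y - x))"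
  note int = integrable_corr[OF \<rho> u] integrable_corr[OF test_function_partial_deriv[OF \<rho>] u]
  have "corr \<rho> u z - corr \<rho> u x - - (\<Sum>i\<in>UNIV. (z - x) $ i *R corr (partial_deriv i \<rho>) u x)
    = (LINT y|lebesgue. \<rho> (y - z) *R u y - \<rho> (y - x) *R u y +
      (\<Sum>i\<in>UNIV. (z - x) $ i *R (partial_deriv i \<rho> (y - x) *R u y)))"
   unfolding corr_def using int by (simp del: scaleR_scaleR)
  also have "... = (LINT y|lebesgue. ?r y *R u y)"
   by (intro Bochner_Integration.integral_cong) (auto simp: scaleR_add_left scaleR_diff_left scaleR_sum_left)
  finally have eq: "corr \<rho> u z - corr \<rho> u x - - (\<Sum>i\<in>UNIV. (z - x) $ i *R corr (partial_deriv i \<rho>) u x)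
    = (LINT y|lebesgue. ?r y *R u y)" .
  have "norm (LINT y|lebesgue. ?r y *R u y) <= (LINT y|lebesgue. e / (M + 1) * norm (z - x) * norm (u y))"
  proof (rule Bochner_Integration.integral_norm_bound_integral)
   have "(%y. ?r y *R u y) = (%y. \<rho> (y - z) *R u y - \<rho> (y - x) *R u y +
      (\<Sum>i\<in>UNIV. (z - x) $ i *R (partial_deriv i \<rho> (y - x) *R u y)))"
    by (auto simp: scaleR_add_left scaleR_diff_left scaleR_sum_left)
   then show "integrable lebesgue (%y. ?r y *R u y)"
    using int by (simp only:) (intro Bochner_Integration.integrable_add Bochner_Integration.integrable_diff
      Bochner_Integration.integrable_sum integrable_scaleR_right; simp)
   show "integrable lebesgue (%y. e / (M + 1) * norm (z - x) * norm (u y))" using u by auto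
   fix y
   have "\<bar>?r y\<bar> <= e / (M + 1) * norm (z - x)"
   proof -
    have "\<bar>\<rho> (y - x + - (z - x)) - \<rho> (y - x) - (\<Sum>i\<in>UNIV. (- (z - x)) $ i * partial_deriv i \<rho> (y - x))\<bar>
      <= e / (M + 1) * norm (- (z - x))" using z by (intro d(2)) (simp only: norm_minus_cancel)
    moreover have "y - x + - (z - x) = y - z" by simp
    moreover have "(\<Sum>i\<in>UNIV. (- (z - x)) $ i * partial_deriv i \<rho> (y - x))
      = - (\<Sum>i\<in>UNIV. (z - x) $ i * partial_deriv i \<rho> (y - x))"
     unfolding sum_negf[symmetric] by (intro sum.cong) (simp_all add: algebra_simps)
    ultimately show ?thesis by (simp only: norm_minus_cancel diff_minus_eq_add)
   qed
   then show "norm (?r y *R u y) <= e / (M + 1) * norm (z - x) * norm (u y)"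
    unfolding norm_scaleR by (rule mult_right_mono) auto
  qed
  also have "... = e * norm (z - x) * (M / (M + 1))" unfolding M_def by simp
  also have "... <= e * norm (z - x) * 1" using M \<open>e > 0\<close> by (intro mult_left_mono) auto
  finally show ?thesis unfolding eq by simp
 qed
 then show "\<exists>d>0. \<forall>y. norm (y - x) < d \<longrightarrow>
   norm (corr \<rho> u y - corr \<rho> u x - - (\<Sum>i\<in>UNIV. (y - x) $ i *R corr (partial_deriv i \<rho>) u x))
   <= e * norm (y - x)" using d(1) by blast
qed

lemma partial_deriv_corr:
 fixes u :: "real^'d::finite => 'b::euclidean_space"
 assumes "test_function UNIV \<rho>" "integrable lebesgue u"
 shows "partial_deriv i (corr \<rho> u) = (%x. - corr (partial_deriv i \<rho>) u x)"
proof -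
 have "(\<Sum>k\<in>UNIV. axis i 1 $ k *R c k) = c i" for c :: "'d => 'b"
  by (simp add: axis_def if_distrib[of "%a. a *R _"] cong: if_cong)
 then show ?thesis by (intro ext, subst partial_deriv_eqI[OF corr_has_derivative[OF assms]]) simp
qed

lemma smooth_corr:
 fixes u :: "real^'d::finite => 'b::euclidean_space"
 assumes "test_function UNIV \<rho>" "integrable lebesgue u"
 shows "smooth (corr \<rho> u)"
proof (rule smooth_coinduct[of "%h. \<exists>\<rho>. test_function UNIV \<rho> & h = corr \<rho> u"])
 fix h assume "\<exists>\<rho>. test_function UNIV \<rho> & h = corr \<rho> u"
 then obtain \<rho> where \<rho>: "test_function UNIV \<rho>" "h = corr \<rho> u" by blast
 have "partial_deriv i h = corr (%x. - partial_deriv i \<rho> x) u" for i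
  unfolding \<rho>(2) partial_deriv_corr[OF \<rho>(1) assms(2)] by (simp add: corr_def[abs_def])
 moreover have "test_function UNIV (%x. - partial_deriv i \<rho> x)" for i
  using test_function_cmult[OF test_function_partial_deriv[OF \<rho>(1)], of "-1"] by simp
 moreover have "h differentiable (at x)" for x
  unfolding \<rho>(2) differentiable_def using corr_has_derivative[OF \<rho>(1) assms(2)] by blast
 ultimately show "(\<forall>x. h differentiable (at x)) \<and>
   (\<forall>i. \<exists>\<rho>. test_function UNIV \<rho> & partial_deriv i h = corr \<rho> u)" by blast
qed (use assms in blast)

text \<open>The integral of a translate of \<open>F\<close> does not depend on the translation, so its derivative vanishes.\<close>

lemma integral_partial_deriv_test_function:
 fixes F :: "real^'d::finite => real"
 assumes F: "test_function UNIV F"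
 shows "(LINT x|lebesgue. partial_deriv i F x) = 0"
proof -
 obtain K where K: "compact K" "!!x. x ~: K ==> F x = 0" using test_function_support[OF F] by metis
 obtain R where R: "R > 0" "!!x. x : K ==> norm x <= R" using compact_imp_bounded[OF K(1)] by (meson bounded_pos)
 define u where "u = (indicator (ball 0 (R + 2)) :: real^'d => real)"
 have u: "integrable lebesgue u" unfolding u_def by (rule integrable_indicator_bounded) auto
 have loc: "G (y - x) *R u y = G (y - x)" if G: "\<forall>x. x ~: K --> G x = 0" and x: "norm x < 1" for G and x y :: "real^'d"
 proof (cases "y - x : K")
  case True
  then have "norm y <= R + 1" using R(2)[OF True] norm_triangle_sub[of y x] x by simp
  then show ?thesis by (simp add: u_def)
 qed (use G in simp)
 have locF: "F (y - x) *R u y = F (y - x)" if "norm x < 1" for x y using loc[of F x y] K(2) that by blast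
 have const: "corr F u x = (LINT y|lebesgue. F y)" if "norm x < 1" for x unfolding corr_def locF[OF that]
  by (rule integral_lebesgue_translation[OF test_function_measurable[OF F]])
 have "(corr F u has_derivative (%h. 0)) (at 0)"
  by (rule has_derivative_transform_within_open[OF has_derivative_const, of "ball 0 1"]) (use const in auto)
 then have "0 = partial_deriv i (corr F u) 0" by (rule partial_deriv_eqI[symmetric])
 also have "... = - corr (partial_deriv i F) u 0" by (simp add: partial_deriv_corr[OF F u])
 also have "corr (partial_deriv i F) u 0 = (LINT y|lebesgue. partial_deriv i F y)"
 proof -
  have "partial_deriv i F (y - 0) *R u y = partial_deriv i F (y - 0)" for y
   by (rule loc) (auto intro: partial_deriv_zero_off_closed[OF compact_imp_closed[OF K(1)], of F] K(2))
  then show ?thesis unfolding corr_def by (simp only: diff_zero)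
 qed
 finally show ?thesis by simp
qed

section \<open>The fundamental lemma of the calculus of variations\<close>

lemma sigma_finite_lebesgue: "sigma_finite_measure (lebesgue :: 'a::euclidean_space measure)"
proof
 obtain A :: "'a set set" where "countable A" "A <= sets lborel" "\<Union>A = space lborel" "\<forall>a\<in>A. emeasure lborel a ~= \<infinity>"
  using lborel.sigma_finite_countable by blast
 then show "\<exists>A. countable A & A <= sets lebesgue & \<Union>A = space lebesgue \<and>
   (\<forall>a\<in>A. emeasure (lebesgue :: 'a measure) a ~= \<infinity>)" by (intro exI[of _ A]) auto
qed

text \<open>Boxes generate the Borel sets and are stable under intersection, so this is Dynkin's lemma.\<close>

lemma integrable_zero_on_boxes:
 fixes f :: "'a::euclidean_space => 'b::euclidean_space"
 assumes f: "integrable lebesgue f" and box: "!!a b. (LINT x|lebesgue. indicator (box a b) x *R f x) = 0"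
  and univ: "(LINT x|lebesgue. f x) = 0"
 shows "AE x in lebesgue. f x = 0"
proof (rule sigma_finite_measure.density_zero[OF sigma_finite_lebesgue f])
 fix A :: "'a set" assume A: "A : sets lebesgue"
 have bor: "(LINT x|lebesgue. indicator B x *R f x) = 0" if "B : sets borel" for B
 proof -
  let ?G = "range (%(a, b). box a b) :: 'a set set"
  have sets_eq: "sigma_sets UNIV ?G = sets borel" by (subst borel_eq_box) simp
  have G: "Int_stable ?G" "?G <= Pow UNIV" unfolding Int_stable_def by (auto simp: box_Int_box)
  have "B : sigma_sets UNIV ?G" using that unfolding sets_eq .
  with G show ?thesis
  proof (induction rule: sigma_sets_induct_disjoint)
   case (basic A) then show ?case using box by auto
  next
   case empty then show ?case by simp
  next
   case (compl A)
   have [measurable]: "A : sets lebesgue" using compl(1) unfolding sets_eq by auto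
   have "(%x. indicator (UNIV - A) x *R f x) = (%x. f x - indicator A x *R f x)" by (auto simp: indicator_def)
   moreover have "integrable lebesgue (%x. indicator A x *R f x)" by (intro integrable_mult_indicator f) simp
   ultimately show ?case using compl univ f by simp
  next
   case (union A)
   have [measurable]: "A i : sets lebesgue" for i using union(2) unfolding sets_eq by auto
   have "(LINT x:(\<Union>i. A i)|lebesgue. f x) = (\<Sum>i. (LINT x:(A i)|lebesgue. f x))"
   proof (rule lebesgue_integral_countable_add)
    show "set_integrable lebesgue (\<Union>i. A i) f" unfolding set_integrable_def by (intro integrable_mult_indicator f) auto
   qed (use union(1) in "auto simp: disjoint_family_on_def")
   then show ?case using union(3) by (simp add: set_lebesgue_integral_def)
  qed
 qed
 obtain B N where BN: "B : sets borel" "N : null_sets lebesgue" "A = B Un N"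
  using A by (metis (no_types) null_sets_completionI sets_completionE sets_lborel null_sets_completion_subset)
 have off_N: "AE x in lebesgue. x ~: N" using BN(2) by (rule AE_not_in)
 have "(LINT x|lebesgue. indicator A x *R f x) = (LINT x|lebesgue. indicator B x *R f x)"
 proof (rule integral_cong_AE)
  show "(%x. indicator A x *R f x) : borel_measurable lebesgue"
   "(%x. indicator B x *R f x) : borel_measurable lebesgue"
   using f A BN(1) by (auto intro!: borel_measurable_scaleR borel_measurable_indicator)
  show "AE x in lebesgue. indicator A x *R f x = indicator B x *R f x"
   using off_N by eventually_elim (auto simp: BN(3) indicator_def)
 qed
 then show "(LINT x:A|lebesgue. f x) = 0" using bor[OF BN(1)] by (simp add: set_lebesgue_integral_def)
qed

text \<open>The functions \<open>1 - exp (- k p)\<close>, with \<open>p\<close> smooth and positive precisely on the box, increase to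
 the indicator function of the box.\<close>

lemma box_bump_test_function:
 assumes "cbox a b <= S" "k >= 0"
 shows "test_function S (%x. 1 - exp (- k * box_profile a b x))"
proof (rule test_functionI[of _ "cbox a b"])
 show "smooth (%x. 1 - exp (- k * box_profile a b x))"
  by (intro smooth_diff smooth_const smooth_exp smooth_mult smooth_box_profile)
 show "1 - exp (- k * box_profile a b x) = 0" if "x ~: cbox a b" for x
  using that box_profile_zero[of x a b] box_subset_cbox[of a b] by auto
qed (use assms in auto)

lemma fundamental_lemma_variations:
 fixes g :: "real^'d::finite => 'b::euclidean_space"
 assumes S: "open S" and loc: "locally_integrable S g"
  and zero: "!!\<phi>. test_function S \<phi> ==> (LINT x|lebesgue. \<phi> x *R g x) = 0"
 shows "AE x in lebesgue_on S. g x = 0"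
proof -
 have box0: "(LINT x|lebesgue. indicator (box a b) x *R g x) = 0" if ab: "cbox a b <= S" for a b
 proof -
  have K: "integrable lebesgue (%x. indicator (cbox a b) x *R g x)"
   using loc ab unfolding locally_integrable_def by (subst integrable_lebesgue_on[symmetric]) auto
  let ?\<phi> = "%k x. 1 - exp (- real k * box_profile a b x)"
  have tf: "test_function S (?\<phi> k)" for k by (rule box_bump_test_function[OF ab]) simp
  have off: "?\<phi> k x = 0" if "x ~: box a b" for k x using box_profile_zero[OF that] by simp
  have bd: "\<bar>?\<phi> k x\<bar> <= 1" for k x using box_profile_nonneg[of a b x] by (auto simp: abs_le_iff)
  have "(%k. LINT x|lebesgue. ?\<phi> k x *R g x) ----> (LINT x|lebesgue. indicator (box a b) x *R g x)"
  proof (rule integral_dominated_convergence)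
   have eq: "(%x. indicator (box a b) x *R g x) = (%x. indicator (box a b) x *R (indicator (cbox a b) x *R g x))"
    using box_subset_cbox[of a b] by (force simp: indicator_def fun_eq_iff)
   have "integrable lebesgue (%x. indicator (box a b) x *R (indicator (cbox a b) x *R g x))"
    by (intro integrable_mult_indicator K) auto
   then show "(%x. indicator (box a b) x *R g x) : borel_measurable lebesgue" unfolding eq by auto
   show "(%x. ?\<phi> k x *R g x) : borel_measurable lebesgue" for k
    using integrable_test_function_scaleR[OF tf loc, of k] by auto
   show "integrable lebesgue (%x. norm (indicator (cbox a b) x *R g x))" by (rule integrable_norm[OF K])
   show "AE x in lebesgue. (%k. ?\<phi> k x *R g x) ----> indicator (box a b) x *R g x"
   proof (intro AE_I2 tendsto_intros)
    fix x
    show "(%k. ?\<phi> k x) ----> indicator (box a b) x"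
    proof (cases "x : box a b")
     case True
     have "(%k. exp (- box_profile a b x) ^ k) ----> 0" using box_profile_pos[OF True] by (intro LIMSEQ_power_zero) simp
     then have "(%k. exp (- real k * box_profile a b x)) ----> 0" by (simp add: exp_of_nat_mult[symmetric])
     then have "(%k. ?\<phi> k x) ----> 1 - 0" by (intro tendsto_intros)
     then show ?thesis using True by simp
    next
     case False then show ?thesis by (simp add: box_profile_zero)
    qed
   qed
   show "AE x in lebesgue. norm (?\<phi> k x *R g x) <= norm (indicator (cbox a b) x *R g x)" for k
   proof (intro AE_I2)
    fix x
    show "norm (?\<phi> k x *R g x) <= norm (indicator (cbox a b) x *R g x)"
    proof (cases "x : box a b")
     case True
     then have "x : cbox a b" using box_subset_cbox by blast
     then show ?thesis using bd[of k x] mult_right_mono[OF bd[of k x], of "norm (g x)"] by simp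
    next
     case False then show ?thesis by (simp add: box_profile_zero)
    qed
   qed
  qed
  moreover have "(LINT x|lebesgue. ?\<phi> k x *R g x) = 0" for k by (rule zero[OF tf])
  ultimately show ?thesis by (simp add: LIMSEQ_const_iff)
 qed
 obtain \<D> where \<D>: "countable \<D>" "\<D> <= Pow S" "!!X. X : \<D> ==> \<exists>a b. X = cbox a b" "\<Union>\<D> = S"
  using open_countable_Union_open_cbox[OF S] by metis
 have "AE x in lebesgue. x : X --> g x = 0" if X: "X : \<D>" for X
 proof -
  obtain a b where ab: "X = cbox a b" "cbox a b <= S" using \<D>(2,3) X by blast
  have int0: "integrable lebesgue (%x. indicator (cbox a b) x *R g x)"
   using loc ab unfolding locally_integrable_def by (subst integrable_lebesgue_on[symmetric]) auto
  have "integrable lebesgue (%x. indicator (box a b) x *R (indicator (cbox a b) x *R g x))"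
   by (rule integrable_mult_indicator[OF _ int0]) auto
  moreover have "(%x. indicator (box a b) x *R (indicator (cbox a b) x *R g x)) = (%x. indicator (box a b) x *R g x)"
   using box_subset_cbox[of a b] by (force simp: indicator_def fun_eq_iff)
  ultimately have int: "integrable lebesgue (%x. indicator (box a b) x *R g x)" by simp
  have "AE x in lebesgue. indicator (box a b) x *R g x = 0"
  proof (rule integrable_zero_on_boxes[OF int])
   show "(LINT x|lebesgue. indicator (box a b) x *R g x) = 0" by (rule box0[OF ab(2)])
   fix c d
   obtain a' b' where ab': "box c d Int box a b = box a' b'" using box_Int_box[of c d a b] by blast
   show "(LINT x|lebesgue. indicator (box c d) x *R indicator (box a b) x *R g x) = 0"
   proof (cases "box a' b' = {}")
    case True
    then have "(LINT x|lebesgue. indicator (box c d Int box a b) x *R g x) = 0" by (simp add: ab')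
    then show ?thesis by (simp only: indicator_inter_arith scaleR_scaleR)
   next
    case False
    then have "cbox a' b' = closure (box a' b')" by (simp add: closure_box)
    also have "... <= closure (box a b)" using ab' by (intro closure_mono) blast
    also have "... <= cbox a b" by (intro closure_minimal box_subset_cbox closed_cbox)
    finally have "cbox a' b' <= S" using ab by blast
    from box0[OF this] have "(LINT x|lebesgue. indicator (box c d Int box a b) x *R g x) = 0" unfolding ab' .
    then show ?thesis by (simp only: indicator_inter_arith scaleR_scaleR)
   qed
  qed
  moreover have "negligible (cbox a b - box a b)" by (rule negligible_frontier_interval)
  then have "AE x in lebesgue. x ~: cbox a b - box a b" by (intro AE_not_in) (simp add: negligible_iff_null_sets)
  ultimately show ?thesis unfolding ab(1) by eventually_elim (auto simp: indicator_def split: if_splits)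
 qed
 then have "AE x in lebesgue. \<forall>X\<in>\<D>. x : X --> g x = 0" using \<D>(1) by (subst AE_ball_countable) auto
 then have "AE x in lebesgue. x : S --> g x = 0" by eventually_elim (use \<D>(4) in blast)
 then show ?thesis using S by (simp add: AE_lebesgue_on)
qed

section \<open>Weak gradients\<close>

lemma locally_integrable_component:
 assumes "locally_integrable S (g :: real^'d::finite => 'b::euclidean_space^'d)"
 shows "locally_integrable S (%x. g x $ i)"
 using assms unfolding locally_integrable_def by (auto intro!: integrable_bounded_linear[OF bounded_linear_vec_nth])

lemma locally_integrable_bounded_linear:
 assumes "bounded_linear L" "locally_integrable S u"
 shows "locally_integrable S (%x. L (u x))"
 using assms unfolding locally_integrable_def by (auto intro: integrable_bounded_linear)

lemma locally_integrable_add: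
 "locally_integrable S u ==> locally_integrable S v ==> locally_integrable S (%x. u x + v x)"
 unfolding locally_integrable_def by auto

lemma locally_integrable_mono: "locally_integrable S u ==> T <= S ==> locally_integrable T u"
 unfolding locally_integrable_def by blast

lemma locally_integrable_if_integrable:
 fixes u :: "real^'d::finite => 'b::euclidean_space"
 assumes "integrable lebesgue (%x. indicator S x *R u x)" shows "locally_integrable S u"
 unfolding locally_integrable_def
proof (intro allI impI)
 fix K assume K: "compact K & K <= S"
 then have "integrable lebesgue (%x. indicator K x *R (indicator S x *R u x))"
  by (intro integrable_mult_indicator assms) (auto simp: compact_imp_closed)
 moreover have "(%x. indicator K x *R (indicator S x *R u x)) = (%x. indicator K x *R u x)"
  using K by (force simp: indicator_def fun_eq_iff)
 ultimately show "integrable (lebesgue_on K) u" using K by (simp add: integrable_lebesgue_on compact_imp_closed)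
qed

lemma integrable_locally_integrable:
 fixes u :: "real^'d::finite => 'b::euclidean_space"
 assumes "integrable lebesgue u" shows "locally_integrable S u"
 using locally_integrable_mono[OF locally_integrable_if_integrable[of UNIV u]] assms by simp

lemma continuous_locally_integrable:
 fixes u :: "real^'d::finite => 'b::euclidean_space"
 assumes "continuous_on UNIV u" shows "locally_integrable S u"
 unfolding locally_integrable_def
proof (intro allI impI)
 fix K assume K: "compact K & K <= S"
 have "integrable lborel (%x. indicator K x *R u x)"
  by (rule borel_integrable_compact) (use K assms continuous_on_subset in auto)
 then show "integrable (lebesgue_on K) u"
  using K by (subst integrable_lebesgue_on) (auto simp: compact_imp_closed intro: integrable_completion[THEN iffD2])
qed

lemma has_weak_gradient_iff:
 assumes "open S"
 shows "has_weak_gradient S u g \<longleftrightarrow> locally_integrable S u & locally_integrable S g \<and>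
  (\<forall>\<phi> i. test_function S \<phi> \<longrightarrow>
   (LINT x|lebesgue. partial_deriv i \<phi> x *R u x) = - (LINT x|lebesgue. \<phi> x *R (g x $ i)))"
proof -
 have S: "S : sets lebesgue" using assms by auto
 show ?thesis unfolding has_weak_gradient_def
  by (simp add: integral_test_function_on[OF _ S] test_function_partial_deriv cong: imp_cong)
qed

lemma has_weak_gradientD:
 assumes "has_weak_gradient S u g" "open S"
 shows "locally_integrable S u" "locally_integrable S g"
  "test_function S \<phi> ==> (LINT x|lebesgue. partial_deriv i \<phi> x *R u x) = - (LINT x|lebesgue. \<phi> x *R (g x $ i))"
 using assms has_weak_gradient_iff by blast+

lemma weak_gradient_AE_unique:
 fixes u :: "real^'d::finite => 'b::euclidean_space"
 assumes S: "open S" and u: "has_weak_gradient S u g" and v: "has_weak_gradient S v h"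
  and uv: "AE x in lebesgue_on S. u x = v x"
 shows "AE x in lebesgue_on S. g x = h x"
proof -
 have "AE x in lebesgue_on S. g x $ i - h x $ i = 0" for i
 proof (rule fundamental_lemma_variations[OF S])
  note l = locally_integrable_component[OF has_weak_gradientD(2)[OF u S], of i]
   locally_integrable_component[OF has_weak_gradientD(2)[OF v S], of i]
  then show "locally_integrable S (%x. g x $ i - h x $ i)" unfolding locally_integrable_def by auto
  fix \<phi> :: "real^'d => real" assume t: "test_function S \<phi>"
  obtain K where K: "K <= S" "!!x. x ~: K ==> partial_deriv i \<phi> x = 0"
   using test_function_support[OF test_function_partial_deriv[OF t]] by metis
  note i = integrable_test_function_scaleR[OF t l(1)] integrable_test_function_scaleR[OF t l(2)]
   integrable_test_function_scaleR[OF test_function_partial_deriv[OF t] has_weak_gradientD(1)[OF u S]]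
   integrable_test_function_scaleR[OF test_function_partial_deriv[OF t] has_weak_gradientD(1)[OF v S]]
  have "AE x in lebesgue. x : S --> u x = v x" using uv S by (simp add: AE_lebesgue_on)
  then have "AE x in lebesgue. partial_deriv i \<phi> x *R u x = partial_deriv i \<phi> x *R v x"
   by eventually_elim (use K in force)
  then have "(LINT x|lebesgue. partial_deriv i \<phi> x *R u x) = (LINT x|lebesgue. partial_deriv i \<phi> x *R v x)"
   by (intro integral_cong_AE) (use i in auto)
  then show "(LINT x|lebesgue. \<phi> x *R (g x $ i - h x $ i)) = 0"
   unfolding scaleR_diff_right using i has_weak_gradientD(3)[OF u S t, of i] has_weak_gradientD(3)[OF v S t, of i] by simp
 qed
 then have "AE x in lebesgue_on S. \<forall>i\<in>UNIV. g x $ i - h x $ i = 0" by (intro AE_finite_allI) auto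
 then show ?thesis by eventually_elim (simp add: vec_eq_iff)
qed

lemma weak_gradient_AE_eq:
 assumes "open S" "has_weak_gradient S u g"
 shows "AE x in lebesgue_on S. weak_gradient S u x = g x"
proof -
 have "has_weak_gradient S u (weak_gradient S u)"
  unfolding weak_gradient_def using assms(2) by (rule someI[of "has_weak_gradient S u"])
 then show ?thesis using weak_gradient_AE_unique[OF assms(1) _ assms(2)] by simp
qed

lemma has_weak_gradient_weak_gradient: "has_weak_gradient S u g ==> has_weak_gradient S u (weak_gradient S u)"
 unfolding weak_gradient_def by (rule someI[of "has_weak_gradient S u"])

lemma bounded_linear_vec_lambda:
 fixes L :: "'b::euclidean_space => 'c::euclidean_space"
 assumes "bounded_linear L"
 shows "bounded_linear (%y::'b^'d::finite. (\<chi> i. L (y $ i)) :: 'c^'d)"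
 unfolding linear_conv_bounded_linear[symmetric]
 by (intro linearI) (auto simp: vec_eq_iff linear_add[OF bounded_linear.linear[OF assms]]
   linear_scale[OF bounded_linear.linear[OF assms]])

lemma has_weak_gradient_bounded_linear:
 fixes u :: "real^'d::finite => 'b::euclidean_space" and L :: "'b => 'c::euclidean_space"
 assumes L: "bounded_linear L" and S: "open S" and u: "has_weak_gradient S u g"
 shows "has_weak_gradient S (%x. L (u x)) (%x. \<chi> i. L (g x $ i))"
proof -
 note l = has_weak_gradientD(1,2)[OF u S]
 have "(LINT x|lebesgue. partial_deriv i \<phi> x *R L (u x)) = - (LINT x|lebesgue. \<phi> x *R L (g x $ i))"
  if t: "test_function S \<phi>" for \<phi> i
 proof -
  have "(LINT x|lebesgue. L (partial_deriv i \<phi> x *R u x)) = L (LINT x|lebesgue. partial_deriv i \<phi> x *R u x)"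
   by (rule integral_bounded_linear[OF L integrable_test_function_scaleR[OF test_function_partial_deriv[OF t] l(1)]])
  moreover have "(LINT x|lebesgue. L (\<phi> x *R g x $ i)) = L (LINT x|lebesgue. \<phi> x *R g x $ i)"
   by (rule integral_bounded_linear[OF L integrable_test_function_scaleR[OF t locally_integrable_component[OF l(2)]]])
  ultimately show ?thesis using has_weak_gradientD(3)[OF u S t, of i]
   by (simp add: linear_scale[OF bounded_linear.linear[OF L]] linear_neg[OF bounded_linear.linear[OF L]])
 qed
 then show ?thesis unfolding has_weak_gradient_iff[OF S]
  using locally_integrable_bounded_linear[OF L l(1)] locally_integrable_bounded_linear[OF bounded_linear_vec_lambda[OF L] l(2)]
  by simp
qed

lemma has_weak_gradient_add:
 fixes u v :: "real^'d::finite => 'b::euclidean_space"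
 assumes S: "open S" and u: "has_weak_gradient S u g" and v: "has_weak_gradient S v h"
 shows "has_weak_gradient S (%x. u x + v x) (%x. g x + h x)"
proof -
 note l = has_weak_gradientD(1,2)[OF u S] has_weak_gradientD(1,2)[OF v S]
 show ?thesis unfolding has_weak_gradient_iff[OF S] using has_weak_gradientD(3)[OF u S] has_weak_gradientD(3)[OF v S] l
   integrable_test_function_scaleR[OF test_function_partial_deriv l(1)]
   integrable_test_function_scaleR[OF test_function_partial_deriv l(3)]
   integrable_test_function_scaleR[OF _ locally_integrable_component[OF l(2)]]
   integrable_test_function_scaleR[OF _ locally_integrable_component[OF l(4)]]
  by (auto simp: locally_integrable_add scaleR_add_right)
qed

lemma has_weak_gradient_scaleR:
 assumes "open S" "has_weak_gradient S u g"
 shows "has_weak_gradient S (%x. c *R u x) (%x. c *R g x)"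
proof -
 have "(%x. \<chi> i. c *R g x $ i) = (%x. c *R g x)" by (auto simp: vec_eq_iff)
 then show ?thesis using has_weak_gradient_bounded_linear[OF bounded_linear_scaleR_right assms, of c] by metis
qed

lemma has_weak_gradient_diff:
 assumes "open S" "has_weak_gradient S u g" "has_weak_gradient S v h"
 shows "has_weak_gradient S (%x. u x - v x) (%x. g x - h x)"
 using has_weak_gradient_add[OF assms(1,2) has_weak_gradient_scaleR[OF assms(1,3), of "-1"]] by simp

lemma has_weak_gradient_inner:
 assumes "open S" "has_weak_gradient S u g"
 shows "has_weak_gradient S (%x. u x \<bullet> b) (%x. \<chi> i. g x $ i \<bullet> b)"
 by (rule has_weak_gradient_bounded_linear[OF bounded_linear_inner_left assms])

lemma has_weak_gradient_mono:
 assumes "has_weak_gradient S u g" "open S" "open T" "T <= S"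
 shows "has_weak_gradient T u g"
 using has_weak_gradientD[OF assms(1,2)] assms(4) unfolding has_weak_gradient_iff[OF assms(3)]
 by (auto intro: locally_integrable_mono test_function_mono)

lemma has_weak_gradient_smooth:
 fixes f :: "real^'d::finite => 'b::euclidean_space"
 assumes f: "smooth f" and S: "open S"
 shows "has_weak_gradient S f (%x. \<chi> i. partial_deriv i f x)"
proof -
 have c: "continuous_on UNIV f" "!!i. continuous_on UNIV (partial_deriv i f)"
  using smooth_continuous_on f smooth_partial_deriv by blast+
 have "(LINT x|lebesgue. partial_deriv i \<phi> x *R f x) = - (LINT x|lebesgue. \<phi> x *R partial_deriv i f x)"
  if t: "test_function S \<phi>" for \<phi> i
 proof (rule euclidean_eqI)
  fix b :: 'b assume "b : Basis"
  have fb: "smooth (%x. f x \<bullet> b)" by (rule smooth_bounded_linear[OF bounded_linear_inner_left f])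
  have pb: "partial_deriv i (%x. f x \<bullet> b) = (%x. partial_deriv i f x \<bullet> b)"
   by (rule partial_deriv_bounded_linear[OF bounded_linear_inner_left smooth_differentiable[OF f]])
  have "test_function UNIV (%x. \<phi> x *R (f x \<bullet> b))"
   by (rule test_function_mono[OF test_function_smooth_scaleR[OF t fb]]) simp
  from integral_partial_deriv_test_function[OF this, of i]
  have "(LINT x|lebesgue. \<phi> x *R (partial_deriv i f x \<bullet> b) + partial_deriv i \<phi> x *R (f x \<bullet> b)) = 0"
   by (subst (asm) partial_deriv_scaleR) (auto simp: pb intro: smooth_differentiable fb test_function_smooth[OF t])
  moreover note i1 = integrable_test_function_scaleR[OF t continuous_locally_integrable[OF c(2)[of i]]]
  note i2 = integrable_test_function_scaleR[OF test_function_partial_deriv[OF t, of i] continuous_locally_integrable[OF c(1)]]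
  have "(LINT x|lebesgue. \<phi> x *R (partial_deriv i f x \<bullet> b)) = (LINT x|lebesgue. \<phi> x *R partial_deriv i f x) \<bullet> b"
   "(LINT x|lebesgue. partial_deriv i \<phi> x *R (f x \<bullet> b)) = (LINT x|lebesgue. partial_deriv i \<phi> x *R f x) \<bullet> b"
   using integral_inner_left[OF i1, of b] integral_inner_left[OF i2, of b] by auto
  moreover have "integrable lebesgue (%x. \<phi> x *R (partial_deriv i f x \<bullet> b))"
   "integrable lebesgue (%x. partial_deriv i \<phi> x *R (f x \<bullet> b))"
   using integrable_inner_left[OF i1, of b] integrable_inner_left[OF i2, of b] by auto
  ultimately show "(LINT x|lebesgue. partial_deriv i \<phi> x *R f x) \<bullet> b =
    - (LINT x|lebesgue. \<phi> x *R partial_deriv i f x) \<bullet> b" by simp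
 qed
 moreover have "continuous_on UNIV (%x. \<chi> i. partial_deriv i f x)" using c(2) by (intro continuous_on_vec_lambda) auto
 ultimately show ?thesis unfolding has_weak_gradient_iff[OF S]
  using continuous_locally_integrable[of "%x. \<chi> i. partial_deriv i f x"] continuous_locally_integrable[OF c(1)] by auto
qed

text \<open>Multiplying by a test function localizes a weak gradient: the product, extended by zero, has
 a weak gradient on the whole space.\<close>

lemma has_weak_gradient_test_function_mult:
 fixes u :: "real^'d::finite => 'b::euclidean_space"
 assumes S: "open S" and u: "has_weak_gradient S u g" and \<eta>: "test_function S \<eta>"
 shows "has_weak_gradient UNIV (%x. \<eta> x *R u x) (%x. \<chi> i. \<eta> x *R (g x $ i) + partial_deriv i \<eta> x *R u x)"
proof -
 note l = has_weak_gradientD(1,2)[OF u S]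
 note i = integrable_test_function_scaleR[OF \<eta> l(1)]
  integrable_test_function_scaleR[OF test_function_partial_deriv[OF \<eta>] l(1)]
  integrable_test_function_scaleR[OF \<eta> l(2)]
 have eq: "(%x. \<chi> i. \<eta> x *R (g x $ i) + partial_deriv i \<eta> x *R u x) =
   (%x. \<eta> x *R g x + (\<Sum>i\<in>UNIV. axis i (partial_deriv i \<eta> x *R u x)))"
  by (auto simp: vec_eq_iff sum_component axis_def)
 have "integrable lebesgue (%x. axis k (partial_deriv k \<eta> x *R u x))" for k
 proof (rule integrable_bounded_linear[OF _ i(2)])
  show "bounded_linear (axis k :: 'b => 'b^'d)" unfolding linear_conv_bounded_linear[symmetric]
   by (intro linearI) (auto simp: vec_eq_iff axis_def)
 qed
 then have "integrable lebesgue (%x. \<chi> i. \<eta> x *R (g x $ i) + partial_deriv i \<eta> x *R u x)"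
  unfolding eq using i(3) by auto
 moreover have "(LINT x|lebesgue. partial_deriv i \<phi> x *R \<eta> x *R u x) =
  - (LINT x|lebesgue. \<phi> x *R (\<eta> x *R (g x $ i) + partial_deriv i \<eta> x *R u x))"
  if t: "test_function UNIV \<phi>" for \<phi> i
 proof -
  have alg: "a = - (c + b)" if "a + b = - c" for a b c :: 'b
  proof -
   have "a = (a + b) - b" by simp
   then show ?thesis unfolding that by simp
  qed
  have pt: "test_function S (%x. \<eta> x *R \<phi> x)"
   by (rule test_function_smooth_scaleR[OF \<eta> test_function_smooth[OF t]])
  have pd: "partial_deriv i (%x. \<eta> x *R \<phi> x) = (%x. \<eta> x *R partial_deriv i \<phi> x + partial_deriv i \<eta> x *R \<phi> x)"
   by (rule partial_deriv_scaleR) (auto intro: smooth_differentiable test_function_smooth[OF t] test_function_smooth[OF \<eta>])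
  have t1: "test_function S (%x. \<eta> x *R partial_deriv i \<phi> x)"
   by (rule test_function_smooth_scaleR[OF \<eta> smooth_partial_deriv[OF test_function_smooth[OF t]]])
  have t2: "test_function S (%x. partial_deriv i \<eta> x *R \<phi> x)"
   by (rule test_function_smooth_scaleR[OF test_function_partial_deriv[OF \<eta>] test_function_smooth[OF t]])
  note j = integrable_test_function_scaleR[OF t1 l(1)] integrable_test_function_scaleR[OF t2 l(1)]
   integrable_test_function_scaleR[OF pt locally_integrable_component[OF l(2)], of i]
  have "(LINT x|lebesgue. (\<eta> x *R partial_deriv i \<phi> x) *R u x + (partial_deriv i \<eta> x *R \<phi> x) *R u x) =
    - (LINT x|lebesgue. (\<eta> x *R \<phi> x) *R (g x $ i))"
   using has_weak_gradientD(3)[OF u S pt, of i] unfolding pd scaleR_add_left .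
  then have "(LINT x|lebesgue. (\<eta> x *R partial_deriv i \<phi> x) *R u x) =
    - ((LINT x|lebesgue. (\<eta> x *R \<phi> x) *R (g x $ i)) + (LINT x|lebesgue. (partial_deriv i \<eta> x *R \<phi> x) *R u x))"
   unfolding Bochner_Integration.integral_add[OF j(1,2)] by (rule alg)
  also have "... = - (LINT x|lebesgue. (\<eta> x *R \<phi> x) *R (g x $ i) + (partial_deriv i \<eta> x *R \<phi> x) *R u x)"
   using j by (subst Bochner_Integration.integral_add) auto
  finally show ?thesis by (simp add: mult.commute scaleR_add_right)
 qed
 ultimately show ?thesis unfolding has_weak_gradient_iff[OF open_UNIV]
  using integrable_locally_integrable[OF i(1)] integrable_locally_integrable by auto
qed

section \<open>The Hilbert space of square integrable functions\<close>

definition sq_integrable :: "(real^'d::finite => 'b::euclidean_space) => bool" where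
 "sq_integrable f \<longleftrightarrow> f : borel_measurable lebesgue & integrable lebesgue (%x. (norm (f x))^2)"

lemma sq_integrable_bound:
 assumes "g : borel_measurable lebesgue" "sq_integrable f" "AE x in lebesgue. norm (g x) <= C * norm (f x)"
 shows "sq_integrable g"
 unfolding sq_integrable_def
proof (rule conjI[OF assms(1) Bochner_Integration.integrable_bound])
 show "integrable lebesgue (%x. C^2 * (norm (f x))^2)" using assms(2) unfolding sq_integrable_def by auto
 show "(%x. (norm (g x))^2) : borel_measurable lebesgue" using assms(1) by measurable
 show "AE x in lebesgue. norm ((norm (g x))^2) <= norm (C^2 * (norm (f x))^2)"
  using assms(3) by eventually_elim (auto simp: power_mult_distrib[symmetric] intro!: power_mono)
qed

lemma sq_integrable_add:
 assumes "sq_integrable f" "sq_integrable g" shows "sq_integrable (%x. f x + g x)"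
 unfolding sq_integrable_def
proof (rule conjI[OF _ Bochner_Integration.integrable_bound])
 have [measurable]: "f : borel_measurable lebesgue" "g : borel_measurable lebesgue"
  using assms unfolding sq_integrable_def by auto
 show "(%x. f x + g x) : borel_measurable lebesgue" "(%x. (norm (f x + g x))^2) : borel_measurable lebesgue" by measurable
 show "integrable lebesgue (%x. 2 * (norm (f x))^2 + 2 * (norm (g x))^2)" using assms unfolding sq_integrable_def by auto
 have "(norm (f x + g x))^2 <= 2 * (norm (f x))^2 + 2 * (norm (g x))^2" for x
 proof -
  have "(norm (f x + g x))^2 <= (norm (f x) + norm (g x))^2" by (intro power_mono norm_triangle_ineq) auto
  also have "... <= 2 * (norm (f x))^2 + 2 * (norm (g x))^2"
   using sum_squares_bound[of "norm (f x)" "norm (g x)"] by (simp add: power2_sum)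
  finally show ?thesis .
 qed
 then show "AE x in lebesgue. norm ((norm (f x + g x))^2) <= norm (2 * (norm (f x))^2 + 2 * (norm (g x))^2)" by auto
qed

lemma sq_integrable_scaleR: "sq_integrable f ==> sq_integrable (%x. c *R f x)"
 by (rule sq_integrable_bound[of _ f "\<bar>c\<bar>"]) (auto simp: sq_integrable_def)

lemma sq_integrable_minus: "sq_integrable f ==> sq_integrable (%x. - f x)"
 using sq_integrable_scaleR[of f "-1"] by simp

lemma sq_integrable_diff: "sq_integrable f ==> sq_integrable g ==> sq_integrable (%x. f x - g x)"
 using sq_integrable_add[OF _ sq_integrable_minus] by fastforce

lemma sq_integrable_zero: "sq_integrable (%x. 0)"
 unfolding sq_integrable_def by simp

lemma integrable_inner_sq_integrable:
 assumes "sq_integrable f" "sq_integrable g" shows "integrable lebesgue (%x. f x \<bullet> g x)"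
proof (rule Bochner_Integration.integrable_bound)
 have [measurable]: "f : borel_measurable lebesgue" "g : borel_measurable lebesgue"
  using assms unfolding sq_integrable_def by auto
 show "(%x. f x \<bullet> g x) : borel_measurable lebesgue" by measurable
 show "integrable lebesgue (%x. (norm (f x))^2 + (norm (g x))^2)" using assms unfolding sq_integrable_def by auto
 have "\<bar>f x \<bullet> g x\<bar> <= (norm (f x))^2 + (norm (g x))^2" for x
  using Cauchy_Schwarz_ineq2[of "f x" "g x"] sum_squares_bound[of "norm (f x)" "norm (g x)"]
   mult_nonneg_nonneg[OF norm_ge_zero[of "f x"] norm_ge_zero[of "g x"]] by linarith
 then show "AE x in lebesgue. norm (f x \<bullet> g x) <= norm ((norm (f x))^2 + (norm (g x))^2)" by auto
qed

definition L2_eq :: "(real^'d::finite => 'b::euclidean_space) => (real^'d => 'b) => bool" where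
 "L2_eq f g \<longleftrightarrow> sq_integrable f & sq_integrable g & (AE x in lebesgue. f x = g x)"

quotient_type (overloaded) ('d, 'b) L2 = "real^'d::finite => 'b::euclidean_space" / partial: L2_eq
proof (rule part_equivpI)
 show "\<exists>f. L2_eq f f" using sq_integrable_zero unfolding L2_eq_def by auto
 show "symp L2_eq" unfolding L2_eq_def by (intro sympI) (auto elim: AE_mp)
 show "transp L2_eq" unfolding L2_eq_def by (intro transpI) (auto elim: eventually_elim2)
qed

instantiation L2 :: (finite, euclidean_space) real_inner
begin

lift_definition zero_L2 :: "('a, 'b) L2" is "%x. 0" by (simp add: L2_eq_def sq_integrable_zero)

lift_definition plus_L2 :: "('a, 'b) L2 => ('a, 'b) L2 => ('a, 'b) L2" is "%f g x. f x + g x"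
 unfolding L2_eq_def by (auto intro: sq_integrable_add elim: AE_mp elim!: eventually_elim2)

lift_definition minus_L2 :: "('a, 'b) L2 => ('a, 'b) L2 => ('a, 'b) L2" is "%f g x. f x - g x"
 unfolding L2_eq_def by (auto intro: sq_integrable_diff elim: AE_mp elim!: eventually_elim2)

lift_definition uminus_L2 :: "('a, 'b) L2 => ('a, 'b) L2" is "%f x. - f x"
 unfolding L2_eq_def by (auto intro: sq_integrable_minus)

lift_definition scaleR_L2 :: "real => ('a, 'b) L2 => ('a, 'b) L2" is "%c f x. c *R f x"
 unfolding L2_eq_def by (auto intro: sq_integrable_scaleR elim: eventually_mono)

lift_definition inner_L2 :: "('a, 'b) L2 => ('a, 'b) L2 => real" is "%f g. LINT x|lebesgue. f x \<bullet> g x"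
proof -
 fix f f' g g' :: "real^'a => 'b" assume *: "L2_eq f f'" "L2_eq g g'"
 then have "AE x in lebesgue. f x = f' x" "AE x in lebesgue. g x = g' x" unfolding L2_eq_def by auto
 then have "AE x in lebesgue. f x \<bullet> g x = f' x \<bullet> g' x" by eventually_elim simp
 then show "(LINT x|lebesgue. f x \<bullet> g x) = (LINT x|lebesgue. f' x \<bullet> g' x)"
  using * unfolding L2_eq_def by (intro integral_cong_AE) (auto intro!: borel_measurable_integrable integrable_inner_sq_integrable)
qed

definition norm_L2 :: "('a, 'b) L2 => real" where "norm_L2 f = sqrt (f \<bullet> f)"
definition sgn_L2 :: "('a, 'b) L2 => ('a, 'b) L2" where "sgn_L2 f = inverse (norm f) *R f"
definition dist_L2 :: "('a, 'b) L2 => ('a, 'b) L2 => real" where "dist_L2 f g = norm (f - g)"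
definition uniformity_L2 :: "(('a, 'b) L2 \<times> ('a, 'b) L2) filter" where
 "uniformity_L2 = (INF e\<in>{0<..}. principal {(x, y). dist x y < e})"
definition open_L2 :: "('a, 'b) L2 set => bool" where
 "open_L2 U = (\<forall>x\<in>U. eventually (%(x', y). x' = x --> y : U) uniformity)"

instance
proof
 fix f g h :: "('a, 'b) L2" and a b :: real
 show "f + g + h = f + (g + h)" by transfer (auto simp: L2_eq_def add.assoc intro: sq_integrable_add)
 show "f + g = g + f" by transfer (auto simp: L2_eq_def add.commute intro: sq_integrable_add)
 show "0 + f = f" by transfer (auto simp: L2_eq_def)
 show "- f + f = 0" by transfer (auto simp: L2_eq_def sq_integrable_zero)
 show "f - g = f + - g" by transfer (auto simp: L2_eq_def intro: sq_integrable_diff)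
 show "a *R (f + g) = a *R f + a *R g"
  by transfer (auto simp: L2_eq_def scaleR_add_right intro!: sq_integrable_scaleR sq_integrable_add)
 show "(a + b) *R f = a *R f + b *R f"
  by transfer (auto simp: L2_eq_def scaleR_add_left intro!: sq_integrable_scaleR sq_integrable_add)
 show "a *R b *R f = (a * b) *R f" by transfer (auto simp: L2_eq_def intro!: sq_integrable_scaleR)
 show "1 *R f = f" by transfer (auto simp: L2_eq_def)
 show "dist f g = norm (f - g)" by (simp add: dist_L2_def)
 show "sgn f = inverse (norm f) *R f" by (simp add: sgn_L2_def)
 show "norm f = sqrt (f \<bullet> f)" by (simp add: norm_L2_def)
 show "uniformity = (INF e\<in>{0<..}. principal {(x :: ('a, 'b) L2, y). dist x y < e})" by (simp add: uniformity_L2_def)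
 show "open U = (\<forall>x\<in>U. eventually (%(x', y). x' = x --> y : U) uniformity)" for U :: "('a, 'b) L2 set"
  by (simp add: open_L2_def)
 show "f \<bullet> g = g \<bullet> f" by transfer (simp add: inner_commute)
 show "(f + g) \<bullet> h = f \<bullet> h + g \<bullet> h"
  by transfer (simp add: L2_eq_def inner_add_left integrable_inner_sq_integrable)
 show "a *R f \<bullet> g = a * (f \<bullet> g)" by transfer simp
 show "0 <= f \<bullet> f" by transfer simp
 show "f \<bullet> f = 0 \<longleftrightarrow> f = 0"
 proof transfer
  fix f :: "real^'a => 'b" assume "L2_eq f f"
  then have f: "sq_integrable f" by (simp add: L2_eq_def)
  have "(LINT x|lebesgue. f x \<bullet> f x) = 0 \<longleftrightarrow> (AE x in lebesgue. f x \<bullet> f x = 0)"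
   by (rule integral_nonneg_eq_0_iff_AE) (auto intro: integrable_inner_sq_integrable f)
  then show "(LINT x|lebesgue. f x \<bullet> f x) = 0 \<longleftrightarrow> L2_eq f (%x. 0)"
   using f by (simp add: L2_eq_def sq_integrable_zero)
 qed
qed

end

text \<open>Completeness: along a rapidly convergent subsequence the increments have a square integrable
 sum of absolute values, by Fatou's lemma, which dominates the subsequence.\<close>

instance L2 :: (finite, euclidean_space) complete_space
proof
 fix X :: "nat => ('a, 'b) L2" assume X: "Cauchy X"
 have "\<exists>N. \<forall>m\<ge>N. \<forall>n\<ge>N. dist (X m) (X n) < (1/2)^k" for k using X unfolding Cauchy_def by simp
 then obtain N where N: "!!k m n. m >= N k ==> n >= N k ==> dist (X m) (X n) < (1/2)^k" by metis
 define r where "r k = (\<Sum>j\<le>k. N j) + k" for k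
 have r: "strict_mono r" unfolding strict_mono_Suc_iff r_def by auto
 have rN: "r k >= N k" "r (Suc k) >= N k" for k unfolding r_def using member_le_sum[of k "{..k}" N] by auto
 define f where "f k = rep_L2 (X (r k))" for k
 have f: "sq_integrable (f k)" for k
  unfolding f_def using Quotient3_rep_reflp[OF Quotient3_L2, of "X (r k)"] by (simp add: L2_eq_def)
 have fX: "abs_L2 (f k) = X (r k)" for k unfolding f_def by (rule Quotient3_abs_rep[OF Quotient3_L2])
 have [measurable]: "f k : borel_measurable lebesgue" for k using f[of k] by (simp add: sq_integrable_def)
 define a where "a k x = norm (f (Suc k) x - f k x)" for k x
 have ar: "sq_integrable (a k)" for k
  by (rule sq_integrable_bound[OF _ sq_integrable_diff[OF f[of "Suc k"] f[of k]], of _ 1]) (auto simp: a_def[abs_def])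
 have eqI: "L2_eq g g" if "sq_integrable g" for g using that by (simp add: L2_eq_def)
 have norm_abs: "norm (abs_L2 g) = sqrt (LINT x|lebesgue. (norm (g x))^2)" if "sq_integrable g"
  for g :: "real^'a => 'c::euclidean_space" using that by (simp add: norm_L2_def inner_L2.abs_eq L2_eq_def power2_norm_eq_inner)
 have na: "norm (abs_L2 (a k)) <= (1/2)^k" for k
 proof -
  have "norm (abs_L2 (a k)) = norm (abs_L2 (%x. f (Suc k) x - f k x))"
   unfolding norm_abs[OF ar] norm_abs[OF sq_integrable_diff[OF f f]] by (simp add: a_def)
  also have "abs_L2 (%x. f (Suc k) x - f k x) = X (r (Suc k)) - X (r k)"
   using eqI[OF f] by (simp add: minus_L2.abs_eq[symmetric] fX)
  finally show ?thesis using N[OF rN(2,1), of k] by (simp add: dist_norm)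
 qed
 define S where "S n x = (\<Sum>k<n. a k x)" for n x
 have S: "sq_integrable (S n) & norm (abs_L2 (S n)) <= (\<Sum>k<n. (1/2)^k)" for n
 proof (induction n)
  case 0
  have "abs_L2 (%x. 0 :: real) = (0 :: ('a, real) L2)" by (simp add: zero_L2_def)
  then show ?case by (simp add: S_def[abs_def] sq_integrable_zero)
 next
  case (Suc n)
  have eq: "S (Suc n) = (%x. S n x + a n x)" by (simp add: S_def fun_eq_iff)
  have "abs_L2 (S (Suc n)) = abs_L2 (S n) + abs_L2 (a n)" unfolding eq using Suc ar by (simp add: plus_L2.abs_eq L2_eq_def)
  then have "norm (abs_L2 (S (Suc n))) <= norm (abs_L2 (S n)) + norm (abs_L2 (a n))" by (simp add: norm_triangle_ineq)
  then show ?case using Suc na[of n] sq_integrable_add[of "S n" "a n"] ar eq by auto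
 qed
 have int_S: "(\<integral>\<^sup>+x. ennreal ((S n x)^2) \<partial>lebesgue) <= 4" for n
 proof -
  have "(\<Sum>k<n. (1/2::real)^k) <= 2" by (simp add: sum_gp_strict)
  then have "norm (abs_L2 (S n)) <= 2" using S[of n] by linarith
  then have le4: "(LINT x|lebesgue. (S n x)^2) <= 4" using norm_abs[of "S n"] S[of n] real_sqrt_le_iff[of _ 4] by simp
  have "integrable lebesgue (%x. (S n x)^2)" using S[of n] by (simp add: sq_integrable_def)
  show ?thesis
  proof -
   have "(\<integral>\<^sup>+x. ennreal ((S n x)^2) \<partial>lebesgue) = ennreal (LINT x|lebesgue. (S n x)^2)"
    by (rule nn_integral_eq_integral) (use \<open>integrable lebesgue (\<lambda>x. (S n x)\<^sup>2)\<close> in auto)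
   also have "... <= ennreal 4" by (rule ennreal_leI[OF le4])
   finally show ?thesis by simp
  qed
 qed
 have [measurable]: "S n : borel_measurable lebesgue" for n using S[of n] by (simp add: sq_integrable_def)
 have fatou: "(\<integral>\<^sup>+x. liminf (%n. ennreal ((S n x)^2)) \<partial>lebesgue) <= 4"
 proof -
  have "(\<integral>\<^sup>+x. liminf (%n. ennreal ((S n x)^2)) \<partial>lebesgue) <= liminf (%n. \<integral>\<^sup>+x. ennreal ((S n x)^2) \<partial>lebesgue)"
   by (rule nn_integral_liminf) measurable
  also have "... <= liminf (%n::nat. 4)" by (intro Liminf_mono always_eventually allI int_S)
  also have "... = 4" by (simp add: Liminf_const)
  finally show ?thesis .
 qed
 then have "AE x in lebesgue. liminf (%n. ennreal ((S n x)^2)) ~= \<infinity>"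
  by (intro nn_integral_PInf_AE) (auto simp: top_unique)
 then have summ: "AE x in lebesgue. summable (%k. a k x)"
 proof eventually_elim
  fix x assume fin: "liminf (%n. ennreal ((S n x)^2)) ~= \<infinity>"
  have mono: "incseq (%n. S n x)" unfolding S_def incseq_Suc_iff a_def by simp
  have S0: "S n x >= 0" for n unfolding S_def a_def by (intro sum_nonneg) auto
  have "incseq (%n. ennreal ((S n x)^2))" using mono S0 by (auto simp: incseq_def intro!: ennreal_leI power_mono)
  then have lim: "(%n. ennreal ((S n x)^2)) ----> (SUP n. ennreal ((S n x)^2))" by (rule LIMSEQ_SUP)
  then have "liminf (%n. ennreal ((S n x)^2)) = (SUP n. ennreal ((S n x)^2))" by (intro lim_imp_Liminf) auto
  with fin obtain B where B: "B >= 0" "(SUP n. ennreal ((S n x)^2)) = ennreal B" by (cases "SUP n. ennreal ((S n x)^2)") auto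
  have "(S n x)^2 <= B" for n
  proof -
   have "ennreal ((S n x)^2) <= ennreal B" unfolding B(2)[symmetric] by (rule SUP_upper) simp
   then show ?thesis using B(1) by (simp add: ennreal_le_iff)
  qed
  then have bd: "S n x <= sqrt B" for n by (simp add: real_le_rsqrt)
  show "summable (%k. a k x)"
  proof (rule bounded_imp_summable[of _ "sqrt B"])
   show "a k x >= 0" for k by (simp add: a_def)
   show "(\<Sum>k\<le>n. a k x) <= sqrt B" for n using bd[of "Suc n"] by (simp add: S_def lessThan_Suc_atMost)
  qed
 qed
 define G where "G x = (\<Sum>k. a k x)" for x
 have Gm[measurable]: "G : borel_measurable lebesgue" unfolding G_def a_def by measurable
 have G: "sq_integrable G" unfolding sq_integrable_def
 proof (rule conjI[OF Gm], rule integrableI_bounded)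
  have "AE x in lebesgue. ennreal (norm ((norm (G x))^2)) <= liminf (%n. ennreal ((S n x)^2))" using summ
  proof eventually_elim
   fix x assume "summable (%k. a k x)"
   then have "(%n. S n x) ----> G x" unfolding S_def G_def by (rule summable_LIMSEQ)
   then have "(%n. ennreal ((S n x)^2)) ----> ennreal ((G x)^2)" by (intro tendsto_intros)
   then have "liminf (%n. ennreal ((S n x)^2)) = ennreal ((G x)^2)" by (intro lim_imp_Liminf) auto
   then show "ennreal (norm ((norm (G x))^2)) <= liminf (%n. ennreal ((S n x)^2))" by simp
  qed
  from order_trans[OF nn_integral_mono_AE[OF this] fatou]
  have "(\<integral>\<^sup>+x. ennreal (norm ((norm (G x))^2)) \<partial>lebesgue) <= 4" .
  then show "(\<integral>\<^sup>+x. ennreal (norm ((norm (G x))^2)) \<partial>lebesgue) < \<infinity>"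
   by (rule le_less_trans) simp
 qed measurable
 define F where "F x = lim (%k. f k x)" for x
 have Fm[measurable]: "F : borel_measurable lebesgue" unfolding F_def by measurable
 have tel: "f n x - f m x = (\<Sum>k\<in>{m..<n}. f (Suc k) x - f k x)" if "m <= n" for m n x
  using sum_Suc_diff'[OF that, of "%k. f k x"] by simp
 have AE1: "AE x in lebesgue. (%k. f k x) ----> F x & (\<forall>m. norm (f m x - F x) <= G x)" using summ
 proof eventually_elim
  fix x assume s: "summable (%k. a k x)"
  then have "summable (%k. f (Suc k) x - f k x)" unfolding a_def by (rule summable_norm_cancel)
  then have "convergent (%n. \<Sum>k<n. f (Suc k) x - f k x)" by (simp add: summable_iff_convergent)
  then have "convergent (%n. f 0 x + (f n x - f 0 x))"
   unfolding tel[OF le0] atLeast0LessThan by (intro convergent_add convergent_const)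
  then have lim: "(%k. f k x) ----> F x" unfolding F_def by (simp add: convergent_LIMSEQ_iff)
  have "norm (f m x - F x) <= G x" for m
  proof (rule LIMSEQ_le_const2)
   show "(%n. norm (f m x - f n x)) ----> norm (f m x - F x)" by (intro tendsto_intros lim)
   have "norm (f m x - f n x) <= G x" if "n >= m" for n
   proof -
    have "norm (f m x - f n x) = norm (f n x - f m x)" by (rule norm_minus_commute)
    also have "... <= (\<Sum>k\<in>{m..<n}. a k x)" unfolding tel[OF that] a_def by (rule norm_sum)
    also have "... <= G x" unfolding G_def by (rule sum_le_suminf[OF s]) (auto simp: a_def)
    finally show ?thesis .
   qed
   then show "\<exists>N. \<forall>n\<ge>N. norm (f m x - f n x) <= G x" by blast
  qed
  with lim show "(%k. f k x) ----> F x & (\<forall>m. norm (f m x - F x) <= G x)" by blast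
 qed
 have diff: "sq_integrable (%x. f m x - F x)" for m
 proof (rule sq_integrable_bound[OF _ G, of _ 1])
  show "AE x in lebesgue. norm (f m x - F x) <= 1 * norm (G x)"
   using AE1 by eventually_elim (auto intro: order_trans[OF _ abs_ge_self])
 qed measurable
 have F: "sq_integrable F" using sq_integrable_diff[OF f diff, of 0 0] by simp
 have "(%m. LINT x|lebesgue. (norm (f m x - F x))^2) ----> (LINT x::real^'a|lebesgue. 0 :: real)"
 proof (rule integral_dominated_convergence[where w = "%x. (norm (G x))^2"])
  show "integrable lebesgue (%x. (norm (G x))^2)" using G by (simp add: sq_integrable_def)
  show "AE x in lebesgue. (%m. (norm (f m x - F x))^2) ----> 0" using AE1
  proof eventually_elim
   fix x assume "(%k. f k x) ----> F x & (\<forall>m. norm (f m x - F x) <= G x)"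
   then have "(%m. (norm (f m x - F x))^2) ----> (norm (F x - F x))^2" by (intro tendsto_intros) auto
   then show "(%m. (norm (f m x - F x))^2) ----> 0" by simp
  qed
  show "AE x in lebesgue. norm ((norm (f m x - F x))^2) <= (norm (G x))^2" for m
   using AE1 by eventually_elim (auto intro!: power_mono order_trans[OF _ abs_ge_self])
 qed auto
 then have "(%m. sqrt (LINT x|lebesgue. (norm (f m x - F x))^2)) ----> sqrt 0" by (intro tendsto_real_sqrt) simp
 moreover have "sqrt (LINT x|lebesgue. (norm (f m x - F x))^2) = norm (X (r m) - abs_L2 F)" for m
  unfolding norm_abs[OF diff, symmetric] fX[symmetric] using eqI[OF f] eqI[OF F] by (simp add: minus_L2.abs_eq)
 ultimately have "(%m. norm (X (r m) - abs_L2 F)) ----> 0" by simp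
 then have "(%m. X (r m) - abs_L2 F) ----> 0" by (rule tendsto_norm_zero_cancel)
 then have "(%m. X (r m)) ----> abs_L2 F" by (rule LIM_zero_cancel)
 then have "(X \<circ> r) ----> abs_L2 F" by (simp only: o_def)
 then have "X ----> abs_L2 F" by (rule Cauchy_converges_subseq[OF X r])
 then show "convergent X" by (rule convergentI)
qed

subsection \<open>Classes of functions on a measurable set\<close>

definition toL2 :: "(real^'d::finite) set => (real^'d => 'b::euclidean_space) => ('d, 'b) L2" where
 "toL2 S f = abs_L2 (%x. indicator S x *R f x)"

lemma in_L2_iff:
 fixes f :: "real^'d::finite => 'b::euclidean_space"
 assumes "S : sets lebesgue"
 shows "in_L2 S f \<longleftrightarrow> sq_integrable (%x. indicator S x *R f x)"
proof -
 have "(%x. indicator S x *R (norm (f x))^2) = (%x. (norm (indicator S x *R f x))^2)" by (auto simp: indicator_def)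
 then show ?thesis unfolding in_L2_def sq_integrable_def
  by (simp only: measurable_lebesgue_on[OF assms] integrable_lebesgue_on[OF assms])
qed

lemma in_L2_UNIV_iff: "in_L2 UNIV f \<longleftrightarrow> sq_integrable f"
 by (simp add: in_L2_iff)

lemma in_L2_add:
 assumes "S : sets lebesgue" "in_L2 S f" "in_L2 S g" shows "in_L2 S (%x. f x + g x)"
 using assms sq_integrable_add by (fastforce simp: in_L2_iff scaleR_add_right)

lemma in_L2_scaleR: "S : sets lebesgue ==> in_L2 S f ==> in_L2 S (%x. c *R f x)"
 using sq_integrable_scaleR[of _ c] by (fastforce simp: in_L2_iff mult.commute)

lemma in_L2_diff:
 assumes "S : sets lebesgue" "in_L2 S f" "in_L2 S g" shows "in_L2 S (%x. f x - g x)"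
 using assms sq_integrable_diff by (fastforce simp: in_L2_iff scaleR_diff_right)

lemma in_L2_bound:
 fixes f :: "real^'d::finite => 'b::euclidean_space" and g :: "real^'d::finite => 'c::euclidean_space"
 assumes "S : sets lebesgue" "in_L2 S f" "g : borel_measurable (lebesgue_on S)"
  "AE x in lebesgue_on S. norm (g x) <= C * norm (f x)"
 shows "in_L2 S g"
 unfolding in_L2_iff[OF assms(1)]
proof (rule sq_integrable_bound[of _ "%x. indicator S x *R f x" C])
 have "AE x in lebesgue. x : S --> norm (g x) <= C * norm (f x)" using assms by (simp add: AE_lebesgue_on)
 then show "AE x in lebesgue. norm (indicator S x *R g x) <= C * norm (indicator S x *R f x)"
  by eventually_elim (auto simp: indicator_def)
qed (use assms in "auto simp: in_L2_iff measurable_lebesgue_on")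

lemma in_L2_mono:
 assumes "in_L2 S f" "S : sets lebesgue" "T : sets lebesgue" "T <= S" shows "in_L2 T f"
proof -
 have eq: "(%x. indicator T x *R f x) = (%x. indicator T x *R (indicator S x *R f x))"
  using assms(4) by (force simp: indicator_def fun_eq_iff)
 have "sq_integrable (%x. indicator T x *R (indicator S x *R f x))"
 proof (rule sq_integrable_bound[of _ "%x. indicator S x *R f x" 1])
  have "(%x. indicator S x *R f x) : borel_measurable lebesgue" using assms by (simp add: in_L2_iff sq_integrable_def)
  then show "(%x. indicator T x *R (indicator S x *R f x)) : borel_measurable lebesgue"
   by (rule borel_measurable_scaleR[OF borel_measurable_indicator[OF assms(3)]])
 qed (use assms in "auto simp: in_L2_iff indicator_def[of T]")
 then show ?thesis using assms by (simp only: in_L2_iff eq)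
qed

lemma toL2_abs:
 assumes "S : sets lebesgue" "in_L2 S f"
 shows "L2_eq (%x. indicator S x *R f x) (%x. indicator S x *R f x)"
 using assms by (simp add: L2_eq_def in_L2_iff)

lemma toL2_add:
 assumes "S : sets lebesgue" "in_L2 S f" "in_L2 S g"
 shows "toL2 S (%x. f x + g x) = toL2 S f + toL2 S g"
 unfolding toL2_def using toL2_abs[OF assms(1,2)] toL2_abs[OF assms(1,3)] by (simp add: plus_L2.abs_eq scaleR_add_right)

lemma toL2_diff:
 assumes "S : sets lebesgue" "in_L2 S f" "in_L2 S g"
 shows "toL2 S (%x. f x - g x) = toL2 S f - toL2 S g"
 unfolding toL2_def using toL2_abs[OF assms(1,2)] toL2_abs[OF assms(1,3)] by (simp add: minus_L2.abs_eq scaleR_diff_right)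

lemma toL2_scaleR:
 assumes "S : sets lebesgue" "in_L2 S f"
 shows "toL2 S (%x. c *R f x) = c *R toL2 S f"
 unfolding toL2_def using toL2_abs[OF assms(1,2)] by (simp add: scaleR_L2.abs_eq mult.commute)

lemma toL2_zero: "toL2 S (%x. 0) = 0"
 unfolding toL2_def by (simp add: zero_L2_def)

lemma toL2_eq_iff:
 assumes "S : sets lebesgue" "in_L2 S f" "in_L2 S g"
 shows "toL2 S f = toL2 S g \<longleftrightarrow> (AE x in lebesgue_on S. f x = g x)"
proof -
 have "toL2 S f = toL2 S g \<longleftrightarrow> L2_eq (%x. indicator S x *R f x) (%x. indicator S x *R g x)"
  unfolding toL2_def using Quotient3_rel[OF Quotient3_L2, of "%x. indicator S x *R f x" "%x. indicator S x *R g x"]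
   toL2_abs[OF assms(1,2)] toL2_abs[OF assms(1,3)] by blast
 also have "... \<longleftrightarrow> (AE x in lebesgue. indicator S x *R f x = indicator S x *R g x)"
  using assms by (simp add: L2_eq_def in_L2_iff)
 also have "... \<longleftrightarrow> (AE x in lebesgue. x : S --> f x = g x)" by (intro AE_cong) (auto simp: indicator_def)
 finally show ?thesis using assms(1) by (simp add: AE_lebesgue_on)
qed

lemma inner_toL2:
 assumes "S : sets lebesgue" "in_L2 S f" "in_L2 S g"
 shows "toL2 S f \<bullet> toL2 S g = (LINT x|lebesgue_on S. f x \<bullet> g x)"
proof -
 have "(%x. (indicator S x *R f x) \<bullet> (indicator S x *R g x)) = (%x. indicator S x *R (f x \<bullet> g x))"
  by (auto simp: indicator_def)
 then show ?thesis unfolding toL2_def using toL2_abs[OF assms(1,2)] toL2_abs[OF assms(1,3)] assms(1)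
  by (simp only: inner_L2.abs_eq integral_lebesgue_on)
qed

lemma norm_toL2:
 assumes "S : sets lebesgue" "in_L2 S f" shows "norm (toL2 S f) = L2_norm S f"
 unfolding norm_eq_sqrt_inner L2_norm_def inner_toL2[OF assms assms(2)] by (simp add: power2_norm_eq_inner)

lemma integrable_inner_in_L2:
 assumes "S : sets lebesgue" "in_L2 S f" "in_L2 S g"
 shows "integrable (lebesgue_on S) (%x. f x \<bullet> g x)"
proof -
 have "(%x. (indicator S x *R f x) \<bullet> (indicator S x *R g x)) = (%x. indicator S x *R (f x \<bullet> g x))"
  by (auto simp: indicator_def)
 then show ?thesis using integrable_inner_sq_integrable[of "%x. indicator S x *R f x" "%x. indicator S x *R g x"] assms
  by (simp add: in_L2_iff integrable_lebesgue_on)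
qed

lemma L2_norm_nonneg: "L2_norm S f >= 0" unfolding L2_norm_def by simp

lemma L2_norm_power2: "(L2_norm S f)^2 = (LINT x|lebesgue_on S. (norm (f x))^2)"
 unfolding L2_norm_def by simp

lemma sq_integrable_rep_L2: "sq_integrable (rep_L2 u)"
 using Quotient3_rep_reflp[OF Quotient3_L2, of u] by (simp add: L2_eq_def)

lemma in_L2_rep_L2: "S : sets lebesgue ==> in_L2 S (rep_L2 u)"
 using in_L2_mono[of UNIV "rep_L2 u" S] sq_integrable_rep_L2 by (auto simp: in_L2_UNIV_iff)

lemma toL2_rep_L2: "toL2 UNIV (rep_L2 u) = u"
 unfolding toL2_def using Quotient3_abs_rep[OF Quotient3_L2, of u] by simp

lemma inner_toL2_rep_L2:
 assumes S: "S : sets lebesgue" and f: "in_L2 S f"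
 shows "u \<bullet> toL2 S f = (LINT x|lebesgue_on S. rep_L2 u x \<bullet> f x)"
proof -
 have f': "in_L2 UNIV (%x. indicator S x *R f x)" using f S by (simp add: in_L2_UNIV_iff in_L2_iff)
 have "u \<bullet> toL2 S f = toL2 UNIV (rep_L2 u) \<bullet> toL2 UNIV (%x. indicator S x *R f x)"
  by (simp add: toL2_rep_L2) (simp add: toL2_def)
 also have "... = (LINT x|lebesgue_on UNIV. rep_L2 u x \<bullet> (indicator S x *R f x))"
  by (rule inner_toL2[OF _ in_L2_rep_L2 f']) auto
 also have "... = (LINT x|lebesgue_on S. rep_L2 u x \<bullet> f x)" using S by (simp add: integral_lebesgue_on)
 finally show ?thesis .
qed

declare lebesgue_on_UNIV_eq [simp]

section \<open>Density of test functions and mollification\<close>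

lemma sq_integrable_test_function:
 fixes \<phi> :: "real^'d::finite => 'b::euclidean_space"
 assumes "test_function S \<phi>" shows "sq_integrable \<phi>"
proof -
 obtain C where C: "!!x. norm (\<phi> x) <= C" using test_function_bounded[OF assms] by metis
 have m: "\<phi> : borel_measurable lebesgue" by (rule test_function_measurable[OF assms])
 have "integrable lebesgue (%x. norm (\<phi> x) *R norm (\<phi> x))" by (rule integrable_bounded_scaleR[where C=C])
   (use C m in "auto intro: integrable_norm integrable_test_function[OF assms]")
 then show ?thesis unfolding sq_integrable_def using m by (simp add: power2_eq_square)
qed

lemma in_L2_test_function:
 fixes \<phi> :: "real^'d::finite => 'b::euclidean_space"
 shows "test_function S \<phi> ==> T : sets lebesgue ==> in_L2 T \<phi>"
 using in_L2_mono[of UNIV \<phi> T] sq_integrable_test_function by (auto simp: in_L2_UNIV_iff)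

lemma AE_zero_if_L2_norm_zero:
 assumes "S : sets lebesgue" "in_L2 S f" "L2_norm S f = 0"
 shows "AE x in lebesgue_on S. f x = 0"
proof -
 have "(LINT x|lebesgue_on S. (norm (f x))^2) = 0" using assms(3) by (simp add: L2_norm_def)
 then have "AE x in lebesgue_on S. (norm (f x))^2 = 0"
  using assms(2) by (subst (asm) integral_nonneg_eq_0_iff_AE) (auto simp: in_L2_def)
 then show ?thesis by eventually_elim simp
qed

text \<open>A subspace with trivial orthogonal complement: classes of test functions on \<open>U\<close> plus classes
 of functions that vanish on \<open>U\<close>.\<close>

definition L2_test_space :: "(real^'d::finite) set => ('d, real) L2 set" where
 "L2_test_space U = {x + y | x y. x : toL2 UNIV ` {\<phi>. test_function U \<phi>} & y : toL2 (- U) ` {g. in_L2 (- U) g}}"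

lemma subspace_L2_test_space:
 assumes U: "open U" shows "subspace (L2_test_space U)"
proof -
 have mU: "- U : sets lebesgue" using U by auto
 have z: "test_function U (%x. 0)" by (rule test_functionI[OF smooth_const, of "{}"]) auto
 have tin: "in_L2 UNIV \<phi>" if "test_function U \<phi>" for \<phi> :: "real^'a => real" using in_L2_test_function[OF that] by simp
 have "subspace (toL2 UNIV ` {\<phi> :: real^'a => real. test_function U \<phi>})" unfolding subspace_def
 proof (intro conjI ballI allI)
  show "(0::('a, real) L2) : toL2 UNIV ` {\<phi>. test_function U \<phi>}"
   using z by (intro image_eqI[of _ _ "%x. 0"]) (auto simp: toL2_zero)
  fix x y :: "('a, real) L2" and c :: real assume "x : toL2 UNIV ` {\<phi>. test_function U \<phi>}" "y : toL2 UNIV ` {\<phi>. test_function U \<phi>}"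
  then obtain a b where ab: "test_function U a" "x = toL2 UNIV a" "test_function U b" "y = toL2 UNIV b" by auto
  show "x + y : toL2 UNIV ` {\<phi>. test_function U \<phi>}"
   by (rule image_eqI[of _ _ "%x. a x + b x"]) (use ab tin in "auto simp: toL2_add intro: test_function_add")
 next
  fix x :: "('a, real) L2" and c :: real assume "x : toL2 UNIV ` {\<phi>. test_function U \<phi>}"
  then obtain a where a: "test_function U a" "x = toL2 UNIV a" by auto
  show "c *R x : toL2 UNIV ` {\<phi>. test_function U \<phi>}"
   by (rule image_eqI[of _ _ "%x. c *R a x"]) (use a(1) tin test_function_cmult[OF a(1), of c] in "auto simp: toL2_scaleR[symmetric] a(2)")
 qed
 moreover have "subspace (toL2 (- U) ` {g :: real^'a => real. in_L2 (- U) g})" unfolding subspace_def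
 proof (intro conjI ballI allI)
  show "(0::('a, real) L2) : toL2 (- U) ` {g. in_L2 (- U) g}"
   by (intro image_eqI[of _ _ "%x. 0"]) (use sq_integrable_zero in "auto simp: toL2_zero in_L2_iff[OF mU]")
  fix x y :: "('a, real) L2" assume "x : toL2 (- U) ` {g. in_L2 (- U) g}" "y : toL2 (- U) ` {g. in_L2 (- U) g}"
  then obtain a b where ab: "in_L2 (- U) a" "x = toL2 (- U) a" "in_L2 (- U) b" "y = toL2 (- U) b" by auto
  show "x + y : toL2 (- U) ` {g. in_L2 (- U) g}"
   by (rule image_eqI[of _ _ "%x. a x + b x"]) (use ab mU in "auto simp: toL2_add intro: in_L2_add")
 next
  fix x :: "('a, real) L2" and c :: real assume "x : toL2 (- U) ` {g. in_L2 (- U) g}"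
  then obtain a where a: "in_L2 (- U) a" "x = toL2 (- U) a" by auto
  show "c *R x : toL2 (- U) ` {g. in_L2 (- U) g}"
   by (rule image_eqI[of _ _ "%x. c *R a x"]) (use a(1) mU in_L2_scaleR[OF mU a(1), of c] in "auto simp: toL2_scaleR[symmetric] a(2)")
 qed
 ultimately show ?thesis unfolding L2_test_space_def by (rule subspace_sums)
qed

text \<open>An element orthogonal to the subspace vanishes on \<open>U\<close> by the fundamental lemma of the calculus of
 variations, and outside \<open>U\<close> because it is orthogonal to itself there.\<close>

lemma closure_L2_test_space:
 assumes U: "open U" shows "closure (L2_test_space U) = UNIV"
proof (rule dense_subspace_if_trivial_orthogonal[OF subspace_L2_test_space[OF U]])
 fix x :: "('a, real) L2" assume orth: "!!y. y : L2_test_space U ==> x \<bullet> y = 0"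
 have mU: "U : sets lebesgue" "- U : sets lebesgue" using U by auto
 let ?h = "rep_L2 x"
 have h: "in_L2 U ?h" "in_L2 (- U) ?h" using in_L2_rep_L2 mU by auto
 have 0: "test_function U (%x::real^'a. 0::real)" by (rule test_functionI[OF smooth_const, of "{}"]) auto
 have 1: "toL2 UNIV \<phi> : L2_test_space U" if "test_function U \<phi>" for \<phi>
 proof -
  have "toL2 UNIV \<phi> + toL2 (- U) (%x. 0) : L2_test_space U" unfolding L2_test_space_def
   using that sq_integrable_zero by (force simp: in_L2_iff[OF mU(2)])
  then show ?thesis by (simp add: toL2_zero)
 qed
 have 2: "toL2 (- U) g : L2_test_space U" if "in_L2 (- U) g" for g
 proof -
  have "toL2 UNIV (%x. 0) + toL2 (- U) g : L2_test_space U" unfolding L2_test_space_def using that 0 by blast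
  then show ?thesis by (simp add: toL2_zero)
 qed
 have "AE t in lebesgue_on U. ?h t = 0"
 proof (rule fundamental_lemma_variations[OF U])
  have "sq_integrable ?h" by (rule sq_integrable_rep_L2)
  then have "?h : borel_measurable lebesgue" by (simp add: sq_integrable_def)
  show "locally_integrable U ?h" unfolding locally_integrable_def
  proof (intro allI impI)
   fix K assume K: "compact K & K <= U"
   then have mK: "K : sets lebesgue" by (simp add: compact_imp_closed)
   have "sq_integrable (indicator K :: real^'a => real)"
   proof -
    have "(%x. (norm (indicator K x :: real))^2) = indicator K" by (auto simp: indicator_def)
    then show ?thesis unfolding sq_integrable_def
     using mK K integrable_indicator_bounded[of K] by (simp add: compact_imp_bounded del: norm_power)
   qed
   from integrable_inner_sq_integrable[OF this sq_integrable_rep_L2[of x]]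
   show "integrable (lebesgue_on K) ?h" using mK by (simp add: integrable_lebesgue_on)
  qed
  fix \<phi> :: "real^'a => real" assume t: "test_function U \<phi>"
  have "x \<bullet> toL2 UNIV \<phi> = (LINT t|lebesgue_on UNIV. ?h t \<bullet> \<phi> t)"
   by (rule inner_toL2_rep_L2[OF _ in_L2_test_function[OF t]]) auto
  then show "(LINT t|lebesgue. \<phi> t *R ?h t) = 0" using orth[OF 1[OF t]] by (simp add: mult.commute)
 qed
 moreover have "L2_norm (- U) ?h = 0"
 proof -
  have "(LINT t|lebesgue_on (- U). ?h t \<bullet> ?h t) = 0"
   using inner_toL2_rep_L2[OF mU(2) h(2), of x] orth[OF 2[OF h(2)]] by simp
  then show ?thesis by (simp add: L2_norm_def power2_eq_square)
 qed
 then have "AE t in lebesgue_on (- U). ?h t = 0" by (rule AE_zero_if_L2_norm_zero[OF mU(2) h(2)])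
 ultimately have "AE t in lebesgue. ?h t = 0"
  unfolding AE_lebesgue_on[OF mU(1)] AE_lebesgue_on[OF mU(2)] by eventually_elim auto
 then have "toL2 UNIV ?h = toL2 UNIV (%x. 0)"
  by (subst toL2_eq_iff) (simp_all add: in_L2_UNIV_iff sq_integrable_rep_L2 sq_integrable_zero AE_lebesgue_on)
 then show "x = 0" by (simp add: toL2_rep_L2 toL2_zero)
qed

lemma L2_norm_le_norm_mono:
 assumes S: "S : sets lebesgue" and f: "in_L2 UNIV f" shows "L2_norm S f <= L2_norm UNIV f"
 unfolding L2_norm_def
proof (intro real_sqrt_le_mono)
 show "(LINT x|lebesgue_on S. (norm (f x))^2) <= (LINT x|lebesgue_on UNIV. (norm (f x))^2)" unfolding integral_lebesgue_on[OF S]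
  by (simp only: lebesgue_on_UNIV_eq, rule integral_mono_AE')
   (use f in "auto simp: in_L2_UNIV_iff sq_integrable_def indicator_def")
qed

lemma test_functions_dense_in_L2:
 fixes f :: "real^'d::finite => real"
 assumes U: "open U" and f: "in_L2 U f" and e: "e > 0"
 obtains \<phi> where "test_function U \<phi>" "L2_norm U (%x. f x - \<phi> x) < e"
proof -
 have mU: "U : sets lebesgue" "- U : sets lebesgue" using U by auto
 obtain y where "y : L2_test_space U" "dist y (toL2 U f) < e"
  using closure_approachable[of "toL2 U f" "L2_test_space U"] closure_L2_test_space[OF U] e by auto
 then obtain \<phi> g where \<phi>: "test_function U \<phi>" and g: "in_L2 (- U) g"
  and d: "norm (toL2 U f - (toL2 UNIV \<phi> + toL2 (- U) g)) < e"
  unfolding L2_test_space_def by (auto simp: dist_norm norm_minus_commute)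
 let ?f = "%x. indicator U x *R f x" and ?g = "%x. indicator (- U) x *R g x"
 have sq: "in_L2 UNIV ?f" "in_L2 UNIV ?g" "in_L2 UNIV \<phi>"
  using f g mU sq_integrable_test_function[OF \<phi>] by (auto simp: in_L2_UNIV_iff in_L2_iff)
 have "toL2 U f = toL2 UNIV ?f" "toL2 (- U) g = toL2 UNIV ?g" by (simp_all add: toL2_def)
 then have "toL2 U f - (toL2 UNIV \<phi> + toL2 (- U) g) = toL2 UNIV (%x. ?f x - (\<phi> x + ?g x))"
  using sq in_L2_add[OF _ sq(3,2)] by (simp add: toL2_diff toL2_add)
 then have "L2_norm UNIV (%x. ?f x - (\<phi> x + ?g x)) < e"
  using d norm_toL2[OF _ in_L2_diff[OF _ sq(1) in_L2_add[OF _ sq(3,2)]]] by simp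
 moreover have "L2_norm U (%x. ?f x - (\<phi> x + ?g x)) <= L2_norm UNIV (%x. ?f x - (\<phi> x + ?g x))"
  by (rule L2_norm_le_norm_mono[OF mU(1)]) (use sq in "auto intro!: in_L2_diff in_L2_add simp del: real_scaleR_def")
 moreover have "L2_norm U (%x. ?f x - (\<phi> x + ?g x)) = L2_norm U (%x. f x - \<phi> x)"
 proof -
  have eq: "(%x. indicator U x *R (norm (?f x - (\<phi> x + ?g x)))^2) = (%x. indicator U x *R (norm (f x - \<phi> x))^2)"
   by (auto simp: indicator_def)
  show ?thesis unfolding L2_norm_def integral_lebesgue_on[OF mU(1)] eq ..
 qed
 ultimately show ?thesis using that[OF \<phi>] by simp
qed

text \<open>On a bounded sequence, weak convergence in \<open>L\<^sup>2\<close> is convergence in the sense of distributions.\<close>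

lemma weakly_tendsto_toL2_if_tested:
 fixes f :: "nat => real^'d::finite => real"
 assumes D: "open D" and f: "!!m. in_L2 D (f m)" "in_L2 D g" and bd: "!!m. L2_norm D (f m) <= B"
  and t: "!!\<phi>. test_function D \<phi> ==> (%m. LINT x|lebesgue_on D. f m x * \<phi> x) ----> (LINT x|lebesgue_on D. g x * \<phi> x)"
 shows "weakly_tendsto (%m. toL2 D (f m)) (toL2 D g)"
proof (rule weakly_tendsto_if_tested_on_total[OF subspace_L2_test_space[OF D] closure_L2_test_space[OF D]])
 have mD: "D : sets lebesgue" "- D : sets lebesgue" using D by auto
 show "norm (toL2 D (f m)) <= B" for m using bd f by (simp add: norm_toL2[OF mD(1)])
 fix h assume "h : L2_test_space D"
 then obtain \<phi> k where h: "test_function D \<phi>" "in_L2 (- D) k" "h = toL2 UNIV \<phi> + toL2 (- D) k"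
  unfolding L2_test_space_def by auto
 have ip: "toL2 D q \<bullet> h = (LINT x|lebesgue_on D. q x * \<phi> x)" if q: "in_L2 D q" for q
 proof -
  have q': "in_L2 UNIV (%x. indicator D x *R q x)" and k': "in_L2 UNIV (%x. indicator (- D) x *R k x)"
   using q h(2) mD by (auto simp: in_L2_UNIV_iff in_L2_iff)
  have eq: "toL2 D q = toL2 UNIV (%x. indicator D x *R q x)" "toL2 (- D) k = toL2 UNIV (%x. indicator (- D) x *R k x)"
   by (simp_all add: toL2_def)
  have "toL2 D q \<bullet> toL2 (- D) k = 0"
  proof -
   have 0: "(%x. (indicator D x *R q x) \<bullet> (indicator (- D) x *R k x)) = (%x. 0)" by (auto simp: indicator_def)
   have "toL2 D q \<bullet> toL2 (- D) k = (LINT x|lebesgue_on UNIV. (indicator D x *R q x) \<bullet> (indicator (- D) x *R k x))"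
    unfolding eq by (rule inner_toL2[OF _ q' k']) simp
   then show ?thesis unfolding 0 by simp
  qed
  moreover have "toL2 D q \<bullet> toL2 UNIV \<phi> = (LINT x|lebesgue_on D. q x * \<phi> x)"
   unfolding eq(1) using inner_toL2[OF _ q' in_L2_test_function[OF h(1)]] by (simp add: integral_lebesgue_on[OF mD(1)] mult.assoc)
  ultimately show ?thesis unfolding h(3) by (simp add: inner_add_right)
 qed
 show "(%m. toL2 D (f m) \<bullet> h) ----> toL2 D g \<bullet> h" using t[OF h(1)] by (simp add: ip f)
qed

subsection \<open>Translations\<close>

lemma sq_integrable_translation:
 assumes "sq_integrable f" shows "sq_integrable (%x. f (x + z))"
 using measurable_lebesgue_affine[of 1 f z] integrable_lebesgue_affine[of 1 "%x. (norm (f x))^2" z] assms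
 by (simp add: sq_integrable_def add.commute)

lemma L2_norm_translation:
 assumes "sq_integrable f" shows "L2_norm UNIV (%x. f (x + z)) = L2_norm UNIV f"
proof -
 have "(%x. (norm (f x))^2) : borel_measurable lebesgue"
  using assms by (simp add: sq_integrable_def borel_measurable_integrable)
 from integral_lebesgue_affine[OF _ this, of 1 z] show ?thesis by (simp add: L2_norm_def add.commute)
qed

lemma L2_norm_triangle:
 assumes "S : sets lebesgue" "in_L2 S f" "in_L2 S g"
 shows "L2_norm S (%x. f x + g x) <= L2_norm S f + L2_norm S g"
 using norm_triangle_ineq[of "toL2 S f" "toL2 S g"] norm_toL2[OF assms(1) in_L2_add[OF assms]] assms
 by (simp add: toL2_add norm_toL2)

lemma L2_norm_swap: "L2_norm S (%x. f x - g x) = L2_norm S (%x. g x - f x)"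
 by (simp add: L2_norm_def norm_minus_commute)

lemma L2_translation_continuous:
 fixes f :: "real^'d::finite => real"
 assumes f: "sq_integrable f" and e: "e > 0"
 shows "\<exists>d>0. \<forall>z. norm z < d --> L2_norm UNIV (%x. f (x + z) - f x) < e"
proof -
 have e3: "e/3 > 0" using e by simp
 obtain \<phi> where \<phi>: "test_function UNIV \<phi>" "L2_norm UNIV (%x. f x - \<phi> x) < e/3"
  using test_functions_dense_in_L2[OF open_UNIV _ e3] f by (auto simp: in_L2_UNIV_iff)
 note sp = sq_integrable_test_function[OF \<phi>(1)]
 obtain K where K: "compact K" "!!x. x ~: K ==> \<phi> x = 0" using test_function_support[OF \<phi>(1)] by metis
 obtain R where R: "R > 0" "!!x. x : K ==> norm x <= R" using compact_imp_bounded[OF K(1)] by (meson bounded_pos)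
 define M where "M = measure lebesgue (cball (0::real^'d) (R + 1))"
 have M: "M >= 0" unfolding M_def by simp
 define c where "c = e / 3 / (sqrt M + 1)"
 have c: "c > 0" "c * sqrt M < e / 3"
 proof -
  have "sqrt M + 1 > 0" using M by (simp add: add_nonneg_pos)
  then show "c > 0" unfolding c_def using e by simp
  then have "c * sqrt M < c * (sqrt M + 1)" by simp
  also have "... = e / 3" using \<open>sqrt M + 1 > 0\<close> by (intro nonzero_eq_divide_eq[THEN iffD1, OF _ c_def]) simp
  finally show "c * sqrt M < e / 3" .
 qed
 obtain d where d: "d > 0" "!!x y. dist x y < d ==> dist (\<phi> x) (\<phi> y) < c"
  using uniformly_continuous_compact_support[OF smooth_continuous_on[OF test_function_smooth[OF \<phi>(1)]] K c(1)] by blast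
 have "L2_norm UNIV (%x. f (x + z) - f x) < e" if z: "norm z < min d 1" for z
 proof -
  have pt: "L2_norm UNIV (%x. \<phi> (x + z) - \<phi> x) <= c * sqrt M"
  proof -
   have bd: "(norm (\<phi> (x + z) - \<phi> x))^2 <= c^2 * indicator (cball 0 (R + 1)) x" for x
   proof (cases "x : cball 0 (R + 1)")
    case True
    have "dist (\<phi> (x + z)) (\<phi> x) < c" using d(2)[of "x + z" x] z by (simp add: dist_norm)
    then have "(norm (\<phi> (x + z) - \<phi> x))^2 <= c^2" unfolding dist_norm by (intro power_mono) auto
    then show ?thesis using True by simp
   next
    case False
    have "x ~: K" using False R(2)[of x] by auto
    moreover have "x + z ~: K" using False R(2)[of "x + z"] norm_triangle_ineq4[of "x + z" z] z by auto
    ultimately show ?thesis using K(2) False by simp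
   qed
   have "(LINT x|lebesgue. (norm (\<phi> (x + z) - \<phi> x))^2) <= (LINT x|lebesgue. c^2 * indicator (cball (0::real^'d) (R + 1)) x)"
   proof (rule integral_mono)
    show "integrable lebesgue (%x. (norm (\<phi> (x + z) - \<phi> x))^2)"
     using sq_integrable_diff[OF sq_integrable_translation[OF sp] sp] by (simp add: sq_integrable_def)
    show "integrable lebesgue (%x::real^'d. c^2 * indicator (cball 0 (R + 1)) x)"
     using integrable_indicator_bounded[of "cball (0::real^'d) (R + 1)"] by auto
   qed (rule bd)
   also have "... = c^2 * M" unfolding M_def by simp
   finally have "L2_norm UNIV (%x. \<phi> (x + z) - \<phi> x) <= sqrt (c^2 * M)"
    unfolding L2_norm_def by (simp add: real_sqrt_le_mono)
   then show ?thesis using c(1) by (simp add: real_sqrt_mult)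
  qed
  have in1: "in_L2 UNIV (%x. f (x + z) - \<phi> (x + z))" "in_L2 UNIV (%x. \<phi> (x + z) - \<phi> x)" "in_L2 UNIV (%x. \<phi> x - f x)"
   using f sp sq_integrable_translation by (auto simp: in_L2_UNIV_iff intro!: sq_integrable_diff)
  have "L2_norm UNIV (%x. f (x + z) - f x) =
    L2_norm UNIV (%x. (f (x + z) - \<phi> (x + z)) + ((\<phi> (x + z) - \<phi> x) + (\<phi> x - f x)))" by simp
  also have "... <= L2_norm UNIV (%x. f (x + z) - \<phi> (x + z)) + L2_norm UNIV (%x. (\<phi> (x + z) - \<phi> x) + (\<phi> x - f x))"
   by (rule L2_norm_triangle[OF _ in1(1) in_L2_add[OF _ in1(2,3)]]) auto
  also have "L2_norm UNIV (%x. (\<phi> (x + z) - \<phi> x) + (\<phi> x - f x)) \<le>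
    L2_norm UNIV (%x. \<phi> (x + z) - \<phi> x) + L2_norm UNIV (%x. \<phi> x - f x)"
   by (rule L2_norm_triangle[OF _ in1(2,3)]) auto
  also have "L2_norm UNIV (%x. f (x + z) - \<phi> (x + z)) = L2_norm UNIV (%x. f x - \<phi> x)"
   using L2_norm_translation[OF sq_integrable_diff[OF f sp], of z] by simp
  also have "L2_norm UNIV (%x. \<phi> x - f x) = L2_norm UNIV (%x. f x - \<phi> x)" by (rule L2_norm_swap)
  finally show ?thesis using pt c(2) \<phi>(2) by linarith
 qed
 then show ?thesis using d(1) by (intro exI[of _ "min d 1"]) auto
qed

lemma Cauchy_Schwarz_L2:
 assumes "S : sets lebesgue" "in_L2 S f" "in_L2 S g"
 shows "\<bar>LINT x|lebesgue_on S. f x \<bullet> g x\<bar> <= L2_norm S f * L2_norm S g"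
 using Cauchy_Schwarz_ineq2[of "toL2 S f" "toL2 S g"] assms by (simp add: inner_toL2 norm_toL2)

text \<open>Difference quotients are controlled by the weak gradient.  By duality it is enough to pair
 with a test function, and then the pairing is differentiable along the segment.\<close>

lemma L2_norm_difference_le_gradient:
 fixes u :: "real^'d::finite => real"
 assumes D: "open D" and U: "open U" and seg: "!!x s. x : U ==> 0 <= s ==> s <= 1 ==> x + s *R z : D"
  and u: "has_weak_gradient D u g" and L2: "in_L2 D u" "in_L2 D g"
  and int: "integrable lebesgue (%x. indicator D x *R u x)"
 shows "L2_norm U (%x. u (x + z) - u x) <= norm z * L2_norm D g"
proof -
 have mD: "D : sets lebesgue" and mU: "U : sets lebesgue" using D U by auto
 let ?u = "%x. indicator D x *R u x" and ?C = "norm z * L2_norm D g"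
 define f where "f x = u (x + z) - u x" for x
 have C0: "?C >= 0" by (simp add: L2_norm_nonneg)
 have su: "sq_integrable ?u" using L2(1) by (simp add: in_L2_iff[OF mD])
 have fu: "f x = ?u (x + z) - ?u x" if "x : U" for x using seg[OF that, of 0] seg[OF that, of 1] by (simp add: f_def)
 have eqf: "(%x. indicator U x *R f x) = (%x. indicator U x *R (?u (x + z) - ?u x))" using fu by (auto simp: indicator_def)
 have sf: "in_L2 U f"
  using in_L2_mono[of UNIV "%x. ?u (x + z) - ?u x" U] sq_integrable_diff[OF sq_integrable_translation[OF su] su] mU
  unfolding in_L2_iff[OF mU] eqf by (simp add: in_L2_UNIV_iff)
 have dual: "\<bar>LINT x|lebesgue_on U. f x \<bullet> \<phi> x\<bar> <= ?C * L2_norm U \<phi>" if t: "test_function U \<phi>" for \<phi> :: "real^'d => real"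
 proof -
  have tU: "test_function UNIV \<phi>" by (rule test_function_mono[OF t]) simp
  obtain K where K: "K <= U" "!!x. x ~: K ==> \<phi> x = 0" using test_function_support[OF t] by metis
  have ts: "test_function D (%y. \<phi> (y - s *R z))" if "0 <= s" "s <= 1" for s
   using test_function_affine[OF t, of 1 "- s *R z" D] seg that by (simp add: algebra_simps)
  define h where "h s = corr \<phi> ?u (s *R z)" for s
  define h' where "h' s = - (\<Sum>i\<in>UNIV. z $ i * corr (partial_deriv i \<phi>) ?u (s *R z))" for s
  have der: "(h has_real_derivative h' s) (at s)" for s
  proof -
   have "((%s. s *R z) has_derivative (%t. t *R z)) (at s)" by (auto intro!: derivative_eq_intros)
   from has_derivative_compose[OF this corr_has_derivative[OF tU int]]
   have "(h has_derivative (%t. - (\<Sum>i\<in>UNIV. (t *R z) $ i *R corr (partial_deriv i \<phi>) ?u (s *R z)))) (at s)"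
    unfolding h_def .
   moreover have "(%t. - (\<Sum>i\<in>UNIV. (t *R z) $ i *R corr (partial_deriv i \<phi>) ?u (s *R z))) = (*) (h' s)"
    by (auto simp: h'_def sum_distrib_left mult_ac)
   ultimately show ?thesis by (simp add: has_field_derivative_def)
  qed
  have h'_le: "\<bar>h' s\<bar> <= ?C * L2_norm U \<phi>" if s: "0 <= s" "s <= 1" for s
  proof -
   let ?\<phi> = "%y. \<phi> (y - s *R z)"
   note tst = ts[OF s]
   have pd: "partial_deriv i ?\<phi> = (%y. partial_deriv i \<phi> (y - s *R z))" for i
    using partial_deriv_affine[OF smooth_differentiable[OF test_function_smooth[OF t]], of i 1 "- s *R z"] by simp
   have "corr (partial_deriv i \<phi>) ?u (s *R z) = - (LINT y|lebesgue. ?\<phi> y * g y $ i)" for i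
   proof -
    obtain K' where K': "K' <= D" "!!x. x ~: K' ==> partial_deriv i ?\<phi> x = 0"
     using test_function_support[OF test_function_partial_deriv[OF tst]] by metis
    have "partial_deriv i ?\<phi> y *R ?u y = partial_deriv i ?\<phi> y *R u y" for y
     using K' by (cases "y : K'") (auto simp: indicator_def)
    then have "corr (partial_deriv i \<phi>) ?u (s *R z) = (LINT y|lebesgue. partial_deriv i ?\<phi> y *R u y)"
     unfolding corr_def pd by (simp only:)
    then show ?thesis using has_weak_gradientD(3)[OF u D tst, of i] by simp
   qed
   moreover have in1: "integrable lebesgue (%y. ?\<phi> y * g y $ i)" for i
    using integrable_test_function_scaleR[OF tst locally_integrable_component[OF has_weak_gradientD(2)[OF u D]]] by simp
   ultimately have "h' s = (LINT y|lebesgue. (\<Sum>i\<in>UNIV. z $ i * (?\<phi> y * g y $ i)))"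
    unfolding h'_def by (simp add: sum_negf)
   also have "... = (LINT y|lebesgue. ?\<phi> y *R (z \<bullet> g y))" by (simp add: inner_vec_def sum_distrib_left mult_ac)
   also have "... = (LINT y|lebesgue_on D. ?\<phi> y \<bullet> (z \<bullet> g y))"
    using integral_test_function_on[OF tst mD, of "%y. z \<bullet> g y"] by simp
   finally have h'_eq: "h' s = (LINT y|lebesgue_on D. ?\<phi> y \<bullet> (z \<bullet> g y))" .
   have CS: "\<bar>LINT y|lebesgue_on D. ?\<phi> y \<bullet> (z \<bullet> g y)\<bar> <= L2_norm D ?\<phi> * L2_norm D (%y. z \<bullet> g y)"
   proof (rule Cauchy_Schwarz_L2[OF mD in_L2_test_function[OF tst mD]])
    show "in_L2 D (%y. z \<bullet> g y)"
     by (rule in_L2_bound[OF mD L2(2), of _ "norm z"]) (use L2(2) in "auto simp: in_L2_def Cauchy_Schwarz_ineq2")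
   qed
   have le1: "L2_norm D (%y. z \<bullet> g y) <= ?C"
   proof -
    have "(LINT y|lebesgue_on D. (norm (z \<bullet> g y))^2) <= (LINT y|lebesgue_on D. (norm z)^2 * (norm (g y))^2)"
    proof (rule integral_mono_AE')
     show "integrable (lebesgue_on D) (%y. (norm z)^2 * (norm (g y))^2)" using L2(2) by (auto simp: in_L2_def)
     show "AE y in lebesgue_on D. (norm (z \<bullet> g y))^2 <= (norm z)^2 * (norm (g y))^2"
      by (auto simp: power_mult_distrib[symmetric] abs_le_square_iff[symmetric] abs_mult Cauchy_Schwarz_ineq2)
    qed auto
    then have "L2_norm D (%y. z \<bullet> g y) <= sqrt ((norm z)^2 * (LINT y|lebesgue_on D. (norm (g y))^2))"
     unfolding L2_norm_def by (simp add: real_sqrt_le_mono)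
    then show ?thesis by (simp add: real_sqrt_mult L2_norm_def)
   qed
   have "L2_norm D ?\<phi> <= L2_norm UNIV ?\<phi>" by (rule L2_norm_le_norm_mono[OF mD in_L2_test_function[OF tst]]) simp
   also have "L2_norm UNIV ?\<phi> = L2_norm UNIV \<phi>"
    using L2_norm_translation[OF sq_integrable_test_function[OF t], of "- s *R z"] by simp
   also have "L2_norm UNIV \<phi> = L2_norm U \<phi>"
   proof -
    have eq: "(%x. indicator U x *R (norm (\<phi> x))^2) = (%x. (norm (\<phi> x))^2)"
     using K by (force simp: indicator_def fun_eq_iff)
    show ?thesis unfolding L2_norm_def integral_lebesgue_on[OF mU] eq by simp
   qed
   finally have "L2_norm D ?\<phi> <= L2_norm U \<phi>" .
   then have "L2_norm D ?\<phi> * L2_norm D (%y. z \<bullet> g y) <= L2_norm U \<phi> * ?C"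
    by (intro mult_mono le1 L2_norm_nonneg)
   then show ?thesis unfolding h'_eq using CS by (simp only: mult.commute)
  qed
  obtain s where s: "0 < s" "s < 1" "h 1 - h 0 = (1 - 0) * h' s" using MVT2[of 0 1 h h'] der by auto
  have m1: "(%x. \<phi> x *R ?u (x + z)) : borel_measurable lebesgue" "(%y. \<phi> (y - z) *R ?u y) : borel_measurable lebesgue"
   using integrable_corr[OF tU int, of z]
    sq_integrable_translation[OF su, of z] test_function_measurable[OF t] by (auto simp: sq_integrable_def)
  have i0: "integrable lebesgue (%y. \<phi> (y - 0) *R ?u y)" by (rule integrable_corr[OF tU int])
  have i1: "integrable lebesgue (%x. \<phi> x *R ?u (x + z))"
   using integrable_lebesgue_affine[OF _ integrable_corr[OF tU int, of z], of 1 z] by (simp add: add.commute)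
  have "h 1 = (LINT x|lebesgue. \<phi> x *R ?u (x + z))"
   unfolding h_def corr_def using integral_lebesgue_affine[OF _ m1(2), of 1 z] by (simp add: add.commute)
  moreover have "h 0 = (LINT x|lebesgue. \<phi> x *R ?u x)" by (simp add: h_def corr_def)
  ultimately have "h 1 - h 0 = (LINT x|lebesgue. \<phi> x *R ?u (x + z) - \<phi> x *R ?u x)" using i0 i1 by simp
  also have "... = (LINT x|lebesgue. indicator U x *R (f x \<bullet> \<phi> x))"
  proof (intro Bochner_Integration.integral_cong refl)
   fix x show "\<phi> x *R ?u (x + z) - \<phi> x *R ?u x = indicator U x *R (f x \<bullet> \<phi> x)"
   proof (cases "x : K")
    case True
    then have "x : U" using K(1) by blast
    then show ?thesis unfolding fu[OF \<open>x \<in> U\<close>] by (simp add: algebra_simps)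
   qed (simp add: K(2))
  qed
  finally have "h 1 - h 0 = (LINT x|lebesgue_on U. f x \<bullet> \<phi> x)" by (simp add: integral_lebesgue_on[OF mU])
  then show ?thesis using s h'_le[of s] by simp
 qed
 have "L2_norm U f <= ?C"
 proof (rule ccontr)
  let ?a = "L2_norm U f"
  assume "~ ?a <= ?C"
  then have gt: "?a > ?C" "?a > 0" using C0 by auto
  define e where "e = ?a * (?a - ?C) / (2 * (?a + ?C))"
  have e: "e > 0" unfolding e_def using gt C0 by simp
  obtain \<phi> where \<phi>: "test_function U \<phi>" "L2_norm U (%x. f x - \<phi> x) < e"
   using test_functions_dense_in_L2[OF U sf e] by blast
  note ph = in_L2_test_function[OF \<phi>(1) mU]
  let ?F = "toL2 U f" and ?P = "toL2 U \<phi>"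
  have n: "norm ?F = ?a" "norm ?P = L2_norm U \<phi>" "norm (?F - ?P) < e" "?F \<bullet> ?P <= ?C * norm ?P"
   using \<phi>(2) dual[OF \<phi>(1)] norm_toL2[OF mU in_L2_diff[OF mU sf ph]]
   by (auto simp: norm_toL2[OF mU] sf ph toL2_diff[OF mU] inner_toL2[OF mU])
  have "?a^2 = ?F \<bullet> ?F" using n(1) by (simp add: power2_norm_eq_inner[symmetric])
  also have "... = ?F \<bullet> (?F - ?P) + ?F \<bullet> ?P" by (simp add: inner_diff_right)
  also have "... <= ?a * e + ?C * (?a + e)"
  proof (rule add_mono)
   have "?F \<bullet> (?F - ?P) <= norm ?F * norm (?F - ?P)" by (rule norm_cauchy_schwarz)
   also have "... <= ?a * e" unfolding n(1) using n(3) gt by (intro mult_left_mono) auto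
   finally show "?F \<bullet> (?F - ?P) <= ?a * e" .
   have "norm ?P <= norm ?F + norm (?F - ?P)" by (metis norm_minus_commute norm_triangle_sub)
   then have "norm ?P <= ?a + e" using n by linarith
   then show "?F \<bullet> ?P <= ?C * (?a + e)" using n(4) C0 by (meson mult_left_mono order_trans)
  qed
  also have "... = ?C * ?a + e * (?a + ?C)" by (simp add: algebra_simps)
  also have "e * (?a + ?C) = ?a * (?a - ?C) / 2" unfolding e_def using gt C0 by (simp add: field_simps)
  finally have fin: "?a^2 <= ?C * ?a + ?a * (?a - ?C) / 2" .
  have alg: "a * (a - c) <= 0" if "a^2 <= c * a + a * (a - c) / 2" for a c :: real
   using that by (simp add: field_simps power2_eq_square)
  have "?a * (?a - ?C) > 0" using gt by (intro mult_pos_pos) auto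
  then show False using alg[OF fin] by linarith
 qed
 then show ?thesis unfolding f_def .
qed

section \<open>Mollifiers\<close>

definition mollifier :: "real => (real^'d::finite => real) => bool" where
 "mollifier d \<rho> \<longleftrightarrow> test_function UNIV \<rho> & (\<forall>x. 0 <= \<rho> x) & (\<forall>x. \<rho> x ~= 0 --> norm x < d) \<and>
  (LINT x|lebesgue. \<rho> x) = 1"

lemma mollifier_exists:
 assumes "d > 0" shows "\<exists>\<rho> :: real^'d::finite => real. mollifier d \<rho>"
proof -
 define c where "c = d / (2 * real CARD('d))"
 have c: "c > 0" unfolding c_def using assms by simp
 let ?a = "(\<chi> i. - c) :: real^'d" and ?b = "(\<chi> i. c) :: real^'d"
 define p where "p = box_profile ?a ?b"
 have t: "test_function UNIV p" unfolding p_def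
 proof (rule test_functionI[OF smooth_box_profile, of "cbox ?a ?b"])
  show "box_profile ?a ?b x = 0" if "x ~: cbox ?a ?b" for x
   using that box_subset_cbox[of ?a ?b] by (intro box_profile_zero) blast
 qed auto
 have small: "norm x < d" if "p x ~= 0" for x
 proof -
  have "x : box ?a ?b" using that box_profile_zero unfolding p_def by metis
  then have "\<bar>x $ i\<bar> <= c" for i by (simp add: mem_box_cart abs_le_iff) (metis less_imp_le minus_le_iff)
  then have "norm x <= (\<Sum>i\<in>(UNIV::'d set). c)" by (intro order_trans[OF norm_le_l1_cart] sum_mono)
  also have "... = d / 2" unfolding c_def by simp
  finally show ?thesis using assms by simp
 qed
 have int: "integrable lebesgue p" by (rule integrable_test_function[OF t])
 have nn: "0 <= p x" for x unfolding p_def by (rule box_profile_nonneg)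
 have pos: "(LINT x|lebesgue. p x) > 0"
 proof (rule ccontr)
  assume "~ ?thesis"
  then have "(LINT x|lebesgue. p x) = 0" using nn by (simp add: order_antisym not_less)
  then have "AE x in lebesgue. p x = 0" using int nn by (subst (asm) integral_nonneg_eq_0_iff_AE) auto
  then have "AE x in lebesgue. x ~: box ?a ?b" by eventually_elim (use box_profile_pos[of _ ?a ?b] in "force simp: p_def")
  then have "negligible (box ?a ?b)" by (simp add: negligible_iff_null_sets AE_iff_null_sets)
  then show False using c open_not_negligible[of "box ?a ?b"] by (auto simp: box_ne_empty Basis_vec_def inner_axis interval_ne_empty_cart mem_box_cart intro: exI[of _ 0])
 qed
 define I where "I = (LINT x|lebesgue. p x)"
 define \<rho> where "\<rho> = (%x. (1 / I) *R p x)"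
 have "test_function UNIV \<rho>" unfolding \<rho>_def by (rule test_function_cmult[OF t])
 moreover have "(LINT x|lebesgue. \<rho> x) = 1" unfolding \<rho>_def using pos by (simp add: I_def[symmetric])
 ultimately show ?thesis unfolding mollifier_def using nn pos small
  by (intro exI[of _ \<rho>]) (auto simp: \<rho>_def I_def[symmetric])
qed

lemma mollifier_correlation_support:
 assumes m: "mollifier d \<rho>" and K: "!!y. y ~: K ==> u y = 0"
  and x: "corr \<rho> u x ~= 0"
 shows "\<exists>y\<in>K. dist x y < d"
proof (rule ccontr)
 assume "~ ?thesis"
 then have far: "y : K ==> d <= dist x y" for y by force
 have "\<rho> (y - x) *R u y = 0" for y
 proof (cases "y : K")
  case True
  then have "~ norm (y - x) < d" using far[OF True] by (simp add: dist_norm norm_minus_commute)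
  then have "\<rho> (y - x) = 0" using m unfolding mollifier_def by blast
  then show ?thesis by simp
 qed (simp add: K)
 then have "corr \<rho> u x = 0" unfolding corr_def by (simp only: Bochner_Integration.integral_zero)
 then show False using x by simp
qed

text \<open>Jensen's inequality, in the form \<open>(\<integral> \<rho> a)\<^sup>2 \<le> \<integral> \<rho> a\<^sup>2\<close>: the difference of the two
 sides is a variance.\<close>

lemma mollifier_Jensen:
 assumes m: "mollifier d \<rho>" and a: "integrable lebesgue (%z. \<rho> z * a z)" and [measurable]: "a : borel_measurable lebesgue"
 shows "ennreal ((LINT z|lebesgue. \<rho> z * a z)^2) <= (\<integral>\<^sup>+z. ennreal (\<rho> z * (a z)^2) \<partial>lebesgue)"
proof -
 have \<rho>: "test_function UNIV \<rho>" "!!x. 0 <= \<rho> x" "(LINT x|lebesgue. \<rho> x) = 1"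
  using m unfolding mollifier_def by auto
 have [measurable]: "\<rho> : borel_measurable lebesgue" by (rule test_function_measurable[OF \<rho>(1)])
 show ?thesis
 proof (cases "(\<integral>\<^sup>+z. ennreal (\<rho> z * (a z)^2) \<partial>lebesgue) = \<infinity>")
  case False
  then have i2: "integrable lebesgue (%z. \<rho> z * (a z)^2)"
   by (intro integrableI_nonneg) (auto simp: \<rho>(2) top.not_eq_extremum less_top)
  define t where "t = (LINT z|lebesgue. \<rho> z * a z)"
  have i1: "integrable lebesgue \<rho>" by (rule integrable_test_function[OF \<rho>(1)])
  have "0 <= (LINT z|lebesgue. \<rho> z * (a z - t)^2)" using \<rho>(2) by (intro integral_nonneg_AE) auto
  also have "... = (LINT z|lebesgue. \<rho> z * (a z)^2 - 2 * t * (\<rho> z * a z) + t^2 * \<rho> z)"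
   by (intro Bochner_Integration.integral_cong) (auto simp: power2_diff algebra_simps)
  also have "... = (LINT z|lebesgue. \<rho> z * (a z)^2) - 2 * t * t + t^2 * 1" using a i1 i2 \<rho>(3) by (simp add: t_def)
  finally have "t^2 <= (LINT z|lebesgue. \<rho> z * (a z)^2)" by (simp add: power2_eq_square)
  moreover have "(\<integral>\<^sup>+z. ennreal (\<rho> z * (a z)^2) \<partial>lebesgue) = ennreal (LINT z|lebesgue. \<rho> z * (a z)^2)"
   by (rule nn_integral_eq_integral[OF i2]) (auto simp: \<rho>(2))
  ultimately show ?thesis unfolding t_def by (simp add: ennreal_leI)
 qed simp
qed

lemma borel_representative:
 fixes u :: "real^'d::finite => real"
 assumes "u : borel_measurable lebesgue"
 obtains u' where "u' : borel_measurable borel" "AE x in lebesgue. u x = u' x"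
proof -
 obtain u' where "u' : borel_measurable lborel" "AE x in lborel. u x = u' x"
  using completion_ex_borel_measurable_real[of u lborel] assms by auto
 then show ?thesis by (intro that[of u'] AE_completion) auto
qed

lemma nn_integral_lebesgue_lborel:
 "f : borel_measurable borel ==> (\<integral>\<^sup>+x. f x \<partial>lebesgue) = (\<integral>\<^sup>+x. f x \<partial>lborel)"
 by (rule nn_integral_completion)

text \<open>Averaging over translates: by Jensen and Tonelli, the distance in \<open>L\<^sup>2(E)\<close> of \<open>u\<close> to its
 mollification is at most the largest distance of \<open>u\<close> to one of the translates that are averaged.\<close>

lemma L2_norm_mollification_le:
 fixes u :: "real^'d::finite => real"
 assumes m: "mollifier d \<rho>" and u: "integrable lebesgue u" "sq_integrable u" and E: "E : sets borel"
  and C: "C >= 0" "!!z. norm z < d ==> L2_norm E (%x. u (x + z) - u x) <= C"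
 shows "in_L2 E (%x. u x - corr \<rho> u x)" "L2_norm E (%x. u x - corr \<rho> u x) <= C"
proof -
 have \<rho>: "test_function UNIV \<rho>" "!!x. 0 <= \<rho> x" "(LINT x|lebesgue. \<rho> x) = 1" "!!x. \<rho> x ~= 0 ==> norm x < d"
  using m unfolding mollifier_def by auto
 have mE: "E : sets lebesgue" using E by auto
 have mu: "u : borel_measurable lebesgue" using u by auto
 obtain u' where u': "u' : borel_measurable borel" "AE x in lebesgue. u x = u' x" using borel_representative[OF mu] by blast
 have [measurable]: "u' : borel_measurable borel" "E : sets borel" by fact+
 have [measurable]: "\<rho> : borel_measurable borel"
  using smooth_continuous_on[OF test_function_smooth[OF \<rho>(1)]] by (rule borel_measurable_continuous_onI)
 have cont: "continuous_on UNIV (corr \<rho> u)" by (rule smooth_continuous_on[OF smooth_corr[OF \<rho>(1) u(1)]])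
 have [measurable]: "corr \<rho> u : borel_measurable borel" using cont by (rule borel_measurable_continuous_onI)
 have AEz: "AE x in lebesgue. u (x + z) = u' (x + z)" for z
  using AE_lebesgue_affine[of 1 "%x. u x = u' x" z] u'(2) by (simp add: add.commute)
 have pt: "ennreal ((u' x - corr \<rho> u x)^2) <= (\<integral>\<^sup>+z. ennreal (\<rho> z * (u' (x + z) - u' x)^2) \<partial>lborel)" for x
 proof -
  have i: "integrable lebesgue (%z. \<rho> z *R u (x + z))"
   using integrable_lebesgue_affine[OF _ integrable_corr[OF \<rho>(1) u(1), of x], of 1 x] by (simp add: add.commute)
  have AEx: "AE z in lebesgue. u (x + z) = u' (x + z)" using AEz[of x] by (simp add: add.commute)
  have tm: "(%z. u' (x + z)) : borel_measurable lebesgue" by (intro measurable_completion) simp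
  have \<rho>m: "\<rho> : borel_measurable lebesgue" by (intro measurable_completion) simp
  have i': "integrable lebesgue (%z. \<rho> z * u' (x + z))"
  proof (rule integrable_cong_AE_imp[OF i])
   show "(%z. \<rho> z * u' (x + z)) : borel_measurable lebesgue" using tm \<rho>m by measurable
   show "AE z in lebesgue. \<rho> z *R u (x + z) = \<rho> z * u' (x + z)" using AEx by eventually_elim simp
  qed
  have i\<rho>: "integrable lebesgue \<rho>" by (rule integrable_test_function[OF \<rho>(1)])
  have "corr \<rho> u x = (LINT z|lebesgue. \<rho> z *R u (x + z))" unfolding corr_def
   using integral_lebesgue_affine[of 1 "%y. \<rho> (y - x) *R u y" x] integrable_corr[OF \<rho>(1) u(1), of x]
   by (simp add: borel_measurable_integrable)
  also have "... = (LINT z|lebesgue. \<rho> z * u' (x + z))"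
   by (rule integral_cong_AE) (use i i' AEx in "auto elim: eventually_mono")
  finally have "corr \<rho> u x - u' x = (LINT z|lebesgue. \<rho> z * (u' (x + z) - u' x))"
   using i' i\<rho> \<rho>(3) by (simp add: right_diff_distrib)
  moreover have "ennreal ((LINT z|lebesgue. \<rho> z * (u' (x + z) - u' x))^2) <= (\<integral>\<^sup>+z. ennreal (\<rho> z * (u' (x + z) - u' x)^2) \<partial>lebesgue)"
   by (rule mollifier_Jensen[OF m]) (use i' i\<rho> tm in "auto simp: right_diff_distrib")
  moreover have "(\<integral>\<^sup>+z. ennreal (\<rho> z * (u' (x + z) - u' x)^2) \<partial>lebesgue) = (\<integral>\<^sup>+z. ennreal (\<rho> z * (u' (x + z) - u' x)^2) \<partial>lborel)"
   by (rule nn_integral_lebesgue_lborel) measurable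
  ultimately show ?thesis by (simp add: power2_commute[of "u' x" "corr \<rho> u x"])
 qed
 have inner: "(\<integral>\<^sup>+x. indicator E x * ennreal (\<rho> z * (u' (x + z) - u' x)^2) \<partial>lborel) <= ennreal (\<rho> z * C^2)" for z
 proof (cases "\<rho> z = 0")
  case False
  have "in_L2 E (%x. u (x + z) - u x)"
   using in_L2_mono[of UNIV "%x. u (x + z) - u x" E] sq_integrable_diff[OF sq_integrable_translation[OF u(2)] u(2)] mE
   by (simp add: in_L2_UNIV_iff)
  then have int: "integrable lebesgue (%x. indicator E x *R (u (x + z) - u x)^2)"
   using integrable_lebesgue_on[OF mE, of "%x. (u (x + z) - u x)^2"] by (simp add: in_L2_def)
  have "(\<integral>\<^sup>+x. indicator E x * ennreal (\<rho> z * (u' (x + z) - u' x)^2) \<partial>lborel)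
    = (\<integral>\<^sup>+x. indicator E x * ennreal (\<rho> z * (u' (x + z) - u' x)^2) \<partial>lebesgue)"
   by (rule nn_integral_lebesgue_lborel[symmetric]) measurable
  also have "... = (\<integral>\<^sup>+x. ennreal (\<rho> z * (indicator E x *R (u (x + z) - u x)^2)) \<partial>lebesgue)"
   by (rule nn_integral_cong_AE) (use AEz[of z] u'(2) in "eventually_elim, auto simp: indicator_def")
  also have "... = ennreal (LINT x|lebesgue. \<rho> z * (indicator E x *R (u (x + z) - u x)^2))"
   by (rule nn_integral_eq_integral) (use int \<rho>(2) in auto)
  also have "(LINT x|lebesgue. \<rho> z * (indicator E x *R (u (x + z) - u x)^2)) = \<rho> z * (L2_norm E (%x. u (x + z) - u x))^2"
   by (simp add: L2_norm_power2 integral_lebesgue_on[OF mE])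
  also have "... <= \<rho> z * C^2"
   using C(2)[OF \<rho>(4)[OF False]] \<rho>(2) L2_norm_nonneg by (intro mult_left_mono power_mono) auto
  finally show ?thesis by (simp add: ennreal_leI)
 qed simp
 have "(\<integral>\<^sup>+x. indicator E x * ennreal ((u' x - corr \<rho> u x)^2) \<partial>lborel)
   <= (\<integral>\<^sup>+x. (\<integral>\<^sup>+z. indicator E x * ennreal (\<rho> z * (u' (x + z) - u' x)^2) \<partial>lborel) \<partial>lborel)"
  by (intro nn_integral_mono) (simp add: nn_integral_cmult mult_left_mono pt)
 also have "... = (\<integral>\<^sup>+z. (\<integral>\<^sup>+x. indicator E x * ennreal (\<rho> z * (u' (x + z) - u' x)^2) \<partial>lborel) \<partial>lborel)"
  by (rule lborel_pair.Fubini'[symmetric]) measurable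
 also have "... <= (\<integral>\<^sup>+z. ennreal (\<rho> z * C^2) \<partial>lborel)" by (intro nn_integral_mono inner)
 also have "... = (\<integral>\<^sup>+z. ennreal (\<rho> z * C^2) \<partial>lebesgue)" by (rule nn_integral_lebesgue_lborel[symmetric]) measurable
 also have "... = ennreal (LINT z|lebesgue. \<rho> z * C^2)"
  by (rule nn_integral_eq_integral) (use integrable_test_function[OF \<rho>(1)] \<rho>(2) in auto)
 also have "(LINT z|lebesgue. \<rho> z * C^2) = C^2" using \<rho>(3) by simp
 finally have main: "(\<integral>\<^sup>+x. indicator E x * ennreal ((u' x - corr \<rho> u x)^2) \<partial>lborel) <= ennreal (C^2)" .
 have "(\<integral>\<^sup>+x. indicator E x * ennreal ((u' x - corr \<rho> u x)^2) \<partial>lborel)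
  = (\<integral>\<^sup>+x. indicator E x * ennreal ((u' x - corr \<rho> u x)^2) \<partial>lebesgue)"
  by (rule nn_integral_lebesgue_lborel[symmetric]) measurable
 also have "... = (\<integral>\<^sup>+x. ennreal (indicator E x *R (norm (u x - corr \<rho> u x))^2) \<partial>lebesgue)"
  by (rule nn_integral_cong_AE) (use u'(2) in "eventually_elim, auto simp: indicator_def")
 finally have le: "(\<integral>\<^sup>+x. ennreal (indicator E x *R (norm (u x - corr \<rho> u x))^2) \<partial>lebesgue) <= ennreal (C^2)"
  using main by simp
 have cm: "corr \<rho> u : borel_measurable lebesgue" by (rule continuous_borel_measurable_lebesgue[OF cont])
 have meas: "(%x. indicator E x *R (norm (u x - corr \<rho> u x))^2) : borel_measurable lebesgue"
  "(%x. indicator E x *R (u x - corr \<rho> u x)) : borel_measurable lebesgue" using mu cm mE by measurable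
 have int: "integrable lebesgue (%x. indicator E x *R (norm (u x - corr \<rho> u x))^2)"
  by (rule integrableI_nonneg[OF meas(1)]) (use le in "auto simp: le_less_trans")
 show "in_L2 E (%x. u x - corr \<rho> u x)"
  unfolding in_L2_def using int meas(2) by (simp add: integrable_lebesgue_on[OF mE] measurable_lebesgue_on[OF mE])
 have "ennreal (LINT x|lebesgue. indicator E x *R (norm (u x - corr \<rho> u x))^2) <= ennreal (C^2)"
  using le by (subst (asm) nn_integral_eq_integral[OF int]) auto
 then have "(LINT x|lebesgue. indicator E x *R (norm (u x - corr \<rho> u x))^2) <= C^2" by (simp add: ennreal_le_iff)
 then have "L2_norm E (%x. u x - corr \<rho> u x) <= sqrt (C^2)"
  unfolding L2_norm_def integral_lebesgue_on[OF mE] by (rule real_sqrt_le_mono)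
 then show "L2_norm E (%x. u x - corr \<rho> u x) <= C" using C(1) by simp
qed

lemma mollification_converges:
 fixes u :: "real^'d::finite => real"
 assumes u: "integrable lebesgue u" "sq_integrable u" and e: "e > 0"
 shows "\<exists>d>0. \<forall>d' \<rho>. d' <= d --> mollifier d' \<rho> \<longrightarrow>
  in_L2 UNIV (%x. u x - corr \<rho> u x) & L2_norm UNIV (%x. u x - corr \<rho> u x) <= e"
proof -
 obtain d where d: "d > 0" "!!z. norm z < d ==> L2_norm UNIV (%x. u (x + z) - u x) < e"
  using L2_translation_continuous[OF u(2) e] by blast
 show ?thesis
 proof (intro exI[of _ d] conjI d(1) allI impI)
  fix d' and \<rho> :: "real^'d => real" assume *: "d' <= d" "mollifier d' \<rho>"
  have C: "!!z. norm z < d' ==> L2_norm UNIV (%x. u (x + z) - u x) <= e" by (intro less_imp_le d(2)) (use *(1) in linarith)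
  show "in_L2 UNIV (%x. u x - corr \<rho> u x)" "L2_norm UNIV (%x. u x - corr \<rho> u x) <= e"
   using L2_norm_mollification_le[OF *(2) u _ _ C] e by auto
 qed
qed

text \<open>A distributional equation \<open>- div s = f\<close> with square integrable data may be tested with
 \<open>\<eta> u\<close>, where \<open>u\<close> is merely weakly differentiable: mollify \<open>\<eta> u\<close>, which has compact support.\<close>

lemma divergence_equation_tested_with_cutoff:
 fixes s :: "real^'d::finite => real^'d" and f u :: "real^'d => real"
 assumes D: "open D" and s: "in_L2 D s" and f: "in_L2 D f"
  and eq: "!!\<phi>. test_function D \<phi> ==>
   (LINT x|lebesgue_on D. s x \<bullet> (\<chi> i. partial_deriv i \<phi> x)) = (LINT x|lebesgue_on D. f x * \<phi> x)"
  and u: "has_weak_gradient D u g" "in_L2 D u" "in_L2 D g" and \<eta>: "test_function D \<eta>"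
 shows "(LINT x|lebesgue_on D. s x \<bullet> (\<chi> i. \<eta> x * g x $ i + partial_deriv i \<eta> x * u x)) =
  (LINT x|lebesgue_on D. f x * (\<eta> x * u x))"
proof -
 have mD: "D : sets lebesgue" using D by auto
 define U where "U x = \<eta> x * u x" for x
 define G where "G i x = \<eta> x * g x $ i + partial_deriv i \<eta> x * u x" for i x
 have wg: "has_weak_gradient UNIV U (%x. \<chi> i. G i x)"
  using has_weak_gradient_test_function_mult[OF D u(1) \<eta>] by (simp add: U_def[abs_def] G_def)
 obtain K where K: "compact K" "K <= D" "!!x. x ~: K ==> \<eta> x = 0" using test_function_support[OF \<eta>] by metis
 have K': "x ~: K ==> partial_deriv i \<eta> x = 0" for x i
  by (rule partial_deriv_zero_off_closed[OF compact_imp_closed[OF K(1)] K(3)])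
 have prod: "sq_integrable (%x. \<phi> x * a x) & integrable lebesgue (%x. \<phi> x * a x)"
  if t: "test_function D \<phi>" and a: "in_L2 D a" for \<phi> a :: "real^'d => real"
 proof -
  obtain L where L: "L <= D" "!!x. x ~: L ==> \<phi> x = 0" using test_function_support[OF t] by metis
  obtain C where C: "!!x. norm (\<phi> x) <= C" using test_function_bounded[OF t] by metis
  have eq: "(%x. \<phi> x * a x) = (%x. \<phi> x * (indicator D x *R a x))" using L by (force simp: indicator_def fun_eq_iff)
  have sq: "sq_integrable (%x. indicator D x *R a x)" using a by (simp add: in_L2_iff[OF mD])
  have "sq_integrable (%x. \<phi> x * (indicator D x *R a x))"
  proof (rule sq_integrable_bound[OF _ sq, of _ C])
   show "(%x. \<phi> x * (indicator D x *R a x)) : borel_measurable lebesgue"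
    using sq test_function_measurable[OF t] unfolding sq_integrable_def by (intro borel_measurable_times) auto
   show "AE x in lebesgue. norm (\<phi> x * (indicator D x *R a x)) <= C * norm (indicator D x *R a x)"
    unfolding norm_mult using C by (intro AE_I2 mult_right_mono) auto
  qed
  moreover have "integrable lebesgue (%x. \<phi> x \<bullet> (indicator D x *R a x))"
   by (rule integrable_inner_sq_integrable[OF sq_integrable_test_function[OF t] sq])
  ultimately show ?thesis unfolding eq by simp
 qed
 have gi: "in_L2 D (%x. g x $ i)" for i by (rule in_L2_bound[OF mD u(3), of _ 1])
   (use u(3) in "auto simp: in_L2_def component_le_norm_cart intro!: measurable_compose[OF _ borel_measurable_continuous_onI[OF linear_continuous_on[OF bounded_linear_vec_nth]]]")
 have U: "sq_integrable U" "integrable lebesgue U" unfolding U_def using prod[OF \<eta> u(2)] by auto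
 have G: "sq_integrable (G i)" "integrable lebesgue (G i)" for i unfolding G_def[abs_def]
  using prod[OF \<eta> gi[of i]] prod[OF test_function_partial_deriv[OF \<eta>, of i] u(2)] by (auto intro!: sq_integrable_add)
 have UK: "x ~: K ==> U x = 0" for x using K(3) by (simp add: U_def)
 have si: "in_L2 D (%x. s x $ i)" for i by (rule in_L2_bound[OF mD s, of _ 1])
   (use s in "auto simp: in_L2_def component_le_norm_cart intro!: measurable_compose[OF _ borel_measurable_continuous_onI[OF linear_continuous_on[OF bounded_linear_vec_nth]]]")
 obtain \<delta> where \<delta>: "\<delta> > 0" "(\<Union>x\<in>K. cball x \<delta>) <= D"
  using compact_subset_open_imp_cball_epsilon_subset[OF K(1) D K(2)] by blast
 define N where "N = (\<Sum>i\<in>UNIV. L2_norm D (%x. s x $ i)) + L2_norm D f"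
 have N: "N >= 0" unfolding N_def by (intro add_nonneg_nonneg sum_nonneg L2_norm_nonneg)
 define I where "I = (\<Sum>i\<in>UNIV. LINT x|lebesgue_on D. s x $ i * G i x) - (LINT x|lebesgue_on D. f x * U x)"
 have inD: "in_L2 D q" if "sq_integrable q" for q :: "real^'d => real"
  using in_L2_mono[of UNIV q D] that mD by (simp add: in_L2_UNIV_iff)
 have int_prod: "integrable (lebesgue_on D) (%x. a x * b x)" if "in_L2 D a" "in_L2 D b" for a b :: "real^'d => real"
  using integrable_inner_in_L2[OF mD that] by simp
 have small: "\<bar>I\<bar> <= N * e" if e: "e > 0" for e
 proof -
  obtain d0 where d0: "d0 > 0" "!!d' \<rho>. d' <= d0 ==> mollifier d' \<rho> ==>
    in_L2 UNIV (%x. U x - corr \<rho> U x) & L2_norm UNIV (%x. U x - corr \<rho> U x) <= e"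
   using mollification_converges[OF U(2,1) e] by blast
  have "\<forall>i. \<exists>d>0. \<forall>d' \<rho>. d' <= d --> mollifier d' \<rho> \<longrightarrow>
    in_L2 UNIV (%x. G i x - corr \<rho> (G i) x) & L2_norm UNIV (%x. G i x - corr \<rho> (G i) x) <= e"
   using mollification_converges[OF G(2,1) e] by blast
  then obtain d1 where d1: "!!i. d1 i > 0" "!!i d' \<rho>. d' <= d1 i ==> mollifier d' \<rho> ==>
    in_L2 UNIV (%x. G i x - corr \<rho> (G i) x) & L2_norm UNIV (%x. G i x - corr \<rho> (G i) x) <= e" by metis
  define d where "d = min \<delta> (min d0 (Min (range d1)))"
  have d: "d > 0" "d <= \<delta>" "d <= d0" "d <= d1 i" for i
   unfolding d_def using \<delta>(1) d0(1) d1(1) by (auto simp: min_le_iff_disj)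
  obtain \<rho> :: "real^'d => real" where \<rho>: "mollifier d \<rho>" using mollifier_exists[OF d(1)] by blast
  have t\<rho>: "test_function UNIV \<rho>" using \<rho> by (simp add: mollifier_def)
  let ?V = "corr \<rho> U"
  have tV: "test_function D ?V"
  proof (rule test_functionI[OF smooth_corr[OF t\<rho> U(2)]])
   let ?L = "\<Union>x\<in>K. cball x d"
   have eqL: "?L = {x + y | x y. x : K & y : cball 0 d}"
    by (auto simp: dist_norm) (metis add_diff_cancel_left' diff_add_cancel norm_minus_commute add.commute)
   show "compact ?L" unfolding eqL using K(1) by (intro compact_sums compact_cball)
   have "?L <= (\<Union>x\<in>K. cball x \<delta>)" using d(2) by (intro UN_mono) auto
   then show "?L <= D" using \<delta>(2) by blast
   show "?V x = 0" if "x ~: ?L" for x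
    using mollifier_correlation_support[OF \<rho> UK, where x=x] that by (force simp: dist_commute)
  qed
  have pV: "partial_deriv i ?V = corr \<rho> (G i)" for i
  proof (rule ext)
   fix x
   have tx: "test_function UNIV (%y. \<rho> (y - x))" using test_function_affine[OF t\<rho>, of 1 "-x" UNIV] by simp
   have pd: "partial_deriv i (%y. \<rho> (y - x)) = (%y. partial_deriv i \<rho> (y - x))"
    using partial_deriv_affine[OF smooth_differentiable[OF test_function_smooth[OF t\<rho>]], of i 1 "-x"] by simp
   show "partial_deriv i ?V x = corr \<rho> (G i) x" unfolding partial_deriv_corr[OF t\<rho> U(2)] unfolding corr_def
    using has_weak_gradientD(3)[OF wg open_UNIV tx, of i] by (simp add: pd)
  qed
  have close: "in_L2 D (%x. U x - ?V x)" "L2_norm D (%x. U x - ?V x) <= e"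
   "in_L2 D (%x. G i x - corr \<rho> (G i) x)" "L2_norm D (%x. G i x - corr \<rho> (G i) x) <= e" for i
   using d0(2)[OF d(3) \<rho>] d1(2)[OF d(4) \<rho>, of i] in_L2_mono[OF _ _ mD, of UNIV]
    L2_norm_le_norm_mono[OF mD, of "%x. U x - ?V x"] L2_norm_le_norm_mono[OF mD, of "%x. G i x - corr \<rho> (G i) x"]
   by (auto intro: order_trans)
  have VL: "in_L2 D ?V" "in_L2 D (corr \<rho> (G i))" for i
   using in_L2_test_function[OF tV mD] in_L2_test_function[OF test_function_partial_deriv[OF tV, of i] mD] by (auto simp: pV)
  have "(LINT x|lebesgue_on D. s x \<bullet> (\<chi> i. corr \<rho> (G i) x)) = (LINT x|lebesgue_on D. f x * ?V x)"
   using eq[OF tV] by (simp add: pV)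
  moreover have "(LINT x|lebesgue_on D. s x \<bullet> (\<chi> i. corr \<rho> (G i) x)) = (\<Sum>i\<in>UNIV. LINT x|lebesgue_on D. s x $ i * corr \<rho> (G i) x)"
   unfolding inner_vec_def using int_prod[OF si VL(2)] by simp
  ultimately have "I = (\<Sum>i\<in>UNIV. (LINT x|lebesgue_on D. s x $ i * G i x) - (LINT x|lebesgue_on D. s x $ i * corr \<rho> (G i) x))
    - ((LINT x|lebesgue_on D. f x * U x) - (LINT x|lebesgue_on D. f x * ?V x))" unfolding I_def by (simp add: sum_subtractf)
  also have "... = (\<Sum>i\<in>UNIV. LINT x|lebesgue_on D. s x $ i \<bullet> (G i x - corr \<rho> (G i) x))
    - (LINT x|lebesgue_on D. f x \<bullet> (U x - ?V x))"
   using int_prod[OF si inD[OF G(1)]] int_prod[OF si VL(2)] int_prod[OF f inD[OF U(1)]] int_prod[OF f VL(1)]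
   by (simp add: right_diff_distrib)
  finally have I: "I = (\<Sum>i\<in>UNIV. LINT x|lebesgue_on D. s x $ i \<bullet> (G i x - corr \<rho> (G i) x))
    - (LINT x|lebesgue_on D. f x \<bullet> (U x - ?V x))" .
  have b1: "\<bar>LINT x|lebesgue_on D. s x $ i \<bullet> (G i x - corr \<rho> (G i) x)\<bar> <= L2_norm D (%x. s x $ i) * e" for i
   using Cauchy_Schwarz_L2[OF mD si close(3), of i i] mult_left_mono[OF close(4)[of i] L2_norm_nonneg[of D "%x. s x $ i"]] by linarith
  have b2: "\<bar>LINT x|lebesgue_on D. f x \<bullet> (U x - ?V x)\<bar> <= L2_norm D f * e"
   using Cauchy_Schwarz_L2[OF mD f close(1)] mult_left_mono[OF close(2) L2_norm_nonneg[of D f]] by linarith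
  have "\<bar>I\<bar> <= (\<Sum>i\<in>UNIV. L2_norm D (%x. s x $ i) * e) + L2_norm D f * e"
   unfolding I by (intro order_trans[OF abs_triangle_ineq4] add_mono b2 order_trans[OF sum_abs] sum_mono b1)
  then show ?thesis unfolding N_def by (simp add: sum_distrib_right distrib_right)
 qed
 have "I = 0"
 proof (rule ccontr)
  assume "I ~= 0"
  then have "\<bar>I\<bar> / (2 * (N + 1)) > 0" using N by simp
  note small[OF this]
  also have "N * (\<bar>I\<bar> / (2 * (N + 1))) = \<bar>I\<bar> / 2 * (N / (N + 1))" by (simp add: field_simps)
  also have "... <= \<bar>I\<bar> / 2 * 1" using N by (intro mult_left_mono) auto
  finally have "\<bar>I\<bar> <= \<bar>I\<bar> / 2 * 1" .
  then show False using \<open>I \<noteq> 0\<close> by simp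
 qed
 then show ?thesis using int_prod[OF si inD[OF G(1)]] unfolding I_def inner_vec_def by (simp add: G_def U_def)
qed

section \<open>Rellich compactness under the cone condition\<close>

lemma L2_norm_mono:
 assumes "S : sets lebesgue" "T : sets lebesgue" "S <= T" "in_L2 T f"
 shows "L2_norm S f <= L2_norm T f"
 unfolding L2_norm_def integral_lebesgue_on[OF assms(1)] integral_lebesgue_on[OF assms(2)]
proof (intro real_sqrt_le_mono integral_mono_AE')
 show "integrable lebesgue (%x. indicator T x *R (norm (f x))^2)" using assms by (simp add: in_L2_def integrable_lebesgue_on)
qed (use assms(3) in "auto simp: indicator_def")

lemma L2_norm_cong:
 assumes "S : sets lebesgue" "!!x. x : S ==> f x = g x"
 shows "L2_norm S f = L2_norm S g"
proof -
 have "(%x. indicator S x *R (norm (f x))^2) = (%x. indicator S x *R (norm (g x))^2)"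
  using assms(2) by (auto simp: indicator_def)
 then show ?thesis unfolding L2_norm_def integral_lebesgue_on[OF assms(1)] by simp
qed

lemma integrable_bounded_in_L2:
 fixes u :: "real^'d::finite => real"
 assumes D: "bounded D" "D : sets lebesgue" and u: "in_L2 D u"
 shows "integrable lebesgue (%x. indicator D x *R u x)"
proof -
 have eq: "(%x. (norm (indicator D x :: real))^2) = indicator D" by (auto simp: indicator_def)
 have "sq_integrable (indicator D :: real^'d => real)"
  unfolding sq_integrable_def eq using integrable_indicator_bounded[OF D] D by auto
 from integrable_inner_sq_integrable[OF this u[unfolded in_L2_iff[OF D(2)]]]
 have "integrable lebesgue (%x. indicator D x \<bullet> (indicator D x *R u x))" .
 moreover have "(%x. indicator D x \<bullet> (indicator D x *R u x)) = (%x. indicator D x *R u x)" by (auto simp: indicator_def)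
 ultimately show ?thesis by simp
qed

text \<open>On compact subsets the mollifications of a weakly null sequence converge to zero, because they
 do so pointwise and boundedly; the gradient bound makes them uniformly close to the sequence.\<close>

lemma Rellich_local:
 fixes u :: "nat => real^'d::finite => real"
 assumes D: "open D" "bounded D"
  and u: "!!m. has_weak_gradient D (u m) (g m)" "!!m. in_L2 D (u m)" "!!m. in_L2 D (g m)"
  and bd: "!!m. L2_norm D (u m) <= B" "!!m. L2_norm D (g m) <= C"
  and w: "weakly_tendsto (%m. toL2 D (u m)) 0"
  and K: "compact K" "K <= D"
 shows "(%m. L2_norm K (u m)) ----> 0"
proof (rule LIMSEQ_I)
 fix e :: real assume e: "e > 0"
 have mD: "D : sets lebesgue" and mK: "K : sets lebesgue" and bK: "K : sets borel" using D K by (auto simp: compact_imp_closed)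
 have C0: "C >= 0" using bd(2)[of 0] L2_norm_nonneg order_trans by blast
 have B0: "B >= 0" using bd(1)[of 0] L2_norm_nonneg order_trans by blast
 obtain \<delta> where \<delta>: "\<delta> > 0" "(\<Union>x\<in>K. cball x \<delta>) <= D"
  using compact_subset_open_imp_cball_epsilon_subset[OF K(1) D(1) K(2)] by blast
 define d where "d = min (\<delta> / 2) (e / (4 * (C + 1)))"
 have d: "d > 0" "d <= \<delta> / 2" "d * C < e / 2"
 proof -
  show "d > 0" unfolding d_def using \<delta> e C0 by auto
  show "d <= \<delta> / 2" unfolding d_def by (rule min.cobounded1)
  have "d * C <= e / (4 * (C + 1)) * (C + 1)" unfolding d_def using e C0 by (intro mult_mono) auto
  also have "... = e / 4"
  proof -
   have "e / (4 * y) * y = e / 4" if "y ~= 0" for y :: real using that by simp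
   from this[of "C + 1"] show ?thesis using C0 by simp
  qed
  finally show "d * C < e / 2" using e by linarith
 qed
 obtain \<rho> :: "real^'d => real" where \<rho>: "mollifier d \<rho>" using mollifier_exists[OF d(1)] by blast
 have t\<rho>: "test_function UNIV \<rho>" using \<rho> by (simp add: mollifier_def)
 let ?U = "\<Union>x\<in>K. ball x (\<delta> / 2)"
 have U: "open ?U" "K <= ?U" using \<delta>(1) by auto
 have mU: "?U : sets lebesgue" using U by auto
 let ?u = "%m x. indicator D x *R u m x"
 have su: "sq_integrable (?u m)" for m using u(2)[of m] by (simp add: in_L2_iff[OF mD])
 have iu: "integrable lebesgue (?u m)" for m by (rule integrable_bounded_in_L2[OF D(2) mD u(2)])
 have trans: "L2_norm K (%x. ?u m (x + z) - ?u m x) <= d * C" if z: "norm z < d" for m z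
 proof -
  have seg: "x + s *R z : D" if x: "x : ?U" and s: "0 <= s" "s <= 1" for x s
  proof -
   obtain y where y: "y : K" "dist y x < \<delta> / 2" using x by auto
   have "norm (s *R z) <= 1 * norm z" unfolding norm_scaleR using s by (intro mult_right_mono) auto
   then have "dist x (x + s *R z) < \<delta> / 2" using z d(2) by (simp add: dist_norm)
   then have "dist y (x + s *R z) <= \<delta>" using y(2) dist_triangle[of y "x + s *R z" x] by simp
   then show ?thesis using y(1) \<delta>(2) by (auto simp: subset_iff)
  qed
  have eqU: "L2_norm ?U (%x. ?u m (x + z) - ?u m x) = L2_norm ?U (%x. u m (x + z) - u m x)"
  proof (rule L2_norm_cong[OF mU])
   fix x assume "x : ?U"
   then show "?u m (x + z) - ?u m x = u m (x + z) - u m x" using seg[of x 0] seg[of x 1] by simp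
  qed
  have "in_L2 UNIV (%x. ?u m (x + z) - ?u m x)"
   using sq_integrable_diff[OF sq_integrable_translation[OF su] su] by (simp add: in_L2_UNIV_iff)
  then have "in_L2 ?U (%x. ?u m (x + z) - ?u m x)" by (rule in_L2_mono) (use mU in auto)
  then have "L2_norm K (%x. ?u m (x + z) - ?u m x) <= L2_norm ?U (%x. ?u m (x + z) - ?u m x)"
   by (rule L2_norm_mono[OF mK mU U(2)])
  also have "... <= norm z * L2_norm D (g m)"
   unfolding eqU by (rule L2_norm_difference_le_gradient[OF D(1) U(1) seg u(1,2,3) iu])
  also have "... <= d * C" using z bd(2)[of m] d(1) L2_norm_nonneg by (intro mult_mono) auto
  finally show ?thesis .
 qed
 have close: "in_L2 K (%x. ?u m x - corr \<rho> (?u m) x)" "L2_norm K (%x. ?u m x - corr \<rho> (?u m) x) <= d * C" for m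
  using L2_norm_mollification_le[OF \<rho> iu[of m] su[of m] bK _ trans] d(1) C0 by auto
 define R where "R = L2_norm UNIV \<rho>"
 have corr: "corr \<rho> (?u m) x = toL2 D (u m) \<bullet> toL2 UNIV (%y. \<rho> (y - x))"
  and corr_le: "\<bar>corr \<rho> (?u m) x\<bar> <= B * R" for m x
 proof -
  have tx: "test_function UNIV (%y. \<rho> (y - x))" using test_function_affine[OF t\<rho>, of 1 "-x" UNIV] by simp
  have in2: "in_L2 UNIV (?u m)" "in_L2 UNIV (%y. \<rho> (y - x))"
   using su sq_integrable_test_function[OF tx] by (auto simp: in_L2_UNIV_iff)
  have eqD: "toL2 D (u m) = toL2 UNIV (?u m)" by (simp add: toL2_def)
  show eq: "corr \<rho> (?u m) x = toL2 D (u m) \<bullet> toL2 UNIV (%y. \<rho> (y - x))"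
   unfolding eqD corr_def using inner_toL2[OF _ in2] by (simp add: mult.commute)
  have "\<bar>corr \<rho> (?u m) x\<bar> <= norm (toL2 D (u m)) * norm (toL2 UNIV (%y. \<rho> (y - x)))"
   unfolding eq by (rule Cauchy_Schwarz_ineq2)
  also have "norm (toL2 UNIV (%y. \<rho> (y - x))) = R"
   using norm_toL2[OF _ in2(2)] L2_norm_translation[OF sq_integrable_test_function[OF t\<rho>], of "-x"] by (simp add: R_def)
  also have "norm (toL2 D (u m)) * R <= B * R"
   using bd(1)[of m] by (intro mult_right_mono) (auto simp: norm_toL2[OF mD u(2)] R_def L2_norm_nonneg)
  finally show "\<bar>corr \<rho> (?u m) x\<bar> <= B * R" .
 qed
 have cm: "corr \<rho> (?u m) : borel_measurable lebesgue" for m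
  by (intro continuous_borel_measurable_lebesgue smooth_continuous_on smooth_corr t\<rho> iu)
 have finK: "integrable lebesgue (%x. indicator K x *R (B * R)^2)"
  using integrable_indicator_bounded[OF compact_imp_bounded[OF K(1)] mK] by auto
 have bdK: "norm (indicator K x *R (norm (corr \<rho> (?u m) x))^2) <= indicator K x *R (B * R)^2" for m x
  using power_mono[OF corr_le[of m x], of 2] by (auto simp: indicator_def)
 have "(%m. LINT x|lebesgue. indicator K x *R (norm (corr \<rho> (?u m) x))^2) ----> (LINT x::real^'d|lebesgue. 0)"
 proof (rule integral_dominated_convergence[where w = "%x. indicator K x *R (B * R)^2"])
  show "(%x. indicator K x *R (norm (corr \<rho> (?u m) x))^2) : borel_measurable lebesgue" for m
   using cm[of m] mK by measurable
  show "AE x in lebesgue. (%m. indicator K x *R (norm (corr \<rho> (?u m) x))^2) ----> 0"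
  proof (rule AE_I2)
   fix x
   have "(%m. corr \<rho> (?u m) x) ----> 0" using w unfolding weakly_tendsto_def corr by simp
   then have "(%m. indicator K x *R (norm (corr \<rho> (?u m) x))^2) ----> indicator K x *R (norm (0::real))^2"
    by (intro tendsto_intros)
   then show "(%m. indicator K x *R (norm (corr \<rho> (?u m) x))^2) ----> 0" by simp
  qed
 qed (use finK bdK in auto)
 then have "(%m. L2_norm K (corr \<rho> (?u m))) ----> sqrt 0"
  unfolding L2_norm_def integral_lebesgue_on[OF mK] by (intro tendsto_real_sqrt) simp
 then obtain M where M: "!!m. m >= M ==> L2_norm K (corr \<rho> (?u m)) < e / 2"
  using LIMSEQ_D[of "%m. L2_norm K (corr \<rho> (?u m))" 0 "e/2"] e by (auto simp: L2_norm_nonneg)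
 have "norm (L2_norm K (u m) - 0) < e" if "m >= M" for m
 proof -
  have "in_L2 K (corr \<rho> (?u m))" unfolding in_L2_def
  proof
   show "corr \<rho> (?u m) : borel_measurable (lebesgue_on K)" using cm by (rule measurable_restrict_space1)
   show "integrable (lebesgue_on K) (%x. (norm (corr \<rho> (?u m) x))^2)" unfolding integrable_lebesgue_on[OF mK]
    by (rule Bochner_Integration.integrable_bound[OF finK]) (use bdK cm[of m] mK in "auto intro!: order_trans[OF bdK]")
  qed
  have "L2_norm K (u m) = L2_norm K (%x. (?u m x - corr \<rho> (?u m) x) + corr \<rho> (?u m) x)"
   by (rule L2_norm_cong[OF mK]) (use K(2) in auto)
  also have "... <= L2_norm K (%x. ?u m x - corr \<rho> (?u m) x) + L2_norm K (corr \<rho> (?u m))"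
   by (rule L2_norm_triangle[OF mK close(1)]) fact
  also have "... < e" using close(2)[of m] M[OF that] d(3) by linarith
  finally show ?thesis by (simp add: L2_norm_nonneg)
 qed
 then show "\<exists>M. \<forall>m\<ge>M. norm (L2_norm K (u m) - 0) < e" by blast
qed

lemma sum_power2_le_power2_sum:
 fixes a :: "'i => real"
 assumes "finite I" "!!i. i : I ==> 0 <= a i"
 shows "(\<Sum>i\<in>I. (a i)^2) <= (\<Sum>i\<in>I. a i)^2"
 using assms
proof (induction rule: finite_induct)
 case (insert i I)
 then have "0 <= 2 * a i * (\<Sum>i\<in>I. a i)" by (intro mult_nonneg_nonneg sum_nonneg) auto
 then show ?case using insert by (simp add: power2_sum)
qed simp

text \<open>Finitely many cone directions suffice after widening the complement of the cone a little.\<close>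

lemma cone_property_finite_directions:
 fixes D :: "(real^'d::finite) set"
 assumes "cone_property D"
 obtains A h \<kappa> where "finite A" "h > 0" "0 < \<kappa>"
  "!!x t. x : D ==> 0 < t ==> t < h ==>
   \<exists>b\<in>A. norm b = 1 & (\<forall>s. 0 <= s --> s <= t --> x + s *R b : D) & ball (x + t *R b) (\<kappa> * t) <= D"
proof -
 obtain h c where h: "h > 0" and c: "c < 1" and cone: "!!x. x : D ==> \<exists>a. norm a = 1 \<and>
   (\<forall>y. 0 < dist x y & dist x y < h & (y - x) \<bullet> a > c * norm (y - x) --> y : D)"
  using assms unfolding cone_property_def by metis
 define c0 where "c0 = max c 0"
 define \<tau> where "\<tau> = (1 - c0) / 2"
 define c1 where "c1 = c0 + \<tau>"
 define \<kappa> where "\<kappa> = (1 - c1) / 4"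
 have cc: "c <= c0" "0 <= c0" "c0 < 1" "\<tau> > 0" "c1 < 1" "0 <= c1" "\<kappa> > 0" "\<kappa> < 1" "c1 * (1 + \<kappa>) < 1 - \<kappa>"
 proof -
  show 1: "c <= c0" "0 <= c0" "c0 < 1" unfolding c0_def using c by auto
  then show 2: "\<tau> > 0" "c1 < 1" "0 <= c1" unfolding \<tau>_def c1_def by (auto simp: field_simps)
  then show 3: "\<kappa> > 0" "\<kappa> < 1" unfolding \<kappa>_def by auto
  have "1 - \<kappa> - c1 * (1 + \<kappa>) = \<kappa> * (3 - c1)" unfolding \<kappa>_def by (simp add: field_simps)
  then show "c1 * (1 + \<kappa>) < 1 - \<kappa>" using 2 3 by (smt (verit) mult_pos_pos)
 qed
 have "compact (sphere (0::real^'d) 1)" by simp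
 moreover have "sphere (0::real^'d) 1 <= (\<Union>a\<in>sphere 0 1. ball a \<tau>)" using cc(4) by auto
 ultimately obtain A where A: "A <= sphere 0 1" "finite A" "sphere (0::real^'d) 1 <= (\<Union>a\<in>A. ball a \<tau>)"
  using compactE_image[of "sphere (0::real^'d) 1" "sphere 0 1" "%a. ball a \<tau>"] by (metis open_ball)
 show ?thesis
 proof (rule that[of A "h / 2" \<kappa>])
  fix x t assume x: "x : D" and t: "0 < t" "t < h / 2"
  obtain a where a: "norm a = 1"
   "!!y. 0 < dist x y ==> dist x y < h ==> (y - x) \<bullet> a > c * norm (y - x) ==> y : D" using cone[OF x] by blast
  then obtain b where b: "b : A" "dist b a < \<tau>" using A(3) by (auto simp: subset_iff)
  have nb: "norm b = 1" using A(1) b(1) by auto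
  have inD: "y : D" if y: "0 < norm (y - x)" "norm (y - x) < h" "(y - x) \<bullet> b > c1 * norm (y - x)" for y
  proof (rule a(2))
   have "\<bar>(y - x) \<bullet> (b - a)\<bar> <= norm (y - x) * norm (b - a)" by (rule Cauchy_Schwarz_ineq2)
   also have "... <= norm (y - x) * \<tau>" using b(2) by (intro mult_left_mono) (auto simp: dist_norm)
   finally have "(y - x) \<bullet> a >= (y - x) \<bullet> b - norm (y - x) * \<tau>" by (simp add: inner_diff_right)
   then have "(y - x) \<bullet> a > c0 * norm (y - x)" using y(3) unfolding c1_def by (simp add: algebra_simps)
   moreover have "c * norm (y - x) <= c0 * norm (y - x)" using cc(1) by (intro mult_right_mono) auto
   ultimately show "(y - x) \<bullet> a > c * norm (y - x)" by linarith
  qed (use y in "auto simp: dist_norm norm_minus_commute")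
  have seg: "x + s *R b : D" if s: "0 <= s" "s <= t" for s
  proof (cases "s = 0")
   case False
   show ?thesis by (rule inD) (use False s t nb cc(5) in "auto simp: power2_norm_eq_inner[symmetric]")
  qed (use x in simp)
  have "ball (x + t *R b) (\<kappa> * t) <= D"
  proof
   fix y assume "y : ball (x + t *R b) (\<kappa> * t)"
   define q where "q = y - (x + t *R b)"
   have q: "norm q < \<kappa> * t" "y - x = t *R b + q"
    using \<open>y \<in> _\<close> unfolding q_def by (auto simp: dist_norm norm_minus_commute)
   have up: "norm (y - x) <= t * (1 + \<kappa>)" using norm_triangle_ineq[of "t *R b" q] q nb t by (simp add: algebra_simps)
   have "\<bar>q \<bullet> b\<bar> <= norm q" using Cauchy_Schwarz_ineq2[of q b] nb by simp
   then have lo: "(y - x) \<bullet> b > t * (1 - \<kappa>)"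
    unfolding q(2) inner_add_left using q(1) nb by (simp add: power2_norm_eq_inner[symmetric] algebra_simps)
   show "y : D"
   proof (rule inD)
    have "0 < t * (1 - \<kappa>)" using t cc by simp
    then have "(y - x) \<bullet> b > 0" using lo by linarith
    then show "0 < norm (y - x)" by auto
    have "t * (1 + \<kappa>) < t * 2" using t cc by simp
    then show "norm (y - x) < h" using up t by linarith
    have "c1 * norm (y - x) <= c1 * (t * (1 + \<kappa>))" using up cc by (intro mult_left_mono) auto
    also have "... = t * (c1 * (1 + \<kappa>))" by simp
    also have "... < t * (1 - \<kappa>)" using cc(9) t by (intro mult_strict_left_mono) auto
    finally show "(y - x) \<bullet> b > c1 * norm (y - x)" using lo by linarith
   qed
  qed
  then show "\<exists>b\<in>A. norm b = 1 & (\<forall>s. 0 <= s --> s <= t --> x + s *R b : D) & ball (x + t *R b) (\<kappa> * t) <= D"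
   using b(1) nb seg by blast
 qed (use A h cc in auto)
qed

text \<open>Shifting by \<open>t\<close> along the cone directions moves \<open>D\<close> into a compact subset of \<open>D\<close>, at the cost
 of \<open>t\<close> times the norm of the gradient: no mass can concentrate at the boundary.\<close>

lemma cone_property_interior_estimate:
 fixes D :: "(real^'d::finite) set"
 assumes D: "open D" "bounded D" and cone: "cone_property D"
 obtains N h where "N >= 0" "h > 0"
  "!!t. 0 < t ==> t < h ==> \<exists>K. compact K & K <= D \<and>
   (\<forall>(u :: real^'d => real) g. has_weak_gradient D u g --> in_L2 D u --> in_L2 D g \<longrightarrow>
    L2_norm D u <= N * (L2_norm K u + t * L2_norm D g))"
proof -
 obtain A h \<kappa> where A: "finite A" and h: "h > 0" and \<kappa>: "0 < \<kappa>" and dir: "!!x t. x : D ==> 0 < t ==> t < h ==>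
   \<exists>b\<in>A. norm b = 1 & (\<forall>s. 0 <= s --> s <= t --> x + s *R b : D) & ball (x + t *R b) (\<kappa> * t) <= D"
  using cone_property_finite_directions[OF cone] by metis
 have mD: "D : sets lebesgue" using D by auto
 show ?thesis
 proof (rule that[of "real (card A)" h])
  fix t assume t: "0 < t" "t < h"
  define K where "K = (\<Inter>p\<in>-D. {y. dist y p >= \<kappa> * t}) Int closure D"
  have Kiff: "y : K" if "ball y (\<kappa> * t) <= D" for y
  proof -
   have "y : D" using that \<kappa> t by (meson centre_in_ball mult_pos_pos subsetD)
   moreover have "dist y p >= \<kappa> * t" if "p ~: D" for p using that \<open>ball y _ \<subseteq> D\<close> by (force simp: not_less[symmetric])
   ultimately show ?thesis unfolding K_def using closure_subset by blast
  qed
  have KD: "K <= D"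
  proof
   fix y assume "y : K"
   then have "y ~: D ==> dist y y >= \<kappa> * t" unfolding K_def by blast
   then show "y : D" using \<kappa> t by (simp add: not_le mult_pos_pos) (metis mult_pos_pos not_le)
  qed
  have "closed K" unfolding K_def by (intro closed_Int closed_INT ballI closed_Collect_le continuous_intros closed_closure)
  then have Kc: "compact K" using KD D(2) bounded_subset compact_eq_bounded_closed by blast
  then have mK: "K : sets lebesgue" by (simp add: compact_imp_closed)
  have "L2_norm D u <= real (card A) * (L2_norm K u + t * L2_norm D g)"
   if u: "has_weak_gradient D u g" "in_L2 D u" "in_L2 D g" for u :: "real^'d => real" and g
  proof -
   define U where "U b = {x. \<forall>s\<in>{0..t}. x + s *R b : D}" for b
   define E where "E b = U b Int {x. x + t *R b : K}" for b
   have oU: "open (U b)" for b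
   proof -
    have "closed ((%(x, y). x - y) ` ((- D) \<times> ((%s. s *R b) ` {0..t})))"
    proof -
     have "compact ((%s. s *R b) ` {0..t})" by (intro compact_continuous_image continuous_intros) auto
     then have "closed (\<Union>x\<in>- D. \<Union>y\<in>(%s. s *R b) ` {0..t}. {x - y})"
      using D(1) by (intro closed_compact_differences) auto
     moreover have "(\<Union>x\<in>- D. \<Union>y\<in>(%s. s *R b) ` {0..t}. {x - y}) = (%(x, y). x - y) ` ((- D) \<times> ((%s. s *R b) ` {0..t}))"
      by force
     ultimately show ?thesis by simp
    qed
    moreover have "- U b = (%(x, y). x - y) ` ((- D) \<times> ((%s. s *R b) ` {0..t}))"
    proof (intro set_eqI iffI)
     fix x assume "x : - U b"
     then obtain s where "s : {0..t}" "x + s *R b ~: D" unfolding U_def by auto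
     then show "x : (%(x, y). x - y) ` ((- D) \<times> ((%s. s *R b) ` {0..t}))"
      by (intro image_eqI[of _ _ "(x + s *R b, s *R b)"]) auto
    next
     fix x assume "x : (%(x, y). x - y) ` ((- D) \<times> ((%s. s *R b) ` {0..t}))"
     then obtain p s where ps: "p ~: D" "s : {0..t}" "x = p - s *R b" by auto
     then have "x + s *R b ~: D" by simp
     then show "x : - U b" unfolding U_def using ps(2) by blast
    qed
    ultimately show ?thesis by (simp add: open_closed)
   qed
   have cE: "closed {x. x + t *R b : K}" for b
   proof -
    have "closed ((%x. x + t *R b) -` K)" using \<open>closed K\<close> by (intro closed_vimage continuous_intros)
    then show ?thesis by (simp add: vimage_def)
   qed
   have mE: "E b : sets lebesgue" "U b : sets lebesgue" for b
   proof -
    show "U b : sets lebesgue" using oU by auto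
    moreover have "{x. x + t *R b : K} : sets lebesgue" using cE by auto
    ultimately show "E b : sets lebesgue" unfolding E_def by (rule sets.Int)
   qed
   have ED: "E b <= D" for b
   proof
    fix x assume "x : E b"
    then have "x + 0 *R b : D" unfolding E_def U_def using t by force
    then show "x : D" by simp
   qed
   have cover: "\<exists>b\<in>A. norm b = 1 & x : E b" if x: "x : D" for x
   proof -
    obtain b where b: "b : A" "norm b = 1" "\<forall>s. 0 <= s --> s <= t --> x + s *R b : D" "ball (x + t *R b) (\<kappa> * t) <= D"
     using dir[OF x t] by blast
    then have "x : E b" unfolding E_def U_def using Kiff[OF b(4)] by auto
    then show ?thesis using b by blast
   qed
   let ?A = "{b : A. norm b = 1}"
   have piece: "L2_norm (E b) u <= L2_norm K u + t * L2_norm D g" if b: "norm b = 1" for b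
   proof -
    let ?q = "%x. indicator K x *R u x" and ?z = "t *R b"
    have uK: "in_L2 K u" by (rule in_L2_mono[OF u(2) mD mK KD])
    then have q: "sq_integrable ?q" by (simp add: in_L2_iff[OF mK])
    have qE: "in_L2 (E b) (%x. ?q (x + ?z))"
     using in_L2_mono[of UNIV "%x. ?q (x + ?z)" "E b"] sq_integrable_translation[OF q, of ?z] mE by (simp add: in_L2_UNIV_iff)
    have qle: "L2_norm (E b) (%x. ?q (x + ?z)) <= L2_norm K u"
    proof -
     have "L2_norm (E b) (%x. ?q (x + ?z)) <= L2_norm UNIV (%x. ?q (x + ?z))"
      by (rule L2_norm_le_norm_mono[OF mE(1)]) (use sq_integrable_translation[OF q, of ?z] in "simp add: in_L2_UNIV_iff")
     also have "... = L2_norm UNIV ?q" by (rule L2_norm_translation[OF q])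
     also have "... = L2_norm K u"
     proof -
      have "(%x. (norm (?q x))^2) = (%x. indicator K x *R (norm (u x))^2)" by (auto simp: indicator_def)
      then show ?thesis unfolding L2_norm_def integral_lebesgue_on[OF mK] by simp
     qed
     finally show ?thesis .
    qed
    have seg: "x + s *R ?z : D" if "x : U b" "0 <= s" "s <= 1" for x s
    proof -
     have "s * t : {0..t}" using that t by (auto intro: mult_left_le_one_le)
     then show ?thesis using that(1) unfolding U_def by auto
    qed
    have "L2_norm (U b) (%x. u (x + ?z) - u x) <= norm ?z * L2_norm D g"
     by (rule L2_norm_difference_le_gradient[OF D(1) oU seg u integrable_bounded_in_L2[OF D(2) mD u(2)]])
    then have dle: "L2_norm (U b) (%x. u (x + ?z) - u x) <= t * L2_norm D g" using b t by simp
    have uE: "in_L2 (E b) u" by (rule in_L2_mono[OF u(2) mD mE(1) ED])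
    have diff: "in_L2 (E b) (%x. u x - ?q (x + ?z))" by (rule in_L2_diff[OF mE(1) uE qE])
    have dE: "L2_norm (E b) (%x. u x - ?q (x + ?z)) <= L2_norm (U b) (%x. u (x + ?z) - u x)"
    proof -
     have eq: "L2_norm (E b) (%x. u x - ?q (x + ?z)) = L2_norm (E b) (%x. u (x + ?z) - u x)"
      unfolding L2_norm_swap[of "E b" u] by (rule L2_norm_cong[OF mE(1)]) (auto simp: E_def)
     have "in_L2 (U b) (%x. u (x + ?z) - u x)"
     proof -
      let ?u = "%x. indicator D x *R u x"
      have su: "sq_integrable ?u" using u(2) by (simp add: in_L2_iff[OF mD])
      have "in_L2 (U b) (%x. ?u (x + ?z) - ?u x)"
       using in_L2_mono[of UNIV "%x. ?u (x + ?z) - ?u x" "U b"] sq_integrable_diff[OF sq_integrable_translation[OF su] su] mE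
       by (simp add: in_L2_UNIV_iff)
      moreover have "(%x. indicator (U b) x *R (?u (x + ?z) - ?u x)) = (%x. indicator (U b) x *R (u (x + ?z) - u x))"
       using seg[of _ 0] seg[of _ 1] by (auto simp: indicator_def)
      ultimately show ?thesis unfolding in_L2_iff[OF mE(2)] by simp
     qed
     then show ?thesis unfolding eq by (intro L2_norm_mono mE) (auto simp: E_def)
    qed
    have "L2_norm (E b) u = L2_norm (E b) (%x. ?q (x + ?z) + (u x - ?q (x + ?z)))" by simp
    also have "... <= L2_norm (E b) (%x. ?q (x + ?z)) + L2_norm (E b) (%x. u x - ?q (x + ?z))"
     by (rule L2_norm_triangle[OF mE(1) qE diff])
    finally show ?thesis using qle dle dE by linarith
   qed
   have i2: "integrable lebesgue (%x. indicator (E b) x *R (norm (u x))^2)" for b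
    using in_L2_mono[OF u(2) mD mE(1) ED, of b] by (simp add: in_L2_def integrable_lebesgue_on[OF mE(1)])
   have "(L2_norm D u)^2 = (LINT x|lebesgue. indicator D x *R (norm (u x))^2)"
    by (simp add: L2_norm_power2 integral_lebesgue_on[OF mD])
   also have "... <= (LINT x|lebesgue. (\<Sum>b\<in>?A. indicator (E b) x *R (norm (u x))^2))"
   proof (rule integral_mono_AE')
    show "integrable lebesgue (%x. \<Sum>b\<in>?A. indicator (E b) x *R (norm (u x))^2)" using i2 by (intro Bochner_Integration.integrable_sum)
    show "AE x in lebesgue. indicator D x *R (norm (u x))^2 <= (\<Sum>b\<in>?A. indicator (E b) x *R (norm (u x))^2)"
    proof (rule AE_I2)
     fix x
     show "indicator D x *R (norm (u x))^2 <= (\<Sum>b\<in>?A. indicator (E b) x *R (norm (u x))^2)"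
     proof (cases "x : D")
      case True
      then obtain b where b: "b : ?A" "x : E b" using cover by blast
      have "indicator (E b) x *R (norm (u x))^2 <= (\<Sum>b\<in>?A. indicator (E b) x *R (norm (u x))^2)"
       by (rule member_le_sum[OF b(1)]) (use A in "auto simp: indicator_def")
      then show ?thesis using True b(2) by simp
     qed (auto intro!: sum_nonneg simp: indicator_def)
    qed
    show "AE x in lebesgue. 0 <= (\<Sum>b\<in>?A. indicator (E b) x *R (norm (u x))^2)"
     by (intro AE_I2 sum_nonneg) (auto simp: indicator_def)
   qed
   also have "... = (\<Sum>b\<in>?A. (L2_norm (E b) u)^2)" using i2 by (simp add: L2_norm_power2 integral_lebesgue_on[OF mE(1)])
   also have "... <= (\<Sum>b\<in>?A. L2_norm (E b) u)^2" using A by (intro sum_power2_le_power2_sum L2_norm_nonneg) auto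
   finally have "L2_norm D u <= (\<Sum>b\<in>?A. L2_norm (E b) u)" by (rule power2_le_imp_le) (intro sum_nonneg L2_norm_nonneg)
   also have "... <= (\<Sum>b\<in>?A. L2_norm K u + t * L2_norm D g)" by (intro sum_mono piece) auto
   also have "... = real (card ?A) * (L2_norm K u + t * L2_norm D g)" by simp
   also have "... <= real (card A) * (L2_norm K u + t * L2_norm D g)"
    using A t by (intro mult_right_mono) (auto intro!: card_mono add_nonneg_nonneg mult_nonneg_nonneg L2_norm_nonneg)
   finally show ?thesis .
  qed
  then show "\<exists>K. compact K & K <= D \<and>
   (\<forall>(u :: real^'d => real) g. has_weak_gradient D u g --> in_L2 D u --> in_L2 D g \<longrightarrow>
    L2_norm D u <= real (card A) * (L2_norm K u + t * L2_norm D g))" using Kc KD by blast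
 qed (use h in auto)
qed

text \<open>The mass away from the boundary vanishes in the limit by \<open>Rellich_local\<close>, and the mass near the
 boundary is controlled by the mass further inside and a small multiple of the gradient.\<close>

lemma Rellich_weakly_null:
 fixes u :: "nat => real^'d::finite => real"
 assumes D: "open D" "bounded D" "cone_property D"
  and u: "!!m. has_weak_gradient D (u m) (g m)" "!!m. in_L2 D (u m)" "!!m. in_L2 D (g m)"
  and bd: "!!m. L2_norm D (u m) <= B" "!!m. L2_norm D (g m) <= C"
  and w: "weakly_tendsto (%m. toL2 D (u m)) 0"
 shows "(%m. L2_norm D (u m)) ----> 0"
proof (rule LIMSEQ_I)
 fix e :: real assume e: "e > 0"
 have C0: "C >= 0" using bd(2)[of 0] L2_norm_nonneg order_trans by blast
 obtain N h where N: "N >= 0" and h: "h > 0" and est: "!!t. 0 < t ==> t < h ==> \<exists>K. compact K & K <= D \<and>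
   (\<forall>(u :: real^'d => real) g. has_weak_gradient D u g --> in_L2 D u --> in_L2 D g \<longrightarrow>
    L2_norm D u <= N * (L2_norm K u + t * L2_norm D g))" using cone_property_interior_estimate[OF D] by metis
 define t where "t = min (h / 2) (e / (4 * (N + 1) * (C + 1)))"
 have pos: "N + 1 > 0" "C + 1 > 0" using N C0 by auto
 have t: "0 < t" "t < h" unfolding t_def using h e pos by (auto simp: min_less_iff_disj)
 have tNC: "N * (t * C) <= e / 4"
 proof -
  have "t <= e / (4 * (N + 1) * (C + 1))" unfolding t_def by (rule min.cobounded2)
  moreover have "a * (t * b) <= e / 4" if "a > 0" "b > 0" "t <= e / (4 * a * b)" for a b
   using that by (simp add: pos_le_divide_eq mult_ac)
  ultimately have "(N + 1) * (t * (C + 1)) <= e / 4" using pos by blast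
  moreover have "N * (t * C) <= (N + 1) * (t * (C + 1))" using N C0 t(1) by (intro mult_mono) auto
  ultimately show ?thesis by linarith
 qed
 obtain K where K: "compact K" "K <= D" and KE: "!!m. L2_norm D (u m) <= N * (L2_norm K (u m) + t * L2_norm D (g m))"
  using est[OF t] u by metis
 have "(%m. N * L2_norm K (u m)) ----> N * 0" by (intro tendsto_intros Rellich_local[OF D(1,2) u bd w K])
 then obtain M where M: "!!m. m >= M ==> \<bar>N * L2_norm K (u m)\<bar> < e / 2"
  using LIMSEQ_D[of "%m. N * L2_norm K (u m)" "N * 0" "e / 2"] e by auto
 have "norm (L2_norm D (u m) - 0) < e" if "m >= M" for m
 proof -
  have "N * (t * L2_norm D (g m)) <= N * (t * C)" using N t bd(2) by (intro mult_left_mono) auto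
  then show ?thesis using KE[of m] M[OF that] tNC e L2_norm_nonneg[of D "u m"] by (simp add: distrib_left)
 qed
 then show "\<exists>M. \<forall>m\<ge>M. norm (L2_norm D (u m) - 0) < e" by blast
qed

lemma Rellich_compactness:
 fixes u :: "nat => real^'d::finite => real"
 assumes D: "open D" "bounded D" "cone_property D"
  and u: "!!m. has_weak_gradient D (u m) (g m)" "!!m. in_L2 D (u m)" "!!m. in_L2 D (g m)"
  and v: "has_weak_gradient D v k" "in_L2 D v" "in_L2 D k"
  and bd: "!!m. L2_norm D (u m) <= B" "!!m. L2_norm D (g m) <= C"
  and w: "weakly_tendsto (%m. toL2 D (u m)) (toL2 D v)"
 shows "(%m. L2_norm D (%x. u m x - v x)) ----> 0"
proof (rule Rellich_weakly_null[OF D])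
 have mD: "D : sets lebesgue" using D by auto
 show "has_weak_gradient D (%x. u m x - v x) (%x. g m x - k x)" for m by (rule has_weak_gradient_diff[OF D(1) u(1) v(1)])
 show L: "in_L2 D (%x. u m x - v x)" "in_L2 D (%x. g m x - k x)" for m by (intro in_L2_diff mD u v)+
 show "L2_norm D (%x. u m x - v x) <= B + L2_norm D v" for m
  using norm_triangle_ineq4[of "toL2 D (u m)" "toL2 D v"] bd(1)[of m] norm_toL2[OF mD L(1)[of m]] u v
  by (simp add: toL2_diff[OF mD] norm_toL2[OF mD])
 show "L2_norm D (%x. g m x - k x) <= C + L2_norm D k" for m
  using norm_triangle_ineq4[of "toL2 D (g m)" "toL2 D k"] bd(2)[of m] norm_toL2[OF mD L(2)[of m]] u v
  by (simp add: toL2_diff[OF mD] norm_toL2[OF mD])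
 show "weakly_tendsto (%m. toL2 D (%x. u m x - v x)) 0" unfolding weakly_tendsto_def
 proof (intro allI)
  fix h
  have "(%m. toL2 D (u m) \<bullet> h - toL2 D v \<bullet> h) ----> toL2 D v \<bullet> h - toL2 D v \<bullet> h"
   using w unfolding weakly_tendsto_def by (intro tendsto_diff tendsto_const) auto
  then show "(%m. toL2 D (%x. u m x - v x) \<bullet> h) ----> 0 \<bullet> h"
   using u v by (simp add: toL2_diff[OF mD] inner_diff_left)
 qed
qed

section \<open>Periodic functions\<close>

definition lattice :: "(real^'d::finite) set" where
 "lattice = range (%k :: 'd => int. \<chi> i. of_int (k i))"

text \<open>The half-open cell tiles the space exactly; it differs from the open cell by a null set.\<close>

definition tile :: "(real^'d::finite) set" where
 "tile = {y. \<forall>i. 0 <= y $ i & y $ i < 1}"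

definition lattice_point :: "real^'d::finite => real^'d" where
 "lattice_point x = (\<chi> i. of_int \<lfloor>x $ i\<rfloor>)"

lemma countable_lattice: "countable (lattice :: (real^'d::finite) set)"
 unfolding lattice_def by simp

lemma lattice_iff: "z : lattice \<longleftrightarrow> (\<forall>i. z $ i : \<int>)"
proof
 assume "\<forall>i. z $ i : \<int>"
 then have "z = (\<chi> i. of_int \<lfloor>z $ i\<rfloor>)" by (simp add: vec_eq_iff)
 then show "z : lattice" unfolding lattice_def by (rule image_eqI[of _ _ "%i. \<lfloor>z $ i\<rfloor>"]) auto
qed (auto simp: lattice_def)

lemma lattice_add: "a : lattice ==> b : lattice ==> a + b : lattice"
 by (simp add: lattice_iff)

lemma lattice_uminus: "a : lattice ==> - a : lattice"
 by (simp add: lattice_iff)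

lemma lattice_axis: "axis i 1 : lattice"
 by (simp add: lattice_iff axis_def)

lemma tile_shift_iff:
 assumes "z : lattice" shows "x - z : tile \<longleftrightarrow> z = lattice_point x"
proof -
 obtain k where z: "z = (\<chi> i. of_int (k i))" using assms unfolding lattice_def by auto
 have "x - z : tile \<longleftrightarrow> (\<forall>i. \<lfloor>x $ i\<rfloor> = k i)"
  unfolding tile_def z floor_eq_iff by (simp add: algebra_simps)
 then show ?thesis unfolding z lattice_point_def by (auto simp: vec_eq_iff)
qed

lemma lattice_point_in_lattice: "lattice_point x : lattice"
 unfolding lattice_point_def lattice_def by auto

lemma unit_cell_eq_box: "unit_cell = box (0 :: real^'d::finite) (\<chi> i. 1)"
 unfolding unit_cell_def by (auto simp: mem_box_cart)

lemma unit_cell_facts: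
 "open (unit_cell :: (real^'d::finite) set)" "bounded (unit_cell :: (real^'d) set)"
 "unit_cell : sets lebesgue" "(unit_cell :: (real^'d) set) : sets borel" unfolding unit_cell_eq_box by auto

lemma tile_between:
 "unit_cell <= tile" "tile <= cbox (0 :: real^'d::finite) (\<chi> i. 1)"
 unfolding unit_cell_def tile_def by (auto simp: mem_box_cart less_imp_le)

lemma tile_borel: "(tile :: (real^'d::finite) set) : sets borel"
proof -
 have "tile = (\<Inter>i. {y :: real^'d. 0 <= y $ i} Int {y. y $ i < 1})" unfolding tile_def by auto
 moreover have "... : sets borel"
  by (intro sets.finite_INT sets.Int borel_closed borel_open closed_Collect_le open_Collect_less continuous_intros) auto
 ultimately show ?thesis by simp
qed

lemma AE_tile: "AE y :: real^'d::finite in lebesgue. y : tile \<longleftrightarrow> y : unit_cell"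
proof -
 have "negligible (cbox (0::real^'d) (\<chi> i. 1) - box 0 (\<chi> i. 1))" by (rule negligible_frontier_interval)
 then have "AE y in lebesgue. y ~: cbox (0::real^'d) (\<chi> i. 1) - box 0 (\<chi> i. 1)"
  by (intro AE_not_in) (simp add: negligible_iff_null_sets)
 then show ?thesis by eventually_elim (use tile_between in "auto simp: unit_cell_eq_box[symmetric]")
qed

lemma emeasure_unit_cell: "emeasure lebesgue (unit_cell :: (real^'d::finite) set) = 1"
proof -
 have "b : Basis ==> (\<chi> i. 1) \<bullet> b = (1::real)" for b :: "real^'d" by (auto simp: Basis_vec_def inner_axis)
 then show ?thesis unfolding unit_cell_eq_box by (simp add: emeasure_lborel_box_eq)
qed

lemma emeasure_tile: "emeasure lebesgue (tile :: (real^'d::finite) set) = 1"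
 by (rule trans[OF emeasure_eq_AE emeasure_unit_cell]) (use AE_tile unit_cell_facts tile_borel in auto)

lemma cell_periodic_lattice_shift:
 fixes f :: "real^'d::finite => 'b"
 assumes f: "cell_periodic f" and z: "z : lattice"
 shows "AE y in lebesgue. f (y + z) = f y"
proof -
 let ?Z = "%z. AE y in lebesgue. f (y + z) = f y"
 have add: "?Z (a + b)" if "?Z a" "?Z b" for a b
 proof -
  have "AE y in lebesgue. f (y + b + a) = f (y + b)" using AE_lebesgue_affine[OF _ that(1), of 1 b] by (simp add: add_ac)
  with that(2) show ?thesis by eventually_elim (simp add: add_ac)
 qed
 have neg: "?Z (- a)" if "?Z a" for a using AE_lebesgue_affine[OF _ that, of 1 "- a"] by (simp add: eq_commute)
 have nat: "?Z (real n *R axis i 1)" for n i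
 proof (induction n)
  case (Suc n)
  have "?Z (axis i 1)" using f unfolding cell_periodic_def by simp
  from add[OF Suc this] show ?case by (simp add: algebra_simps)
 qed simp
 have int: "?Z (of_int k *R axis i 1)" for k :: int and i
 proof (cases "k >= 0")
  case True then show ?thesis using nat[of "nat k" i] by simp
 next
  case False then show ?thesis using neg[OF nat[of "nat (- k)" i]] by simp
 qed
 obtain k where k: "z = (\<chi> i. of_int (k i))" using z unfolding lattice_def by auto
 have "?Z (\<Sum>i\<in>I. of_int (k i) *R axis i 1)" if "finite I" for I using that
 proof (induction rule: finite_induct)
  case (insert i I)
  show ?case unfolding sum.insert[OF insert(1,2)] by (rule add[OF int insert(3)])
 qed simp
 from this[of UNIV] have "?Z (\<Sum>i\<in>UNIV. of_int (k i) *R axis i 1)" by simp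
 moreover have "(\<Sum>i\<in>UNIV. of_int (k i) *R axis i 1) = z"
  using basis_expansion[of z] by (simp add: k scalar_mult_eq_scaleR)
 ultimately show ?thesis by simp
qed

lemma cell_periodic_AE_extend:
 fixes f :: "real^'d::finite => 'b"
 assumes f: "cell_periodic f" and P: "AE y in lebesgue_on unit_cell. P (f y)"
 shows "AE y in lebesgue. P (f y)"
proof -
 have "AE y in lebesgue. y : unit_cell --> P (f y)" unfolding AE_lebesgue_on[OF unit_cell_facts(3), symmetric] by (rule P)
 then have Q: "AE y in lebesgue. y : tile --> P (f y)" using AE_tile by eventually_elim blast
 have "AE x in lebesgue. x - z : tile --> P (f x)" if z: "z : lattice" for z :: "real^'d"
 proof -
  have "AE x in lebesgue. x - z : tile --> P (f (x - z))" using AE_lebesgue_affine[OF _ Q, of 1 "- z"] by simp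
  moreover have "AE x in lebesgue. f (x + - z) = f x" by (rule cell_periodic_lattice_shift[OF f lattice_uminus[OF z]])
  ultimately show ?thesis by eventually_elim simp
 qed
 then have "AE x in lebesgue. \<forall>z\<in>lattice. x - z : tile --> P (f x)"
  by (subst AE_ball_countable[OF countable_lattice]) auto
 then show ?thesis by eventually_elim (use tile_shift_iff lattice_point_in_lattice in blast)
qed

lemma nn_integral_unfold_lattice:
 fixes h :: "real^'d::finite => ennreal"
 assumes h: "h : borel_measurable lebesgue"
 shows "(\<integral>\<^sup>+x. h x \<partial>lebesgue) =
  (\<integral>\<^sup>+z. (\<integral>\<^sup>+y. indicator tile y * h (y + z) \<partial>lebesgue) \<partial>count_space lattice)"
proof -
 have Q: "(tile :: (real^'d) set) : sets lebesgue" using tile_borel by auto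
 have one: "(\<integral>\<^sup>+z. indicator tile (x - z) * h x \<partial>count_space lattice) = h x" for x
 proof -
  have "(\<integral>\<^sup>+z. indicator tile (x - z) * h x \<partial>count_space lattice)
    = (\<integral>\<^sup>+z. h x * indicator {lattice_point x} z \<partial>count_space lattice)"
   by (intro nn_integral_cong) (auto simp: tile_shift_iff indicator_def)
  also have "... = h x" using lattice_point_in_lattice[of x] by (subst nn_integral_cmult_indicator) auto
  finally show ?thesis .
 qed
 have meas: "(%x. indicator tile (x - z) * h x) : borel_measurable lebesgue" for z
 proof -
  have "(%x. indicator tile (x - z) :: ennreal) : borel_measurable lebesgue"
   using measurable_lebesgue_affine[of 1 "indicator tile" "- z"] Q by simp
  then show ?thesis using h by measurable
 qed
 have "(\<integral>\<^sup>+x. h x \<partial>lebesgue) = (\<integral>\<^sup>+x. (\<integral>\<^sup>+z. indicator tile (x - z) * h x \<partial>count_space lattice) \<partial>lebesgue)"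
  by (simp only: one)
 also have "... = (\<integral>\<^sup>+z. (\<integral>\<^sup>+x. indicator tile (x - z) * h x \<partial>lebesgue) \<partial>count_space lattice)"
  by (rule nn_integral_count_space_nn_integral[OF countable_lattice meas])
 also have "... = (\<integral>\<^sup>+z. (\<integral>\<^sup>+y. indicator tile y * h (y + z) \<partial>lebesgue) \<partial>count_space lattice)"
 proof (rule nn_integral_cong)
  fix z :: "real^'d"
  show "(\<integral>\<^sup>+x. indicator tile (x - z) * h x \<partial>lebesgue) = (\<integral>\<^sup>+y. indicator tile y * h (y + z) \<partial>lebesgue)"
   using nn_integral_lebesgue_affine[where c=1 and t=z, OF _ meas[of z]] by (simp add: add.commute)
 qed
 finally show ?thesis .
qed

text \<open>The integral of a periodic function over a translated cell: cut the translated cell along the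
 lattice and move the pieces back.\<close>

lemma nn_integral_cell_shift:
 fixes f :: "real^'d::finite => ennreal"
 assumes f: "f : borel_measurable lebesgue" and per: "cell_periodic f"
 shows "(\<integral>\<^sup>+y. indicator tile y * f (y + s) \<partial>lebesgue) = (\<integral>\<^sup>+y. indicator tile y * f y \<partial>lebesgue)"
proof -
 have Q: "(tile :: (real^'d) set) : sets lebesgue" using tile_borel by auto
 have m: "(%x. indicator tile (x - s) :: ennreal) : borel_measurable lebesgue" for s :: "real^'d"
  using measurable_lebesgue_affine[of 1 "indicator tile" "- s"] Q by simp
 have m1: "(%x. indicator tile (x - s) * f x) : borel_measurable lebesgue" using m[of s] f by measurable
 have m2: "(%y. indicator tile (y + z - s) :: ennreal) : borel_measurable lebesgue" for z
  using m[of "s - z"] by (simp add: algebra_simps)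
 have "(\<integral>\<^sup>+y. indicator tile y * f (y + s) \<partial>lebesgue) = (\<integral>\<^sup>+x. indicator tile (x - s) * f x \<partial>lebesgue)"
  using nn_integral_lebesgue_affine[OF _ m1, of 1 s] by (simp add: add.commute)
 also have "... = (\<integral>\<^sup>+z. (\<integral>\<^sup>+y. indicator tile y * (indicator tile (y + z - s) * f (y + z)) \<partial>lebesgue) \<partial>count_space lattice)"
  by (rule nn_integral_unfold_lattice[OF m1])
 also have "... = (\<integral>\<^sup>+z. (\<integral>\<^sup>+y. indicator tile y * (indicator tile (y + z - s) * f y) \<partial>lebesgue) \<partial>count_space lattice)"
 proof (rule nn_integral_cong, rule nn_integral_cong_AE)
  fix z :: "real^'d" assume "z : space (count_space lattice)"
  then have "AE y in lebesgue. f (y + z) = f y" using cell_periodic_lattice_shift[OF per] by simp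
  then show "AE y in lebesgue. indicator tile y * (indicator tile (y + z - s) * f (y + z)) =
    indicator tile y * (indicator tile (y + z - s) * f y)" by eventually_elim simp
 qed
 also have "... = (\<integral>\<^sup>+y. (\<integral>\<^sup>+z. indicator tile y * (indicator tile (y + z - s) * f y) \<partial>count_space lattice) \<partial>lebesgue)"
  by (rule nn_integral_count_space_nn_integral[OF countable_lattice, symmetric]) (use m2 Q f in measurable)
 also have "... = (\<integral>\<^sup>+y. indicator tile y * f y \<partial>lebesgue)"
 proof (intro nn_integral_cong)
  fix y :: "real^'d"
  have iff: "y + z - s : tile \<longleftrightarrow> z = - lattice_point (y - s)" if "z : lattice" for z
   using tile_shift_iff[OF lattice_uminus[OF that], of "y - s"] by (simp add: algebra_simps) (metis minus_minus)
  have "(\<integral>\<^sup>+z. indicator tile y * (indicator tile (y + z - s) * f y) \<partial>count_space lattice)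
   = (\<integral>\<^sup>+z. (indicator tile y * f y) * indicator {- lattice_point (y - s)} z \<partial>count_space lattice)"
   by (intro nn_integral_cong) (auto simp: iff indicator_def)
  also have "... = indicator tile y * f y"
   using lattice_uminus[OF lattice_point_in_lattice[of "y - s"]] by (subst nn_integral_cmult_indicator) auto
  finally show "(\<integral>\<^sup>+z. indicator tile y * (indicator tile (y + z - s) * f y) \<partial>count_space lattice)
   = indicator tile y * f y" .
 qed
 finally show ?thesis .
qed

lemma cell_periodic_compose: "cell_periodic f ==> cell_periodic (%x. g (f x))"
 unfolding cell_periodic_def
proof (intro allI)
 fix i assume "\<forall>i. AE y in lebesgue. f (y + axis i 1) = f y"
 then have "AE y in lebesgue. f (y + axis i 1) = f y" by blast
 then show "AE y in lebesgue. g (f (y + axis i 1)) = g (f y)" by eventually_elim simp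
qed

lemma cell_periodic_cong_AE:
 fixes f g :: "real^'d::finite => 'b"
 assumes "cell_periodic f" "AE x in lebesgue. f x = g x" shows "cell_periodic g"
 unfolding cell_periodic_def
proof
 fix i
 have "AE y in lebesgue. f (y + axis i 1) = g (y + axis i 1)"
  using AE_lebesgue_affine[OF _ assms(2), of 1 "axis i 1"] by (simp add: add.commute)
 moreover have "AE y in lebesgue. f (y + axis i 1) = f y" using assms(1) unfolding cell_periodic_def by blast
 ultimately show "AE y in lebesgue. g (y + axis i 1) = g y" using assms(2) by eventually_elim simp
qed

lemma tile_norm: "t : tile ==> norm (t :: real^'d::finite) <= real CARD('d)"
proof -
 assume "t : tile"
 then have "norm t <= (\<Sum>i\<in>(UNIV::'d set). 1)"
  unfolding tile_def by (intro order_trans[OF norm_le_l1_cart] sum_mono) (auto simp: abs_le_iff less_imp_le intro: order_trans[of _ 0])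
 then show ?thesis by simp
qed

text \<open>Averaging over all translations of the pattern by vectors of the cell replaces the integral of
 an oscillating function by its cell average, exactly and for every \<open>\<epsilon>\<close>.\<close>

lemma nn_integral_oscillating_average:
 fixes F :: "real^'d::finite => ennreal"
 assumes F[measurable]: "F : borel_measurable borel" and per: "cell_periodic F" and e: "\<epsilon> > 0" and B: "B : sets borel"
 shows "(\<integral>\<^sup>+t. indicator tile t * (\<integral>\<^sup>+x. indicator B x * F (x /\<^sub>R \<epsilon> + t) \<partial>lborel) \<partial>lborel) =
  emeasure lborel B * (\<integral>\<^sup>+y. indicator tile y * F y \<partial>lborel)"
proof -
 have [measurable]: "(tile :: (real^'d) set) : sets borel" "B : sets borel" using tile_borel B by auto
 have "(\<integral>\<^sup>+t. indicator tile t * (\<integral>\<^sup>+x. indicator B x * F (x /\<^sub>R \<epsilon> + t) \<partial>lborel) \<partial>lborel)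
   = (\<integral>\<^sup>+t. (\<integral>\<^sup>+x. indicator tile t * (indicator B x * F (x /\<^sub>R \<epsilon> + t)) \<partial>lborel) \<partial>lborel)"
  by (intro nn_integral_cong nn_integral_cmult[symmetric]) measurable
 also have "... = (\<integral>\<^sup>+x. (\<integral>\<^sup>+t. indicator tile t * (indicator B x * F (x /\<^sub>R \<epsilon> + t)) \<partial>lborel) \<partial>lborel)"
  by (rule lborel_pair.Fubini') measurable
 also have "... = (\<integral>\<^sup>+x. indicator B x * (\<integral>\<^sup>+y. indicator tile y * F y \<partial>lborel) \<partial>lborel)"
 proof (intro nn_integral_cong)
  fix x
  have "(\<integral>\<^sup>+t. indicator tile t * (indicator B x * F (x /\<^sub>R \<epsilon> + t)) \<partial>lborel) =
    indicator B x * (\<integral>\<^sup>+t. indicator tile t * F (t + x /\<^sub>R \<epsilon>) \<partial>lborel)"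
   by (subst nn_integral_cmult[symmetric]) (auto intro!: nn_integral_cong simp: mult_ac add.commute)
  also have "(\<integral>\<^sup>+t. indicator tile t * F (t + x /\<^sub>R \<epsilon>) \<partial>lborel) = (\<integral>\<^sup>+y. indicator tile y * F y \<partial>lborel)"
   using nn_integral_cell_shift[OF measurable_completion per, of "x /\<^sub>R \<epsilon>"] F
   by (simp add: nn_integral_completion)
  finally show "(\<integral>\<^sup>+t. indicator tile t * (indicator B x * F (x /\<^sub>R \<epsilon> + t)) \<partial>lborel) =
    indicator B x * (\<integral>\<^sup>+y. indicator tile y * F y \<partial>lborel)" .
 qed
 also have "... = emeasure lborel B * (\<integral>\<^sup>+y. indicator tile y * F y \<partial>lborel)"
  by (subst nn_integral_multc) auto
 finally show ?thesis .
qed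

lemma nn_integral_oscillating_le:
 fixes F :: "real^'d::finite => ennreal"
 assumes F[measurable]: "F : borel_measurable borel" and per: "cell_periodic F" and e: "0 < \<epsilon>" "\<epsilon> <= 1"
 shows "(\<integral>\<^sup>+x. indicator (ball 0 R) x * F (x /\<^sub>R \<epsilon>) \<partial>lborel) \<le>
  emeasure lborel (ball (0::real^'d) (R + real CARD('d))) * (\<integral>\<^sup>+y. indicator tile y * F y \<partial>lborel)"
proof -
 let ?B' = "ball (0::real^'d) (R + real CARD('d))"
 have [measurable]: "(tile :: (real^'d) set) : sets borel" using tile_borel .
 have le: "(\<integral>\<^sup>+x. indicator (ball 0 R) x * F (x /\<^sub>R \<epsilon>) \<partial>lborel) <= (\<integral>\<^sup>+x. indicator ?B' x * F (x /\<^sub>R \<epsilon> + t) \<partial>lborel)"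
  if t: "t : tile" for t
 proof -
  have m: "(%x. indicator (ball 0 R) x * F (x /\<^sub>R \<epsilon>)) : borel_measurable lebesgue"
  proof -
   have "(%x. F (x /\<^sub>R \<epsilon>)) : borel_measurable borel" by (rule measurable_compose[OF _ F]) simp
   then show ?thesis by (intro measurable_completion borel_measurable_times_ennreal borel_measurable_indicator) auto
  qed
  have "(\<integral>\<^sup>+x. indicator (ball 0 R) x * F (x /\<^sub>R \<epsilon>) \<partial>lborel) = (\<integral>\<^sup>+x. indicator (ball 0 R) x * F (x /\<^sub>R \<epsilon>) \<partial>lebesgue)"
   by (rule nn_integral_completion[symmetric])
  also have "... = (\<integral>\<^sup>+x. indicator (ball 0 R) (\<epsilon> *R t + x) * F ((\<epsilon> *R t + x) /\<^sub>R \<epsilon>) \<partial>lebesgue)"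
   using nn_integral_lebesgue_affine[OF _ m, of 1 "\<epsilon> *R t"] by simp
  also have "... <= (\<integral>\<^sup>+x. indicator ?B' x * F (x /\<^sub>R \<epsilon> + t) \<partial>lebesgue)"
  proof (intro nn_integral_mono mult_mono)
   fix x
   have "(\<epsilon> *R t + x) /\<^sub>R \<epsilon> = x /\<^sub>R \<epsilon> + t" using e by (simp add: scaleR_add_right add.commute)
   then show "F ((\<epsilon> *R t + x) /\<^sub>R \<epsilon>) <= F (x /\<^sub>R \<epsilon> + t)" by simp
   have "norm (\<epsilon> *R t) <= 1 * real CARD('d)" unfolding norm_scaleR using e tile_norm[OF t] by (intro mult_mono) auto
   then have "norm (\<epsilon> *R t + x) < R ==> norm x < R + real CARD('d)"
    using norm_triangle_ineq4[of "\<epsilon> *R t + x" "\<epsilon> *R t"] by simp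
   then show "(indicator (ball 0 R) (\<epsilon> *R t + x) :: ennreal) <= indicator ?B' x" by (auto simp: indicator_def)
  qed auto
  also have "... = (\<integral>\<^sup>+x. indicator ?B' x * F (x /\<^sub>R \<epsilon> + t) \<partial>lborel)" by (rule nn_integral_completion)
  finally show ?thesis .
 qed
 have one: "(\<integral>\<^sup>+t. indicator tile t \<partial>(lborel :: (real^'d) measure)) = 1"
  using emeasure_tile[where 'd='d] by simp
 have "(\<integral>\<^sup>+x. indicator (ball 0 R) x * F (x /\<^sub>R \<epsilon>) \<partial>lborel)
   = (\<integral>\<^sup>+t. indicator tile (t::real^'d) * (\<integral>\<^sup>+x. indicator (ball 0 R) x * F (x /\<^sub>R \<epsilon>) \<partial>lborel) \<partial>lborel)"
  by (subst nn_integral_multc) (auto simp: one)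
 also have "... <= (\<integral>\<^sup>+t. indicator tile t * (\<integral>\<^sup>+x. indicator ?B' x * F (x /\<^sub>R \<epsilon> + t) \<partial>lborel) \<partial>lborel)"
 proof (rule nn_integral_mono)
  fix t :: "real^'d"
  show "indicator tile t * (\<integral>\<^sup>+x. indicator (ball 0 R) x * F (x /\<^sub>R \<epsilon>) \<partial>lborel)
    <= indicator tile t * (\<integral>\<^sup>+x. indicator ?B' x * F (x /\<^sub>R \<epsilon> + t) \<partial>lborel)"
   using le[of t] by (cases "t : tile") simp_all
 qed
 also have "... = emeasure lborel ?B' * (\<integral>\<^sup>+y. indicator tile y * F y \<partial>lborel)"
  by (rule nn_integral_oscillating_average[OF F per e(1)]) auto
 finally show ?thesis .
qed

section \<open>Oscillating functions converge weakly to their mean\<close>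

lemma scaled_measurable:
 assumes "f : borel_measurable lebesgue" "\<epsilon> > 0" shows "scaled \<epsilon> f : borel_measurable lebesgue"
 using measurable_lebesgue_affine[of "inverse \<epsilon>" f 0] assms by (simp add: scaled_def[abs_def])

lemma AE_scaled:
 assumes "AE y in lebesgue. P y" "\<epsilon> > 0" shows "AE x in lebesgue. P (x /\<^sub>R \<epsilon>)"
 using AE_lebesgue_affine[of "inverse \<epsilon>" P 0] assms by simp

text \<open>The translations by vectors of the cell move a ball by at most the diameter of the cell, so the
 averaging identity over a larger ball bounds the norm over the given one.\<close>

lemma L2_norm_scaled_bounded:
 fixes f :: "real^'d::finite => real"
 assumes f: "f : borel_measurable lebesgue" "cell_periodic f" "in_L2 unit_cell f"
 obtains C where "C >= 0" "!!\<epsilon>. 0 < \<epsilon> ==> \<epsilon> <= 1 ==> in_L2 (ball 0 R) (scaled \<epsilon> f) & L2_norm (ball 0 R) (scaled \<epsilon> f) <= C"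
proof -
 obtain f' where f': "f' : borel_measurable borel" "AE x in lebesgue. f x = f' x" using borel_representative[OF f(1)] by blast
 have [measurable]: "f' : borel_measurable borel" by (rule f')
 define F where "F x = ennreal ((f' x)^2)" for x
 have F: "F : borel_measurable borel" unfolding F_def[abs_def] by measurable
 have perF: "cell_periodic F" unfolding F_def[abs_def] by (rule cell_periodic_compose[OF cell_periodic_cong_AE[OF f(2) f'(2)]])
 have Qb: "(tile :: (real^'d) set) : sets borel" by (rule tile_borel)
 have "(\<integral>\<^sup>+y. indicator tile y * F y \<partial>lborel) = (\<integral>\<^sup>+y. indicator tile y * F y \<partial>lebesgue)"
  by (rule nn_integral_completion[symmetric])
 also have "... = (\<integral>\<^sup>+y. ennreal (indicator unit_cell y *R (norm (f y))^2) \<partial>lebesgue)"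
  by (rule nn_integral_cong_AE) (use AE_tile f'(2) in "eventually_elim, auto simp: indicator_def F_def")
 also have "... < \<infinity>"
 proof -
  have i: "integrable lebesgue (%y. indicator unit_cell y *R (norm (f y))^2)"
   unfolding integrable_lebesgue_on[OF unit_cell_facts(3), symmetric] using f(3) by (simp add: in_L2_def)
  show ?thesis by (subst nn_integral_eq_integral[OF i]) auto
 qed
 finally have "(\<integral>\<^sup>+y. indicator tile y * F y \<partial>lborel) < \<infinity>" .
 then have "emeasure lborel (ball (0::real^'d) (R + real CARD('d))) * (\<integral>\<^sup>+y. indicator tile y * F y \<partial>lborel) < \<infinity>"
  using emeasure_lborel_ball_finite[of "0::real^'d" "R + real CARD('d)"] by (simp add: ennreal_mult_less_top)
 then obtain M where M: "M >= 0" "emeasure lborel (ball (0::real^'d) (R + real CARD('d))) * (\<integral>\<^sup>+y. indicator tile y * F y \<partial>lborel) = ennreal M"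
  by (metis ennreal_cases infinity_ennreal_def less_irrefl)
 show ?thesis
 proof (rule that[of "sqrt M"])
  fix \<epsilon> :: real assume e: "0 < \<epsilon>" "\<epsilon> <= 1"
  have mB: "ball (0::real^'d) R : sets lebesgue" by auto
  have ms: "scaled \<epsilon> f : borel_measurable lebesgue" by (rule scaled_measurable[OF f(1) e(1)])
  have "(\<integral>\<^sup>+x. ennreal (indicator (ball 0 R) x *R (norm (scaled \<epsilon> f x))^2) \<partial>lebesgue)
    = (\<integral>\<^sup>+x. indicator (ball 0 R) x * F (x /\<^sub>R \<epsilon>) \<partial>lebesgue)"
   by (rule nn_integral_cong_AE)
    (use AE_scaled[OF f'(2) e(1)] in "eventually_elim, auto simp: indicator_def F_def scaled_def")
  also have "... = (\<integral>\<^sup>+x. indicator (ball 0 R) x * F (x /\<^sub>R \<epsilon>) \<partial>lborel)" by (rule nn_integral_completion)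
  also have "... <= ennreal M" unfolding M(2)[symmetric] by (rule nn_integral_oscillating_le[OF F perF e])
  finally have le: "(\<integral>\<^sup>+x. ennreal (indicator (ball 0 R) x *R (norm (scaled \<epsilon> f x))^2) \<partial>lebesgue) <= ennreal M" .
  have m2: "(%x. indicator (ball 0 R) x *R (norm (scaled \<epsilon> f x))^2) : borel_measurable lebesgue"
   using ms mB by measurable
  have int: "integrable lebesgue (%x. indicator (ball 0 R) x *R (norm (scaled \<epsilon> f x))^2)"
   by (rule integrableI_nonneg[OF m2]) (use le in "auto simp: le_less_trans")
  have "in_L2 (ball 0 R) (scaled \<epsilon> f)" unfolding in_L2_def integrable_lebesgue_on[OF mB]
   using int measurable_restrict_space1[OF ms] by auto
  moreover have "(LINT x|lebesgue. indicator (ball 0 R) x *R (norm (scaled \<epsilon> f x))^2) <= M"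
   using le M(1) by (subst (asm) nn_integral_eq_integral[OF int]) (auto simp: ennreal_le_iff)
  ultimately show "in_L2 (ball 0 R) (scaled \<epsilon> f) & L2_norm (ball 0 R) (scaled \<epsilon> f) <= sqrt M"
   unfolding L2_norm_def integral_lebesgue_on[OF mB] by (simp add: real_sqrt_le_mono)
 qed (use M in simp)
qed

lemma in_L2_locally_integrable:
 fixes f :: "real^'d::finite => 'b::euclidean_space"
 assumes S: "S : sets lebesgue" and f: "in_L2 S f" shows "locally_integrable S f"
 unfolding locally_integrable_def
proof (intro allI impI)
 fix K assume K: "compact K & K <= S"
 then have mK: "K : sets lebesgue" by (simp add: compact_imp_closed)
 have fK: "in_L2 K f" by (rule in_L2_mono[OF f S mK]) (use K in auto)
 then have m: "f : borel_measurable (lebesgue_on K)" unfolding in_L2_def by blast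
 have "in_L2 K (%x. norm (f x))" by (rule in_L2_bound[OF mK fK, of _ 1]) (use m in auto)
 from integrable_bounded_in_L2[OF _ mK this] K have "integrable (lebesgue_on K) (%x. norm (f x))"
  by (simp add: integrable_lebesgue_on[OF mK] compact_imp_bounded)
 then show "integrable (lebesgue_on K) f" using integrable_norm_iff[OF m] by blast
qed

lemma scaled_locally_integrable:
 fixes f :: "real^'d::finite => real"
 assumes f: "f : borel_measurable lebesgue" "cell_periodic f" "in_L2 unit_cell f" and e: "0 < \<epsilon>" "\<epsilon> <= 1"
 shows "locally_integrable UNIV (scaled \<epsilon> f)"
 unfolding locally_integrable_def
proof (intro allI impI)
 fix K :: "(real^'d) set" assume K: "compact K & K <= UNIV"
 then obtain R where R: "!!x. x : K ==> norm x < R" using bounded_pos_less[of K] compact_imp_bounded by blast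
 obtain C where "in_L2 (ball 0 R) (scaled \<epsilon> f)" using L2_norm_scaled_bounded[OF f, of R] e by metis
 then have "locally_integrable (ball 0 R) (scaled \<epsilon> f)" by (intro in_L2_locally_integrable) auto
 then show "integrable (lebesgue_on K) (scaled \<epsilon> f)" unfolding locally_integrable_def using K R by force
qed

lemma nn_integral_cell_L1:
 fixes f :: "real^'d::finite => real"
 assumes f: "f : borel_measurable lebesgue" "in_L2 unit_cell f"
 shows "(\<integral>\<^sup>+y. indicator tile y * ennreal \<bar>f y\<bar> \<partial>lebesgue) < \<infinity>"
  "integrable lebesgue (%y. indicator tile y * f y)"
  "(LINT y|lebesgue. indicator tile y * f y) = (LINT y|lebesgue_on unit_cell. f y)"
proof -
 have i: "integrable lebesgue (%x. indicator unit_cell x *R f x)"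
  by (rule integrable_bounded_in_L2[OF unit_cell_facts(2,3) f(2)])
 have m: "(%y. indicator tile y * f y) : borel_measurable lebesgue"
  using f(1) tile_borel by (intro borel_measurable_times borel_measurable_indicator) auto
 have AE: "AE x in lebesgue. indicator unit_cell x *R f x = indicator tile x * f x"
  using AE_tile by eventually_elim (auto simp: indicator_def)
 show i2: "integrable lebesgue (%y. indicator tile y * f y)" by (rule integrable_cong_AE_imp[OF i m AE])
 show "(LINT y|lebesgue. indicator tile y * f y) = (LINT y|lebesgue_on unit_cell. f y)"
  unfolding integral_lebesgue_on[OF unit_cell_facts(3)] by (rule integral_cong_AE[symmetric]) (use i i2 AE in auto)
 have "(\<integral>\<^sup>+y. indicator tile y * ennreal \<bar>f y\<bar> \<partial>lebesgue) = (\<integral>\<^sup>+y. ennreal (norm (indicator tile y * f y)) \<partial>lebesgue)"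
  by (intro nn_integral_cong) (auto simp: indicator_def)
 then show "(\<integral>\<^sup>+y. indicator tile y * ennreal \<bar>f y\<bar> \<partial>lebesgue) < \<infinity>"
  using i2 by (simp add: integrable_iff_bounded)
qed

lemma integral_cell_shift:
 fixes f :: "real^'d::finite => real"
 assumes f: "f : borel_measurable lebesgue" "cell_periodic f" "in_L2 unit_cell f"
 shows "integrable lebesgue (%y. indicator tile y * f (y + s))"
  "(LINT y|lebesgue. indicator tile y * f (y + s)) = (LINT y|lebesgue_on unit_cell. f y)"
proof -
 have ms: "(%y. f (y + s)) : borel_measurable lebesgue" using measurable_lebesgue_affine[OF _ f(1), of 1 s] by (simp add: add.commute)
 have m: "(%y. indicator tile y * f (y + s)) : borel_measurable lebesgue"
  using ms tile_borel by (intro borel_measurable_times borel_measurable_indicator) auto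
 have shift: "(\<integral>\<^sup>+y. ennreal (indicator tile y * g (f (y + s))) \<partial>lebesgue) = (\<integral>\<^sup>+y. ennreal (indicator tile y * g (f y)) \<partial>lebesgue)"
  if [measurable]: "g : borel_measurable borel" for g :: "real => real"
 proof -
  have "(%y. ennreal (g (f y))) : borel_measurable lebesgue" using f(1) by measurable
  from nn_integral_cell_shift[OF this cell_periodic_compose[OF f(2)], of s]
  show ?thesis by (simp add: ennreal_mult' ennreal_indicator)
 qed
 have "(\<integral>\<^sup>+y. ennreal (norm (indicator tile y * f (y + s))) \<partial>lebesgue) = (\<integral>\<^sup>+y. ennreal (indicator tile y * \<bar>f (y + s)\<bar>) \<partial>lebesgue)"
  by (simp add: abs_mult)
 also have "... = (\<integral>\<^sup>+y. ennreal (indicator tile y * \<bar>f y\<bar>) \<partial>lebesgue)" by (rule shift) measurable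
 also have "... < \<infinity>" using nn_integral_cell_L1(1)[OF f(1,3)] by (simp add: ennreal_mult' ennreal_indicator)
 finally show i: "integrable lebesgue (%y. indicator tile y * f (y + s))" by (intro integrableI_bounded m)
 have "(LINT y|lebesgue. indicator tile y * f (y + s)) = (LINT y|lebesgue. indicator tile y * f y)"
  unfolding real_lebesgue_integral_def[OF i] real_lebesgue_integral_def[OF nn_integral_cell_L1(2)[OF f(1,3)]]
  using shift[of "%x. x"] shift[of uminus] by simp
 also have "... = (LINT y|lebesgue_on unit_cell. f y)" by (rule nn_integral_cell_L1(3)[OF f(1,3)])
 finally show "(LINT y|lebesgue. indicator tile y * f (y + s)) = (LINT y|lebesgue_on unit_cell. f y)" .
qed

text \<open>Average over all translations of the pattern.  Moving the translation by \<open>\<epsilon> t\<close> from the oscillating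
 function to \<open>\<phi>\<close> costs little, since \<open>\<phi>\<close> is uniformly continuous, and after the translations are
 integrated the pattern has become its mean.  Fubini's theorem requires a Borel representative.\<close>

lemma oscillating_integral_test_function:
 fixes f \<phi> :: "real^'d::finite => real"
 assumes f: "f : borel_measurable lebesgue" "cell_periodic f" "in_L2 unit_cell f"
  and \<phi>: "test_function UNIV \<phi>" and e: "!!m. 0 < \<epsilon> m" "!!m. \<epsilon> m <= 1" "\<epsilon> ----> 0"
 shows "(%m. LINT x|lebesgue. scaled (\<epsilon> m) f x * \<phi> x) ----> (LINT y|lebesgue_on unit_cell. f y) * (LINT x|lebesgue. \<phi> x)"
proof (rule LIMSEQ_I)
 fix r :: real assume r: "r > 0"
 obtain f' where f': "f' : borel_measurable borel" "AE x in lebesgue. f x = f' x" using borel_representative[OF f(1)] by blast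
 have [measurable]: "f' : borel_measurable borel" by (rule f')
 have f'm: "f' : borel_measurable lebesgue" by (rule measurable_completion) simp
 have per: "cell_periodic f'" by (rule cell_periodic_cong_AE[OF f(2) f'(2)])
 have f'L: "in_L2 unit_cell f'"
 proof (rule in_L2_bound[OF unit_cell_facts(3) f(3), of _ 1])
  show "f' : borel_measurable (lebesgue_on unit_cell)" by (rule measurable_restrict_space1[OF f'm])
  show "AE x in lebesgue_on unit_cell. norm (f' x) <= 1 * norm (f x)"
   unfolding AE_lebesgue_on[OF unit_cell_facts(3)] using f'(2) by eventually_elim simp
 qed
 define M where "M = (LINT y|lebesgue_on unit_cell. f y)"
 have M': "M = (LINT y|lebesgue_on unit_cell. f' y)"
  unfolding M_def nn_integral_cell_L1(3)[OF f(1,3), symmetric] nn_integral_cell_L1(3)[OF f'm f'L, symmetric]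
  by (rule integral_cong_AE)
   (use nn_integral_cell_L1(2)[OF f(1,3)] nn_integral_cell_L1(2)[OF f'm f'L] f'(2) in "auto elim: eventually_mono")
 have [measurable]: "(tile :: (real^'d) set) : sets borel" by (rule tile_borel)
 have \<phi>c: "continuous_on UNIV \<phi>" by (rule smooth_continuous_on[OF test_function_smooth[OF \<phi>]])
 have [measurable]: "\<phi> : borel_measurable borel" using \<phi>c by (rule borel_measurable_continuous_onI)
 obtain K where K: "compact K" "!!x. x ~: K ==> \<phi> x = 0" using test_function_support[OF \<phi>] by metis
 obtain R where R: "R > 0" "!!x. x : K ==> norm x < R" using compact_imp_bounded[OF K(1)] by (meson bounded_pos_less)
 obtain C where C: "C > 0" "!!x. norm (\<phi> x) <= C" using test_function_bounded[OF \<phi>] by metis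
 define n where "n = real CARD('d)"
 have n: "n > 0" unfolding n_def by simp
 define B where "B = ball (0::real^'d) (R + n)"
 have Bb[measurable]: "B : sets borel" unfolding B_def by auto
 define a where "a = (\<integral>\<^sup>+y. indicator tile y * ennreal \<bar>f' y\<bar> \<partial>lborel)"
 have afin: "a < \<infinity>" unfolding a_def using nn_integral_cell_L1(1)[OF f'm f'L] by (simp add: nn_integral_completion)
 have "emeasure lborel B * a < \<infinity>"
  using afin emeasure_lborel_ball_finite[of "0::real^'d" "R + n"] unfolding B_def by (simp add: ennreal_mult_less_top)
 then obtain V where V: "V >= 0" "emeasure lborel B * a = ennreal V" by (metis ennreal_cases infinity_ennreal_def less_irrefl)
 have avg: "(\<integral>\<^sup>+t. indicator tile t * (\<integral>\<^sup>+x. indicator B x * ennreal \<bar>f' (x /\<^sub>R \<epsilon> + t)\<bar> \<partial>lborel) \<partial>lborel) = ennreal V"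
  if "\<epsilon> > 0" for \<epsilon> unfolding V(2)[symmetric] a_def
  by (rule nn_integral_oscillating_average[OF _ cell_periodic_compose[OF per] that Bb]) measurable
 define w where "w = r / (2 * (V + 1))"
 have w: "w > 0" "w * V < r"
 proof -
  show "w > 0" unfolding w_def using r V by simp
  have "w * V <= w * (V + 1)" using \<open>w > 0\<close> by simp
  also have "w * (V + 1) = r / 2"
  proof -
   have "r / (2 * y) * y = r / 2" if "y ~= 0" for y :: real using that by simp
   from this[of "V + 1"] show ?thesis unfolding w_def using V by simp
  qed
  finally show "w * V < r" using r by linarith
 qed
 obtain d where d: "d > 0" "!!x y. dist x y < d ==> dist (\<phi> x) (\<phi> y) < w"
  using uniformly_continuous_compact_support[OF \<phi>c K w(1)] by blast
 have close: "\<bar>(LINT x|lebesgue. scaled \<epsilon> f x * \<phi> x) - M * (LINT x|lebesgue. \<phi> x)\<bar> <= w * V"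
  if e: "0 < \<epsilon>" "\<epsilon> <= 1" "\<epsilon> * n < d" for \<epsilon>
 proof -
  let ?h = "%t x. f' (x /\<^sub>R \<epsilon> + t)"
  let ?N = "%t. \<integral>\<^sup>+x. indicator B x * ennreal \<bar>?h t x\<bar> \<partial>lborel"
  have loc: "locally_integrable UNIV (scaled \<epsilon> f')" by (rule scaled_locally_integrable[OF f'm per f'L e(1,2)])
  define I where "I = (LINT x|lebesgue. scaled \<epsilon> f' x * \<phi> x)"
  have If: "(LINT x|lebesgue. scaled \<epsilon> f x * \<phi> x) = I" unfolding I_def
  proof (rule integral_cong_AE)
   show "(%x. scaled \<epsilon> f x * \<phi> x) : borel_measurable lebesgue" "(%x. scaled \<epsilon> f' x * \<phi> x) : borel_measurable lebesgue"
    using scaled_measurable[OF f(1) e(1)] scaled_measurable[OF f'm e(1)] test_function_measurable[OF \<phi>] by auto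
   show "AE x in lebesgue. scaled \<epsilon> f x * \<phi> x = scaled \<epsilon> f' x * \<phi> x"
    using AE_scaled[OF f'(2) e(1)] by eventually_elim (simp add: scaled_def)
  qed
  have tt: "test_function UNIV (%x. \<phi> (x + b))" for b using test_function_affine[OF \<phi>, of 1 b UNIV] by simp
  have i0: "integrable lebesgue (%x. ?h t x * \<phi> (x + b))" for t b
  proof -
   have "integrable lebesgue (%x. \<phi> (x + (b - \<epsilon> *R t)) *R scaled \<epsilon> f' x)" by (rule integrable_test_function_scaleR[OF tt loc])
   from integrable_lebesgue_affine[OF _ this, of 1 "\<epsilon> *R t"] show ?thesis
    using e(1) by (simp add: scaled_def scaleR_add_right algebra_simps)
  qed
  have It: "(LINT x|lebesgue. ?h t x * \<phi> (x + \<epsilon> *R t)) = I" for t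
  proof -
   have "(%x. scaled \<epsilon> f' x * \<phi> x) : borel_measurable lebesgue"
    using scaled_measurable[OF f'm e(1)] test_function_measurable[OF \<phi>] by auto
   from integral_lebesgue_affine[OF _ this, of 1 "\<epsilon> *R t"] show ?thesis
    unfolding I_def using e(1) by (simp add: scaled_def scaleR_add_right add.commute)
  qed
  define k where "k t = (LINT x|lborel. ?h t x * \<phi> x)" for t
  have klb: "k t = (LINT x|lebesgue. ?h t x * \<phi> x)" for t
   unfolding k_def by (rule integral_completion[symmetric]) measurable
  have sup: "\<phi> x ~= 0 ==> x : B" for x using K(2)[of x] R(2)[of x] n unfolding B_def by fastforce
  have prod_int: "integrable (lborel \<Otimes>\<^sub>M lborel) (%(t, x). indicator tile t * (?h t x * \<phi> x))"
  proof (rule integrableI_bounded)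
   show "(%(t, x). indicator tile t * (?h t x * \<phi> x)) : borel_measurable (lborel \<Otimes>\<^sub>M lborel)" by measurable
   have "(\<integral>\<^sup>+p. ennreal (norm (case p of (t, x) => indicator tile t * (?h t x * \<phi> x))) \<partial>(lborel \<Otimes>\<^sub>M lborel))
     = (\<integral>\<^sup>+t. (\<integral>\<^sup>+x. ennreal (norm (indicator tile t * (?h t x * \<phi> x))) \<partial>lborel) \<partial>lborel)"
    by (subst lborel.nn_integral_fst[symmetric]) (simp_all, measurable)
   also have "... <= (\<integral>\<^sup>+t. ennreal C * (indicator tile t * ?N t) \<partial>lborel)"
   proof (rule nn_integral_mono)
    fix t :: "real^'d"
    have "(\<integral>\<^sup>+x. ennreal (norm (indicator tile t * (?h t x * \<phi> x))) \<partial>lborel)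
     <= (\<integral>\<^sup>+x. (ennreal C * indicator tile t) * (indicator B x * ennreal \<bar>?h t x\<bar>) \<partial>lborel)"
    proof (rule nn_integral_mono)
     fix x
     have "norm (?h t x * \<phi> x) <= C * \<bar>?h t x\<bar>"
      using mult_right_mono[OF C(2)[of x], of "\<bar>?h t x\<bar>"] by (simp add: abs_mult mult.commute)
     then show "ennreal (norm (indicator tile t * (?h t x * \<phi> x)))
      <= (ennreal C * indicator tile t) * (indicator B x * ennreal \<bar>?h t x\<bar>)"
      using sup[of x] C(1) by (cases "\<phi> x = 0") (auto simp: indicator_def ennreal_mult[symmetric] intro!: ennreal_leI)
    qed
    also have "... = (ennreal C * indicator tile t) * ?N t" by (rule nn_integral_cmult) measurable
    finally show "(\<integral>\<^sup>+x. ennreal (norm (indicator tile t * (?h t x * \<phi> x))) \<partial>lborel)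
     <= ennreal C * (indicator tile t * ?N t)" by (simp add: mult.assoc)
   qed
   also have "... = ennreal C * ennreal V" unfolding avg[OF e(1), symmetric] by (rule nn_integral_cmult) measurable
   finally show "(\<integral>\<^sup>+p. ennreal (norm (case p of (t, x) => indicator tile t * (?h t x * \<phi> x))) \<partial>(lborel \<Otimes>\<^sub>M lborel)) < \<infinity>"
    by (rule le_less_trans) (simp add: ennreal_mult_less_top)
  qed
  have kQ: "(LINT t|lborel. indicator tile t * k t) = M * (LINT x|lebesgue. \<phi> x)"
  proof -
   have "(LINT t|lborel. indicator tile t * k t) = (LINT t|lborel. LINT x|lborel. indicator tile t * (?h t x * \<phi> x))"
    unfolding k_def by simp
   also have "... = (LINT x|lborel. LINT t|lborel. indicator tile t * (?h t x * \<phi> x))"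
    by (rule lborel_pair.Fubini_integral[OF prod_int, symmetric])
   also have "... = (LINT x|lborel. M * \<phi> x)"
   proof (rule Bochner_Integration.integral_cong[OF refl])
    fix x
    have "(LINT t|lborel. indicator tile t * (?h t x * \<phi> x)) = (LINT t|lborel. (indicator tile t * f' (t + x /\<^sub>R \<epsilon>)) * \<phi> x)"
     by (simp add: add.commute mult.assoc)
    also have "... = (LINT t|lborel. indicator tile t * f' (t + x /\<^sub>R \<epsilon>)) * \<phi> x" by simp
    also have "(LINT t|lborel. indicator tile t * f' (t + x /\<^sub>R \<epsilon>)) = (LINT t|lebesgue. indicator tile t * f' (t + x /\<^sub>R \<epsilon>))"
     by (rule integral_completion[symmetric]) measurable
    also have "... = M" unfolding M' by (rule integral_cell_shift(2)[OF f'm per f'L])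
    finally show "(LINT t|lborel. indicator tile t * (?h t x * \<phi> x)) = M * \<phi> x" .
   qed
   also have "... = M * (LINT x|lborel. \<phi> x)" by simp
   also have "(LINT x|lborel. \<phi> x) = (LINT x|lebesgue. \<phi> x)" by (rule integral_completion[symmetric]) measurable
   finally show ?thesis .
  qed
  have iQ: "integrable lborel (indicator tile :: real^'d => real)"
   using emeasure_tile[where 'd='d] by (intro integrable_real_indicator) auto
  have mQ: "(LINT t|lborel. indicator tile (t::real^'d) :: real) = 1"
   using emeasure_tile[where 'd='d] by (simp add: measure_def)
  have ik: "integrable lborel (%t. indicator tile t * k t)"
   using lborel_pair.integrable_fst'[OF prod_int] unfolding k_def by simp
  have "I - M * (LINT x|lebesgue. \<phi> x) = (LINT t|lborel. indicator tile t * I - indicator tile t * k t)"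
   using iQ ik mQ kQ by simp
  also have "... = (LINT t|lborel. indicator tile t * (I - k t))" by (simp add: right_diff_distrib)
  finally have eq: "I - M * (LINT x|lebesgue. \<phi> x) = (LINT t|lborel. indicator tile t * (I - k t))" .
  have "ennreal \<bar>I - M * (LINT x|lebesgue. \<phi> x)\<bar> <= (\<integral>\<^sup>+t. ennreal (norm (indicator tile t * (I - k t))) \<partial>lborel)"
   unfolding eq real_norm_def[symmetric] by (rule integral_norm_bound_ennreal) (use iQ ik in "simp add: right_diff_distrib")
  also have "... <= (\<integral>\<^sup>+t. ennreal w * (indicator tile t * ?N t) \<partial>lborel)"
  proof (rule nn_integral_mono)
   fix t :: "real^'d"
   show "ennreal (norm (indicator tile t * (I - k t))) <= ennreal w * (indicator tile t * ?N t)"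
   proof (cases "t : tile")
    case True
    have nt: "norm (\<epsilon> *R t) <= \<epsilon> * n" unfolding norm_scaleR n_def using e(1) tile_norm[OF True] by (intro mult_mono) auto
    have nt1: "norm (\<epsilon> *R t) <= n" using nt mult_right_mono[OF e(2), of n] n by linarith
    have pt: "\<bar>\<phi> (x + \<epsilon> *R t) - \<phi> x\<bar> <= w * indicator B x" for x
    proof (cases "x : B")
     case True
     have "dist (\<phi> (x + \<epsilon> *R t)) (\<phi> x) < w" by (rule d(2)) (use nt e(3) in "simp add: dist_norm")
     then show ?thesis using True by (simp add: dist_real_def)
    next
     case False
     have "norm (x + \<epsilon> *R t) >= R" using False nt1 norm_triangle_ineq4[of "x + \<epsilon> *R t" "\<epsilon> *R t"] unfolding B_def by simp
     then have "\<phi> (x + \<epsilon> *R t) = 0" using K(2) R(2) by (meson not_less)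
     moreover have "\<phi> x = 0" using sup False by blast
     ultimately show ?thesis using w(1) by (simp add: indicator_def)
    qed
    have i1: "integrable lebesgue (%x. ?h t x * \<phi> (x + \<epsilon> *R t))" by (rule i0)
    have i2: "integrable lebesgue (%x. ?h t x * \<phi> x)" using i0[of t 0] by simp
    have "I - k t = (LINT x|lebesgue. ?h t x * \<phi> (x + \<epsilon> *R t) - ?h t x * \<phi> x)"
     using i1 i2 by (simp add: It klb)
    then have "ennreal \<bar>I - k t\<bar> = ennreal (norm (LINT x|lebesgue. ?h t x * \<phi> (x + \<epsilon> *R t) - ?h t x * \<phi> x))" by simp
    also have "... <= (\<integral>\<^sup>+x. ennreal (norm (?h t x * \<phi> (x + \<epsilon> *R t) - ?h t x * \<phi> x)) \<partial>lebesgue)"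
     by (rule integral_norm_bound_ennreal[OF Bochner_Integration.integrable_diff[OF i1 i2]])
    also have "... <= (\<integral>\<^sup>+x. ennreal w * (indicator B x * ennreal \<bar>?h t x\<bar>) \<partial>lebesgue)"
    proof (rule nn_integral_mono)
     fix x
     have "norm (?h t x * \<phi> (x + \<epsilon> *R t) - ?h t x * \<phi> x) = \<bar>\<phi> (x + \<epsilon> *R t) - \<phi> x\<bar> * \<bar>?h t x\<bar>"
      unfolding right_diff_distrib[symmetric] real_norm_def abs_mult by (rule mult.commute)
     also have "... <= (w * indicator B x) * \<bar>?h t x\<bar>" by (rule mult_right_mono[OF pt]) simp
     finally have "ennreal (norm (?h t x * \<phi> (x + \<epsilon> *R t) - ?h t x * \<phi> x)) <= ennreal ((w * indicator B x) * \<bar>?h t x\<bar>)"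
      by (rule ennreal_leI)
     also have "... = ennreal w * (indicator B x * ennreal \<bar>?h t x\<bar>)"
      using w(1) by (simp add: indicator_def ennreal_mult)
     finally show "ennreal (norm (?h t x * \<phi> (x + \<epsilon> *R t) - ?h t x * \<phi> x)) <= ennreal w * (indicator B x * ennreal \<bar>?h t x\<bar>)" .
    qed
    also have "... = (\<integral>\<^sup>+x. ennreal w * (indicator B x * ennreal \<bar>?h t x\<bar>) \<partial>lborel)" by (rule nn_integral_completion)
    also have "... = ennreal w * ?N t" by (rule nn_integral_cmult) measurable
    finally show ?thesis using True by simp
   qed simp
  qed
  also have "... = ennreal w * ennreal V" unfolding avg[OF e(1), symmetric] by (rule nn_integral_cmult) measurable
  also have "... = ennreal (w * V)" using w V by (simp add: ennreal_mult)
  finally show ?thesis unfolding If using w V by (simp add: ennreal_le_iff)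
 qed
 have "(%m. \<epsilon> m * n) ----> 0 * n" by (intro tendsto_intros e(3))
 then have "\<forall>\<^sub>F m in sequentially. \<epsilon> m * n < d" using d(1) by (intro order_tendstoD(2)) auto
 then obtain N where "!!m. m >= N ==> \<epsilon> m * n < d" unfolding eventually_sequentially by blast
 then show "\<exists>N. \<forall>m\<ge>N. norm ((LINT x|lebesgue. scaled (\<epsilon> m) f x * \<phi> x) - (LINT y|lebesgue_on unit_cell. f y) * (LINT x|lebesgue. \<phi> x)) < r"
  using close[OF e(1,2)] w(2) unfolding M_def real_norm_def by (meson le_less_trans)
qed

lemma oscillating_weakly_tendsto:
 fixes f :: "real^'d::finite => real"
 assumes f: "f : borel_measurable lebesgue" "cell_periodic f" "in_L2 unit_cell f"
  and D: "open D" "bounded D" and e: "!!m. 0 < \<epsilon> m" "!!m. \<epsilon> m <= 1" "\<epsilon> ----> 0"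
 shows "in_L2 D (scaled (\<epsilon> m) f)"
  "\<exists>C. \<forall>m. L2_norm D (scaled (\<epsilon> m) f) <= C"
  "weakly_tendsto (%m. toL2 D (scaled (\<epsilon> m) f)) (toL2 D (%x. LINT y|lebesgue_on unit_cell. f y))"
proof -
 have mD: "D : sets lebesgue" using D by auto
 obtain R where R: "D <= ball 0 R" using D(2) bounded_subset_ballD by blast
 obtain C where C: "!!\<epsilon>. 0 < \<epsilon> ==> \<epsilon> <= 1 ==> in_L2 (ball 0 R) (scaled \<epsilon> f) & L2_norm (ball 0 R) (scaled \<epsilon> f) <= C"
  using L2_norm_scaled_bounded[OF f, of R] by metis
 show L: "in_L2 D (scaled (\<epsilon> m) f)" for m by (rule in_L2_mono[OF _ _ mD R]) (use C e in auto)
 have bd: "L2_norm D (scaled (\<epsilon> m) f) <= C" for m by (rule order_trans[OF L2_norm_mono[OF mD _ R]]) (use C e in auto)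
 then show "\<exists>C. \<forall>m. L2_norm D (scaled (\<epsilon> m) f) <= C" by blast
 have const: "in_L2 D (%x. c)" for c :: real
  unfolding in_L2_def integrable_lebesgue_on[OF mD] using integrable_indicator_bounded[OF D(2) mD] by simp
 show "weakly_tendsto (%m. toL2 D (scaled (\<epsilon> m) f)) (toL2 D (%x. LINT y|lebesgue_on unit_cell. f y))"
 proof (rule weakly_tendsto_toL2_if_tested[OF D(1) L const bd])
  fix \<phi> :: "real^'d => real" assume t: "test_function D \<phi>"
  have "(LINT x|lebesgue_on D. u x * \<phi> x) = (LINT x|lebesgue. u x * \<phi> x)" for u
   using integral_test_function_on[OF t mD, of u] by (simp add: mult.commute)
  note eq = this this[of "%x. 1", simplified]
  show "(%m. LINT x|lebesgue_on D. scaled (\<epsilon> m) f x * \<phi> x) ----> (LINT x|lebesgue_on D. (LINT y|lebesgue_on unit_cell. f y) * \<phi> x)"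
   unfolding eq(1) using oscillating_integral_test_function[OF f test_function_mono[OF t] e] by simp
 qed
qed

section \<open>Periodic correctors\<close>

lemma locally_integrable_measurable:
 fixes u :: "real^'d::finite => 'b::euclidean_space"
 assumes "locally_integrable UNIV u" shows "u : borel_measurable lebesgue"
proof (rule borel_measurable_LIMSEQ_metric)
 fix n :: nat
 have "integrable (lebesgue_on (cball (0::real^'d) (real n))) u" using assms unfolding locally_integrable_def by simp
 then show "(%x. indicator (cball 0 (real n)) x *R u x) : borel_measurable lebesgue"
  by (simp add: integrable_lebesgue_on borel_measurable_integrable)
next
 fix x :: "real^'d"
 obtain N :: nat where N: "norm x <= real N" using real_arch_simple by blast
 have "\<forall>\<^sub>F n in sequentially. indicator (cball 0 (real n)) x *R u x = u x"
  unfolding eventually_sequentially using N by (intro exI[of _ N]) auto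
 then show "(%n. indicator (cball 0 (real n)) x *R u x) ----> u x" by (rule tendsto_eventually)
qed

lemma locally_integrable_affine:
 fixes u :: "real^'d::finite => 'b::euclidean_space"
 assumes "locally_integrable UNIV u" "c ~= 0" shows "locally_integrable UNIV (%x. u (b + c *R x))"
 unfolding locally_integrable_def
proof (intro allI impI)
 fix K :: "(real^'d) set" assume K: "compact K & K <= UNIV"
 let ?L = "(%x. b + c *R x) ` K"
 have L: "compact ?L" using K by (intro compact_continuous_image continuous_intros) auto
 then have "integrable lebesgue (%x. indicator ?L x *R u x)"
  using assms(1) unfolding locally_integrable_def by (subst integrable_lebesgue_on[symmetric]) (auto simp: compact_imp_closed)
 from integrable_lebesgue_affine[OF assms(2) this, of b]
 have "integrable lebesgue (%x. indicator ?L (b + c *R x) *R u (b + c *R x))" .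
 moreover have "b + c *R x : ?L \<longleftrightarrow> x : K" for x using assms(2) by auto
 then have "(%x. indicator ?L (b + c *R x) :: real) = indicator K" by (auto simp: indicator_def)
 ultimately have "integrable lebesgue (%x. indicator K x *R u (b + c *R x))" by (metis (no_types, lifting) ext)
 then show "integrable (lebesgue_on K) (%x. u (b + c *R x))" using K by (simp add: integrable_lebesgue_on compact_imp_closed)
qed

lemma has_weak_gradient_affine:
 fixes u :: "real^'d::finite => real"
 assumes u: "has_weak_gradient UNIV u g" and c: "c ~= 0"
 shows "has_weak_gradient UNIV (%x. u (b + c *R x)) (%x. c *R g (b + c *R x))"
proof -
 note l = has_weak_gradientD(1,2)[OF u open_UNIV]
 have "(LINT x|lebesgue. partial_deriv i \<phi> x *R u (b + c *R x)) = - (LINT x|lebesgue. \<phi> x *R ((c *R g (b + c *R x)) $ i))"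
  if t: "test_function UNIV \<phi>" for \<phi> i
 proof -
  let ?\<phi> = "%y. \<phi> ((1 / c) *R y + - (1 / c) *R b)"
  have t': "test_function UNIV ?\<phi>" by (rule test_function_affine[OF t]) (use c in auto)
  have pd: "partial_deriv i ?\<phi> = (%y. (1 / c) *R partial_deriv i \<phi> ((1 / c) *R y + - (1 / c) *R b))"
   by (rule partial_deriv_affine[OF smooth_differentiable[OF test_function_smooth[OF t]]])
  have arg: "(1 / c) *R (b + c *R x) + - (1 / c) *R b = x" for x using c by (simp add: scaleR_add_right)
  have i1: "integrable lebesgue (%y. partial_deriv i ?\<phi> y *R u y)"
   by (rule integrable_test_function_scaleR[OF test_function_partial_deriv[OF t'] l(1)])
  have i2: "integrable lebesgue (%y. ?\<phi> y *R (g y $ i))"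
   by (rule integrable_test_function_scaleR[OF t' locally_integrable_component[OF l(2)]])
  have "(LINT y|lebesgue. partial_deriv i ?\<phi> y *R u y) = - (LINT y|lebesgue. ?\<phi> y *R (g y $ i))"
   by (rule has_weak_gradientD(3)[OF u open_UNIV t'])
  then have "(\<bar>c\<bar> ^ DIM(real^'d)) *R (LINT x|lebesgue. partial_deriv i ?\<phi> (b + c *R x) *R u (b + c *R x)) =
   (\<bar>c\<bar> ^ DIM(real^'d)) *R (- (LINT x|lebesgue. ?\<phi> (b + c *R x) *R (g (b + c *R x) $ i)))"
   unfolding integral_lebesgue_affine[OF c borel_measurable_integrable[OF i1], of b]
    integral_lebesgue_affine[OF c borel_measurable_integrable[OF i2], of b] scaleR_minus_right .
  moreover have "\<bar>c\<bar> ^ DIM(real^'d) ~= 0" using c by simp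
  ultimately have "(LINT x|lebesgue. partial_deriv i ?\<phi> (b + c *R x) *R u (b + c *R x)) =
   - (LINT x|lebesgue. ?\<phi> (b + c *R x) *R (g (b + c *R x) $ i))" by (simp only: scaleR_cancel_left) blast
  then have "(1 / c) * (LINT x|lebesgue. partial_deriv i \<phi> x * u (b + c *R x)) = - (LINT x|lebesgue. \<phi> x * (g (b + c *R x) $ i))"
   unfolding pd arg by (simp add: mult.assoc)
  then have "(LINT x|lebesgue. partial_deriv i \<phi> x * u (b + c *R x)) = - (c * (LINT x|lebesgue. \<phi> x * (g (b + c *R x) $ i)))"
   using c by (simp add: field_simps)
  also have "c * (LINT x|lebesgue. \<phi> x * (g (b + c *R x) $ i)) = (LINT x|lebesgue. \<phi> x *R ((c *R g (b + c *R x)) $ i))"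
   by (subst integral_mult_right_zero[symmetric]) (simp add: mult_ac)
  finally show ?thesis by simp
 qed
 moreover have "locally_integrable UNIV (%x. c *R g (b + c *R x))"
  by (rule locally_integrable_bounded_linear[OF bounded_linear_scaleR_right locally_integrable_affine[OF l(2) c]])
 ultimately show ?thesis unfolding has_weak_gradient_iff[OF open_UNIV] using locally_integrable_affine[OF l(1) c] by blast
qed

lemma cell_periodic_weak_gradient:
 fixes u :: "real^'d::finite => real"
 assumes u: "has_weak_gradient UNIV u g" and per: "cell_periodic u"
 shows "cell_periodic g"
 unfolding cell_periodic_def
proof
 fix i
 have "has_weak_gradient UNIV (%x. u (axis i 1 + 1 *R x)) (%x. 1 *R g (axis i 1 + 1 *R x))"
  by (rule has_weak_gradient_affine[OF u]) simp
 then have s: "has_weak_gradient UNIV (%x. u (x + axis i 1)) (%x. g (x + axis i 1))" by (simp add: add.commute)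
 have "AE x in lebesgue_on UNIV. u (x + axis i 1) = u x" using per unfolding cell_periodic_def lebesgue_on_UNIV_eq by blast
 from weak_gradient_AE_unique[OF open_UNIV s u this] show "AE y in lebesgue. g (y + axis i 1) = g y" unfolding lebesgue_on_UNIV_eq .
qed

text \<open>Periodization of test functions.  The sum has locally finitely many nonzero terms.\<close>

definition periodization :: "(real^'d::finite => real) => real^'d => real" where
 "periodization f y = (\<Sum>z | z : lattice & f (y + z) ~= 0. f (y + z))"

lemma finite_lattice_ball: "finite {z : lattice. norm (z :: real^'d::finite) <= r}"
proof -
 let ?I = "{- \<lceil>r\<rceil>..\<lceil>r\<rceil>}"
 have "{z : lattice. norm (z :: real^'d) <= r} <= (%k. \<chi> i. of_int (k i)) ` (PiE UNIV (%_. ?I))"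
 proof
  fix z :: "real^'d" assume "z : {z : lattice. norm z <= r}"
  then obtain k where k: "z = (\<chi> i. of_int (k i))" "norm z <= r" unfolding lattice_def by auto
  have "k i : ?I" for i
  proof -
   have "\<bar>of_int (k i) :: real\<bar> <= r" using component_le_norm_cart[of z i] k by simp
   then have "of_int (k i) <= r" "- of_int (k i) <= r" by auto
   then have "k i <= \<lceil>r\<rceil>" "- k i <= \<lceil>r\<rceil>"
    by (metis ceiling_mono ceiling_of_int, metis ceiling_mono ceiling_of_int of_int_minus)
   then show ?thesis by simp
  qed
  then have "k : PiE UNIV (%_. ?I)" by (simp add: PiE_def Pi_def)
  then show "z : (%k. \<chi> i. of_int (k i)) ` (PiE UNIV (%_. ?I))" using k(1) by blast
 qed
 moreover have "finite (PiE (UNIV :: 'd set) (%_. ?I))" by (intro finite_PiE) auto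
 ultimately show ?thesis by (meson finite_imageI finite_subset)
qed

lemma periodization_eq_sum:
 assumes "finite Z" "Z <= lattice" "!!z. z : lattice ==> f (y + z) ~= 0 ==> z : Z"
 shows "periodization f y = (\<Sum>z\<in>Z. f (y + z))"
 unfolding periodization_def by (rule sum.mono_neutral_left) (use assms in auto)

lemma periodization_local:
 assumes R: "!!x. f x ~= 0 ==> norm x <= R" and y: "norm y <= r"
 shows "periodization f y = (\<Sum>z | z : lattice & norm z <= R + r. f (y + z))"
proof (rule periodization_eq_sum[OF finite_lattice_ball])
 fix z assume "z : lattice" "f (y + z) ~= 0"
 then show "z : {z : lattice. norm z <= R + r}" using R[of "y + z"] norm_triangle_ineq4[of "y + z" y] y by simp
qed auto

lemma periodization_shift:
 assumes "a : lattice" shows "periodization f (y + a) = periodization f y"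
 unfolding periodization_def by (rule sum.reindex_bij_witness[of _ "%z. z - a" "%z. z + a"])
  (use assms lattice_add lattice_add[OF _ lattice_uminus[OF assms]] in "auto simp: add_ac")

lemma test_function_radius:
 assumes "test_function S f" obtains R where "R > 0" "!!x. f x ~= 0 ==> norm x <= R"
proof -
 obtain K where "compact K" "!!x. x ~: K ==> f x = 0" using test_function_support[OF assms] by metis
 then show ?thesis using that by (metis bounded_pos compact_imp_bounded)
qed

lemma periodization_has_derivative:
 assumes f: "test_function UNIV f"
 shows "(periodization f has_derivative (%h. \<Sum>i\<in>UNIV. h $ i *R periodization (partial_deriv i f) x)) (at x)"
proof -
 obtain R where R: "R > 0" "!!x. f x ~= 0 ==> norm x <= R" using test_function_radius[OF f] by blast
 have R': "norm x <= R" if "partial_deriv i f x ~= 0" for i x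
  using partial_deriv_zero_off_closed[of "cball 0 R" f x i] that R(2) by fastforce
 define Z where "Z = {z : lattice. norm (z :: real^'a) <= R + (norm x + 1)}"
 have d: "((%y. \<Sum>z\<in>Z. f (y + z)) has_derivative (%h. \<Sum>z\<in>Z. \<Sum>i\<in>UNIV. h $ i *R partial_deriv i f (x + z))) (at x)"
 proof (rule has_derivative_sum)
  fix z
  have "((%y. y + z) has_derivative (%h. h)) (at x)" by (auto intro!: derivative_eq_intros)
  from has_derivative_compose[OF this has_derivative_partial_deriv[OF smooth_differentiable[OF test_function_smooth[OF f]]]]
  show "((%y. f (y + z)) has_derivative (%h. \<Sum>i\<in>UNIV. h $ i *R partial_deriv i f (x + z))) (at x)" .
 qed
 have "(periodization f has_derivative (%h. \<Sum>z\<in>Z. \<Sum>i\<in>UNIV. h $ i *R partial_deriv i f (x + z))) (at x)"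
 proof (rule has_derivative_transform_within_open[OF d, of "ball x 1"])
  fix y assume "y : ball x 1"
  then have "norm y <= norm x + 1" using norm_triangle_sub[of y x] by (simp add: dist_norm norm_minus_commute)
  then show "(\<Sum>z\<in>Z. f (y + z)) = periodization f y" unfolding Z_def using periodization_local[OF R(2)] by simp
 qed auto
 moreover have "(\<Sum>z\<in>Z. \<Sum>i\<in>UNIV. h $ i *R partial_deriv i f (x + z)) = (\<Sum>i\<in>UNIV. h $ i *R periodization (partial_deriv i f) x)" for h
 proof -
  have "periodization (partial_deriv i f) x = (\<Sum>z\<in>Z. partial_deriv i f (x + z))" for i
   unfolding Z_def by (rule periodization_local[OF R']) auto
  then show ?thesis by (subst sum.swap) (simp add: sum_distrib_left)
 qed
 ultimately show ?thesis by simp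
qed

lemma partial_deriv_periodization:
 assumes "test_function UNIV f" shows "partial_deriv i (periodization f) = periodization (partial_deriv i f)"
proof
 fix x
 have "(\<Sum>k\<in>UNIV. axis i 1 $ k *R c k) = c i" for c :: "'a => real"
  by (simp add: axis_def if_distrib[of "%a. a * _"] cong: if_cong)
 then show "partial_deriv i (periodization f) x = periodization (partial_deriv i f) x"
  unfolding partial_deriv_eqI[OF periodization_has_derivative[OF assms]] .
qed

lemma smooth_periodization:
 assumes "test_function UNIV f" shows "smooth (periodization f)"
proof (rule smooth_coinduct[of "%h. \<exists>f. test_function UNIV f & h = periodization f"])
 fix h assume "\<exists>f. test_function UNIV f & h = periodization f"
 then obtain f where f: "test_function UNIV f" "h = periodization f" by blast
 then show "(\<forall>x. h differentiable (at x)) & (\<forall>i. \<exists>f. test_function UNIV f & partial_deriv i h = periodization f)"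
  using partial_deriv_periodization[OF f(1)] test_function_partial_deriv[OF f(1)] periodization_has_derivative[OF f(1)]
  unfolding differentiable_def by blast
qed (use assms in blast)

lemma continuous_in_L2_bounded:
 fixes u :: "real^'d::finite => 'b::euclidean_space"
 assumes c: "continuous_on UNIV u" and S: "bounded S" "S : sets lebesgue" shows "in_L2 S u"
proof -
 obtain a where a: "S <= cbox (- a) a" using bounded_subset_cbox_symmetric[OF S(1)] by blast
 have m: "cbox (- a) a : sets lebesgue" by auto
 have "locally_integrable UNIV (%x. (norm (u x))^2)" by (rule continuous_locally_integrable) (intro continuous_intros c)
 then have "integrable (lebesgue_on (cbox (- a) a)) (%x. (norm (u x))^2)" unfolding locally_integrable_def by simp
 then have "in_L2 (cbox (- a) a) u"
  unfolding in_L2_def using continuous_borel_measurable_lebesgue[OF c] measurable_restrict_space1 by blast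
 then show ?thesis by (rule in_L2_mono[OF _ m S(2) a])
qed

lemma in_H1_per_periodization:
 assumes f: "test_function UNIV f"
 shows "in_H1_per (periodization f)"
  "AE x in lebesgue. weak_gradient UNIV (periodization f) x = (\<chi> i. periodization (partial_deriv i f) x)"
proof -
 have wg: "has_weak_gradient UNIV (periodization f) (%x. \<chi> i. periodization (partial_deriv i f) x)"
  using has_weak_gradient_smooth[OF smooth_periodization[OF f] open_UNIV] by (simp add: partial_deriv_periodization[OF f])
 have c: "continuous_on UNIV (%x. \<chi> i. periodization (partial_deriv i f) x)"
  by (intro continuous_on_vec_lambda smooth_continuous_on smooth_periodization test_function_partial_deriv f)
 have "cell_periodic (periodization f)" unfolding cell_periodic_def by (simp add: periodization_shift[OF lattice_axis])
 then show "in_H1_per (periodization f)" unfolding in_H1_per_def using wg continuous_in_L2_bounded[OF c unit_cell_facts(2,3)]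
   continuous_in_L2_bounded[OF smooth_continuous_on[OF smooth_periodization[OF f]] unit_cell_facts(2,3)] by blast
 show "AE x in lebesgue. weak_gradient UNIV (periodization f) x = (\<chi> i. periodization (partial_deriv i f) x)"
  using weak_gradient_AE_eq[OF open_UNIV wg] unfolding lebesgue_on_UNIV_eq .
qed

lemma in_L2_component:
 fixes v :: "real^'d::finite => real^'n::finite"
 assumes "S : sets lebesgue" "in_L2 S v" shows "in_L2 S (%x. v x $ i)"
proof (rule in_L2_bound[OF assms, of _ 1])
 have "v : borel_measurable (lebesgue_on S)" using assms(2) by (simp add: in_L2_def)
 then show "(%x. v x $ i) : borel_measurable (lebesgue_on S)"
  by (rule measurable_compose[OF _ borel_measurable_continuous_onI[OF linear_continuous_on[OF bounded_linear_vec_nth]]])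
qed (auto simp: component_le_norm_cart)

lemma measurable_component:
 fixes v :: "'a => real^'n::finite"
 assumes "v : borel_measurable M" shows "(%x. v x $ i) : borel_measurable M"
 by (rule measurable_compose[OF assms borel_measurable_continuous_onI[OF linear_continuous_on[OF bounded_linear_vec_nth]]])

text \<open>A periodic field that is orthogonal to all periodic gradients has zero divergence on the
 whole space: test with the periodization of a test function and unfold the sum over the lattice.\<close>

lemma periodic_divergence_free:
 fixes B :: "real^'d::finite => real^'d"
 assumes B: "B : borel_measurable lebesgue" "cell_periodic B" "in_L2 unit_cell B"
  and orth: "!!\<phi>. in_H1_per \<phi> ==> (LINT y|lebesgue_on unit_cell. B y \<bullet> weak_gradient UNIV \<phi> y) = 0"
  and f: "test_function UNIV f"
 shows "(LINT x|lebesgue. B x \<bullet> (\<chi> i. partial_deriv i f x)) = 0"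
proof -
 have mY: "unit_cell : sets lebesgue" by (rule unit_cell_facts)
 have Q: "(tile :: (real^'d) set) : sets lebesgue" using tile_borel by auto
 let ?g = "%x. (\<chi> i. partial_deriv i f x) :: real^'d"
 obtain R where R: "R > 0" "!!x. f x ~= 0 ==> norm x <= R" using test_function_radius[OF f] by blast
 have R': "norm x <= R" if "partial_deriv i f x ~= 0" for i x
  using partial_deriv_zero_off_closed[of "cball 0 R" f x i] that R(2) by fastforce
 have gR: "norm x <= R" if "?g x ~= 0" for x using that R' by (auto simp: vec_eq_iff)
 define n where "n = real CARD('d)"
 define Z where "Z = {z : lattice. norm (z :: real^'d) <= R + n}"
 have Z: "finite Z" "Z <= lattice" unfolding Z_def by (rule finite_lattice_ball) auto
 have per_eq: "(\<chi> i. periodization (partial_deriv i f) y) = (\<Sum>z\<in>Z. ?g (y + z))" if "y : tile" for y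
  using periodization_local[OF R' tile_norm[OF that]] by (simp add: vec_eq_iff Z_def n_def sum_component)
 have Bc: "(%y. B y $ i) : borel_measurable lebesgue" "cell_periodic (%y. B y $ i)" "in_L2 unit_cell (%y. B y $ i)" for i
  using measurable_component[OF B(1)] cell_periodic_compose[OF B(2), of "%v. v $ i"] in_L2_component[OF mY B(3)] by auto
 have Bloc: "locally_integrable UNIV (%y. B y $ i)" for i
  using scaled_locally_integrable[OF Bc[of i], of 1] by (simp add: scaled_def[abs_def])
 have i1: "integrable lebesgue (%x. B x \<bullet> ?g x)" unfolding inner_vec_def
  using integrable_test_function_scaleR[OF test_function_partial_deriv[OF f] Bloc] by (auto simp: mult.commute)
 have iz: "integrable lebesgue (%x. indicator tile (x - z) * (B x \<bullet> ?g x))" for z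
 proof -
  have "(%x. indicator tile (x - z) :: real) : borel_measurable lebesgue"
   using measurable_lebesgue_affine[of 1 "indicator tile" "- z"] Q by simp
  then show ?thesis using integrable_bounded_scaleR[OF i1, of _ 1] by (auto simp: indicator_def)
 qed
 have shift: "integrable lebesgue (%y. indicator tile y * (B y \<bullet> ?g (y + z)))"
  "(LINT y|lebesgue. indicator tile y * (B y \<bullet> ?g (y + z))) = (LINT x|lebesgue. indicator tile (x - z) * (B x \<bullet> ?g x))"
  if z: "z : Z" for z
 proof -
  have "AE y in lebesgue. B (y + z) = B y" using cell_periodic_lattice_shift[OF B(2)] z Z(2) by blast
  then have AE: "AE y in lebesgue. indicator tile y * (B (y + z) \<bullet> ?g (y + z)) = indicator tile y * (B y \<bullet> ?g (y + z))"
   by eventually_elim simp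
  have i3: "integrable lebesgue (%y. indicator tile y * (B (y + z) \<bullet> ?g (y + z)))"
   using integrable_lebesgue_affine[OF _ iz[of z], of 1 z] by (simp add: add.commute)
  have "(%y. ?g (y + z)) : borel_measurable lebesgue" by (intro continuous_borel_measurable_lebesgue continuous_on_vec_lambda
     continuous_on_compose2[OF smooth_continuous_on[OF smooth_partial_deriv[OF test_function_smooth[OF f]], of UNIV]] continuous_intros) auto
  then have m: "(%y. indicator tile y * (B y \<bullet> ?g (y + z))) : borel_measurable lebesgue" using B(1) Q by measurable
  show "integrable lebesgue (%y. indicator tile y * (B y \<bullet> ?g (y + z)))" by (rule integrable_cong_AE_imp[OF i3 m AE])
  have "(LINT y|lebesgue. indicator tile y * (B y \<bullet> ?g (y + z))) = (LINT y|lebesgue. indicator tile y * (B (y + z) \<bullet> ?g (y + z)))"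
   by (rule integral_cong_AE[symmetric]) (use i3 m AE in auto)
  also have "... = (LINT x|lebesgue. indicator tile (x - z) * (B x \<bullet> ?g x))"
   using integral_lebesgue_affine[OF _ borel_measurable_integrable[OF iz[of z]], of 1 z] by (simp add: add.commute)
  finally show "(LINT y|lebesgue. indicator tile y * (B y \<bullet> ?g (y + z))) = (LINT x|lebesgue. indicator tile (x - z) * (B x \<bullet> ?g x))" .
 qed
 have one: "(\<Sum>z\<in>Z. indicator tile (x - z) * (B x \<bullet> ?g x)) = B x \<bullet> ?g x" for x
 proof (cases "?g x = 0")
  case False
  have "x - lattice_point x : tile" using tile_shift_iff[OF lattice_point_in_lattice] by blast
  from tile_norm[OF this] have "norm (lattice_point x) <= R + n"
   using gR[OF False] norm_triangle_ineq4[of x "x - lattice_point x"] unfolding n_def by simp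
  then have "lattice_point x : Z" unfolding Z_def using lattice_point_in_lattice by blast
  moreover have "indicator tile (x - z) * (B x \<bullet> ?g x) = (if z = lattice_point x then B x \<bullet> ?g x else 0)" if "z : Z" for z
   using tile_shift_iff[of z x] that Z(2) by (auto simp: indicator_def)
  ultimately show ?thesis using Z(1) by (simp cong: sum.cong)
 qed simp
 have "(LINT x|lebesgue. B x \<bullet> ?g x) = (LINT x|lebesgue. (\<Sum>z\<in>Z. indicator tile (x - z) * (B x \<bullet> ?g x)))"
  by (simp only: one)
 also have "... = (\<Sum>z\<in>Z. LINT x|lebesgue. indicator tile (x - z) * (B x \<bullet> ?g x))"
  by (rule Bochner_Integration.integral_sum) (rule iz)
 also have "... = (\<Sum>z\<in>Z. LINT y|lebesgue. indicator tile y * (B y \<bullet> ?g (y + z)))"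
  by (intro sum.cong refl shift(2)[symmetric])
 also have "... = (LINT y|lebesgue. (\<Sum>z\<in>Z. indicator tile y * (B y \<bullet> ?g (y + z))))"
  by (rule Bochner_Integration.integral_sum[symmetric]) (rule shift(1))
 also have "... = (LINT y|lebesgue. indicator unit_cell y *R (B y \<bullet> weak_gradient UNIV (periodization f) y))"
 proof (rule integral_cong_AE)
  have hg: "has_weak_gradient UNIV (periodization f) (weak_gradient UNIV (periodization f))"
   using has_weak_gradient_weak_gradient[OF has_weak_gradient_smooth[OF smooth_periodization[OF f] open_UNIV]] .
  have "weak_gradient UNIV (periodization f) : borel_measurable lebesgue"
   by (rule locally_integrable_measurable[OF has_weak_gradientD(2)[OF hg open_UNIV]])
  then show "(%y. indicator unit_cell y *R (B y \<bullet> weak_gradient UNIV (periodization f) y)) : borel_measurable lebesgue"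
   using B(1) mY by (intro borel_measurable_scaleR borel_measurable_indicator borel_measurable_inner)
  show "(%y. \<Sum>z\<in>Z. indicator tile y * (B y \<bullet> ?g (y + z))) : borel_measurable lebesgue"
   by (intro borel_measurable_sum borel_measurable_integrable shift(1))
  show "AE y in lebesgue. (\<Sum>z\<in>Z. indicator tile y * (B y \<bullet> ?g (y + z))) =
   indicator unit_cell y *R (B y \<bullet> weak_gradient UNIV (periodization f) y)"
   using AE_tile in_H1_per_periodization(2)[OF f] by eventually_elim (auto simp: indicator_def per_eq inner_sum_right)
 qed
 also have "... = 0" using orth[OF in_H1_per_periodization(1)[OF f]] by (simp add: integral_lebesgue_on[OF mY])
 finally show ?thesis .
qed

lemma scaled_divergence_free:
 fixes B :: "real^'d::finite => real^'d"
 assumes B: "B : borel_measurable lebesgue"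
  and div: "!!f. test_function UNIV f ==> (LINT x|lebesgue. B x \<bullet> (\<chi> i. partial_deriv i f x)) = 0"
  and e: "\<epsilon> > 0" and f: "test_function UNIV f"
 shows "(LINT x|lebesgue. scaled \<epsilon> B x \<bullet> (\<chi> i. partial_deriv i f x)) = 0"
proof -
 let ?f = "%y. f (\<epsilon> *R y + 0)"
 have t: "test_function UNIV ?f" by (rule test_function_affine[OF f]) (use e in auto)
 have pd: "partial_deriv i ?f y = \<epsilon> *R partial_deriv i f (\<epsilon> *R y + 0)" for i y
  by (rule fun_cong[OF partial_deriv_affine[OF smooth_differentiable[OF test_function_smooth[OF f]]]])
 have "(%x. \<chi> i. partial_deriv i f x) : borel_measurable lebesgue"
  by (intro continuous_borel_measurable_lebesgue continuous_on_vec_lambda smooth_continuous_on smooth_partial_deriv test_function_smooth[OF f])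
 then have m: "(%x. scaled \<epsilon> B x \<bullet> (\<chi> i. partial_deriv i f x)) : borel_measurable lebesgue"
  using scaled_measurable[OF B e] by (rule borel_measurable_inner[rotated])
 have "(LINT y|lebesgue. B y \<bullet> (\<chi> i. partial_deriv i ?f y)) = 0" by (rule div[OF t])
 moreover have "B y \<bullet> (\<chi> i. partial_deriv i ?f y) = \<epsilon> * (B y \<bullet> (\<chi> i. partial_deriv i f (\<epsilon> *R y)))" for y
  unfolding pd inner_vec_def by (simp add: sum_distrib_left mult_ac)
 ultimately have "(LINT y|lebesgue. B y \<bullet> (\<chi> i. partial_deriv i f (\<epsilon> *R y))) = 0" using e by simp
 then show ?thesis using integral_lebesgue_affine[OF _ m, of \<epsilon> 0] e by (simp add: scaled_def)
qed

section \<open>Identification of the homogenized flux\<close>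

lemma norm_matrix_vector_le: "norm ((M :: real^'n::finite^'m::finite) *v x) <= norm M * norm x"
proof -
 have "norm (M *v x) = L2_set (%i. norm ((M *v x) $ i)) UNIV" by (simp add: norm_vec_def)
 also have "... <= L2_set (%i. norm (M $ i) * norm x) UNIV"
  by (intro L2_set_mono) (auto simp: matrix_vector_mul_component Cauchy_Schwarz_ineq2)
 also have "... = norm M * norm x" by (simp add: norm_vec_def L2_set_left_distrib)
 finally show ?thesis .
qed

lemma measurable_matrix_vector:
 fixes M :: "'a => real^'n::finite^'m::finite"
 assumes "M : borel_measurable N" "v : borel_measurable N"
 shows "(%x. M x *v v x) : borel_measurable N"
proof (rule borel_measurable_continuous_Pair[OF assms])
 show "continuous_on UNIV (%p. (fst p :: real^'n^'m) *v snd p)"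
  unfolding matrix_vector_mult_def by (intro continuous_on_vec_lambda continuous_intros)
qed

lemma inner_matrix_vector_sym:
 fixes M :: "real^'n::finite^'n"
 assumes "transpose M = M" shows "(M *v x) \<bullet> y = x \<bullet> (M *v y)"
proof -
 have "x \<bullet> (M *v y) = (x v* M) \<bullet> y" by (rule dot_lmul_matrix[symmetric])
 also have "x v* M = M *v x" using transpose_matrix_vector[of M x] assms by simp
 finally show ?thesis by simp
qed

lemma L2_norm_bound:
 fixes f :: "real^'d::finite => 'b::euclidean_space" and g :: "real^'d::finite => 'c::euclidean_space"
 assumes S: "S : sets lebesgue" and f: "in_L2 S f" and C: "C >= 0" and le: "AE x in lebesgue_on S. norm (g x) <= C * norm (f x)"
 shows "L2_norm S g <= C * L2_norm S f"
proof -
 have "(LINT x|lebesgue_on S. (norm (g x))^2) <= (LINT x|lebesgue_on S. C^2 * (norm (f x))^2)"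
 proof (rule integral_mono_AE')
  show "integrable (lebesgue_on S) (%x. C^2 * (norm (f x))^2)" using f by (auto simp: in_L2_def)
  show "AE x in lebesgue_on S. (norm (g x))^2 <= C^2 * (norm (f x))^2"
   using le by eventually_elim (auto simp: power_mult_distrib[symmetric] intro!: power_mono)
 qed auto
 then have "L2_norm S g <= sqrt (C^2 * (LINT x|lebesgue_on S. (norm (f x))^2))"
  unfolding L2_norm_def by (simp add: real_sqrt_le_mono)
 then show ?thesis using C by (simp add: real_sqrt_mult L2_norm_def)
qed

lemma weak_strong_inner_tendsto:
 fixes a h :: "nat => 'a::real_inner"
 assumes w: "weakly_tendsto a a0" and bd: "!!m. norm (a m) <= B" and h: "h ----> h0"
 shows "(%m. a m \<bullet> h m) ----> a0 \<bullet> h0"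
proof -
 have "(%m. a m \<bullet> (h m - h0)) ----> 0"
 proof (rule Lim_null_comparison)
  show "\<forall>\<^sub>F m in sequentially. norm (a m \<bullet> (h m - h0)) <= B * norm (h m - h0)" unfolding real_norm_def
   by (intro always_eventually allI order_trans[OF Cauchy_Schwarz_ineq2] mult_right_mono bd norm_ge_zero)
  have "(%m. B * norm (h m - h0)) ----> B * norm (h0 - h0)" by (intro tendsto_intros h)
  then show "(%m. B * norm (h m - h0)) ----> 0" by simp
 qed
 moreover have "(%m. a m \<bullet> h0) ----> a0 \<bullet> h0" using w unfolding weakly_tendsto_def by blast
 ultimately have "(%m. a m \<bullet> (h m - h0) + a m \<bullet> h0) ----> 0 + a0 \<bullet> h0" by (rule tendsto_add)
 then show ?thesis by (simp add: inner_diff_right)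
qed

lemma in_L2_scaleR_test_function:
 fixes \<theta> :: "real^'d::finite => 'b::euclidean_space" and c :: "real^'d => real"
 assumes S: "S : sets lebesgue" and t: "test_function T \<theta>" and c: "in_L2 S c"
 shows "in_L2 S (%x. c x *R \<theta> x)"
proof -
 obtain C where C: "!!x. norm (\<theta> x) <= C" using test_function_bounded[OF t] by metis
 show ?thesis
 proof (rule in_L2_bound[OF S c, of _ C])
  show "(%x. c x *R \<theta> x) : borel_measurable (lebesgue_on S)"
   by (rule borel_measurable_scaleR[OF _ measurable_restrict_space1[OF test_function_measurable[OF t]]])
    (use c in "simp add: in_L2_def")
  show "AE x in lebesgue_on S. norm (c x *R \<theta> x) <= C * norm (c x)"
  proof (intro AE_I2)
   fix x show "norm (c x *R \<theta> x) <= C * norm (c x)"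
    using mult_left_mono[OF C[of x], of "\<bar>c x\<bar>"] by (simp add: mult.commute)
  qed
 qed
qed

lemma tendsto_toL2_iff:
 assumes "S : sets lebesgue" "!!m. in_L2 S (f m)" "in_L2 S g"
 shows "(%m. toL2 S (f m)) ----> toL2 S g \<longleftrightarrow> (%m. L2_norm S (%x. f m x - g x)) ----> 0"
proof -
 have "L2_norm S (%x. f m x - g x) = dist (toL2 S (f m)) (toL2 S g)" for m
  using norm_toL2[OF assms(1) in_L2_diff[OF assms(1,2,3)], of m] assms by (simp add: dist_norm toL2_diff)
 note eq = this
 show ?thesis unfolding eq by (rule tendsto_dist_iff)
qed

lemma weak_strong_integral_tendsto:
 fixes a :: "nat => real^'d::finite => 'b::euclidean_space" and c :: "nat => real^'d => real"
 assumes S: "S : sets lebesgue" and a: "!!m. in_L2 S (a m)" "in_L2 S a0" "!!m. L2_norm S (a m) <= B"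
  and w: "weakly_tendsto (%m. toL2 S (a m)) (toL2 S a0)"
  and c: "!!m. in_L2 S (c m)" "in_L2 S c0" "(%m. L2_norm S (%x. c m x - c0 x)) ----> 0"
  and t: "test_function T \<theta>"
 shows "(%m. LINT x|lebesgue_on S. c m x * (a m x \<bullet> \<theta> x)) ----> (LINT x|lebesgue_on S. c0 x * (a0 x \<bullet> \<theta> x))"
proof -
 note ct = in_L2_scaleR_test_function[OF S t]
 obtain C where C: "C > 0" "!!x. norm (\<theta> x) <= C" using test_function_bounded[OF t] by metis
 have "(%m. L2_norm S (%x. c m x *R \<theta> x - c0 x *R \<theta> x)) ----> 0"
 proof (rule Lim_null_comparison)
  show "\<forall>\<^sub>F m in sequentially. norm (L2_norm S (%x. c m x *R \<theta> x - c0 x *R \<theta> x)) <= C * L2_norm S (%x. c m x - c0 x)"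
  proof (intro always_eventually allI)
   fix m
   have "norm (c m x *R \<theta> x - c0 x *R \<theta> x) <= C * norm (c m x - c0 x)" for x
    unfolding scaleR_diff_left[symmetric] norm_scaleR
    using mult_left_mono[OF C(2)[of x], of "\<bar>c m x - c0 x\<bar>"] by (simp add: mult.commute)
   then show "norm (L2_norm S (%x. c m x *R \<theta> x - c0 x *R \<theta> x)) <= C * L2_norm S (%x. c m x - c0 x)"
    using L2_norm_bound[OF S in_L2_diff[OF S c(1,2)], of C "%x. c m x *R \<theta> x - c0 x *R \<theta> x" m] C(1)
    by (simp add: L2_norm_nonneg)
  qed
  have "(%m. C * L2_norm S (%x. c m x - c0 x)) ----> C * 0" by (intro tendsto_intros c(3))
  then show "(%m. C * L2_norm S (%x. c m x - c0 x)) ----> 0" by simp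
 qed
 then have strong: "(%m. toL2 S (%x. c m x *R \<theta> x)) ----> toL2 S (%x. c0 x *R \<theta> x)"
  by (subst tendsto_toL2_iff[OF S ct[OF c(1)] ct[OF c(2)]])
 have "(%m. toL2 S (a m) \<bullet> toL2 S (%x. c m x *R \<theta> x)) ----> toL2 S a0 \<bullet> toL2 S (%x. c0 x *R \<theta> x)"
  by (rule weak_strong_inner_tendsto[OF w _ strong, of B]) (use a in "simp add: norm_toL2[OF S]")
 then show ?thesis by (simp add: inner_toL2[OF S] a ct c)
qed

lemma in_L2_linear:
 fixes f :: "real^'d::finite => 'b::euclidean_space" and L :: "'b => 'c::euclidean_space"
 assumes S: "S : sets lebesgue" and L: "linear L" and f: "in_L2 S f"
 shows "in_L2 S (%x. L (f x))"
proof -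
 have bl: "bounded_linear L" using L by (simp add: linear_conv_bounded_linear)
 obtain K where K: "!!x. norm (L x) <= norm x * K" using bounded_linear.bounded[OF bl] by blast
 show ?thesis
 proof (rule in_L2_bound[OF S f, of _ K])
  have "L : borel_measurable borel" by (rule borel_measurable_continuous_onI[OF linear_continuous_on[OF bl]])
  then show "(%x. L (f x)) : borel_measurable (lebesgue_on S)"
   using f unfolding in_L2_def by (blast intro: measurable_compose[of f _ borel L])
 qed (use K in "auto simp: mult.commute")
qed

lemma in_L2_inner_const:
 fixes f :: "real^'d::finite => 'b::euclidean_space"
 shows "S : sets lebesgue ==> in_L2 S f ==> in_L2 S (%x. f x \<bullet> b)"
 by (rule in_L2_linear[where L = "%z. z \<bullet> b"]) (auto simp: linear_iff inner_add_left)

lemma weakly_tendsto_toL2_Basis: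
 fixes a :: "nat => real^'d::finite => 'b::euclidean_space"
 assumes S: "S : sets lebesgue" and a: "!!m. in_L2 S (a m)" "in_L2 S a0"
  and w: "!!b. b : Basis ==> weakly_tendsto (%m. toL2 S (%x. a m x \<bullet> b)) (toL2 S (%x. a0 x \<bullet> b))"
 shows "weakly_tendsto (%m. toL2 S (a m)) (toL2 S a0)"
 unfolding weakly_tendsto_def
proof
 fix h :: "('d, 'b) L2"
 have ip: "toL2 S u \<bullet> h = (\<Sum>b\<in>Basis. toL2 S (%x. u x \<bullet> b) \<bullet> toL2 S (%x. rep_L2 h x \<bullet> b))" if u: "in_L2 S u" for u
 proof -
  note c = in_L2_inner_const[OF S u] in_L2_inner_const[OF S in_L2_rep_L2[OF S, of h]]
  have "toL2 S u \<bullet> h = (LINT x|lebesgue_on S. u x \<bullet> rep_L2 h x)" using inner_toL2_rep_L2[OF S u, of h] by (simp add: inner_commute)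
  also have "... = (LINT x|lebesgue_on S. (\<Sum>b\<in>Basis. (u x \<bullet> b) \<bullet> (rep_L2 h x \<bullet> b)))" by (subst euclidean_inner) simp
  also have "... = (\<Sum>b\<in>Basis. LINT x|lebesgue_on S. (u x \<bullet> b) \<bullet> (rep_L2 h x \<bullet> b))"
   by (rule Bochner_Integration.integral_sum) (rule integrable_inner_in_L2[OF S c])
  finally show ?thesis by (simp only: inner_toL2[OF S c])
 qed
 show "(%m. toL2 S (a m) \<bullet> h) ----> toL2 S a0 \<bullet> h"
  unfolding ip[OF a(1)] ip[OF a(2)] using w unfolding weakly_tendsto_def by (intro tendsto_sum) blast
qed

lemma in_L2_vec:
 fixes g :: "real^'d::finite => 'b::euclidean_space^'n::finite"
 assumes S: "S : sets lebesgue" and g: "!!i. in_L2 S (%x. g x $ i)"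
 shows "in_L2 S g"
proof -
 have nsq: "(norm (g x))^2 = (\<Sum>i\<in>UNIV. (norm (g x $ i))^2)" for x
  unfolding power2_norm_eq_inner inner_vec_def by (rule refl)
 have "(%x. g x \<bullet> e) : borel_measurable (lebesgue_on S)" if e_Basis: "e : Basis" for e
 proof -
  obtain i b where e: "e = axis i b" using e_Basis by (auto simp: Basis_vec_def)
  have "(%x. g x $ i) : borel_measurable (lebesgue_on S)" using g[of i] unfolding in_L2_def by blast
  then show ?thesis unfolding e inner_axis by simp
 qed
 then have "g : borel_measurable (lebesgue_on S)" by (subst borel_measurable_euclidean_space) blast
 then show ?thesis using g unfolding in_L2_def nsq by auto
qed

lemma in_H1_per_weak_gradient:
 assumes "in_H1_per \<phi>"
 shows "has_weak_gradient UNIV \<phi> (weak_gradient UNIV \<phi>)" "weak_gradient UNIV \<phi> : borel_measurable lebesgue"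
  "in_L2 unit_cell (weak_gradient UNIV \<phi>)"
proof -
 obtain g where g: "has_weak_gradient UNIV \<phi> g" "in_L2 unit_cell g" using assms unfolding in_H1_per_def by blast
 show w: "has_weak_gradient UNIV \<phi> (weak_gradient UNIV \<phi>)" by (rule has_weak_gradient_weak_gradient[OF g(1)])
 show m: "weak_gradient UNIV \<phi> : borel_measurable lebesgue"
  by (rule locally_integrable_measurable[OF has_weak_gradientD(2)[OF w open_UNIV]])
 show "in_L2 unit_cell (weak_gradient UNIV \<phi>)"
 proof (rule in_L2_bound[OF unit_cell_facts(3) g(2), of _ 1])
  show "weak_gradient UNIV \<phi> : borel_measurable (lebesgue_on unit_cell)" by (rule measurable_restrict_space1[OF m])
  have "AE x in lebesgue. weak_gradient UNIV \<phi> x = g x"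
   using weak_gradient_AE_eq[OF open_UNIV g(1)] unfolding lebesgue_on_UNIV_eq .
  then show "AE x in lebesgue_on unit_cell. norm (weak_gradient UNIV \<phi> x) <= 1 * norm (g x)"
   unfolding AE_lebesgue_on[OF unit_cell_facts(3)] by eventually_elim simp
 qed
qed

lemma in_L2_matrix_vector:
 fixes M :: "real^'d::finite => real^'d^'d"
 assumes S: "S : sets lebesgue" and M: "M : borel_measurable lebesgue" "AE x in lebesgue. norm (M x) <= C" and v: "in_L2 S v" and C: "C >= 0"
 shows "in_L2 S (%x. M x *v v x)" "L2_norm S (%x. M x *v v x) <= C * L2_norm S v"
proof -
 have "AE x in lebesgue. norm (M x *v v x) <= C * norm (v x)"
  using M(2) by eventually_elim (meson mult_right_mono norm_ge_zero norm_matrix_vector_le order_trans)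
 then have AE: "AE x in lebesgue_on S. norm (M x *v v x) <= C * norm (v x)"
  unfolding AE_lebesgue_on[OF S] by eventually_elim simp
 show "in_L2 S (%x. M x *v v x)"
  by (rule in_L2_bound[OF S v _ AE]) (use v measurable_restrict_space1[OF M(1)] in "auto simp: in_L2_def intro: measurable_matrix_vector")
 show "L2_norm S (%x. M x *v v x) <= C * L2_norm S v" by (rule L2_norm_bound[OF S v C AE])
qed

lemma in_L2_const:
 fixes c :: "'b::euclidean_space"
 assumes "bounded (S :: (real^'d::finite) set)" "S : sets lebesgue" shows "in_L2 S (%x. c)"
 by (rule continuous_in_L2_bounded[OF _ assms]) auto

locale corrector_problem =
 fixes A :: "real^'d::finite => real^'d^'d" and \<psi> :: "'d => real^'d => real"
 assumes A_Linfty: "in_Linfty A" and A_periodic: "cell_periodic A"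
  and A_symmetric: "AE y in lebesgue. transpose (A y) = A y"
  and cell: "!!i. cell_solution A i (\<psi> i)"
begin

definition corrector_gradient :: "'d => real^'d => real^'d" where
 "corrector_gradient i = weak_gradient UNIV (\<psi> i)"

definition flux :: "'d => real^'d => real^'d" where
 "flux i y = A y *v (axis i 1 - corrector_gradient i y)"

text \<open>The oscillating test function of Tartar's method, a perturbation of the \<open>i\<close>-th coordinate.\<close>

definition corrected_coordinate :: "real => 'd => real^'d => real" where
 "corrected_coordinate \<epsilon> i x = x $ i - \<epsilon> * scaled \<epsilon> (\<psi> i) x"

lemma A_measurable: "A : borel_measurable lebesgue" using A_Linfty unfolding in_Linfty_def by blast

lemma A_bound: obtains C where "C >= 0" "AE y in lebesgue. norm (A y) <= C"
proof -
 obtain C where "AE y in lebesgue. norm (A y) <= C" using A_Linfty unfolding in_Linfty_def by blast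
 then have "AE y in lebesgue. norm (A y) <= max C 0" by eventually_elim simp
 then show ?thesis using that[of "max C 0"] by simp
qed

lemma psi: "in_H1_per (\<psi> i)" "cell_periodic (\<psi> i)" "in_L2 unit_cell (\<psi> i)" "\<psi> i : borel_measurable lebesgue"
 "has_weak_gradient UNIV (\<psi> i) (corrector_gradient i)" "cell_periodic (corrector_gradient i)"
 "corrector_gradient i : borel_measurable lebesgue" "in_L2 unit_cell (corrector_gradient i)"
proof -
 show 1: "in_H1_per (\<psi> i)" using cell[of i] unfolding cell_solution_def by blast
 then show 2: "cell_periodic (\<psi> i)" "in_L2 unit_cell (\<psi> i)" unfolding in_H1_per_def by blast+
 note w = in_H1_per_weak_gradient[OF 1]
 show 3: "has_weak_gradient UNIV (\<psi> i) (corrector_gradient i)"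
  "corrector_gradient i : borel_measurable lebesgue" "in_L2 unit_cell (corrector_gradient i)"
  unfolding corrector_gradient_def by (rule w)+
 show "\<psi> i : borel_measurable lebesgue" by (rule locally_integrable_measurable[OF has_weak_gradientD(1)[OF 3(1) open_UNIV]])
 show "cell_periodic (corrector_gradient i)" by (rule cell_periodic_weak_gradient[OF 3(1) 2(1)])
qed

lemma flux: "flux i : borel_measurable lebesgue" "cell_periodic (flux i)" "in_L2 unit_cell (flux i)"
proof -
 obtain C where C: "C >= 0" "AE y in lebesgue. norm (A y) <= C" using A_bound by blast
 show "flux i : borel_measurable lebesgue" unfolding flux_def[abs_def]
  using psi(7) by (intro measurable_matrix_vector A_measurable borel_measurable_diff) auto
 show "in_L2 unit_cell (flux i)" unfolding flux_def[abs_def]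
  by (rule in_L2_matrix_vector(1)[OF unit_cell_facts(3) A_measurable C(2) _ C(1)])
   (intro in_L2_diff in_L2_const unit_cell_facts psi)
 show "cell_periodic (flux i)" unfolding cell_periodic_def
 proof
  fix j
  have "AE y in lebesgue. A (y + axis j 1) = A y" using A_periodic unfolding cell_periodic_def by blast
  moreover have "AE y in lebesgue. corrector_gradient i (y + axis j 1) = corrector_gradient i y"
   using psi(6) unfolding cell_periodic_def by blast
  ultimately show "AE y in lebesgue. flux i (y + axis j 1) = flux i y" unfolding flux_def by eventually_elim simp
 qed
qed

lemma flux_orthogonal:
 assumes "in_H1_per \<phi>" shows "(LINT y|lebesgue_on unit_cell. flux i y \<bullet> weak_gradient UNIV \<phi> y) = 0"
proof -
 obtain C where C: "C >= 0" "AE y in lebesgue. norm (A y) <= C" using A_bound by blast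
 note mv = in_L2_matrix_vector(1)[OF unit_cell_facts(3) A_measurable C(2) _ C(1)]
 note g = in_H1_per_weak_gradient(3)[OF assms]
 have i: "integrable (lebesgue_on unit_cell) (%y. (A y *v axis i 1) \<bullet> weak_gradient UNIV \<phi> y)"
  "integrable (lebesgue_on unit_cell) (%y. (A y *v corrector_gradient i y) \<bullet> weak_gradient UNIV \<phi> y)"
  by (intro integrable_inner_in_L2 unit_cell_facts mv in_L2_const psi g)+
 have "(LINT y|lebesgue_on unit_cell. flux i y \<bullet> weak_gradient UNIV \<phi> y) =
  (LINT y|lebesgue_on unit_cell. (A y *v axis i 1) \<bullet> weak_gradient UNIV \<phi> y - (A y *v corrector_gradient i y) \<bullet> weak_gradient UNIV \<phi> y)"
  by (simp add: flux_def matrix_vector_mult_diff_distrib inner_diff_left)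
 also have "... = 0" using cell[of i] assms i unfolding cell_solution_def corrector_gradient_def by simp
 finally show ?thesis .
qed

lemma homogenized_matrix_entry:
 "homogenized_matrix A \<psi> $ j $ i = (LINT y|lebesgue_on unit_cell. flux i y $ j)"
proof -
 have m: "flux i : borel_measurable (lebesgue_on unit_cell)" by (rule measurable_restrict_space1[OF flux(1)])
 have "in_L2 unit_cell (%y. norm (flux i y))" by (rule in_L2_bound[OF unit_cell_facts(3) flux(3), of _ 1]) (use m in auto)
 from integrable_bounded_in_L2[OF unit_cell_facts(2,3) this]
 have "integrable (lebesgue_on unit_cell) (%y. norm (flux i y))" by (simp add: integrable_lebesgue_on[OF unit_cell_facts(3)])
 then have i: "integrable (lebesgue_on unit_cell) (flux i)" using integrable_norm_iff[OF m] by blast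
 have "measure lebesgue (unit_cell :: (real^'d) set) = 1" using emeasure_unit_cell[where 'd='d] by (simp add: measure_def)
 then have "homogenized_matrix A \<psi> $ j $ i = (LINT y|lebesgue_on unit_cell. flux i y) $ j"
  unfolding homogenized_matrix_def cell_average_def flux_def corrector_gradient_def by simp
 then show ?thesis using integral_bounded_linear[OF bounded_linear_vec_nth i] by simp
qed

lemma homogenized_matrix_symmetric: "homogenized_matrix A \<psi> $ j $ i = homogenized_matrix A \<psi> $ i $ j"
proof -
 obtain C where C: "C >= 0" "AE y in lebesgue. norm (A y) <= C" using A_bound by blast
 have e: "homogenized_matrix A \<psi> $ j $ i = (LINT y|lebesgue_on unit_cell. flux i y \<bullet> (axis j 1 - corrector_gradient j y))" for i j
 proof -
  have i: "integrable (lebesgue_on unit_cell) (%y. flux i y \<bullet> axis j 1)"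
   "integrable (lebesgue_on unit_cell) (%y. flux i y \<bullet> corrector_gradient j y)"
   by (intro integrable_inner_in_L2 unit_cell_facts flux in_L2_const psi)+
  have "(LINT y|lebesgue_on unit_cell. flux i y \<bullet> (axis j 1 - corrector_gradient j y))
   = (LINT y|lebesgue_on unit_cell. flux i y \<bullet> axis j 1) - (LINT y|lebesgue_on unit_cell. flux i y \<bullet> corrector_gradient j y)"
   using i by (simp add: inner_diff_right)
  also have "(LINT y|lebesgue_on unit_cell. flux i y \<bullet> corrector_gradient j y) = 0"
   unfolding corrector_gradient_def by (rule flux_orthogonal[OF psi(1)])
  finally show ?thesis by (simp add: homogenized_matrix_entry inner_axis)
 qed
 have AE: "AE y in lebesgue_on unit_cell. flux i y \<bullet> (axis j 1 - corrector_gradient j y) = flux j y \<bullet> (axis i 1 - corrector_gradient i y)"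
  unfolding AE_lebesgue_on[OF unit_cell_facts(3)]
  using A_symmetric by eventually_elim (metis flux_def inner_matrix_vector_sym inner_commute)
 have m: "(%y. flux i y \<bullet> (axis j 1 - corrector_gradient j y)) : borel_measurable (lebesgue_on unit_cell)" for i j
  by (intro borel_measurable_integrable integrable_inner_in_L2 unit_cell_facts flux in_L2_diff in_L2_const psi)
 show ?thesis unfolding e by (rule integral_cong_AE[OF m m AE])
qed

lemma scaled_flux_divergence_free:
 assumes "\<epsilon> > 0" "test_function UNIV f"
 shows "(LINT x|lebesgue. scaled \<epsilon> (flux i) x \<bullet> (\<chi> k. partial_deriv k f x)) = 0"
 by (rule scaled_divergence_free[OF flux(1) periodic_divergence_free[OF flux flux_orthogonal] assms])

lemma has_weak_gradient_corrected_coordinate: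
 assumes "\<epsilon> > 0"
 shows "has_weak_gradient UNIV (corrected_coordinate \<epsilon> i) (%x. axis i 1 - scaled \<epsilon> (corrector_gradient i) x)"
proof -
 have "(\<chi> k. partial_deriv k (%x. x $ i) x) = (axis i 1 :: real^'d)" for x :: "real^'d"
  by (simp add: partial_deriv_component vec_eq_iff axis_def)
 then have 1: "has_weak_gradient UNIV (%x :: real^'d. x $ i) (%x. axis i 1)"
  using has_weak_gradient_smooth[OF smooth_component open_UNIV, of i] by simp
 have "has_weak_gradient UNIV (%x. \<psi> i (0 + inverse \<epsilon> *R x)) (%x. inverse \<epsilon> *R corrector_gradient i (0 + inverse \<epsilon> *R x))"
  by (rule has_weak_gradient_affine[OF psi(5)]) (use assms in simp)
 from has_weak_gradient_scaleR[OF open_UNIV this, of \<epsilon>]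
 have 2: "has_weak_gradient UNIV (%x. \<epsilon> * scaled \<epsilon> (\<psi> i) x) (%x. scaled \<epsilon> (corrector_gradient i) x)"
  using assms by (simp add: scaled_def)
 show ?thesis using has_weak_gradient_diff[OF open_UNIV 1 2] by (simp add: corrected_coordinate_def[abs_def])
qed

text \<open>Tartar's method.  Test the equation for \<open>u m\<close> with \<open>\<eta>\<close> times the corrected coordinate, and
 the corrector equation with \<open>\<eta> u m\<close>.  By symmetry of the coefficients the two products of weakly
 convergent sequences coincide and cancel; every remaining term is a product of a weakly and a
 strongly convergent sequence.\<close>

theorem homogenized_flux:
 assumes D: "open D" "bounded D"
  and e: "!!m. 0 < \<epsilon> m" "!!m. \<epsilon> m <= 1" "\<epsilon> ----> 0"
  and u: "!!m. has_weak_gradient D (u m) (g m)" "!!m. in_L2 D (u m)" "!!m. in_L2 D (g m)"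
  and u0: "has_weak_gradient D u0 g0" "in_L2 D u0" "in_L2 D g0"
  and strong: "(%m. L2_norm D (%x. u m x - u0 x)) ----> 0"
  and gbd: "!!m. L2_norm D (g m) <= Bg"
  and flux_lim: "weakly_tendsto (%m. toL2 D (%x. scaled (\<epsilon> m) A x *v g m x)) (toL2 D \<sigma>)" "in_L2 D \<sigma>"
  and f: "!!m. in_L2 D (f m)" "in_L2 D f0" "!!m. L2_norm D (f m) <= Bf"
   "weakly_tendsto (%m. toL2 D (f m)) (toL2 D f0)"
  and eq: "!!m \<phi>. test_function D \<phi> ==>
   (LINT x|lebesgue_on D. (scaled (\<epsilon> m) A x *v g m x) \<bullet> (\<chi> k. partial_deriv k \<phi> x)) = (LINT x|lebesgue_on D. f m x * \<phi> x)"
 shows "AE x in lebesgue_on D. \<sigma> x = homogenized_matrix A \<psi> *v g0 x"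
proof -
 have mD: "D : sets lebesgue" using D by auto
 let ?H = "homogenized_matrix A \<psi>"
 define s where "s m x = scaled (\<epsilon> m) A x *v g m x" for m x
 obtain C where C: "C >= 0" "AE y in lebesgue. norm (A y) <= C" using A_bound by blast
 have sm: "scaled (\<epsilon> m) A : borel_measurable lebesgue" for m by (rule scaled_measurable[OF A_measurable e(1)])
 have sC: "AE x in lebesgue. norm (scaled (\<epsilon> m) A x) <= C" for m
  using AE_scaled[OF C(2) e(1)] by (simp add: scaled_def)
 have s: "in_L2 D (s m)" and sbd: "L2_norm D (s m) <= C * Bg" for m
 proof -
  note * = in_L2_matrix_vector[OF mD sm sC u(3) C(1), of m m]
  show "in_L2 D (s m)" unfolding s_def[abs_def] by (rule *(1))
  show "L2_norm D (s m) <= C * Bg" unfolding s_def[abs_def] using *(2) mult_left_mono[OF gbd[of m] C(1)] by linarith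
 qed
 have sw: "weakly_tendsto (%m. toL2 D (s m)) (toL2 D \<sigma>)" using flux_lim(1) unfolding s_def .
 note comp = in_L2_component[OF mD]
 have ip: "integrable (lebesgue_on D) (%x. a x * (b x \<bullet> \<theta> x))"
  if "in_L2 D a" "in_L2 D b" "test_function D \<theta>" for a and b \<theta> :: "real^'d => 'b::euclidean_space"
  using integrable_inner_in_L2[OF mD that(2) in_L2_scaleR_test_function[OF mD that(3,1)]] by simp
 have "AE x in lebesgue_on D. \<sigma> x $ i - (?H *v g0 x) $ i = 0" for i
 proof (rule fundamental_lemma_variations[OF D(1)])
  have Hg: "in_L2 D (%x. ?H *v g0 x)" by (rule in_L2_matrix_vector(1)[OF mD _ _ u0(3), of _ "norm ?H"]) auto
  show "locally_integrable D (%x. \<sigma> x $ i - (?H *v g0 x) $ i)"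
   by (intro in_L2_locally_integrable mD in_L2_diff comp flux_lim(2) Hg)
  fix \<eta> :: "real^'d => real" assume t: "test_function D \<eta>"
  let ?d = "%x. (\<chi> k. partial_deriv k \<eta> x) :: real^'d"
  have td: "test_function D ?d"
  proof -
   have eqd: "?d = (%x. \<Sum>k\<in>UNIV. partial_deriv k \<eta> x *R axis k 1)"
    by (auto simp: vec_eq_iff sum_component axis_def if_distrib cong: if_cong)
   obtain K where K: "compact K" "K <= D" "!!x. x ~: K ==> \<eta> x = 0" using test_function_support[OF t] by blast
   have "smooth (%x. \<Sum>k\<in>UNIV. partial_deriv k \<eta> x *R (axis k 1 :: real^'d))"
    by (intro smooth_sum smooth_scaleR smooth_partial_deriv test_function_smooth[OF t] smooth_const) auto
   moreover have "?d x = 0" if "x ~: K" for x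
    using partial_deriv_zero_off_closed[OF compact_imp_closed[OF K(1)] K(3) that] by (simp add: vec_eq_iff)
   ultimately show ?thesis by (intro test_functionI[OF _ K(1,2)]) (simp_all only: eqd[symmetric])
  qed
  define \<xi> where "\<xi> m = corrected_coordinate (\<epsilon> m) i" for m
  define q where "q m x = axis i 1 - scaled (\<epsilon> m) (corrector_gradient i) x" for m x
  define b where "b m = scaled (\<epsilon> m) (flux i)" for m
  have xi: "in_L2 D (%x. x $ i)" by (rule continuous_in_L2_bounded[OF _ D(2) mD]) (intro continuous_intros)
  have osc: "in_L2 D (scaled (\<epsilon> m) (\<psi> i))" for m by (rule oscillating_weakly_tendsto(1)[OF psi(4,2,3) D e])
  obtain Cp where Cp: "!!m. L2_norm D (scaled (\<epsilon> m) (\<psi> i)) <= Cp"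
   using oscillating_weakly_tendsto(2)[OF psi(4,2,3) D e, of i] by blast
  have \<xi>: "in_L2 D (\<xi> m)" for m
   using in_L2_diff[OF mD xi in_L2_scaleR[OF mD osc[of m], of "\<epsilon> m"]] by (simp add: \<xi>_def corrected_coordinate_def[abs_def])
  have \<xi>s: "(%m. L2_norm D (%x. \<xi> m x - x $ i)) ----> 0"
  proof (rule Lim_null_comparison)
   show "\<forall>\<^sub>F m in sequentially. norm (L2_norm D (%x. \<xi> m x - x $ i)) <= \<epsilon> m * Cp"
   proof (intro always_eventually allI)
    fix m
    have "L2_norm D (%x. \<xi> m x - x $ i) <= \<epsilon> m * L2_norm D (scaled (\<epsilon> m) (\<psi> i))"
     by (rule L2_norm_bound[OF mD osc]) (use e(1)[of m] in \<open>auto simp: \<xi>_def corrected_coordinate_def abs_mult\<close>)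
    also have "... <= \<epsilon> m * Cp" using Cp e(1)[of m] by (intro mult_left_mono) auto
    finally show "norm (L2_norm D (%x. \<xi> m x - x $ i)) <= \<epsilon> m * Cp" by (simp add: L2_norm_nonneg)
   qed
   have "(%m. \<epsilon> m * Cp) ----> 0 * Cp" by (intro tendsto_intros e(3))
   then show "(%m. \<epsilon> m * Cp) ----> 0" by simp
  qed
  have \<xi>g: "has_weak_gradient D (\<xi> m) (q m)" for m unfolding \<xi>_def q_def[abs_def]
   by (rule has_weak_gradient_mono[OF has_weak_gradient_corrected_coordinate[OF e(1)] open_UNIV D(1)]) simp
  have fc: "(%y. flux i y $ j) : borel_measurable lebesgue" "cell_periodic (%y. flux i y $ j)" "in_L2 unit_cell (%y. flux i y $ j)" for j
   using measurable_component[OF flux(1)] cell_periodic_compose[OF flux(2), of "%v. v $ j"] in_L2_component[OF unit_cell_facts(3) flux(3)] by auto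
  have gc: "(%y. corrector_gradient i y $ j) : borel_measurable lebesgue" "cell_periodic (%y. corrector_gradient i y $ j)" "in_L2 unit_cell (%y. corrector_gradient i y $ j)" for j
   using measurable_component[OF psi(7)] cell_periodic_compose[OF psi(6), of "%v. v $ j"] in_L2_component[OF unit_cell_facts(3) psi(8)] by auto
  have bc: "scaled (\<epsilon> m) (%y. flux i y $ j) = (%x. b m x $ j)" for m j by (simp add: b_def scaled_def fun_eq_iff)
  have bj: "in_L2 D (%x. b m x $ j)" for m j using oscillating_weakly_tendsto(1)[OF fc[of j] D e, of m] by (simp add: bc)
  have b: "in_L2 D (b m)" for m by (rule in_L2_vec[OF mD bj])
  have "\<exists>Cb. \<forall>m. L2_norm D (%x. b m x $ j) <= Cb" for j
   using oscillating_weakly_tendsto(2)[OF fc[of j] D e] by (simp add: bc)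
  then obtain Cb where Cb: "!!j m. L2_norm D (%x. b m x $ j) <= Cb j" by metis
  have bbd: "L2_norm D (b m) <= (\<Sum>j\<in>UNIV. Cb j)" for m
  proof -
   have nsq: "(norm (b m x))^2 = (\<Sum>j\<in>UNIV. (norm (b m x $ j))^2)" for x unfolding power2_norm_eq_inner inner_vec_def by (rule refl)
   have "(L2_norm D (b m))^2 = (\<Sum>j\<in>UNIV. (L2_norm D (%x. b m x $ j))^2)"
    unfolding L2_norm_power2 nsq by (rule Bochner_Integration.integral_sum) (use bj in "simp add: in_L2_def")
   also have "... <= (\<Sum>j\<in>UNIV. L2_norm D (%x. b m x $ j))^2" by (intro sum_power2_le_power2_sum L2_norm_nonneg) auto
   finally have "L2_norm D (b m) <= (\<Sum>j\<in>UNIV. L2_norm D (%x. b m x $ j))"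
    by (rule power2_le_imp_le) (intro sum_nonneg L2_norm_nonneg)
   also have "... <= (\<Sum>j\<in>UNIV. Cb j)" by (intro sum_mono Cb)
   finally show ?thesis .
  qed
  define b0 where "b0 = (\<chi> j. ?H $ j $ i)"
  have b0L: "in_L2 D (%x. b0)" by (rule in_L2_const[OF D(2) mD])
  have bw: "weakly_tendsto (%m. toL2 D (b m)) (toL2 D (%x. b0))"
  proof (rule weakly_tendsto_toL2_Basis[OF mD b b0L])
   fix h :: "real^'d" assume "h : Basis"
   then obtain j where h: "h = axis j 1" by (auto simp: Basis_vec_def)
   show "weakly_tendsto (%m. toL2 D (%x. b m x \<bullet> h)) (toL2 D (%x. b0 \<bullet> h))"
    using oscillating_weakly_tendsto(3)[OF fc[of j] D e] by (simp add: bc b0_def homogenized_matrix_entry h inner_axis)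
  qed
  have q: "in_L2 D (q m)" for m
  proof -
   have "scaled (\<epsilon> m) (%y. corrector_gradient i y $ j) = (%x. scaled (\<epsilon> m) (corrector_gradient i) x $ j)" for j by (simp add: scaled_def fun_eq_iff)
   then have "in_L2 D (%x. scaled (\<epsilon> m) (corrector_gradient i) x $ j)" for j
    using oscillating_weakly_tendsto(1)[OF gc[of j] D e, of m] by simp
   from in_L2_vec[OF mD this] show ?thesis unfolding q_def[abs_def] by (intro in_L2_diff mD in_L2_const[OF D(2) mD])
  qed
  \<comment> \<open>The product of the two weakly convergent sequences, written in two ways.\<close>
  have AEq: "AE x in lebesgue_on D. s m x \<bullet> q m x = b m x \<bullet> g m x" for m
  proof -
   have "AE x in lebesgue. transpose (scaled (\<epsilon> m) A x) = scaled (\<epsilon> m) A x"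
    using AE_scaled[OF A_symmetric e(1)] by (simp add: scaled_def)
   then have "AE x in lebesgue. s m x \<bullet> q m x = b m x \<bullet> g m x"
   proof eventually_elim
    fix x assume "transpose (scaled (\<epsilon> m) A x) = scaled (\<epsilon> m) A x"
    moreover have "b m x = scaled (\<epsilon> m) A x *v q m x" by (simp add: b_def flux_def scaled_def q_def)
    ultimately show "s m x \<bullet> q m x = b m x \<bullet> g m x" by (metis s_def inner_matrix_vector_sym inner_commute)
   qed
   then show ?thesis unfolding AE_lebesgue_on[OF mD] by eventually_elim simp
  qed
  have split: "(LINT x|lebesgue_on D. a x \<bullet> (\<chi> k. \<eta> x * p x $ k + partial_deriv k \<eta> x * c x)) =
    (LINT x|lebesgue_on D. \<eta> x * (a x \<bullet> p x)) + (LINT x|lebesgue_on D. c x * (a x \<bullet> ?d x))"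
   and int_split: "integrable (lebesgue_on D) (%x. \<eta> x * (a x \<bullet> p x))"
   if "in_L2 D a" "in_L2 D p" "in_L2 D c" for a p :: "real^'d => real^'d" and c
  proof -
   obtain Ce where Ce: "!!x. norm (\<eta> x) <= Ce" using test_function_bounded[OF t] by metis
   have "in_L2 D (%x. \<eta> x *R p x)" by (rule in_L2_bound[OF mD that(2), of _ Ce])
     (use that(2) Ce measurable_restrict_space1[OF test_function_measurable[OF t], of D] in "auto simp: in_L2_def intro!: mult_right_mono")
   from integrable_inner_in_L2[OF mD that(1) this] show i1: "integrable (lebesgue_on D) (%x. \<eta> x * (a x \<bullet> p x))" by simp
   have "a x \<bullet> (\<chi> k. \<eta> x * p x $ k + partial_deriv k \<eta> x * c x) = \<eta> x * (a x \<bullet> p x) + c x * (a x \<bullet> ?d x)" for x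
    unfolding inner_vec_def by (simp add: sum_distrib_left sum.distrib[symmetric] algebra_simps)
   then show "(LINT x|lebesgue_on D. a x \<bullet> (\<chi> k. \<eta> x * p x $ k + partial_deriv k \<eta> x * c x)) =
    (LINT x|lebesgue_on D. \<eta> x * (a x \<bullet> p x)) + (LINT x|lebesgue_on D. c x * (a x \<bullet> ?d x))"
    using i1 ip[OF that(3,1) td] by simp
  qed
  have eq1: "(LINT x|lebesgue_on D. \<eta> x * (s m x \<bullet> q m x)) + (LINT x|lebesgue_on D. \<xi> m x * (s m x \<bullet> ?d x)) =
    (LINT x|lebesgue_on D. \<xi> m x * (f m x \<bullet> \<eta> x))" for m
  proof -
   have "(LINT x|lebesgue_on D. s m x \<bullet> (\<chi> k. \<eta> x * q m x $ k + partial_deriv k \<eta> x * \<xi> m x)) = (LINT x|lebesgue_on D. f m x * (\<eta> x * \<xi> m x))"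
    by (rule divergence_equation_tested_with_cutoff[OF D(1) s f(1) _ \<xi>g \<xi> q t]) (use eq in "simp add: s_def")
   then show ?thesis unfolding split[OF s q \<xi>] by (simp add: mult_ac)
  qed
  have eq2: "(LINT x|lebesgue_on D. \<eta> x * (b m x \<bullet> g m x)) + (LINT x|lebesgue_on D. u m x * (b m x \<bullet> ?d x)) = 0" for m
  proof -
   have "(LINT x|lebesgue_on D. b m x \<bullet> (\<chi> k. \<eta> x * g m x $ k + partial_deriv k \<eta> x * u m x)) = (LINT x|lebesgue_on D. 0 * (\<eta> x * u m x))"
   proof (rule divergence_equation_tested_with_cutoff[OF D(1) b _ _ u(1) u(2) u(3) t])
    show "in_L2 D (%x. 0)" by (rule in_L2_const[OF D(2) mD])
    fix \<phi> :: "real^'d => real" assume tp: "test_function D \<phi>"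
    obtain K where K: "K <= D" "!!x. x ~: K ==> \<phi> x = 0" "closed K"
     using test_function_support[OF tp] compact_imp_closed by metis
    have "indicator D x *R (b m x \<bullet> (\<chi> k. partial_deriv k \<phi> x)) = b m x \<bullet> (\<chi> k. partial_deriv k \<phi> x)" for x
    proof (cases "x : D")
     case False
     then have "x ~: K" using K(1) by blast
     then have "(\<chi> k. partial_deriv k \<phi> x) = 0" using partial_deriv_zero_off_closed[OF K(3,2)] by (simp add: vec_eq_iff)
     then show ?thesis by simp
    qed simp
    then have ind: "(%x. indicator D x *R (b m x \<bullet> (\<chi> k. partial_deriv k \<phi> x))) = (%x. b m x \<bullet> (\<chi> k. partial_deriv k \<phi> x))" by blast
    have "(LINT x|lebesgue_on D. b m x \<bullet> (\<chi> k. partial_deriv k \<phi> x)) = 0"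
     unfolding integral_lebesgue_on[OF mD] ind unfolding b_def
     by (rule scaled_flux_divergence_free[OF e(1) test_function_mono[OF tp]]) simp
    then show "(LINT x|lebesgue_on D. b m x \<bullet> (\<chi> k. partial_deriv k \<phi> x)) = (LINT x|lebesgue_on D. 0 * \<phi> x)" by simp
   qed
   then show ?thesis unfolding split[OF b u(3) u(2)] by simp
  qed
  have same: "(LINT x|lebesgue_on D. \<eta> x * (s m x \<bullet> q m x)) = (LINT x|lebesgue_on D. \<eta> x * (b m x \<bullet> g m x))" for m
   by (rule integral_cong_AE)
    (use int_split[OF s q \<xi>] int_split[OF b u(3) u(2)] AEq[of m] in "auto elim: eventually_mono")
  have id: "(LINT x|lebesgue_on D. \<xi> m x * (f m x \<bullet> \<eta> x)) - (LINT x|lebesgue_on D. \<xi> m x * (s m x \<bullet> ?d x)) =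
    - (LINT x|lebesgue_on D. u m x * (b m x \<bullet> ?d x))" for m using eq1[of m] eq2[of m] same[of m] by linarith
  have lim1: "(%m. LINT x|lebesgue_on D. \<xi> m x * (f m x \<bullet> \<eta> x)) ----> (LINT x|lebesgue_on D. x $ i * (f0 x \<bullet> \<eta> x))"
   by (rule weak_strong_integral_tendsto[OF mD f(1,2,3,4) \<xi> xi \<xi>s t])
  have lim2: "(%m. LINT x|lebesgue_on D. \<xi> m x * (s m x \<bullet> ?d x)) ----> (LINT x|lebesgue_on D. x $ i * (\<sigma> x \<bullet> ?d x))"
   by (rule weak_strong_integral_tendsto[OF mD s flux_lim(2) sbd sw \<xi> xi \<xi>s td])
  have lim3: "(%m. LINT x|lebesgue_on D. u m x * (b m x \<bullet> ?d x)) ----> (LINT x|lebesgue_on D. u0 x * (b0 \<bullet> ?d x))"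
   by (rule weak_strong_integral_tendsto[OF mD b b0L bbd bw u(2) u0(2) strong td])
  have "(LINT x|lebesgue_on D. x $ i * (f0 x \<bullet> \<eta> x)) - (LINT x|lebesgue_on D. x $ i * (\<sigma> x \<bullet> ?d x)) = - (LINT x|lebesgue_on D. u0 x * (b0 \<bullet> ?d x))"
   by (rule LIMSEQ_unique[OF tendsto_diff[OF lim1 lim2]]) (use tendsto_minus[OF lim3] in "simp only: id")
  \<comment> \<open>The limit equation, tested with \<open>\<eta>\<close> times the coordinate.\<close>
  moreover have "(LINT x|lebesgue_on D. \<eta> x * (\<sigma> x $ i)) + (LINT x|lebesgue_on D. x $ i * (\<sigma> x \<bullet> ?d x)) = (LINT x|lebesgue_on D. x $ i * (f0 x \<bullet> \<eta> x))"
  proof -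
   have tx: "test_function D (%x. \<eta> x *R x $ i)" by (rule test_function_smooth_scaleR[OF t smooth_component])
   have pd: "partial_deriv k (%x. \<eta> x *R x $ i) = (%x. \<eta> x *R (if i = k then 1 else 0) + partial_deriv k \<eta> x *R x $ i)" for k
    by (subst partial_deriv_scaleR) (auto simp: partial_deriv_component intro: smooth_differentiable smooth_component test_function_smooth[OF t])
   have ax: "(\<chi> k. partial_deriv k (%x. \<eta> x *R x $ i) x) = (\<chi> k. \<eta> x * (axis i 1 :: real^'d) $ k + partial_deriv k \<eta> x * x $ i)" for x
    unfolding pd by (auto simp: vec_eq_iff axis_def)
   have aL: "in_L2 D (%x. axis i 1 :: real^'d)" by (rule in_L2_const[OF D(2) mD])
   have E: "(LINT x|lebesgue_on D. \<eta> x * (s m x \<bullet> axis i 1)) + (LINT x|lebesgue_on D. x $ i * (s m x \<bullet> ?d x)) = (LINT x|lebesgue_on D. x $ i * (f m x \<bullet> \<eta> x))" for m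
    using eq[OF tx, of m] unfolding ax s_def[symmetric] split[OF s aL xi] by (simp add: mult_ac)
   have one: "in_L2 D (%x. 1 :: real)" by (rule in_L2_const[OF D(2) mD])
   have ta: "test_function D (%x. \<eta> x *R (axis i 1 :: real^'d))" by (rule test_function_scaleR_const[OF t])
   have c0: "(%m. L2_norm D (%x. c x - c x)) ----> 0" for c :: "real^'d => real" by (simp add: L2_norm_def)
   have l1: "(%m. LINT x|lebesgue_on D. 1 * (s m x \<bullet> (\<eta> x *R axis i 1))) ----> (LINT x|lebesgue_on D. 1 * (\<sigma> x \<bullet> (\<eta> x *R axis i 1)))"
    by (rule weak_strong_integral_tendsto[OF mD s flux_lim(2) sbd sw one one c0 ta])
   have l2: "(%m. LINT x|lebesgue_on D. x $ i * (s m x \<bullet> ?d x)) ----> (LINT x|lebesgue_on D. x $ i * (\<sigma> x \<bullet> ?d x))"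
    by (rule weak_strong_integral_tendsto[OF mD s flux_lim(2) sbd sw xi xi c0 td])
   have l3: "(%m. LINT x|lebesgue_on D. x $ i * (f m x \<bullet> \<eta> x)) ----> (LINT x|lebesgue_on D. x $ i * (f0 x \<bullet> \<eta> x))"
    by (rule weak_strong_integral_tendsto[OF mD f(1,2,3,4) xi xi c0 t])
   have "(LINT x|lebesgue_on D. 1 * (\<sigma> x \<bullet> (\<eta> x *R axis i 1))) + (LINT x|lebesgue_on D. x $ i * (\<sigma> x \<bullet> ?d x)) = (LINT x|lebesgue_on D. x $ i * (f0 x \<bullet> \<eta> x))"
    by (rule LIMSEQ_unique[OF tendsto_add[OF l1 l2]]) (use l3 E in simp)
   then show ?thesis by (simp add: inner_axis mult.commute)
  qed
  moreover have "(LINT x|lebesgue_on D. u0 x * (b0 \<bullet> ?d x)) = - (LINT x|lebesgue_on D. \<eta> x * (?H *v g0 x) $ i)"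
  proof -
   have tk: "test_function D (partial_deriv k \<eta>)" for k by (rule test_function_partial_deriv[OF t])
   have on: "(LINT x|lebesgue_on D. \<phi> x * c x) = (LINT x|lebesgue. \<phi> x * c x)" if "test_function D \<phi>" for \<phi> c :: "real^'d => real"
    using integral_test_function_on[OF that mD, of c] by simp
   have iu: "integrable (lebesgue_on D) (%x. u0 x * partial_deriv k \<eta> x)" for k
    using integrable_inner_in_L2[OF mD u0(2) in_L2_test_function[OF tk mD]] by simp
   have ig: "integrable (lebesgue_on D) (%x. \<eta> x * g0 x $ k)" for k
    using integrable_inner_in_L2[OF mD in_L2_test_function[OF t mD] comp[OF u0(3)]] by simp
   have wk: "(LINT x|lebesgue_on D. u0 x * partial_deriv k \<eta> x) = - (LINT x|lebesgue_on D. \<eta> x * g0 x $ k)" for k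
    using has_weak_gradientD(3)[OF u0(1) D(1) t, of k] on[OF tk, of k u0] on[OF t, of "%x. g0 x $ k"] by (simp add: mult.commute)
   have "(LINT x|lebesgue_on D. u0 x * (b0 \<bullet> ?d x)) = (LINT x|lebesgue_on D. (\<Sum>k\<in>UNIV. b0 $ k * (u0 x * partial_deriv k \<eta> x)))"
    by (simp add: inner_vec_def sum_distrib_left mult_ac)
   also have "... = (\<Sum>k\<in>UNIV. b0 $ k * (LINT x|lebesgue_on D. u0 x * partial_deriv k \<eta> x))" using iu by simp
   also have "... = - (\<Sum>k\<in>UNIV. ?H $ i $ k * (LINT x|lebesgue_on D. \<eta> x * g0 x $ k))"
    by (simp add: wk b0_def sum_negf homogenized_matrix_symmetric[of _ i])
   also have "(\<Sum>k\<in>UNIV. ?H $ i $ k * (LINT x|lebesgue_on D. \<eta> x * g0 x $ k)) = (LINT x|lebesgue_on D. (\<Sum>k\<in>UNIV. ?H $ i $ k * (\<eta> x * g0 x $ k)))"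
    using ig by simp
   also have "... = (LINT x|lebesgue_on D. \<eta> x * (?H *v g0 x) $ i)"
    by (simp add: matrix_vector_mult_def sum_distrib_left mult_ac)
   finally show ?thesis .
  qed
  ultimately have "(LINT x|lebesgue_on D. \<eta> x * (\<sigma> x $ i)) = (LINT x|lebesgue_on D. \<eta> x * (?H *v g0 x) $ i)" by linarith
  moreover have "integrable (lebesgue_on D) (%x. \<eta> x * (\<sigma> x $ i))" "integrable (lebesgue_on D) (%x. \<eta> x * (?H *v g0 x) $ i)"
   using integrable_inner_in_L2[OF mD in_L2_test_function[OF t mD] comp[OF flux_lim(2)]]
    integrable_inner_in_L2[OF mD in_L2_test_function[OF t mD] comp[OF Hg]] by auto
  ultimately have "(LINT x|lebesgue_on D. \<eta> x *R (\<sigma> x $ i - (?H *v g0 x) $ i)) = 0" by (simp add: right_diff_distrib)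
  then show "(LINT x|lebesgue. \<eta> x *R (\<sigma> x $ i - (?H *v g0 x) $ i)) = 0" by (simp only: integral_test_function_on[OF t mD])
 qed
 then have "AE x in lebesgue_on D. \<forall>i\<in>UNIV. \<sigma> x $ i - (?H *v g0 x) $ i = 0" by (intro AE_finite_allI) auto
 then show ?thesis by eventually_elim (simp add: vec_eq_iff)
qed

end

section \<open>The space \<open>X(D)\<close> as a closed subspace of a Hilbert space\<close>

lemma weakly_tendsto_fst: "weakly_tendsto x p ==> weakly_tendsto (%m. fst (x m)) (fst p)"
 unfolding weakly_tendsto_def by (intro allI, drule_tac x="(h, 0)" in spec) (simp add: inner_prod_def)

lemma weakly_tendsto_snd: "weakly_tendsto x p ==> weakly_tendsto (%m. snd (x m)) (snd p)"
 unfolding weakly_tendsto_def by (intro allI, drule_tac x="(0, h)" in spec) (simp add: inner_prod_def)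

lemma weakly_tendsto_diff:
 "weakly_tendsto x p ==> weakly_tendsto y q ==> weakly_tendsto (%m. x m - y m) (p - q)"
 unfolding weakly_tendsto_def by (auto simp: inner_diff_left intro!: tendsto_diff)

text \<open>Inner products with functions supported in \<open>S\<close> see only the values on \<open>S\<close>, so that restricting
 a weak limit of such functions to \<open>S\<close> does not change it.\<close>

lemma toL2_rep_weak_limit:
 assumes S: "S : sets lebesgue" and f: "!!m. in_L2 S (f m)" and w: "weakly_tendsto (%m. toL2 S (f m)) p"
 shows "toL2 S (rep_L2 p) = p"
proof -
 note r = in_L2_rep_L2[OF S]
 have "toL2 S (rep_L2 p) \<bullet> h = p \<bullet> h" for h
 proof -
  have e: "toL2 S (f m) \<bullet> toL2 S (rep_L2 h) = toL2 S (f m) \<bullet> h" for m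
   using inner_toL2_rep_L2[OF S f, of h m] inner_toL2[OF S f r, of m h] by (simp add: inner_commute)
  have "(%m. toL2 S (f m) \<bullet> toL2 S (rep_L2 h)) ----> p \<bullet> toL2 S (rep_L2 h)" "(%m. toL2 S (f m) \<bullet> h) ----> p \<bullet> h"
   using w unfolding weakly_tendsto_def by blast+
  then have "p \<bullet> toL2 S (rep_L2 h) = p \<bullet> h" unfolding e by (rule LIMSEQ_unique)
  then show ?thesis using inner_toL2_rep_L2[OF S r, of p h] inner_toL2_rep_L2[OF S r, of h p] by (simp add: inner_commute)
 qed
 then show ?thesis using vector_eq_rdot by blast
qed

lemma in_L2_cong_AE:
 fixes f g :: "real^'d::finite => 'b::euclidean_space"
 assumes S: "S : sets lebesgue" and f: "in_L2 S f" and AE: "AE x in lebesgue_on S. g x = f x"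
 shows "in_L2 S g"
proof (rule in_L2_bound[OF S f, of _ 1])
 have "(%x. indicator S x *R f x) : borel_measurable lebesgue" using f unfolding in_L2_def measurable_lebesgue_on[OF S] by blast
 moreover have "AE x in lebesgue. indicator S x *R f x = indicator S x *R g x"
  using AE unfolding AE_lebesgue_on[OF S] by eventually_elim (auto simp: indicator_def)
 ultimately show "g : borel_measurable (lebesgue_on S)" unfolding measurable_lebesgue_on[OF S] by (rule borel_measurable_AE)
 show "AE x in lebesgue_on S. norm (g x) <= 1 * norm (f x)" using AE by eventually_elim simp
qed

lemma in_H1D:
 assumes D: "open D" and u: "in_H1 D u"
 shows "in_L2 D u" "has_weak_gradient D u (weak_gradient D u)" "in_L2 D (weak_gradient D u)"
proof -
 obtain g where g: "has_weak_gradient D u g" "in_L2 D g" using u unfolding in_H1_def by blast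
 show "in_L2 D u" using u unfolding in_H1_def by blast
 show "has_weak_gradient D u (weak_gradient D u)" by (rule has_weak_gradient_weak_gradient[OF g(1)])
 show "in_L2 D (weak_gradient D u)" by (rule in_L2_cong_AE[OF _ g(2) weak_gradient_AE_eq[OF D g(1)]]) (use D in auto)
qed

definition jet :: "(real^'d::finite) set => (real^'d => 'b::euclidean_space) => ('d, 'b) L2 \<times> ('d, 'b^'d) L2" where
 "jet D u = (toL2 D u, toL2 D (weak_gradient D u))"

lemma jet_eqI:
 assumes D: "open D" and u: "in_L2 D u" "has_weak_gradient D u g" "in_L2 D g"
 shows "in_H1 D u" "jet D u = (toL2 D u, toL2 D g)"
proof -
 have mD: "D : sets lebesgue" using D by auto
 show H: "in_H1 D u" using u unfolding in_H1_def by blast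
 show "jet D u = (toL2 D u, toL2 D g)"
  unfolding jet_def using toL2_eq_iff[OF mD in_H1D(3)[OF D H] u(3)] weak_gradient_AE_eq[OF D u(2)] by simp
qed

lemma jet_add:
 assumes D: "open D" and u: "in_H1 D u" and v: "in_H1 D v"
 shows "in_H1 D (%x. u x + v x)" "jet D (%x. u x + v x) = jet D u + jet D v"
proof -
 have mD: "D : sets lebesgue" using D by auto
 note U = in_H1D[OF D u] and V = in_H1D[OF D v]
 note * = jet_eqI[OF D in_L2_add[OF mD U(1) V(1)] has_weak_gradient_add[OF D U(2) V(2)] in_L2_add[OF mD U(3) V(3)]]
 show "in_H1 D (%x. u x + v x)" by (rule *(1))
 show "jet D (%x. u x + v x) = jet D u + jet D v"
  unfolding *(2) toL2_add[OF mD U(1) V(1)] toL2_add[OF mD U(3) V(3)] by (simp add: jet_def)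
qed

lemma jet_scaleR:
 assumes D: "open D" and u: "in_H1 D u"
 shows "in_H1 D (%x. c *R u x)" "jet D (%x. c *R u x) = c *R jet D u"
proof -
 have mD: "D : sets lebesgue" using D by auto
 note U = in_H1D[OF D u]
 note * = jet_eqI[OF D in_L2_scaleR[OF mD U(1)] has_weak_gradient_scaleR[OF D U(2)] in_L2_scaleR[OF mD U(3)]]
 show "in_H1 D (%x. c *R u x)" by (rule *(1))
 show "jet D (%x. c *R u x) = c *R jet D u"
  unfolding *(2) toL2_scaleR[OF mD U(1)] toL2_scaleR[OF mD U(3)] by (simp add: jet_def)
qed

lemma jet_diff:
 assumes D: "open D" and u: "in_H1 D u" and v: "in_H1 D v"
 shows "in_H1 D (%x. u x - v x)" "jet D (%x. u x - v x) = jet D u - jet D v"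
 using jet_add[OF D u jet_scaleR(1)[OF D v, of "-1"]] jet_scaleR(2)[OF D v, of "-1"] by simp_all

lemma jet_times_i:
 assumes D: "open D" and u: "in_H1 D u"
 shows "in_H1 D (%x. \<i> * u x)"
  "jet D (%x. \<i> * u x) = (toL2 D (%x. \<i> * u x), toL2 D (%x. \<chi> j. \<i> * weak_gradient D u x $ j))"
  "in_L2 D (%x. \<i> * u x)" "in_L2 D (%x. \<chi> j. \<i> * weak_gradient D u x $ j)"
  "norm (jet D (%x. \<i> * u x)) = norm (jet D u)"
proof -
 have mD: "D : sets lebesgue" using D by auto
 note U = in_H1D[OF D u]
 have ng: "norm (\<chi> j. \<i> * z $ j :: complex^'d) = norm z" for z by (simp add: norm_vec_def norm_mult)
 show iu: "in_L2 D (%x. \<i> * u x)" by (rule in_L2_bound[OF mD U(1), of _ 1]) (use U(1) in "auto simp: in_L2_def norm_mult")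
 show ig: "in_L2 D (%x. \<chi> j. \<i> * weak_gradient D u x $ j)"
 proof (rule in_L2_vec[OF mD], rule in_L2_bound[OF mD U(3), of _ 1])
  fix j
  have "(%x. weak_gradient D u x $ j) : borel_measurable (lebesgue_on D)"
   by (rule measurable_compose[OF _ borel_measurable_continuous_onI]) (use U(3) in "auto simp: in_L2_def intro: continuous_intros")
  then show "(%x. (\<chi> j. \<i> * weak_gradient D u x $ j) $ j) : borel_measurable (lebesgue_on D)" by simp
  show "AE x in lebesgue_on D. norm ((\<chi> j. \<i> * weak_gradient D u x $ j) $ j) <= 1 * norm (weak_gradient D u x)"
   by (intro AE_I2) (use Finite_Cartesian_Product.norm_nth_le in "simp add: norm_mult")
 qed
 note * = jet_eqI[OF D iu has_weak_gradient_bounded_linear[OF bounded_linear_mult_right D U(2)] ig]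
 show "in_H1 D (%x. \<i> * u x)" by (rule *(1))
 show e: "jet D (%x. \<i> * u x) = (toL2 D (%x. \<i> * u x), toL2 D (%x. \<chi> j. \<i> * weak_gradient D u x $ j))" by (rule *(2))
 have "L2_norm D (%x. \<i> * u x) = L2_norm D u"
  "L2_norm D (%x. \<chi> j. \<i> * weak_gradient D u x $ j) = L2_norm D (weak_gradient D u)"
  by (simp_all add: L2_norm_def norm_mult ng)
 then show "norm (jet D (%x. \<i> * u x)) = norm (jet D u)"
  unfolding e unfolding jet_def norm_Pair by (simp add: norm_toL2[OF mD] iu ig U)
qed

lemma jet_test_function:
 fixes \<phi> :: "real^'d::finite => 'b::euclidean_space"
 assumes D: "open D" and t: "test_function D \<phi>"
 shows "in_H1 D \<phi>" "jet D \<phi> = (toL2 D \<phi>, toL2 D (%x. \<chi> i. partial_deriv i \<phi> x))"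
  "in_L2 D (%x. \<chi> i. partial_deriv i \<phi> x)"
proof -
 have mD: "D : sets lebesgue" using D by auto
 show g: "in_L2 D (%x. \<chi> i. partial_deriv i \<phi> x)"
  by (rule in_L2_vec[OF mD]) (simp add: in_L2_test_function[OF test_function_partial_deriv[OF t] mD])
 note * = jet_eqI[OF D in_L2_test_function[OF t mD] has_weak_gradient_smooth[OF test_function_smooth[OF t] D] g]
 show "in_H1 D \<phi>" "jet D \<phi> = (toL2 D \<phi>, toL2 D (%x. \<chi> i. partial_deriv i \<phi> x))" by (rule *)+
qed

lemma H1_norm_eq_norm_jet: "open D ==> in_H1 D u ==> H1_norm D u = norm (jet D u)"
 by (simp add: H1_norm_def jet_def norm_Pair norm_toL2 in_H1D)

lemma in_H1_0_iff:
 fixes u :: "real^'d::finite => 'b::euclidean_space"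
 assumes D: "open D"
 shows "in_H1_0 D u \<longleftrightarrow> in_H1 D u & jet D u : closure (jet D ` Collect (test_function D))"
proof -
 have "H1_norm D (%x. u x - \<phi> x) = dist (jet D \<phi>) (jet D u)" if "in_H1 D u" "test_function D \<phi>" for \<phi>
  using jet_diff[OF D that(1) jet_test_function(1)[OF D that(2)]]
  by (simp only: H1_norm_eq_norm_jet[OF D] dist_norm norm_minus_commute[of "jet D u"])
 then show ?thesis unfolding in_H1_0_def closure_approachable by (simp cong: conj_cong)
qed

lemma subspace_closure:
 fixes S :: "'a::real_normed_vector set"
 assumes "subspace S" shows "subspace (closure S)"
proof (rule subspaceI)
 show "0 : closure S" using subspace_0[OF assms] closure_subset by blast
next
 fix x y assume "x : closure S" "y : closure S"
 then obtain f g where "!!n. f n : S" "f ----> x" "!!n. g n : S" "g ----> y" unfolding closure_sequential by blast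
 then show "x + y : closure S" unfolding closure_sequential using subspace_add[OF assms]
  by (intro exI[of _ "%n. f n + g n"]) (auto intro: tendsto_add)
next
 fix c x assume "x : closure S"
 then obtain f where "!!n. f n : S" "f ----> x" unfolding closure_sequential by blast
 then show "c *R x : closure S" unfolding closure_sequential using subspace_scale[OF assms]
  by (intro exI[of _ "%n. c *R f n"]) (auto intro: tendsto_scaleR)
qed

lemma subspace_H1_0_jets:
 assumes D: "open D"
 shows "subspace (closure (jet D ` Collect (test_function D)) :: (('d::finite, 'b::euclidean_space) L2 \<times> ('d, 'b^'d) L2) set)"
proof -
 note J = jet_test_function(1)[OF D]
 have "subspace (jet D ` Collect (test_function D) :: (('d, 'b) L2 \<times> ('d, 'b^'d) L2) set)"
 proof (rule subspaceI)
  have t: "test_function D (%x. 0 :: 'b)" by (rule test_functionI[of _ "{}"]) (auto simp: smooth_const)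
  have "jet D (%x. 0 :: 'b) = 0" using jet_scaleR(2)[OF D J[OF t], of 0] by simp
  with t show "(0 :: ('d, 'b) L2 \<times> ('d, 'b^'d) L2) : jet D ` Collect (test_function D)" by (metis image_eqI mem_Collect_eq)
 next
  fix p q :: "('d, 'b) L2 \<times> ('d, 'b^'d) L2"
  assume "p : jet D ` Collect (test_function D)" "q : jet D ` Collect (test_function D)"
  then obtain \<phi> \<eta> where "test_function D \<phi>" "p = jet D \<phi>" "test_function D \<eta>" "q = jet D \<eta>" by blast
  then show "p + q : jet D ` Collect (test_function D)"
   using jet_add(2)[OF D J J, of \<phi> \<eta>] test_function_add[of D \<phi> \<eta>] by (metis image_eqI mem_Collect_eq)
 next
  fix c and p :: "('d, 'b) L2 \<times> ('d, 'b^'d) L2"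
  assume "p : jet D ` Collect (test_function D)"
  then obtain \<phi> where "test_function D \<phi>" "p = jet D \<phi>" by blast
  then show "c *R p : jet D ` Collect (test_function D)"
   using jet_scaleR(2)[OF D J, of \<phi> c] test_function_bounded_linear[OF bounded_linear_scaleR_right, of D \<phi> c]
   by (metis image_eqI mem_Collect_eq)
 qed
 then show ?thesis by (rule subspace_closure)
qed

lemma X_space_iff:
 assumes "open D"
 shows "(w, v) : X_space D \<longleftrightarrow> in_H1 D w & in_H1 D v & jet D w - jet D v : closure (jet D ` Collect (test_function D))"
 unfolding X_space_def by (auto simp: in_H1_0_iff[OF assms] jet_diff[OF assms])

definition X_jet where "X_jet D p = (jet D (fst p), jet D (snd p))"

lemma X_norm_eq_norm_X_jet: "open D ==> p : X_space D ==> X_norm D p = norm (X_jet D p)"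
 using X_space_iff[of D "fst p" "snd p"] by (simp add: X_norm_def X_jet_def norm_Pair H1_norm_eq_norm_jet)

lemma X_space_add:
 assumes D: "open D" and p: "(w, v) : X_space D" "(w', v') : X_space D"
 shows "(%x. w x + w' x, %x. v x + v' x) : X_space D"
  "X_jet D (%x. w x + w' x, %x. v x + v' x) = X_jet D (w, v) + X_jet D (w', v')"
proof -
 note H = p[unfolded X_space_iff[OF D]]
 have e: "jet D (%x. w x + w' x) = jet D w + jet D w'" "jet D (%x. v x + v' x) = jet D v + jet D v'"
  using H jet_add(2)[OF D] by blast+
 then show "X_jet D (%x. w x + w' x, %x. v x + v' x) = X_jet D (w, v) + X_jet D (w', v')" by (simp add: X_jet_def)
 have "(jet D w - jet D v) + (jet D w' - jet D v') : closure (jet D ` Collect (test_function D))"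
  by (rule subspace_add[OF subspace_H1_0_jets[OF D]]) (use H in auto)
 then show "(%x. w x + w' x, %x. v x + v' x) : X_space D"
  unfolding X_space_iff[OF D] e using H jet_add(1)[OF D] by (auto simp: algebra_simps)
qed

lemma X_space_scaleR:
 assumes D: "open D" and p: "(w, v) : X_space D"
 shows "(%x. c *R w x, %x. c *R v x) : X_space D" "X_jet D (%x. c *R w x, %x. c *R v x) = c *R X_jet D (w, v)"
proof -
 note H = p[unfolded X_space_iff[OF D]]
 have e: "jet D (%x. c *R w x) = c *R jet D w" "jet D (%x. c *R v x) = c *R jet D v" using H jet_scaleR(2)[OF D] by blast+
 then show "X_jet D (%x. c *R w x, %x. c *R v x) = c *R X_jet D (w, v)" by (simp add: X_jet_def)
 have "c *R (jet D w - jet D v) : closure (jet D ` Collect (test_function D))"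
  by (rule subspace_scale[OF subspace_H1_0_jets[OF D]]) (use H in auto)
 then show "(%x. c *R w x, %x. c *R v x) : X_space D"
  unfolding X_space_iff[OF D] e using H jet_scaleR(1)[OF D] by (auto simp: scaleR_diff_right)
qed

lemma X_space_times_i:
 assumes D: "open D" and p: "(w, v) : X_space D"
 shows "(%x. \<i> * w x, %x. \<i> * v x) : X_space D"
proof -
 have H: "in_H1 D w" "in_H1 D v" "in_H1_0 D (%x. w x - v x)" using p unfolding X_space_def by auto
 note dH = jet_diff(1)[OF D H(1,2)]
 have "in_H1_0 D (%x. \<i> * (w x - v x))" unfolding in_H1_0_def
 proof (intro conjI allI impI)
  show "in_H1 D (%x. \<i> * (w x - v x))" by (rule jet_times_i(1)[OF D dH])
  fix e :: real assume "e > 0"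
  then obtain \<phi> where \<phi>: "test_function D \<phi>" "H1_norm D (%x. w x - v x - \<phi> x) < e"
   using H(3) unfolding in_H1_0_def by blast
  note dd = jet_diff(1)[OF D dH jet_test_function(1)[OF D \<phi>(1)]]
  have "H1_norm D (%x. \<i> * (w x - v x - \<phi> x)) < e"
   using \<phi>(2) by (simp only: H1_norm_eq_norm_jet[OF D dd] H1_norm_eq_norm_jet[OF D jet_times_i(1)[OF D dd]] jet_times_i(5)[OF D dd])
  then have "H1_norm D (%x. \<i> * (w x - v x) - \<i> * \<phi> x) < e" by (simp only: right_diff_distrib)
  then show "\<exists>\<phi>. test_function D \<phi> & H1_norm D (%x. \<i> * (w x - v x) - \<phi> x) < e"
   using test_function_bounded_linear[OF bounded_linear_mult_right \<phi>(1)] by blast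
 qed
 then show ?thesis unfolding X_space_def using jet_times_i(1)[OF D] H by (simp add: right_diff_distrib)
qed

text \<open>The identity that defines a weak gradient consists of inner products with fixed elements of \<open>L\<^sup>2\<close>,
 so it survives a weak limit.\<close>

lemma H1_weak_limit:
 fixes u :: "nat => real^'d::finite => 'b::euclidean_space"
 assumes D: "open D" and u: "!!m. in_H1 D (u m)" and w: "weakly_tendsto (%m. jet D (u m)) P"
 shows "in_H1 D (rep_L2 (fst P))" "jet D (rep_L2 (fst P)) = P"
proof -
 have mD: "D : sets lebesgue" using D by auto
 note U = in_H1D[OF D u] and r = in_L2_rep_L2[OF mD]
 have w1: "weakly_tendsto (%m. toL2 D (u m)) (fst P)" and w2: "weakly_tendsto (%m. toL2 D (weak_gradient D (u m))) (snd P)"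
  using weakly_tendsto_fst[OF w] weakly_tendsto_snd[OF w] by (simp_all add: jet_def)
 note e = toL2_rep_weak_limit[OF mD U(1) w1] toL2_rep_weak_limit[OF mD U(3) w2]
 let ?u = "rep_L2 (fst P)" and ?g = "rep_L2 (snd P)"
 have "has_weak_gradient D ?u ?g" unfolding has_weak_gradient_iff[OF D]
 proof (intro conjI allI impI in_L2_locally_integrable[OF mD] r)
  fix \<phi> :: "real^'d => real" and i assume t: "test_function D \<phi>"
  note ti = test_function_partial_deriv[OF t, of i]
  have i1: "integrable (lebesgue_on D) (%x. partial_deriv i \<phi> x *R f x)" and i2: "integrable (lebesgue_on D) (%x. \<phi> x *R f x)"
   if "in_L2 D f" for f :: "real^'d => 'b" unfolding integrable_lebesgue_on[OF mD]
   by (intro integrable_mult_indicator[OF mD] integrable_test_function_scaleR[OF ti] integrable_test_function_scaleR[OF t]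
     in_L2_locally_integrable[OF mD that])+
  have ip: "(LINT x|lebesgue_on D. f x) \<bullet> b = (LINT x|lebesgue_on D. f x \<bullet> b)" if "integrable (lebesgue_on D) f" for f :: "real^'d => 'b" and b
   using integral_inner_left[of b] that by simp
  have "((LINT x|lebesgue_on D. partial_deriv i \<phi> x *R ?u x) + (LINT x|lebesgue_on D. \<phi> x *R (?g x $ i))) \<bullet> b = 0" for b
  proof -
   have tb: "test_function D (%x. partial_deriv i \<phi> x *R b)" by (rule test_function_scaleR_const[OF ti])
   have gL: "in_L2 D (%x. f x $ i)" if "in_L2 D f" for f :: "real^'d => 'b^'d"
   proof (rule in_L2_bound[OF mD that, of _ 1])
    show "(%x. f x $ i) : borel_measurable (lebesgue_on D)"
     by (rule measurable_compose[OF _ borel_measurable_continuous_onI]) (use that in "auto simp: in_L2_def intro: continuous_intros")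
   qed (intro AE_I2, use Finite_Cartesian_Product.norm_nth_le in simp)
   have ab: "in_L2 D (%x. axis i (\<phi> x *R b))"
   proof (rule in_L2_vec[OF mD])
    fix j
    have "test_function D (%x. (\<phi> x *R b))" by (rule test_function_scaleR_const[OF t])
    from in_L2_test_function[OF this mD] in_L2_test_function[OF test_function_scaleR_const[OF t, of 0] mD]
    show "in_L2 D (%x. axis i (\<phi> x *R b) $ j)" by (cases "j = i") (auto simp: axis_def)
   qed
   have pair: "((LINT x|lebesgue_on D. partial_deriv i \<phi> x *R f x) + (LINT x|lebesgue_on D. \<phi> x *R (h x $ i))) \<bullet> b
     = toL2 D f \<bullet> toL2 D (%x. partial_deriv i \<phi> x *R b) + toL2 D h \<bullet> toL2 D (%x. axis i (\<phi> x *R b))"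
    if "in_L2 D f" "in_L2 D h" for f h
    by (simp add: inner_toL2[OF mD] that in_L2_test_function[OF tb mD] ab inner_add_left ip i1 i2 gL inner_axis)
   have "toL2 D (u m) \<bullet> toL2 D (%x. partial_deriv i \<phi> x *R b) + toL2 D (weak_gradient D (u m)) \<bullet> toL2 D (%x. axis i (\<phi> x *R b)) = 0" for m
    unfolding pair[OF U(1,3), symmetric] using has_weak_gradientD(3)[OF U(2)[of m] D t, of i]
    by (simp add: integral_test_function_on[OF t mD] integral_test_function_on[OF ti mD])
   moreover have "(%m. toL2 D (u m) \<bullet> toL2 D (%x. partial_deriv i \<phi> x *R b) + toL2 D (weak_gradient D (u m)) \<bullet> toL2 D (%x. axis i (\<phi> x *R b)))
     ----> fst P \<bullet> toL2 D (%x. partial_deriv i \<phi> x *R b) + snd P \<bullet> toL2 D (%x. axis i (\<phi> x *R b))"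
    using w1 w2 unfolding weakly_tendsto_def by (intro tendsto_add) blast+
   ultimately have "fst P \<bullet> toL2 D (%x. partial_deriv i \<phi> x *R b) + snd P \<bullet> toL2 D (%x. axis i (\<phi> x *R b)) = 0"
    by (simp add: LIMSEQ_const_iff)
   then show ?thesis unfolding pair[OF r r] e .
  qed
  from this[of "(LINT x|lebesgue_on D. partial_deriv i \<phi> x *R ?u x) + (LINT x|lebesgue_on D. \<phi> x *R (?g x $ i))"]
  show "(LINT x|lebesgue. partial_deriv i \<phi> x *R ?u x) = - (LINT x|lebesgue. \<phi> x *R (?g x $ i))"
   by (simp add: integral_test_function_on[OF t mD] integral_test_function_on[OF ti mD] eq_neg_iff_add_eq_0)
 qed
 note * = jet_eqI[OF D r this r]
 show "in_H1 D ?u" by (rule *(1))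
 show "jet D ?u = P" using *(2) by (simp add: e)
qed

lemma X_space_weak_limit:
 assumes D: "open D" and p: "!!m. (w m, v m) : X_space D" and lim: "weakly_tendsto (%m. X_jet D (w m, v m)) P"
 obtains w0 v0 where "(w0, v0) : X_space D" "X_jet D (w0, v0) = P"
proof -
 have H: "in_H1 D (w m)" "in_H1 D (v m)" "jet D (w m) - jet D (v m) : closure (jet D ` Collect (test_function D))" for m
  using p[of m] unfolding X_space_iff[OF D] by auto
 have w1: "weakly_tendsto (%m. jet D (w m)) (fst P)" and w2: "weakly_tendsto (%m. jet D (v m)) (snd P)"
  using weakly_tendsto_fst[OF lim] weakly_tendsto_snd[OF lim] by (simp_all add: X_jet_def)
 note l1 = H1_weak_limit[OF D H(1) w1] and l2 = H1_weak_limit[OF D H(2) w2]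
 have "fst P - snd P : closure (jet D ` Collect (test_function D))"
  by (rule weakly_tendsto_closed_convex[OF closed_closure subspace_imp_convex[OF subspace_H1_0_jets[OF D]] H(3) weakly_tendsto_diff[OF w1 w2]])
 then have "(rep_L2 (fst (fst P)), rep_L2 (fst (snd P))) : X_space D" unfolding X_space_iff[OF D] using l1 l2 by simp
 moreover have "X_jet D (rep_L2 (fst (fst P)), rep_L2 (fst (snd P))) = P" using l1 l2 by (simp add: X_jet_def)
 ultimately show ?thesis by (rule that)
qed

text \<open>A bounded functional on \<open>X(D)\<close> factors through the jets, so that it is a bounded functional
 on a subspace of a Hilbert space.\<close>

lemma X_real_functional_weakly_continuous:
 fixes G :: "'d::finite cfun \<times> 'd cfun => real"
 assumes D: "open D" and p: "!!m. p m : X_space D" "q : X_space D"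
  and lim: "weakly_tendsto (%m. X_jet D (p m)) (X_jet D q)"
  and add: "!!w v w' v'. (w, v) : X_space D ==> (w', v') : X_space D ==>
   G (%x. w x + w' x, %x. v x + v' x) = G (w, v) + G (w', v')"
  and scale: "!!c w v. (w, v) : X_space D ==> G (%x. c *R w x, %x. c *R v x) = c * G (w, v)"
  and bd: "!!p. p : X_space D ==> \<bar>G p\<bar> <= C * X_norm D p"
 shows "(%m. G (p m)) ----> G q"
proof -
 have eq: "G a = G b" if "a : X_space D" "b : X_space D" "X_jet D a = X_jet D b" for a b
 proof -
  obtain w v w' v' where ab: "a = (w, v)" "b = (w', v')" by (metis surj_pair)
  note b' = X_space_scaleR[OF D that(2)[unfolded ab], of "-1"]
  note s = X_space_add[OF D that(1)[unfolded ab] b'(1)]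
  have "X_norm D (%x. w x + (-1) *R w' x, %x. v x + (-1) *R v' x) = 0"
   unfolding X_norm_eq_norm_X_jet[OF D s(1)] s(2) b'(2) using that(3) ab by simp
  then have "G (%x. w x + (-1) *R w' x, %x. v x + (-1) *R v' x) = 0" using bd[OF s(1)] by simp
  then show ?thesis using add[OF that(1)[unfolded ab] b'(1)] scale[OF that(2)[unfolded ab], of "-1"] ab by simp
 qed
 define f where "f J = G (SOME p. p : X_space D & X_jet D p = J)" for J
 have f: "f (X_jet D a) = G a" if "a : X_space D" for a
  unfolding f_def using someI[of "%p. p : X_space D & X_jet D p = X_jet D a" a] that by (intro eq) auto
 have S1: "a + b : X_jet D ` X_space D" and f1: "f (a + b) = f a + f b"
  if ab: "a : X_jet D ` X_space D" "b : X_jet D ` X_space D" for a b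
 proof -
  obtain w v w' v' where *: "(w, v) : X_space D" "a = X_jet D (w, v)" "(w', v') : X_space D" "b = X_jet D (w', v')"
   using ab by auto
  note s = X_space_add[OF D *(1,3)]
  show "a + b : X_jet D ` X_space D" unfolding * s(2)[symmetric] using s(1) by blast
  show "f (a + b) = f a + f b" unfolding *(2,4) unfolding s(2)[symmetric] unfolding f[OF s(1)] f[OF *(1)] f[OF *(3)] by (rule add[OF *(1,3)])
 qed
 have S2: "c *R a : X_jet D ` X_space D" and f2: "f (c *R a) = c * f a" if a: "a : X_jet D ` X_space D" for c a
 proof -
  obtain w v where *: "(w, v) : X_space D" "a = X_jet D (w, v)" using a by auto
  note s = X_space_scaleR[OF D *(1), of c]
  show "c *R a : X_jet D ` X_space D" unfolding * s(2)[symmetric] using s(1) by blast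
  show "f (c *R a) = c * f a" unfolding *(2) unfolding s(2)[symmetric] unfolding f[OF s(1)] f[OF *(1)] by (rule scale[OF *(1)])
 qed
 have "subspace (X_jet D ` X_space D)"
 proof (rule subspaceI)
  show "0 : X_jet D ` X_space D" using S2[of "X_jet D q" 0] p(2) by simp
 qed (rule S1 S2; assumption)+
 then have "(%m. f (X_jet D (p m))) ----> f (X_jet D q)"
 proof (rule bounded_functional_weakly_continuous[OF _ _ _ lim f1 f2, where C = C])
  fix a assume "a : X_jet D ` X_space D"
  then obtain b where "b : X_space D" "a = X_jet D b" by blast
  then show "\<bar>f a\<bar> <= C * norm a" using f[of b] bd[of b] X_norm_eq_norm_X_jet[OF D, of b] by simp
 qed (use p in auto)
 then show ?thesis by (simp add: f p)
qed

lemma X_weakly_tendsto_if_jets: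
 assumes D: "open D" and p: "!!m. p m : X_space D" "q : X_space D"
  and lim: "weakly_tendsto (%m. X_jet D (p m)) (X_jet D q)"
 shows "X_weakly_tendsto D p q"
 unfolding X_weakly_tendsto_def
proof (intro conjI allI impI p)
 fix F assume F: "X_bounded_functional D F"
 then obtain C where C: "!!p. p : X_space D ==> cmod (F p) <= C * X_norm D p" unfolding X_bounded_functional_def by blast
 have add: "F (%x. w x + w' x, %x. v x + v' x) = F (w, v) + F (w', v')"
  if "(w, v) : X_space D" "(w', v') : X_space D" for w v w' v' using F that unfolding X_bounded_functional_def by blast
 have "F (%x. complex_of_real c * w x, %x. complex_of_real c * v x) = complex_of_real c * F (w, v)"
  if "(w, v) : X_space D" for c w v using F that unfolding X_bounded_functional_def by blast
 then have scale: "F (%x. c *R w x, %x. c *R v x) = complex_of_real c * F (w, v)"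
  if "(w, v) : X_space D" for c w v using that by (simp add: scaleR_conv_of_real)
 have "(%m. Re (F (p m))) ----> Re (F q)" by (rule X_real_functional_weakly_continuous[OF D p lim, of "%p. Re (F p)" C])
   (use C in "auto simp: add scale intro: order_trans[OF abs_Re_le_cmod]")
 moreover have "(%m. Im (F (p m))) ----> Im (F q)"
  by (rule X_real_functional_weakly_continuous[OF D p lim, of "%p. Im (F p)" C])
   (use C in "auto simp: add scale intro: order_trans[OF abs_Im_le_cmod]")
 ultimately show "(%m. F (p m)) ----> F q" by (simp add: tendsto_complex_iff)
qed

section \<open>The transmission eigenvalue problem in real form\<close>

lemma complex_matrix_component: "(\<chi> i. (complex_matrix M *v \<xi>) $ i \<bullet> b) = M *v (\<chi> i. \<xi> $ i \<bullet> b)"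
 by (simp add: vec_eq_iff matrix_vector_mult_def complex_matrix_def inner_sum_left scaleR_conv_of_real[symmetric])

lemma inner_vec_eq_sum_components:
 fixes a b :: "'b::euclidean_space^'n::finite"
 shows "a \<bullet> b = (\<Sum>e\<in>Basis. (\<chi> i. a $ i \<bullet> e) \<bullet> (\<chi> i. b $ i \<bullet> e))"
proof -
 have "a \<bullet> b = (\<Sum>i\<in>UNIV. \<Sum>e\<in>Basis. (a $ i \<bullet> e) * (b $ i \<bullet> e))"
  unfolding inner_vec_def by (intro sum.cong refl euclidean_inner)
 also have "... = (\<Sum>e\<in>Basis. \<Sum>i\<in>UNIV. (a $ i \<bullet> e) * (b $ i \<bullet> e))" by (rule sum.swap)
 finally show ?thesis by (simp add: inner_vec_def)
qed

lemma complex_matrix_inner_sym: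
 assumes "transpose M = M" shows "(complex_matrix M *v x) \<bullet> y = x \<bullet> (complex_matrix M *v y)"
 unfolding inner_vec_eq_sum_components[of "complex_matrix M *v x"] inner_vec_eq_sum_components[of x]
  complex_matrix_component by (simp only: inner_matrix_vector_sym[OF assms])

lemma norm_complex_matrix_vector_le: "norm (complex_matrix M *v \<xi>) <= norm M * norm \<xi>"
proof (rule power2_le_imp_le)
 have "(norm (complex_matrix M *v \<xi>))^2 = (\<Sum>e\<in>Basis. (norm (M *v (\<chi> i. \<xi> $ i \<bullet> e)))^2)"
  unfolding power2_norm_eq_inner inner_vec_eq_sum_components[of "complex_matrix M *v \<xi>"] complex_matrix_component by (rule refl)
 also have "... <= (\<Sum>e\<in>Basis. (norm M * norm (\<chi> i. \<xi> $ i \<bullet> e))^2)"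
  by (intro sum_mono power_mono norm_matrix_vector_le norm_ge_zero)
 also have "... = (norm M)^2 * (norm \<xi>)^2"
  unfolding power_mult_distrib sum_distrib_left[symmetric] power2_norm_eq_inner[of \<xi>] inner_vec_eq_sum_components[of \<xi>]
  by (simp only: power2_norm_eq_inner)
 finally show "(norm (complex_matrix M *v \<xi>))^2 <= (norm M * norm \<xi>)^2" by (simp only: power_mult_distrib)
qed simp

lemma complex_matrix_scaleR: "complex_matrix M *v (c *R \<xi>) = c *R (complex_matrix M *v \<xi>)"
 by (simp add: vec_eq_iff matrix_vector_mult_def scaleR_sum_right)

lemma linear_component: "linear (%\<xi>. \<chi> i. \<xi> $ i \<bullet> b)"
 by (rule linearI) (simp_all add: vec_eq_iff inner_add_left)

lemma in_L2_complex_matrix_vector: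
 fixes M :: "real^'d::finite => real^'d^'d"
 assumes S: "S : sets lebesgue" and M: "M : borel_measurable lebesgue" "AE x in lebesgue. norm (M x) <= C" and C: "C >= 0"
  and v: "in_L2 S v"
 shows "in_L2 S (%x. complex_matrix (M x) *v v x)" "L2_norm S (%x. complex_matrix (M x) *v v x) <= C * L2_norm S v"
proof -
 have "AE x in lebesgue. norm (complex_matrix (M x) *v v x) <= C * norm (v x)"
  using M(2) by eventually_elim (meson mult_right_mono norm_ge_zero norm_complex_matrix_vector_le order_trans)
 then have AE: "AE x in lebesgue_on S. norm (complex_matrix (M x) *v v x) <= C * norm (v x)"
  unfolding AE_lebesgue_on[OF S] by eventually_elim simp
 have "(%x. (complex_matrix (M x) *v v x) \<bullet> e) : borel_measurable (lebesgue_on S)" if e_Basis: "e : Basis" for e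
 proof -
  obtain i b where e: "e = axis i b" using e_Basis by (auto simp: Basis_vec_def)
  have "(complex_matrix (M x) *v v x) \<bullet> e = (M x *v (\<chi> i. v x $ i \<bullet> b)) $ i" for x
   unfolding complex_matrix_component[symmetric] e inner_axis by simp
  moreover have "in_L2 S (%x. (M x *v (\<chi> i. v x $ i \<bullet> b)) $ i)"
   by (intro in_L2_component[OF S] in_L2_matrix_vector(1)[OF S M _ C] in_L2_linear[OF S linear_component v])
  ultimately show ?thesis unfolding in_L2_def by simp
 qed
 then have m: "(%x. complex_matrix (M x) *v v x) : borel_measurable (lebesgue_on S)"
  by (subst borel_measurable_euclidean_space) blast
 show "in_L2 S (%x. complex_matrix (M x) *v v x)" by (rule in_L2_bound[OF S v m AE])
 show "L2_norm S (%x. complex_matrix (M x) *v v x) <= C * L2_norm S v" by (rule L2_norm_bound[OF S v C AE])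
qed

lemma in_L2_bounded_multiple:
 fixes u :: "real^'d::finite => 'b::euclidean_space" and n :: "real^'d => real"
 assumes S: "S : sets lebesgue" and n: "n : borel_measurable lebesgue" "AE x in lebesgue. \<bar>n x\<bar> <= N" and N: "N >= 0"
  and u: "in_L2 S u"
 shows "in_L2 S (%x. n x *R u x)" "L2_norm S (%x. n x *R u x) <= N * L2_norm S u"
proof -
 have "AE x in lebesgue_on S. \<bar>n x\<bar> <= N" using n(2) unfolding AE_lebesgue_on[OF S] by eventually_elim simp
 then have AE: "AE x in lebesgue_on S. norm (n x *R u x) <= N * norm (u x)" by eventually_elim (simp add: mult_right_mono)
 show "in_L2 S (%x. n x *R u x)" by (rule in_L2_bound[OF S u _ AE])
   (use u measurable_restrict_space1[OF n(1), of S] in "auto simp: in_L2_def intro: borel_measurable_scaleR")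
 show "L2_norm S (%x. n x *R u x) <= N * L2_norm S u" by (rule L2_norm_bound[OF S u N AE])
qed

lemma hermitian_dot_eq: "hermitian_dot a b = Complex (a \<bullet> b) (a \<bullet> (\<chi> j. \<i> * b $ j))"
 by (simp add: complex_eq_iff hermitian_dot_def inner_vec_def inner_complex_def algebra_simps sum_subtractf sum_negf sum.distrib)

text \<open>The real part of the weak formulation, as a function of the jets of the test functions.\<close>

definition real_form where
 "real_form D M n \<kappa> w v J1 J2 =
  toL2 D (%x. complex_matrix (M x) *v weak_gradient D w x) \<bullet> snd J1 - snd (jet D v) \<bullet> snd J2
  - \<kappa> * (toL2 D (%x. n x *R w x) \<bullet> fst J1 - fst (jet D v) \<bullet> fst J2)"

text \<open>The real parts determine the complex equations, since test functions may be multiplied by \<open>\<i>\<close>.\<close>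

lemma transmission_eigenpair_iff:
 fixes D :: "(real^'d::finite) set"
 assumes D: "open D" "bounded D"
  and M: "M : borel_measurable lebesgue" "AE x in lebesgue. norm (M x) <= C" and C: "C >= 0"
  and n: "n : borel_measurable lebesgue" "AE x in lebesgue. \<bar>n x\<bar> <= N" and N: "N >= 0"
 shows "transmission_eigenpair D M n (w, v) k \<longleftrightarrow>
  (w, v) : X_space D & ~ (toL2 D w = 0 & toL2 D v = 0) \<and>
  (\<forall>\<phi>1 \<phi>2. (\<phi>1, \<phi>2) : X_space D --> real_form D M n (k^2) w v (jet D \<phi>1) (jet D \<phi>2) = 0)"
proof (cases "(w, v) : X_space D")
 case True
 have mD: "D : sets lebesgue" using D by auto
 have H: "in_H1 D w" "in_H1 D v" using True unfolding X_space_def by auto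
 note W = in_H1D[OF D(1) H(1)] and V = in_H1D[OF D(1) H(2)]
 note s = in_L2_complex_matrix_vector(1)[OF mD M C W(3)] and nw = in_L2_bounded_multiple(1)[OF mD n N W(1)]
 define R where "R p1 g1 p2 g2 x = (complex_matrix (M x) *v weak_gradient D w x) \<bullet> g1 x - weak_gradient D v x \<bullet> g2 x
   - k^2 * ((n x *R w x) \<bullet> p1 x - v x \<bullet> p2 x)" for p1 g1 p2 g2 x
 have R: "integrable (lebesgue_on D) (R p1 g1 p2 g2)"
  "(LINT x|lebesgue_on D. R p1 g1 p2 g2 x) = real_form D M n (k^2) w v (toL2 D p1, toL2 D g1) (toL2 D p2, toL2 D g2)"
  if g: "in_L2 D p1" "in_L2 D g1" "in_L2 D p2" "in_L2 D g2" for p1 g1 p2 g2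
 proof -
  note i = integrable_inner_in_L2[OF mD s g(2)] integrable_inner_in_L2[OF mD V(3) g(4)]
   integrable_inner_in_L2[OF mD nw g(1)] integrable_inner_in_L2[OF mD V(1) g(3)]
  show "integrable (lebesgue_on D) (R p1 g1 p2 g2)"
   unfolding R_def by (intro Bochner_Integration.integrable_diff integrable_mult_right i)
  show "(LINT x|lebesgue_on D. R p1 g1 p2 g2 x) = real_form D M n (k^2) w v (toL2 D p1, toL2 D g1) (toL2 D p2, toL2 D g2)"
   unfolding R_def real_form_def jet_def fst_conv snd_conv inner_toL2[OF mD s g(2)] inner_toL2[OF mD V(3) g(4)]
    inner_toL2[OF mD nw g(1)] inner_toL2[OF mD V(1) g(3)]
   by ((subst Bochner_Integration.integral_diff, (intro Bochner_Integration.integrable_diff integrable_mult_right i)+)+,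
     subst integral_mult_right_zero, subst Bochner_Integration.integral_diff, (intro i)+, rule refl)
 qed
 have I: "(LINT x|lebesgue_on D.
      hermitian_dot (complex_matrix (M x) *v weak_gradient D w x) (weak_gradient D \<phi>1 x)
     - hermitian_dot (weak_gradient D v x) (weak_gradient D \<phi>2 x)
     - (complex_of_real k)^2 * (complex_of_real (n x) * w x * cnj (\<phi>1 x) - v x * cnj (\<phi>2 x)))
   = Complex (real_form D M n (k^2) w v (jet D \<phi>1) (jet D \<phi>2))
     (real_form D M n (k^2) w v (jet D (%x. \<i> * \<phi>1 x)) (jet D (%x. \<i> * \<phi>2 x)))" (is "?I = _")
  if \<phi>: "(\<phi>1, \<phi>2) : X_space D" for \<phi>1 \<phi>2
 proof -
  have H: "in_H1 D \<phi>1" "in_H1 D \<phi>2" using \<phi> unfolding X_space_def by auto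
  note F1 = in_H1D[OF D(1) H(1)] jet_times_i[OF D(1) H(1)] and F2 = in_H1D[OF D(1) H(2)] jet_times_i[OF D(1) H(2)]
  note R1 = R[OF F1(1,3) F2(1,3)] and R2 = R[OF F1(6,7) F2(6,7)]
  have "?I = (LINT x|lebesgue_on D. complex_of_real (R \<phi>1 (weak_gradient D \<phi>1) \<phi>2 (weak_gradient D \<phi>2) x) +
   \<i> * complex_of_real (R (%x. \<i> * \<phi>1 x) (%x. \<chi> j. \<i> * weak_gradient D \<phi>1 x $ j) (%x. \<i> * \<phi>2 x) (%x. \<chi> j. \<i> * weak_gradient D \<phi>2 x $ j) x))"
  proof (rule Bochner_Integration.integral_cong[OF refl])
   fix x
   have z: "a * cnj b = Complex (a \<bullet> b) (a \<bullet> (\<i> * b))" for a b by (simp add: complex_eq_iff inner_complex_def algebra_simps)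
   have cc: "Complex p p' - Complex q q' - (complex_of_real k)^2 * (Complex r r' - Complex t t') =
     complex_of_real (p - q - k^2 * (r - t)) + \<i> * complex_of_real (p' - q' - k^2 * (r' - t'))" for p p' q q' r r' t t'
    by (simp add: complex_eq_iff power2_eq_square algebra_simps)
   show "hermitian_dot (complex_matrix (M x) *v weak_gradient D w x) (weak_gradient D \<phi>1 x)
     - hermitian_dot (weak_gradient D v x) (weak_gradient D \<phi>2 x)
     - (complex_of_real k)^2 * (complex_of_real (n x) * w x * cnj (\<phi>1 x) - v x * cnj (\<phi>2 x)) =
    complex_of_real (R \<phi>1 (weak_gradient D \<phi>1) \<phi>2 (weak_gradient D \<phi>2) x) +
   \<i> * complex_of_real (R (%x. \<i> * \<phi>1 x) (%x. \<chi> j. \<i> * weak_gradient D \<phi>1 x $ j) (%x. \<i> * \<phi>2 x) (%x. \<chi> j. \<i> * weak_gradient D \<phi>2 x $ j) x)"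
    unfolding hermitian_dot_eq z cc R_def scaleR_conv_of_real by (rule refl)
  qed
  also have "... = complex_of_real (real_form D M n (k^2) w v (jet D \<phi>1) (jet D \<phi>2)) +
    \<i> * complex_of_real (real_form D M n (k^2) w v (jet D (%x. \<i> * \<phi>1 x)) (jet D (%x. \<i> * \<phi>2 x)))"
   unfolding F1(5) F2(5) R2(2)[symmetric] unfolding jet_def R1(2)[symmetric]
   using R1(1) R2(1) by (subst Bochner_Integration.integral_add) (auto simp: integral_complex_of_real)
  finally show ?thesis by (simp add: complex_eq_iff)
 qed
 have z: "in_L2 D (%x. 0 :: complex)" by (rule in_L2_const[OF D(2) mD])
 have nz: "(AE x in lebesgue_on D. w x = 0 & v x = 0) \<longleftrightarrow> toL2 D w = 0 & toL2 D v = 0"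
  using toL2_eq_iff[OF mD W(1) z] toL2_eq_iff[OF mD V(1) z] by (simp add: toL2_zero)
 have eqs: "(\<forall>(\<phi>1, \<phi>2) \<in> X_space D. Complex (real_form D M n (k^2) w v (jet D \<phi>1) (jet D \<phi>2))
     (real_form D M n (k^2) w v (jet D (%x. \<i> * \<phi>1 x)) (jet D (%x. \<i> * \<phi>2 x))) = 0) \<longleftrightarrow>
   (\<forall>\<phi>1 \<phi>2. (\<phi>1, \<phi>2) \<in> X_space D --> real_form D M n (k^2) w v (jet D \<phi>1) (jet D \<phi>2) = 0)"
  using X_space_times_i[OF D(1)] by (auto simp: complex_eq_iff)
 show ?thesis unfolding transmission_eigenpair_def prod.case nz eqs[symmetric] using True I by (auto split: prod.splits)
qed (simp add: transmission_eigenpair_def)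

section \<open>Uniform bounds for the gradients\<close>

lemma ess_inf_cell_AE: "AE y in lebesgue_on unit_cell. ess_inf_cell f <= f y"
 unfolding ess_inf_cell_def using esssup_AE[of "%y. - f y" "lebesgue_on unit_cell"]
 by eventually_elim (simp add: ereal_uminus_le_reorder)

lemma ess_sup_cell_AE: "AE y in lebesgue_on unit_cell. f y <= ess_sup_cell f"
 unfolding ess_sup_cell_def by (rule esssup_AE)

lemma quadratic_form_normalize:
 assumes "\<xi> ~= 0"
 obtains u where "norm u = 1" "(complex_matrix M *v \<xi>) \<bullet> \<xi> = Re (hermitian_dot (complex_matrix M *v u) u) * (norm \<xi>)^2"
proof
 show "norm (\<xi> /\<^sub>R norm \<xi>) = 1" using assms by simp
 show "(complex_matrix M *v \<xi>) \<bullet> \<xi> = Re (hermitian_dot (complex_matrix M *v (\<xi> /\<^sub>R norm \<xi>)) (\<xi> /\<^sub>R norm \<xi>)) * (norm \<xi>)^2"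
  using assms by (simp add: hermitian_dot_eq complex_matrix_scaleR power2_eq_square field_simps)
qed

lemma coefficient_lower_bound:
 assumes A: "cell_periodic A" and \<alpha>: "ereal \<alpha> <= A_min A"
 shows "AE y in lebesgue. \<forall>\<xi>. \<alpha> * (norm \<xi>)^2 <= (complex_matrix (A y) *v \<xi>) \<bullet> \<xi>"
proof (rule cell_periodic_AE_extend[OF A])
 show "AE y in lebesgue_on unit_cell. \<forall>\<xi>. \<alpha> * (norm \<xi>)^2 <= (complex_matrix (A y) *v \<xi>) \<bullet> \<xi>"
  using ess_inf_cell_AE
 proof eventually_elim
  fix y assume f: "ess_inf_cell (%y. INF \<xi>\<in>{\<xi>. norm \<xi> = 1}. ereal (Re (hermitian_dot (complex_matrix (A y) *v \<xi>) \<xi>)))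
   <= (INF \<xi>\<in>{\<xi>. norm \<xi> = 1}. ereal (Re (hermitian_dot (complex_matrix (A y) *v \<xi>) \<xi>)))"
  have *: "ereal \<alpha> <= ereal (Re (hermitian_dot (complex_matrix (A y) *v u) u))" if "norm u = 1" for u
   by (rule order_trans[OF order_trans[OF \<alpha>[unfolded A_min_def] f] INF_lower]) (use that in simp)
  show "\<forall>\<xi>. \<alpha> * (norm \<xi>)^2 <= (complex_matrix (A y) *v \<xi>) \<bullet> \<xi>"
  proof
   fix \<xi> show "\<alpha> * (norm \<xi>)^2 <= (complex_matrix (A y) *v \<xi>) \<bullet> \<xi>"
   proof (cases "\<xi> = 0")
    case False
    then show ?thesis using * by (elim quadratic_form_normalize[of _ "A y"]) (simp add: mult_right_mono)
   qed simp
  qed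
 qed
qed

lemma coefficient_upper_bound:
 assumes A: "cell_periodic A" and \<beta>: "A_max A <= ereal \<beta>"
 shows "AE y in lebesgue. \<forall>\<xi>. (complex_matrix (A y) *v \<xi>) \<bullet> \<xi> <= \<beta> * (norm \<xi>)^2"
proof (rule cell_periodic_AE_extend[OF A])
 show "AE y in lebesgue_on unit_cell. \<forall>\<xi>. (complex_matrix (A y) *v \<xi>) \<bullet> \<xi> <= \<beta> * (norm \<xi>)^2"
  using ess_sup_cell_AE
 proof eventually_elim
  fix y assume f: "(SUP \<xi>\<in>{\<xi>. norm \<xi> = 1}. ereal (Re (hermitian_dot (complex_matrix (A y) *v \<xi>) \<xi>)))
   <= ess_sup_cell (%y. SUP \<xi>\<in>{\<xi>. norm \<xi> = 1}. ereal (Re (hermitian_dot (complex_matrix (A y) *v \<xi>) \<xi>)))"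
  have *: "ereal (Re (hermitian_dot (complex_matrix (A y) *v u) u)) <= ereal \<beta>" if "norm u = 1" for u
   by (rule order_trans[OF SUP_upper order_trans[OF f \<beta>[unfolded A_max_def]]]) (use that in simp)
  show "\<forall>\<xi>. (complex_matrix (A y) *v \<xi>) \<bullet> \<xi> <= \<beta> * (norm \<xi>)^2"
  proof
   fix \<xi> show "(complex_matrix (A y) *v \<xi>) \<bullet> \<xi> <= \<beta> * (norm \<xi>)^2"
   proof (cases "\<xi> = 0")
    case False
    then show ?thesis using * by (elim quadratic_form_normalize[of _ "A y"]) (simp add: mult_right_mono)
   qed simp
  qed
 qed
qed

lemma le_sqrt_if_quadratic:
 assumes "c > 0" "c * x^2 <= (R::real)" shows "x <= sqrt (R / c)"
 using assms by (intro real_le_rsqrt) (simp add: field_simps)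

text \<open>The form is not coercive, but it becomes so when it is tested with the image of \<open>(w, v)\<close> under
 an isomorphism of \<open>X(D)\<close>: \<open>(w, 2w - v)\<close> if the coefficients exceed one and \<open>(w - 2v, - v)\<close> if they
 are less than one.\<close>

lemma gradient_bounds:
 fixes D :: "(real^'d::finite) set"
 assumes D: "open D" "bounded D"
  and M: "M : borel_measurable lebesgue" "AE x in lebesgue. norm (M x) <= C" and C: "C >= 0"
  and n: "n : borel_measurable lebesgue" "AE x in lebesgue. \<bar>n x\<bar> <= N" and N: "N >= 0"
  and sym: "AE x in lebesgue. transpose (M x) = M x"
  and lower: "AE x in lebesgue. \<forall>\<xi>. \<alpha> * (norm \<xi>)^2 <= (complex_matrix (M x) *v \<xi>) \<bullet> \<xi>"
  and contrast: "1 < \<alpha> | 0 < \<alpha> & \<beta> < 1 & (AE x in lebesgue. \<forall>\<xi>. (complex_matrix (M x) *v \<xi>) \<bullet> \<xi> <= \<beta> * (norm \<xi>)^2)"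
  and eigen: "transmission_eigenpair D M n (w, v) k"
  and le1: "L2_norm D w <= 1" "L2_norm D v <= 1" and K: "k^2 <= K" and R: "R = K * (3 * N + 3)"
  and G: "G = (if 1 < \<alpha> then sqrt (R / (\<alpha> - 1)) + sqrt (R / 1) else sqrt (R / (1 - \<beta>)) + sqrt (R / \<alpha>))"
 shows "L2_norm D (weak_gradient D w) <= G" "L2_norm D (weak_gradient D v) <= G"
proof -
 have mD: "D : sets lebesgue" using D by auto
 note E = eigen[unfolded transmission_eigenpair_iff[OF D M C n N]]
 have X: "(w, v) : X_space D" and form: "!!\<phi>1 \<phi>2. (\<phi>1, \<phi>2) : X_space D ==> real_form D M n (k^2) w v (jet D \<phi>1) (jet D \<phi>2) = 0"
  using E by blast+
 have H: "in_H1 D w" "in_H1 D v" and J: "jet D w - jet D v : closure (jet D ` Collect (test_function D))"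
  using X unfolding X_space_iff[OF D(1)] by auto
 note W = in_H1D[OF D(1) H(1)] and V = in_H1D[OF D(1) H(2)]
 note mv = in_L2_complex_matrix_vector(1)[OF mD M C]
 let ?s = "%g. toL2 D (%x. complex_matrix (M x) *v g x)"
 define \<xi> \<zeta> p q m where "\<xi> = toL2 D (weak_gradient D w)" and "\<zeta> = toL2 D (weak_gradient D v)"
  and "p = toL2 D w" and "q = toL2 D v" and "m = toL2 D (%x. n x *R w x)"
 note defs = \<xi>_def \<zeta>_def p_def q_def m_def
 have norms: "norm p <= 1" "norm q <= 1" "norm m <= N"
  using le1 in_L2_bounded_multiple[OF mD n N W(1)] mult_left_mono[OF le1(1) N]
  by (simp_all add: p_def q_def m_def norm_toL2[OF mD] W V)
 have ip: "\<bar>a \<bullet> b\<bar> <= A * B" if "norm a <= A" "norm b <= B" for a b :: "('d, complex) L2" and A B :: real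
  using Cauchy_Schwarz_ineq2[of a b] mult_mono[OF that] norm_ge_zero[of a] norm_ge_zero[of b] that by linarith
 \<comment> \<open>Each zero-order term is at most \<open>N\<close> or \<open>1\<close> in size; with either choice of the test functions
  they add up to at most \<open>3 N + 3\<close>.\<close>
 note ips = ip[OF norms(3,1)] ip[OF norms(3,2)] ip[OF norms(2,1)] ip[OF norms(2,2)]
 have K0: "k^2 * t <= R" if "t <= 3 * N + 3" for t
 proof -
  have "k^2 * (3 * N + 3) <= K * (3 * N + 3)" by (rule mult_right_mono[OF K]) (use N in simp)
  then show ?thesis using mult_left_mono[OF that, of "k^2"] R by simp
 qed
 have lo: "\<alpha> * (norm (toL2 D g))^2 <= ?s g \<bullet> toL2 D g" if g: "in_L2 D g" for g
 proof -
  have "(LINT x|lebesgue_on D. \<alpha> * (norm (g x))^2) <= (LINT x|lebesgue_on D. (complex_matrix (M x) *v g x) \<bullet> g x)"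
  proof (rule integral_mono_AE)
   show "AE x in lebesgue_on D. \<alpha> * (norm (g x))^2 <= (complex_matrix (M x) *v g x) \<bullet> g x"
    unfolding AE_lebesgue_on[OF mD] using lower by eventually_elim simp
  qed (use g integrable_inner_in_L2[OF mD mv[OF g] g] in "auto simp: in_L2_def")
  then show ?thesis by (simp add: norm_toL2[OF mD g] L2_norm_power2 inner_toL2[OF mD mv[OF g] g])
 qed
 have "\<exists>c1 c2. c1 > 0 & c2 > 0 & G = sqrt (R / c1) + sqrt (R / c2) & c2 * (norm (\<xi> - \<zeta>))^2 <= R \<and>
   (c1 * (norm \<xi>)^2 <= R | c1 * (norm \<zeta>)^2 <= R)"
 proof (cases "1 < \<alpha>")
  case True
  note j = jet_scaleR[OF D(1) H(1), of 2]
  note j2 = jet_diff[OF D(1) j(1) H(2)]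
  have "(w, %x. 2 *R w x - v x) : X_space D"
   unfolding X_space_iff[OF D(1)] j2(2) j(2) using H(1) j2(1) subspace_neg[OF subspace_H1_0_jets[OF D(1)] J]
   by (simp add: scaleR_2)
  from form[OF this] have "?s (weak_gradient D w) \<bullet> \<xi> - \<zeta> \<bullet> (2 *R \<xi> - \<zeta>) = k^2 * (m \<bullet> p - q \<bullet> (2 *R p - q))"
   unfolding j2(2) j(2) real_form_def by (simp add: jet_def defs)
  also have "... <= R" using ips N by (intro K0) (simp add: inner_diff_right)
  finally have *: "\<alpha> * (norm \<xi>)^2 - \<zeta> \<bullet> (2 *R \<xi> - \<zeta>) <= R" using lo[OF W(3)] by (simp add: \<xi>_def)
  have "(\<alpha> - 1) * (norm \<xi>)^2 + (norm (\<xi> - \<zeta>))^2 = \<alpha> * (norm \<xi>)^2 - \<zeta> \<bullet> (2 *R \<xi> - \<zeta>)"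
   unfolding power2_norm_eq_inner by (simp add: inner_diff_left inner_diff_right inner_commute algebra_simps)
  moreover have "0 <= (\<alpha> - 1) * (norm \<xi>)^2" "0 <= (norm (\<xi> - \<zeta>))^2" using True by simp_all
  ultimately have "(\<alpha> - 1) * (norm \<xi>)^2 <= R" "1 * (norm (\<xi> - \<zeta>))^2 <= R" using * by linarith+
  then show ?thesis using True G by (intro exI[of _ "\<alpha> - 1"] exI[of _ 1]) simp
 next
  case False
  then have \<beta>: "0 < \<alpha>" "\<beta> < 1" "AE x in lebesgue. \<forall>\<xi>. (complex_matrix (M x) *v \<xi>) \<bullet> \<xi> <= \<beta> * (norm \<xi>)^2" using contrast by auto
  let ?sw = "?s (weak_gradient D w)" and ?sv = "?s (weak_gradient D v)"
  note j = jet_scaleR[OF D(1) H(2), of 2] and j' = jet_scaleR[OF D(1) H(2), of "-1"]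
  note j2 = jet_diff[OF D(1) H(1) j(1)]
  have "(%x. w x - 2 *R v x, %x. (-1) *R v x) : X_space D"
   unfolding X_space_iff[OF D(1)] j2(2) j(2) j'(2) using j2(1) j'(1) J by (simp add: scaleR_2 algebra_simps)
  from form[OF this] have "?sw \<bullet> (\<xi> - 2 *R \<zeta>) + \<zeta> \<bullet> \<zeta> = k^2 * (m \<bullet> (p - 2 *R q) + q \<bullet> q)"
   unfolding j2(2) j(2) j'(2) real_form_def by (simp add: jet_def defs)
  also have "... <= R" using ips N by (intro K0) (simp add: inner_diff_right)
  finally have *: "?sw \<bullet> (\<xi> - 2 *R \<zeta>) + \<zeta> \<bullet> \<zeta> <= R" .
  have up: "?sv \<bullet> \<zeta> <= \<beta> * (norm \<zeta>)^2"
  proof -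
   have "(LINT x|lebesgue_on D. (complex_matrix (M x) *v weak_gradient D v x) \<bullet> weak_gradient D v x)
     <= (LINT x|lebesgue_on D. \<beta> * (norm (weak_gradient D v x))^2)"
   proof (rule integral_mono_AE)
    show "AE x in lebesgue_on D. (complex_matrix (M x) *v weak_gradient D v x) \<bullet> weak_gradient D v x <= \<beta> * (norm (weak_gradient D v x))^2"
     unfolding AE_lebesgue_on[OF mD] using \<beta>(3) by eventually_elim simp
   qed (use V(3) integrable_inner_in_L2[OF mD mv[OF V(3)] V(3)] in "auto simp: in_L2_def")
   then show ?thesis by (simp add: \<zeta>_def norm_toL2[OF mD V(3)] L2_norm_power2 inner_toL2[OF mD mv[OF V(3)] V(3)])
  qed
  have sm: "?sv \<bullet> \<xi> = ?sw \<bullet> \<zeta>"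
  proof -
   have "(LINT x|lebesgue_on D. (complex_matrix (M x) *v weak_gradient D v x) \<bullet> weak_gradient D w x)
     = (LINT x|lebesgue_on D. (complex_matrix (M x) *v weak_gradient D w x) \<bullet> weak_gradient D v x)"
   proof (rule integral_cong_AE)
    show "AE x in lebesgue_on D. (complex_matrix (M x) *v weak_gradient D v x) \<bullet> weak_gradient D w x
      = (complex_matrix (M x) *v weak_gradient D w x) \<bullet> weak_gradient D v x"
     unfolding AE_lebesgue_on[OF mD] using sym by eventually_elim (metis complex_matrix_inner_sym inner_commute)
   qed (intro borel_measurable_integrable integrable_inner_in_L2 mD mv W V)+
   then show ?thesis by (simp add: \<xi>_def \<zeta>_def inner_toL2[OF mD] mv W V)
  qed
  have dl: "toL2 D (%x. weak_gradient D w x - weak_gradient D v x) = \<xi> - \<zeta>"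
   unfolding \<xi>_def \<zeta>_def by (rule toL2_diff[OF mD W(3) V(3)])
  have ds: "?s (%x. weak_gradient D w x - weak_gradient D v x) = ?sw - ?sv"
   unfolding matrix_vector_mult_diff_distrib by (rule toL2_diff[OF mD mv[OF W(3)] mv[OF V(3)]])
  have "\<alpha> * (norm (\<xi> - \<zeta>))^2 <= (?sw - ?sv) \<bullet> (\<xi> - \<zeta>)"
   using lo[OF in_L2_diff[OF mD W(3) V(3)]] unfolding dl ds .
  also have "... = ?sw \<bullet> (\<xi> - 2 *R \<zeta>) + ?sv \<bullet> \<zeta>"
   by (simp add: inner_diff_left inner_diff_right sm)
  finally have **: "\<alpha> * (norm (\<xi> - \<zeta>))^2 + (1 - \<beta>) * (norm \<zeta>)^2 <= R"
   using * up by (simp add: power2_norm_eq_inner algebra_simps)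
  have "0 <= \<alpha> * (norm (\<xi> - \<zeta>))^2" "0 <= (1 - \<beta>) * (norm \<zeta>)^2" using \<beta> by simp_all
  then have "\<alpha> * (norm (\<xi> - \<zeta>))^2 <= R" "(1 - \<beta>) * (norm \<zeta>)^2 <= R" using ** by linarith+
  then show ?thesis using False \<beta> G by (intro exI[of _ "1 - \<beta>"] exI[of _ \<alpha>]) simp
 qed
 then obtain c1 c2 where c: "c1 > 0" "c2 > 0" "G = sqrt (R / c1) + sqrt (R / c2)" "c2 * (norm (\<xi> - \<zeta>))^2 <= R"
   "c1 * (norm \<xi>)^2 <= R | c1 * (norm \<zeta>)^2 <= R" by blast
 have "norm (\<xi> - \<zeta>) <= sqrt (R / c2)" by (rule le_sqrt_if_quadratic[OF c(2,4)])
 moreover have "norm \<xi> <= sqrt (R / c1) | norm \<zeta> <= sqrt (R / c1)" using c(5) le_sqrt_if_quadratic[OF c(1)] by blast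
 moreover have "norm \<xi> <= norm \<zeta> + norm (\<xi> - \<zeta>)" "norm \<zeta> <= norm \<xi> + norm (\<xi> - \<zeta>)"
  using norm_triangle_ineq[of \<zeta> "\<xi> - \<zeta>"] norm_triangle_ineq[of \<xi> "\<zeta> - \<xi>"] by (simp_all add: norm_minus_commute)
 moreover have "0 <= norm (\<xi> - \<zeta>)" by simp
 ultimately have "norm \<xi> <= G & norm \<zeta> <= G" unfolding c(3) by linarith
 then show "L2_norm D (weak_gradient D w) <= G" "L2_norm D (weak_gradient D v) <= G"
  by (simp_all add: \<xi>_def \<zeta>_def norm_toL2[OF mD] W V)
qed

section \<open>Passage to the limit\<close>

lemma weakly_tendsto_linear:
 fixes f :: "nat => real^'d::finite => 'b::euclidean_space" and L :: "'b => 'c::euclidean_space"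
 assumes S: "S : sets lebesgue" and L: "linear L" "linear L'" "!!x y. L x \<bullet> y = x \<bullet> L' y"
  and f: "!!m. in_L2 S (f m)" "in_L2 S f0" and w: "weakly_tendsto (%m. toL2 S (f m)) (toL2 S f0)"
 shows "weakly_tendsto (%m. toL2 S (%x. L (f m x))) (toL2 S (%x. L (f0 x)))"
 unfolding weakly_tendsto_def
proof
 fix h :: "('d, 'c) L2"
 note r = in_L2_rep_L2[OF S, of h]
 have e: "toL2 S (%x. L (g x)) \<bullet> h = toL2 S g \<bullet> toL2 S (%x. L' (rep_L2 h x))" if g: "in_L2 S g" for g
  using inner_toL2_rep_L2[OF S in_L2_linear[OF S L(1) g], of h] inner_toL2[OF S g in_L2_linear[OF S L(2) r]]
  by (simp add: inner_commute[of h] inner_commute[of "rep_L2 h _"] L(3))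
 show "(%m. toL2 S (%x. L (f m x)) \<bullet> h) ----> toL2 S (%x. L (f0 x)) \<bullet> h"
  unfolding e[OF f(1)] e[OF f(2)] using w unfolding weakly_tendsto_def by blast
qed

lemma norm_component_le:
 fixes b :: "'b::euclidean_space" and g :: "'b^'n::finite"
 assumes "b : Basis" shows "norm (\<chi> i. g $ i \<bullet> b) <= norm g"
 unfolding norm_vec_def by (rule L2_set_mono) (use assms Basis_le_norm in auto)

lemma Rellich_compactness_euclidean:
 fixes u :: "nat => real^'d::finite => 'b::euclidean_space"
 assumes D: "open D" "bounded D" "cone_property D" and u: "!!m. in_H1 D (u m)" and v: "in_H1 D v"
  and bd: "!!m. L2_norm D (u m) <= B" "!!m. L2_norm D (weak_gradient D (u m)) <= C"
  and w: "weakly_tendsto (%m. toL2 D (u m)) (toL2 D v)"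
 shows "(%m. L2_norm D (%x. u m x - v x)) ----> 0"
proof -
 have mD: "D : sets lebesgue" using D by auto
 note U = in_H1D[OF D(1) u] and V = in_H1D[OF D(1) v]
 have lim: "(%m. L2_norm D (%x. u m x \<bullet> b - v x \<bullet> b)) ----> 0" if b: "b : Basis" for b
 proof (rule Rellich_compactness[OF D has_weak_gradient_inner[OF D(1) U(2)] in_L2_inner_const[OF mD U(1)] in_L2_linear[OF mD linear_component U(3)]
   has_weak_gradient_inner[OF D(1) V(2)] in_L2_inner_const[OF mD V(1)] in_L2_linear[OF mD linear_component V(3)]])
  fix m
  have "L2_norm D (%x. u m x \<bullet> b) <= 1 * L2_norm D (u m)"
   by (rule L2_norm_bound[OF mD U(1)]) (use b Basis_le_norm in auto)
  then show "L2_norm D (%x. u m x \<bullet> b) <= B" using bd(1)[of m] by simp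
  have "L2_norm D (%x. \<chi> i. weak_gradient D (u m) x $ i \<bullet> b) <= 1 * L2_norm D (weak_gradient D (u m))"
   by (rule L2_norm_bound[OF mD U(3)]) (use norm_component_le[OF b] in auto)
  then show "L2_norm D (%x. \<chi> i. weak_gradient D (u m) x $ i \<bullet> b) <= C" using bd(2)[of m] by simp
 next
  show "weakly_tendsto (%m. toL2 D (%x. u m x \<bullet> b)) (toL2 D (%x. v x \<bullet> b))"
   by (rule weakly_tendsto_linear[OF mD _ _ _ U(1) V(1) w, where L' = "%r. r *R b"])
    (auto simp: linear_iff inner_add_left scaleR_left_distrib)
 qed
 have "(L2_norm D (%x. u m x - v x))^2 = (\<Sum>b\<in>Basis. (L2_norm D (%x. u m x \<bullet> b - v x \<bullet> b))^2)" for m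
 proof -
  have nsq: "(norm (z :: 'b))^2 = (\<Sum>b\<in>Basis. (norm (z \<bullet> b))^2)" for z
   unfolding power2_norm_eq_inner by (subst euclidean_inner) (simp add: inner_real_def)
  note L = in_L2_inner_const[OF mD in_L2_diff[OF mD U(1)[of m] V(1)]]
  show ?thesis unfolding L2_norm_power2 nsq[of "_ - _"] inner_diff_left
   by (rule Bochner_Integration.integral_sum) (use L in "simp add: in_L2_def inner_diff_left")
 qed
 moreover have "(%m. \<Sum>b\<in>Basis. (L2_norm D (%x. u m x \<bullet> b - v x \<bullet> b))^2) ----> (\<Sum>b\<in>(Basis :: 'b set). 0^2)"
  by (intro tendsto_sum tendsto_power lim)
 ultimately have "(%m. (L2_norm D (%x. u m x - v x))^2) ----> 0" by simp
 from tendsto_real_sqrt[OF this] show ?thesis by (simp add: L2_norm_nonneg)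
qed

lemma scaled_coefficient:
 fixes f :: "real^'d::finite => 'b::real_normed_vector"
 assumes "f : borel_measurable lebesgue" "AE y in lebesgue. P (f y)" "\<epsilon> > 0"
 shows "scaled \<epsilon> f : borel_measurable lebesgue" "AE x in lebesgue. P (scaled \<epsilon> f x)"
 using scaled_measurable[OF assms(1,3)] AE_scaled[OF assms(2,3)] by (simp_all add: scaled_def)

text \<open>Along a sequence with weakly convergent jets and fluxes, Rellich's theorem gives strong
 convergence in \<open>L\<^sup>2\<close>, and Tartar's method identifies the weak limits of the fluxes of the real and
 imaginary parts; then every term of the real form converges.\<close>

lemma homogenized_limit:
 fixes D :: "(real^'d::finite) set" and w v :: "nat => real^'d => complex"
 assumes cp: "corrector_problem A \<psi>" and D: "open D" "bounded D" "cone_property D"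
  and e: "!!m. 0 < \<epsilon> m" "!!m. \<epsilon> m <= 1" "\<epsilon> ----> 0"
  and A: "AE x in lebesgue. norm (A x) <= C" "C >= 0"
  and n: "n : borel_measurable lebesgue" "cell_periodic n" "AE x in lebesgue. \<bar>n x\<bar> <= N" "N >= 0"
  and X: "!!m. (w m, v m) : X_space D" and X0: "(w0, v0) : X_space D"
  and lim: "weakly_tendsto (%m. X_jet D (w m, v m)) (X_jet D (w0, v0))"
  and flux_lim: "weakly_tendsto (%m. toL2 D (%x. complex_matrix (scaled (\<epsilon> m) A x) *v weak_gradient D (w m) x)) \<Sigma>"
  and bd: "!!m. L2_norm D (w m) <= 1" "!!m. L2_norm D (v m) <= 1"
   "!!m. L2_norm D (weak_gradient D (w m)) <= G" "!!m. L2_norm D (weak_gradient D (v m)) <= G"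
  and k: "k ----> k0"
  and form: "!!m \<phi>1 \<phi>2. (\<phi>1, \<phi>2) : X_space D ==>
   real_form D (scaled (\<epsilon> m) A) (scaled (\<epsilon> m) n) ((k m)^2) (w m) (v m) (jet D \<phi>1) (jet D \<phi>2) = 0"
 shows "(%m. L2_norm D (%x. w m x - w0 x)) ----> 0" "(%m. L2_norm D (%x. v m x - v0 x)) ----> 0"
  "(\<phi>1, \<phi>2) : X_space D ==>
   real_form D (%_. homogenized_matrix A \<psi>) (%_. cell_average n) (k0^2) w0 v0 (jet D \<phi>1) (jet D \<phi>2) = 0"
proof -
 interpret corrector_problem A \<psi> by (rule cp)
 have mD: "D : sets lebesgue" using D by auto
 let ?H = "homogenized_matrix A \<psi>" and ?nh = "cell_average n"
 let ?A = "%m. scaled (\<epsilon> m) A" and ?n = "%m. scaled (\<epsilon> m) n"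
 have H: "in_H1 D (w m)" "in_H1 D (v m)" for m using X[of m] unfolding X_space_def by auto
 have H0: "in_H1 D w0" "in_H1 D v0" using X0 unfolding X_space_def by auto
 note W = in_H1D[OF D(1) H(1)] and V = in_H1D[OF D(1) H(2)] and W0 = in_H1D[OF D(1) H0(1)] and V0 = in_H1D[OF D(1) H0(2)]
 have jw: "weakly_tendsto (%m. jet D (w m)) (jet D w0)" and jv: "weakly_tendsto (%m. jet D (v m)) (jet D v0)"
  using weakly_tendsto_fst[OF lim] weakly_tendsto_snd[OF lim] by (simp_all add: X_jet_def)
 have ww: "weakly_tendsto (%m. toL2 D (w m)) (toL2 D w0)" and vw: "weakly_tendsto (%m. toL2 D (v m)) (toL2 D v0)"
  using weakly_tendsto_fst[OF jw] weakly_tendsto_fst[OF jv] by (simp_all add: jet_def)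
 show sw: "(%m. L2_norm D (%x. w m x - w0 x)) ----> 0" by (rule Rellich_compactness_euclidean[OF D H(1) H0(1) bd(1,3) ww])
 show sv: "(%m. L2_norm D (%x. v m x - v0 x)) ----> 0" by (rule Rellich_compactness_euclidean[OF D H(2) H0(2) bd(2,4) vw])
 note cA = scaled_coefficient[OF A_measurable A(1) e(1)] and cn = scaled_coefficient[OF n(1,3) e(1)]
 have s: "in_L2 D (%x. complex_matrix (?A m x) *v weak_gradient D (w m) x)" for m
  by (rule in_L2_complex_matrix_vector(1)[OF mD cA A(2) W(3)])
 have nw: "in_L2 D (%x. ?n m x *R w m x)" for m by (rule in_L2_bounded_multiple(1)[OF mD cn n(4) W(1)])
 define \<sigma> where "\<sigma> = rep_L2 \<Sigma>"
 have \<sigma>: "in_L2 D \<sigma>" "toL2 D \<sigma> = \<Sigma>" unfolding \<sigma>_def using in_L2_rep_L2[OF mD] toL2_rep_weak_limit[OF mD s flux_lim] by auto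
 have flux_lim': "weakly_tendsto (%m. toL2 D (%x. complex_matrix (?A m x) *v weak_gradient D (w m) x)) (toL2 D \<sigma>)"
  using flux_lim \<sigma>(2) by simp
 have k2: "(%m. (k m)^2) ----> k0^2" by (intro tendsto_power k)
 then obtain K where K: "!!m. (k m)^2 <= K"
  using convergent_imp_Bseq[of "%m. (k m)^2"] unfolding convergent_def Bseq_def by (metis abs_le_D1 real_norm_def)
 have nh: "?nh = (LINT y|lebesgue_on unit_cell. n y)"
  using emeasure_unit_cell[where 'd='d] by (simp add: cell_average_def measure_def)
 have nL2: "in_L2 unit_cell n"
  using in_L2_bounded_multiple(1)[OF unit_cell_facts(3) n(1,3,4) in_L2_const[OF unit_cell_facts(2,3), of "1::real"]] by simp
 note osc = oscillating_weakly_tendsto[OF n(1,2) nL2 D(1,2) e, folded nh]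
 obtain Bn where Bn: "!!m. L2_norm D (?n m) <= Bn" using osc(2) by blast
 have nb: "in_L2 D (%x. ?n m x * (w m x \<bullet> b))" for m b using in_L2_inner_const[OF mD nw, of m b] by simp
 have nb0: "in_L2 D (%x. ?nh * (w0 x \<bullet> b))" for b
  using in_L2_scaleR[OF mD in_L2_inner_const[OF mD W0(1), of b], of ?nh] by simp
 have wb: "(%m. L2_norm D (%x. w m x \<bullet> b - w0 x \<bullet> b)) ----> 0"
  and nbd: "L2_norm D (%x. ?n m x * (w m x \<bullet> b)) <= N" if b: "b : Basis" for b m
 proof -
  have le: "L2_norm D (%x. z x \<bullet> b) <= L2_norm D z" if z: "in_L2 D z" for z :: "real^'d => complex"
   using L2_norm_bound[OF mD z, of 1 "%x. z x \<bullet> b"] Basis_le_norm[OF b] by simp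
  have "norm (L2_norm D (%x. w m x \<bullet> b - w0 x \<bullet> b)) <= L2_norm D (%x. w m x - w0 x)" for m
   using le[OF in_L2_diff[OF mD W(1)[of m] W0(1)]] by (simp add: inner_diff_left L2_norm_nonneg)
  then show "(%m. L2_norm D (%x. w m x \<bullet> b - w0 x \<bullet> b)) ----> 0"
   by (intro Lim_null_comparison[OF _ sw] always_eventually allI)
  have "L2_norm D (%x. ?n m x *R w m x) <= N"
   using in_L2_bounded_multiple(2)[OF mD cn n(4) W(1), of m m] mult_left_mono[OF bd(1)[of m] n(4)] by simp
  then show "L2_norm D (%x. ?n m x * (w m x \<bullet> b)) <= N" using le[OF nw[of m]] by simp
 qed
 have nwb: "weakly_tendsto (%m. toL2 D (%x. ?n m x * (w m x \<bullet> b))) (toL2 D (%x. ?nh * (w0 x \<bullet> b)))" if b: "b : Basis" for b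
 proof (rule weakly_tendsto_toL2_if_tested[OF D(1) nb nb0 nbd[OF b]])
  fix \<phi> :: "real^'d => real" assume t: "test_function D \<phi>"
  show "(%m. LINT x|lebesgue_on D. ?n m x * (w m x \<bullet> b) * \<phi> x) ----> (LINT x|lebesgue_on D. ?nh * (w0 x \<bullet> b) * \<phi> x)"
   using weak_strong_integral_tendsto[OF mD osc(1) in_L2_const[OF D(2) mD] Bn osc(3)
     in_L2_inner_const[OF mD W(1)] in_L2_inner_const[OF mD W0(1)] wb[OF b] t] by (simp add: mult_ac)
 qed
 have nww: "weakly_tendsto (%m. toL2 D (%x. ?n m x *R w m x)) (toL2 D (%x. ?nh *R w0 x))"
  by (rule weakly_tendsto_toL2_Basis[OF mD nw in_L2_scaleR[OF mD W0(1)]]) (use nwb in simp)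
 have comp: "AE x in lebesgue_on D. (\<chi> i. \<sigma> x $ i \<bullet> b) = ?H *v (\<chi> i. weak_gradient D w0 x $ i \<bullet> b)" if b: "b : Basis" for b
 proof -
  note hf = homogenized_flux[where u = "%m x. w m x \<bullet> b" and ?u0.0 = "%x. w0 x \<bullet> b" and g = "%m x. \<chi> i. weak_gradient D (w m) x $ i \<bullet> b"
   and f = "%m x. (k m)^2 * (?n m x * (w m x \<bullet> b))" and ?f0.0 = "%x. k0^2 * (?nh * (w0 x \<bullet> b))" and Bg = G and Bf = "K * N",
   OF D(1,2) e has_weak_gradient_inner[OF D(1) W(2)] in_L2_inner_const[OF mD W(1)] in_L2_linear[OF mD linear_component W(3)]
   has_weak_gradient_inner[OF D(1) W0(2)] in_L2_inner_const[OF mD W0(1)] in_L2_linear[OF mD linear_component W0(3)] wb[OF b]]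
  show ?thesis
  proof (rule hf)
  fix m
  have "L2_norm D (%x. \<chi> i. weak_gradient D (w m) x $ i \<bullet> b) <= 1 * L2_norm D (weak_gradient D (w m))"
   by (rule L2_norm_bound[OF mD W(3)]) (use norm_component_le[OF b] in auto)
  then show "L2_norm D (%x. \<chi> i. weak_gradient D (w m) x $ i \<bullet> b) <= G" using bd(3)[of m] by simp
  show f: "in_L2 D (%x. (k m)^2 * (?n m x * (w m x \<bullet> b)))" using in_L2_scaleR[OF mD nb, of "(k m)^2" m b] by simp
  have "L2_norm D (%x. (k m)^2 * (?n m x * (w m x \<bullet> b))) <= (k m)^2 * L2_norm D (%x. ?n m x * (w m x \<bullet> b))"
   by (rule L2_norm_bound[OF mD nb]) (auto simp: abs_mult)
  also have "... <= K * N" using K[of m] nbd[OF b, of m] order_trans[OF zero_le_power2 K[of m]] by (intro mult_mono L2_norm_nonneg)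
  finally show "L2_norm D (%x. (k m)^2 * (?n m x * (w m x \<bullet> b))) <= K * N" .
 next
  have "weakly_tendsto (%m. toL2 D (%x. \<chi> i. (complex_matrix (?A m x) *v weak_gradient D (w m) x) $ i \<bullet> b)) (toL2 D (%x. \<chi> i. \<sigma> x $ i \<bullet> b))"
  proof (rule weakly_tendsto_linear[OF mD linear_component _ _ s \<sigma>(1) flux_lim', where L' = "%r. \<chi> i. r $ i *R b"])
   show "linear (%r. \<chi> i. r $ i *R b)" by (rule linearI) (simp_all add: vec_eq_iff scaleR_left_distrib)
  qed (simp add: inner_vec_def mult.commute)
  then show "weakly_tendsto (%m. toL2 D (%x. ?A m x *v (\<chi> i. weak_gradient D (w m) x $ i \<bullet> b))) (toL2 D (%x. \<chi> i. \<sigma> x $ i \<bullet> b))"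
   unfolding complex_matrix_component .
  show "in_L2 D (%x. \<chi> i. \<sigma> x $ i \<bullet> b)" by (rule in_L2_linear[OF mD linear_component \<sigma>(1)])
  show "in_L2 D (%x. k0^2 * (?nh * (w0 x \<bullet> b)))" using in_L2_scaleR[OF mD nb0, of "k0^2" b] by simp
  show "weakly_tendsto (%m. toL2 D (%x. (k m)^2 * (?n m x * (w m x \<bullet> b)))) (toL2 D (%x. k0^2 * (?nh * (w0 x \<bullet> b))))"
   using nwb[OF b] toL2_scaleR[OF mD nb, of "(k _)^2" _ b] toL2_scaleR[OF mD nb0, of "k0^2" b] k2
   by (simp add: weakly_tendsto_def tendsto_mult)
 next
  fix m and \<phi> :: "real^'d => real" assume t: "test_function D \<phi>"
  have tb: "test_function D (%x. \<phi> x *R b)" by (rule test_function_scaleR_const[OF t])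
  have pd: "partial_deriv i (%x. \<phi> x *R b) = (%x. partial_deriv i \<phi> x *R b)" for i
   by (rule partial_deriv_bounded_linear[OF bounded_linear_scaleR_left smooth_differentiable[OF test_function_smooth[OF t]]])
  note j = jet_test_function[OF D(1) tb, unfolded pd] and z = jet_scaleR[OF D(1) jet_test_function(1)[OF D(1) tb], of 0]
  have "jet D (%x. \<phi> x *R b) : closure (jet D ` Collect (test_function D))"
   by (rule subsetD[OF closure_subset], rule imageI) (simp add: tb)
  then have "(%x. \<phi> x *R b, %x. 0 *R (\<phi> x *R b)) : X_space D" unfolding X_space_iff[OF D(1)] using j(1) z by simp
  from form[OF this, of m] have "toL2 D (%x. complex_matrix (?A m x) *v weak_gradient D (w m) x) \<bullet> toL2 D (%x. \<chi> i. partial_deriv i \<phi> x *R b)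
    = (k m)^2 * (toL2 D (%x. ?n m x *R w m x) \<bullet> toL2 D (%x. \<phi> x *R b))" unfolding z(2) j(2) real_form_def by simp
  moreover have "a \<bullet> (\<chi> i. partial_deriv i \<phi> x *R b) = (\<chi> i. a $ i \<bullet> b) \<bullet> (\<chi> i. partial_deriv i \<phi> x)" for a :: "complex^'d" and x
   by (simp add: inner_vec_def mult.commute)
  moreover have "(LINT x|lebesgue_on D. (k m)^2 * (?n m x * (w m x \<bullet> b)) * \<phi> x) = (k m)^2 * (LINT x|lebesgue_on D. \<phi> x * (?n m x * (w m x \<bullet> b)))"
   by (subst integral_mult_right_zero[symmetric]) (simp only: mult_ac)
  ultimately show "(LINT x|lebesgue_on D. (?A m x *v (\<chi> i. weak_gradient D (w m) x $ i \<bullet> b)) \<bullet> (\<chi> k. partial_deriv k \<phi> x))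
    = (LINT x|lebesgue_on D. (k m)^2 * (?n m x * (w m x \<bullet> b)) * \<phi> x)"
   unfolding inner_toL2[OF mD s j(3)] inner_toL2[OF mD nw in_L2_test_function[OF tb mD]] by (simp add: complex_matrix_component)
  qed
 qed
 have "AE x in lebesgue_on D. \<forall>b\<in>Basis. (\<chi> i. \<sigma> x $ i \<bullet> b) = ?H *v (\<chi> i. weak_gradient D w0 x $ i \<bullet> b)"
  by (rule AE_finite_allI) (use comp in auto)
 then have "AE x in lebesgue_on D. \<sigma> x = complex_matrix ?H *v weak_gradient D w0 x"
 proof eventually_elim
  fix x assume "\<forall>b\<in>Basis. (\<chi> i. \<sigma> x $ i \<bullet> b) = ?H *v (\<chi> i. weak_gradient D w0 x $ i \<bullet> b)"
  then show "\<sigma> x = complex_matrix ?H *v weak_gradient D w0 x"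
   unfolding complex_matrix_component[symmetric] by (simp add: vec_eq_iff euclidean_eq_iff[where 'a = complex])
 qed
 moreover have "in_L2 D (%x. complex_matrix ?H *v weak_gradient D w0 x)"
  by (rule in_L2_complex_matrix_vector(1)[OF mD _ _ _ W0(3), of _ "norm ?H"]) auto
 ultimately have \<Sigma>: "\<Sigma> = toL2 D (%x. complex_matrix ?H *v weak_gradient D w0 x)"
  using toL2_eq_iff[OF mD \<sigma>(1)] \<sigma>(2) by auto
 assume \<phi>: "(\<phi>1, \<phi>2) : X_space D"
 have "(%m. real_form D (?A m) (?n m) ((k m)^2) (w m) (v m) (jet D \<phi>1) (jet D \<phi>2))
   ----> real_form D (%_. ?H) (%_. ?nh) (k0^2) w0 v0 (jet D \<phi>1) (jet D \<phi>2)"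
  unfolding real_form_def \<Sigma>[symmetric]
  using flux_lim nww weakly_tendsto_fst[OF jv] weakly_tendsto_snd[OF jv] unfolding weakly_tendsto_def
  by (intro tendsto_diff tendsto_mult k2) blast+
 then show "real_form D (%_. ?H) (%_. ?nh) (k0^2) w0 v0 (jet D \<phi>1) (jet D \<phi>2) = 0"
  unfolding form[OF \<phi>] by (simp add: LIMSEQ_const_iff)
qed

theorem theorem3p1:
  fixes D :: "(real^'d::finite) set"
    and A :: "real^'d \<Rightarrow> real^'d^'d"
    and n :: "real^'d \<Rightarrow> real"
    and \<psi> :: "'d \<Rightarrow> real^'d \<Rightarrow> real"
    and \<epsilon> :: "nat \<Rightarrow> real"
    and k :: "nat \<Rightarrow> real"
    and w v :: "nat \<Rightarrow> real^'d \<Rightarrow> complex"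
  assumes dim: "CARD('d) = 2 \<or> CARD('d) = 3"
    and D: "open D" "bounded D" "simply_connected D" "piecewise_smooth_boundary D"
    and A: "in_Linfty A" "cell_periodic A" "AE y in lebesgue. sym_pos_def (A y)"
    and n: "in_Linfty n" "cell_periodic n" "AE y in lebesgue. 0 < n y"
    and bounds: "0 < A_min A" "A_max A < \<infinity>" "0 < n_min n" "n_max n < \<infinity>"
    and contrast: "1 < A_min A \<or> (0 < A_max A \<and> A_max A < 1)"
    and cell: "\<And>i. cell_solution A i (\<psi> i)"
    and eps: "\<And>m. 0 < \<epsilon> m" "\<epsilon> \<longlonglongrightarrow> 0"
    and eigen: "\<And>m. transmission_eigenpair D (scaled (\<epsilon> m) A) (scaled (\<epsilon> m) n) (w m, v m) (k m)"
    and normalized: "\<And>m. L2_norm D (w m) + L2_norm D (v m) = 1"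
    and k_bounded: "bounded (range k)"
  shows "\<exists>(r :: nat \<Rightarrow> nat) w\<^sub>0 v\<^sub>0 k\<^sub>0.
           strict_mono r \<and>
           X_weakly_tendsto D (\<lambda>m. (w (r m), v (r m))) (w\<^sub>0, v\<^sub>0) \<and>
           (\<lambda>m. L2_norm D (\<lambda>x. w (r m) x - w\<^sub>0 x)) \<longlonglongrightarrow> 0 \<and>
           (\<lambda>m. L2_norm D (\<lambda>x. v (r m) x - v\<^sub>0 x)) \<longlonglongrightarrow> 0 \<and>
           (\<lambda>m. k (r m)) \<longlonglongrightarrow> k\<^sub>0 \<and>
           transmission_eigenpair D (\<lambda>_. homogenized_matrix A \<psi>) (\<lambda>_. cell_average n) (w\<^sub>0, v\<^sub>0) k\<^sub>0"
proof -
 have mD: "D : sets lebesgue" and cone: "cone_property D" using D by (auto simp: piecewise_smooth_boundary_def)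
 have Asym: "AE y in lebesgue. transpose (A y) = A y" using A(3) by eventually_elim (simp add: sym_pos_def_def)
 have cp: "corrector_problem A \<psi>" by unfold_locales (use A Asym cell in auto)
 obtain C' where C': "A : borel_measurable lebesgue" "AE x in lebesgue. norm (A x) <= C'" using A(1) unfolding in_Linfty_def by blast
 define C where "C = max C' 0"
 have C: "A : borel_measurable lebesgue" "AE x in lebesgue. norm (A x) <= C" "C >= 0"
  using C' unfolding C_def by (auto elim: eventually_mono)
 obtain N' where N': "n : borel_measurable lebesgue" "AE x in lebesgue. norm (n x) <= N'" using n(1) unfolding in_Linfty_def by blast
 define N where "N = max N' 0"
 have N: "n : borel_measurable lebesgue" "AE x in lebesgue. \<bar>n x\<bar> <= N" "N >= 0"
  using N' unfolding N_def by (auto elim: eventually_mono)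
 obtain \<alpha> \<beta> where lower: "AE y in lebesgue. \<forall>\<xi>. \<alpha> * (norm \<xi>)^2 <= (complex_matrix (A y) *v \<xi>) \<bullet> \<xi>"
  and \<alpha>\<beta>: "1 < \<alpha> | 0 < \<alpha> & \<beta> < 1 & (AE y in lebesgue. \<forall>\<xi>. (complex_matrix (A y) *v \<xi>) \<bullet> \<xi> <= \<beta> * (norm \<xi>)^2)"
 proof (cases "1 < A_min A")
  case True
  then obtain a where "1 < ereal a" "ereal a < A_min A" using ereal_dense2 by blast
  then show ?thesis using that[of a 0] coefficient_lower_bound[OF A(2), of a] by (simp add: one_ereal_def)
 next
  case False
  then obtain b where b: "A_max A < ereal b" "ereal b < 1" using contrast ereal_dense2 by blast
  obtain a where "0 < ereal a" "ereal a < A_min A" using bounds(1) ereal_dense2 by blast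
  then show ?thesis using that[of a b] coefficient_lower_bound[OF A(2), of a] coefficient_upper_bound[OF A(2), of b] b
   by (simp add: one_ereal_def zero_ereal_def)
 qed
 obtain Kb where Kb: "!!m. \<bar>k m\<bar> <= Kb" using k_bounded unfolding bounded_iff by auto
 have K: "(k m)^2 <= Kb^2" for m using power_mono[OF Kb[of m], of 2] by simp
 have le1: "L2_norm D (w m) <= 1" "L2_norm D (v m) <= 1" for m
  using normalized[of m] L2_norm_nonneg[of D "w m"] L2_norm_nonneg[of D "v m"] by linarith+
 note sA = scaled_coefficient[OF C(1,2) eps(1)] and sn = scaled_coefficient[OF N(1,2) eps(1)]
 define R where "R = Kb^2 * (3 * N + 3)"
 define G where "G = (if 1 < \<alpha> then sqrt (R / (\<alpha> - 1)) + sqrt (R / 1) else sqrt (R / (1 - \<beta>)) + sqrt (R / \<alpha>))"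
 have scontrast: "1 < \<alpha> | 0 < \<alpha> & \<beta> < 1 & (AE x in lebesgue. \<forall>\<xi>. (complex_matrix (scaled (\<epsilon> m) A x) *v \<xi>) \<bullet> \<xi> <= \<beta> * (norm \<xi>)^2)" for m
  using \<alpha>\<beta> scaled_coefficient(2)[OF C(1) _ eps(1), of "%M. \<forall>\<xi>. (complex_matrix M *v \<xi>) \<bullet> \<xi> <= \<beta> * (norm \<xi>)^2" m] by blast
 have grad: "L2_norm D (weak_gradient D (w m)) <= G" "L2_norm D (weak_gradient D (v m)) <= G" for m
  by (rule gradient_bounds[OF D(1,2) sA C(3) sn N(3) scaled_coefficient(2)[OF C(1) Asym eps(1)]
    scaled_coefficient(2)[OF C(1) lower eps(1)] scontrast eigen le1 K R_def G_def])+
 note E = eigen[unfolded transmission_eigenpair_iff[OF D(1,2) sA C(3) sn N(3)]]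
 have X: "(w m, v m) : X_space D" for m using E by blast
 have H: "in_H1 D (w m)" "in_H1 D (v m)" for m using X[of m] unfolding X_space_def by auto
 note W = in_H1D[OF D(1) H(1)] and V = in_H1D[OF D(1) H(2)]
 let ?s = "%m. toL2 D (%x. complex_matrix (scaled (\<epsilon> m) A x) *v weak_gradient D (w m) x)"
 have s: "norm (?s m) <= C * G" for m
  using in_L2_complex_matrix_vector[OF mD sA C(3) W(3)[of m], of m] mult_left_mono[OF grad(1)[of m] C(3)]
  by (simp add: norm_toL2[OF mD])
 obtain m0 where m0: "!!m. m >= m0 ==> \<epsilon> m < 1"
  using order_tendstoD(2)[OF eps(2), of 1] unfolding eventually_sequentially by auto
 \<comment> \<open>One extraction serves the jets, the fluxes and the eigenvalues.\<close>
 define Z where "Z m = (X_jet D (w (m + m0), v (m + m0)), ?s (m + m0), k (m + m0))" for m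
 have "norm (Z m) <= ((1 + G) + (1 + G)) + (C * G + Kb)" for m
 proof -
  have nP: "norm (a, b) <= s + t" if "norm a <= s" "norm b <= t" for a :: "'x::real_normed_vector" and b :: "'y::real_normed_vector" and s t
   using norm_Pair_le[of a b] that by linarith
  show ?thesis unfolding Z_def X_jet_def jet_def fst_conv snd_conv
   using s le1 grad Kb by (intro nP) (simp_all add: norm_toL2[OF mD] W V)
 qed
 then obtain r' P where r': "strict_mono r'" "weakly_tendsto (Z \<circ> r') P" by (rule weak_sequential_compactness)
 define r where "r m = r' m + m0" for m
 have r: "strict_mono r" using r'(1) by (simp add: r_def strict_mono_def)
 have jets: "weakly_tendsto (%m. X_jet D (w (r m), v (r m))) (fst P)"
  and flux: "weakly_tendsto (%m. ?s (r m)) (fst (snd P))" and "weakly_tendsto (%m. k (r m)) (snd (snd P))"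
  using weakly_tendsto_fst[OF r'(2)] weakly_tendsto_fst[OF weakly_tendsto_snd[OF r'(2)]] weakly_tendsto_snd[OF weakly_tendsto_snd[OF r'(2)]]
  by (simp_all add: Z_def r_def)
 then have k: "(%m. k (r m)) ----> snd (snd P)" unfolding weakly_tendsto_def by (auto dest: spec[of _ 1])
 obtain w0 v0 where X0: "(w0, v0) : X_space D" "X_jet D (w0, v0) = fst P" by (rule X_space_weak_limit[OF D(1) X jets])
 have form: "real_form D (scaled (\<epsilon> m) A) (scaled (\<epsilon> m) n) ((k m)^2) (w m) (v m) (jet D \<phi>1) (jet D \<phi>2) = 0"
  if "(\<phi>1, \<phi>2) : X_space D" for m \<phi>1 \<phi>2 using E that by blast
 have "\<epsilon> (r m) <= 1" for m using m0[of "r m"] by (simp add: r_def less_imp_le)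
 note lim = homogenized_limit[OF cp D(1,2) cone eps(1) this LIMSEQ_subseq_LIMSEQ[OF eps(2) r, unfolded comp_def] C(2,3) N(1) n(2) N(2,3)
   X X0(1) jets[folded X0(2)] flux le1 grad k form]
 have H0: "in_H1 D w0" "in_H1 D v0" using X0(1) unfolding X_space_def by auto
 note W0 = in_H1D[OF D(1) H0(1)] and V0 = in_H1D[OF D(1) H0(2)]
 have "(%m. norm (toL2 D (w (r m))) + norm (toL2 D (v (r m)))) ----> norm (toL2 D w0) + norm (toL2 D v0)"
  using lim(1,2) by (intro tendsto_add tendsto_norm) (simp_all add: tendsto_toL2_iff[OF mD] W V W0 V0)
 then have "norm (toL2 D w0) + norm (toL2 D v0) = 1" using normalized by (simp add: norm_toL2[OF mD] W V LIMSEQ_const_iff)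
 then have nz: "~ (toL2 D w0 = 0 & toL2 D v0 = 0)" by auto
 have "transmission_eigenpair D (%_. homogenized_matrix A \<psi>) (%_. cell_average n) (w0, v0) (snd (snd P))"
  by (subst transmission_eigenpair_iff[OF D(1,2), of _ "norm (homogenized_matrix A \<psi>)" _ "\<bar>cell_average n\<bar>"])
   (use X0(1) nz lim(3) in auto)
 moreover have "X_weakly_tendsto D (%m. (w (r m), v (r m))) (w0, v0)"
  by (rule X_weakly_tendsto_if_jets[OF D(1) X X0(1) jets[folded X0(2)]])
 ultimately show ?thesis using r lim(1,2) k by blast
qed

end
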